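(* Let $\Omega\subset\mathbb{R}^2$ be a bounded, possibly multiply connected domain with Lipschitz boundary, let $f\in H^{-1}(\Omega)$ and let $\mathrm{Pe}\ge0$. The maximization problem $$\max\left\{ \int_\Omega \Big( f\xi-\tfrac14|\nabla\xi|^2\Big)\,d\mathbf{x} - a \;:\; a\in\mathbb{R},\ \xi\in H^1_0(\Omega),\ \mathcal{Q}(a,\xi)\succeq 0\right\}$$ has a unique optimal solution: there is exactly one feasible pair $(a^*,\xi^* )\in\mathbb{R}\times H^1_0(\Omega)$ attaining the maximum.
   Context: The pairing of $f\in H^{-1}(\Omega)$ with $\xi\in H^1_0(\Omega)$ is written $\int_\Omega f\xi\,d\mathbf{x}$. Let $\Gamma_0$ be the exterior boundary of $\Omega$ and $\Gamma_1,\dots,\Gamma_p$ the other connected components of $\partial\Omega$ (if any). $\mathcal{H}$ is the space of $\psi\in H^1(\Omega)$ with $\psi|_{\Gamma_0}=0$ and $\psi|_{\Gamma_i}$ equal to a constant $c_i\in\mathbb{R}$ for each $1\le i\le p$; thus $\mathcal{H}=H^1_0(\Omega)$ if $\Omega$ is simply connected. Write $\nabla^\perp\psi=(\partial_y\psi,-\partial_x\psi)$. There is a constant $c(\Omega)>0$ such that $\left|\int_\Omega \xi\,\nabla^\perp\psi\cdot\nabla\theta\,d\mathbf{x}\right|\le c(\Omega)\|\nabla\xi\|_{L^2}\|\nabla\psi\|_{L^2}\|\nabla\theta\|_{L^2}$ for $\xi,\theta\in H^1_0(\Omega)$, $\psi\in\mathcal{H}$; the integral is understood as the continuous extension in $\xi$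 from $H^1_0(\Omega)\cap L^\infty(\Omega)$. For $(a,\xi)\in\mathbb{R}\times H^1_0(\Omega)$, $\mathcal{Q}(a,\xi):\mathcal{H}\times H^1_0(\Omega)\to\mathbb{R}$ is $$\mathcal{Q}(a,\xi)[\psi,\theta]=\int_\Omega \big(a|\nabla\psi|^2+|\nabla\theta|^2-\mathrm{Pe}\,\xi\,\nabla^\perp\psi\cdot\nabla\theta\big)\,d\mathbf{x},$$ and $\mathcal{Q}(a,\xi)\succeq0$ means $\mathcal{Q}(a,\xi)[\psi,\theta]\ge0$ for all $(\psi,\theta)\in\mathcal{H}\times H^1_0(\Omega)$. *)

theory Defs
  imports "HOL-Analysis.Analysis"
begin

type_synonym plane = "real^2"

section \<open>Lipschitz domains\<close>

text \<open>
  Near each boundary point the domain is, after a rigid motion, the strict epigraph of a Lipschitz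
  function of one variable; in particular it lies on one side of its boundary.
\<close>

definition lipschitz_boundary :: "plane set \<Rightarrow> bool" where
  "lipschitz_boundary \<Omega> \<longleftrightarrow>
     (\<forall>p \<in> frontier \<Omega>. \<exists>(R :: plane \<Rightarrow> plane) (\<gamma> :: real \<Rightarrow> real) L r.
        orthogonal_transformation R \<and> L-lipschitz_on UNIV \<gamma> \<and> r > 0 \<and>
        (\<forall>x \<in> ball p r. x \<in> \<Omega> \<longleftrightarrow> R (x - p) $ 2 > \<gamma> (R (x - p) $ 1)))"

definition bounded_lipschitz_domain :: "plane set \<Rightarrow> bool" where
  "bounded_lipschitz_domain \<Omega> \<longleftrightarrow>
     open \<Omega> \<and> connected \<Omega> \<and> \<Omega> \<noteq> {} \<and> bounded \<Omega> \<and> lipschitz_boundary \<Omega>"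

text \<open>
  The boundary of the unbounded component of the complement of the closure. The remaining
  connected components of the boundary are the elements of
  \<open>components (frontier \<Omega>) - {exterior_boundary \<Omega>}\<close>.
\<close>

definition exterior_boundary :: "plane set \<Rightarrow> plane set" where
  "exterior_boundary \<Omega> = frontier (outside (closure \<Omega>))"


section \<open>Smooth functions and test functions\<close>

primrec C_diff :: "nat \<Rightarrow> (plane \<Rightarrow> real) \<Rightarrow> bool" where
  "C_diff 0 u \<longleftrightarrow> continuous_on UNIV u"
| "C_diff (Suc k) u \<longleftrightarrow>
     u differentiable_on UNIV \<and> (\<forall>h. C_diff k (\<lambda>x. frechet_derivative u (at x) h))"

definition smooth :: "(plane \<Rightarrow> real) \<Rightarrow> bool" where
  "smooth u \<longleftrightarrow> (\<forall>k. C_diff k u)"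

definition test_functions :: "plane set \<Rightarrow> (plane \<Rightarrow> real) set" where
  "test_functions \<Omega> =
     {\<phi>. smooth \<phi> \<and> compact (closure {x. \<phi> x \<noteq> 0}) \<and> closure {x. \<phi> x \<noteq> 0} \<subseteq> \<Omega>}"


section \<open>Sobolev spaces\<close>

text \<open>
  Elements of the Lebesgue and Sobolev spaces are represented by functions on the whole plane whose
  values outside \<open>\<Omega>\<close> are irrelevant; two functions represent the same element iff they agree
  almost everywhere on \<open>\<Omega>\<close>.
\<close>

definition L2 :: "plane set \<Rightarrow> (plane \<Rightarrow> 'b::euclidean_space) set" where
  "L2 \<Omega> = {u. u \<in> borel_measurable (lebesgue_on \<Omega>) \<and>
              integrable (lebesgue_on \<Omega>) (\<lambda>x. (norm (u x))\<^sup>2)}"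

definition L2_norm :: "plane set \<Rightarrow> (plane \<Rightarrow> 'b::euclidean_space) \<Rightarrow> real" where
  "L2_norm \<Omega> u = sqrt (LINT x|lebesgue_on \<Omega>. (norm (u x))\<^sup>2)"

definition Linf :: "plane set \<Rightarrow> (plane \<Rightarrow> real) set" where
  "Linf \<Omega> = {u. u \<in> borel_measurable (lebesgue_on \<Omega>) \<and>
                (\<exists>M. AE x in lebesgue_on \<Omega>. \<bar>u x\<bar> \<le> M)}"

definition has_weak_gradient :: "plane set \<Rightarrow> (plane \<Rightarrow> real) \<Rightarrow> (plane \<Rightarrow> plane) \<Rightarrow> bool" where
  "has_weak_gradient \<Omega> u G \<longleftrightarrow>
     u \<in> L2 \<Omega> \<and> G \<in> L2 \<Omega> \<and>
     (\<forall>\<phi> \<in> test_functions \<Omega>. \<forall>i.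
        (LINT x|lebesgue_on \<Omega>. u x * frechet_derivative \<phi> (at x) (axis i 1)) =
        - (LINT x|lebesgue_on \<Omega>. G x $ i * \<phi> x))"

definition H1 :: "plane set \<Rightarrow> (plane \<Rightarrow> real) set" where
  "H1 \<Omega> = {u. \<exists>G. has_weak_gradient \<Omega> u G}"

text \<open>The weak gradient is determined almost everywhere on \<open>\<Omega>\<close>; an arbitrary version is chosen.\<close>

definition grad :: "plane set \<Rightarrow> (plane \<Rightarrow> real) \<Rightarrow> plane \<Rightarrow> plane" where
  "grad \<Omega> u = (SOME G. has_weak_gradient \<Omega> u G)"

definition perp_grad :: "plane set \<Rightarrow> (plane \<Rightarrow> real) \<Rightarrow> plane \<Rightarrow> plane" where
  "perp_grad \<Omega> u x = vector [grad \<Omega> u x $ 2, - (grad \<Omega> u x $ 1)]"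

definition H1_norm :: "plane set \<Rightarrow> (plane \<Rightarrow> real) \<Rightarrow> real" where
  "H1_norm \<Omega> u = sqrt ((L2_norm \<Omega> u)\<^sup>2 + (L2_norm \<Omega> (grad \<Omega> u))\<^sup>2)"

definition H10 :: "plane set \<Rightarrow> (plane \<Rightarrow> real) set" where
  "H10 \<Omega> = {u \<in> H1 \<Omega>. \<exists>\<phi> :: nat \<Rightarrow> plane \<Rightarrow> real.
     (\<forall>n. \<phi> n \<in> test_functions \<Omega>) \<and> (\<lambda>n. H1_norm \<Omega> (\<lambda>x. u x - \<phi> n x)) \<longlonglongrightarrow> 0}"

text \<open>
  The dual space of \<open>H10 \<Omega>\<close>; the pairing of \<open>f\<close> with \<open>\<xi>\<close> is \<open>f \<xi>\<close>. The bound together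
  with linearity forces \<open>f\<close> to take equal values on functions that agree almost everywhere.
\<close>

definition Hminus1 :: "plane set \<Rightarrow> ((plane \<Rightarrow> real) \<Rightarrow> real) set" where
  "Hminus1 \<Omega> = {f.
     (\<forall>u \<in> H10 \<Omega>. \<forall>v \<in> H10 \<Omega>. f (\<lambda>x. u x + v x) = f u + f v) \<and>
     (\<forall>u \<in> H10 \<Omega>. \<forall>c. f (\<lambda>x. c * u x) = c * f u) \<and>
     (\<exists>C. \<forall>u \<in> H10 \<Omega>. \<bar>f u\<bar> \<le> C * H1_norm \<Omega> u)}"


section \<open>Boundary traces\<close>

definition hausdorff1_pre :: "real \<Rightarrow> plane set \<Rightarrow> ennreal" where
  "hausdorff1_pre \<delta> A =
     (INF U \<in> {U :: nat \<Rightarrow> plane set. A \<subseteq> (\<Union>i. U i) \<and>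
                (\<forall>i. bounded (U i) \<and> diameter (U i) \<le> \<delta>)}. \<Sum>i. ennreal (diameter (U i)))"

text \<open>
  The one-dimensional Hausdorff measure, as a Borel measure. Countable additivity of the set
  function on Borel sets is the classical fact about metric outer measures.
\<close>

definition hausdorff1 :: "plane measure" where
  "hausdorff1 = measure_of UNIV (sets borel) (\<lambda>A. SUP \<delta> \<in> {0<..}. hausdorff1_pre \<delta> A)"

definition boundary_measure :: "plane set \<Rightarrow> plane measure" where
  "boundary_measure \<Omega> = restrict_space hausdorff1 (frontier \<Omega>)"

text \<open>
  The trace operator is the continuous extension to \<open>H1 \<Omega>\<close>, with values in the space of square
  integrable functions on the boundary, of the restriction of smooth functions to the boundary:
  its graph is the closure of the graph of the restriction map.
\<close>

definition has_trace :: "plane set \<Rightarrow> (plane \<Rightarrow> real) \<Rightarrow> (plane \<Rightarrow> real) \<Rightarrow> bool" where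
  "has_trace \<Omega> u g \<longleftrightarrow>
     u \<in> H1 \<Omega> \<and> g \<in> borel_measurable (boundary_measure \<Omega>) \<and>
     (\<exists>v :: nat \<Rightarrow> plane \<Rightarrow> real. (\<forall>n. smooth (v n)) \<and>
        (\<lambda>n. H1_norm \<Omega> (\<lambda>x. u x - v n x)) \<longlonglongrightarrow> 0 \<and>
        (\<lambda>n. \<integral>\<^sup>+ x. ennreal ((v n x - g x)\<^sup>2) \<partial>boundary_measure \<Omega>) \<longlonglongrightarrow> 0)"

definition stream_space :: "plane set \<Rightarrow> (plane \<Rightarrow> real) set" where
  "stream_space \<Omega> = {\<psi> \<in> H1 \<Omega>. \<exists>g. has_trace \<Omega> \<psi> g \<and>
     (AE x in boundary_measure \<Omega>. x \<in> exterior_boundary \<Omega> \<longrightarrow> g x = 0) \<and>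
     (\<forall>\<Gamma> \<in> components (frontier \<Omega>) - {exterior_boundary \<Omega>}.
        \<exists>c. AE x in boundary_measure \<Omega>. x \<in> \<Gamma> \<longrightarrow> g x = c)}"


section \<open>The quadratic form and the maximization problem\<close>

text \<open>
  For \<open>\<xi>\<close> in \<open>H10 \<Omega>\<close> the product \<open>\<xi> \<nabla>\<^sup>\<bottom>\<psi> \<cdot> \<nabla>\<theta>\<close> need not be integrable; its integral is the
  value at \<open>\<xi>\<close> of the continuous extension from \<open>H10 \<Omega> \<inter> Linf \<Omega>\<close>, where the integral converges.
\<close>

definition advection :: "plane set \<Rightarrow> (plane \<Rightarrow> real) \<Rightarrow> (plane \<Rightarrow> real) \<Rightarrow> (plane \<Rightarrow> real) \<Rightarrow> real" where
  "advection \<Omega> \<xi> \<psi> \<theta> =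
     (THE l. \<forall>\<eta> :: nat \<Rightarrow> plane \<Rightarrow> real.
        (\<forall>n. \<eta> n \<in> H10 \<Omega> \<inter> Linf \<Omega>) \<and> (\<lambda>n. H1_norm \<Omega> (\<lambda>x. \<eta> n x - \<xi> x)) \<longlonglongrightarrow> 0 \<longrightarrow>
        (\<lambda>n. LINT x|lebesgue_on \<Omega>. \<eta> n x * (perp_grad \<Omega> \<psi> x \<bullet> grad \<Omega> \<theta> x)) \<longlonglongrightarrow> l)"

definition Q_form ::
  "plane set \<Rightarrow> real \<Rightarrow> real \<Rightarrow> (plane \<Rightarrow> real) \<Rightarrow> (plane \<Rightarrow> real) \<Rightarrow> (plane \<Rightarrow> real) \<Rightarrow> real" where
  "Q_form \<Omega> Pe a \<xi> \<psi> \<theta> =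
     a * (LINT x|lebesgue_on \<Omega>. (norm (grad \<Omega> \<psi> x))\<^sup>2)
     + (LINT x|lebesgue_on \<Omega>. (norm (grad \<Omega> \<theta> x))\<^sup>2)
     - Pe * advection \<Omega> \<xi> \<psi> \<theta>"

definition Q_nonneg :: "plane set \<Rightarrow> real \<Rightarrow> real \<Rightarrow> (plane \<Rightarrow> real) \<Rightarrow> bool" where
  "Q_nonneg \<Omega> Pe a \<xi> \<longleftrightarrow>
     (\<forall>\<psi> \<in> stream_space \<Omega>. \<forall>\<theta> \<in> H10 \<Omega>. Q_form \<Omega> Pe a \<xi> \<psi> \<theta> \<ge> 0)"

definition feasible :: "plane set \<Rightarrow> real \<Rightarrow> real \<times> (plane \<Rightarrow> real) \<Rightarrow> bool" where
  "feasible \<Omega> Pe = (\<lambda>(a, \<xi>). \<xi> \<in> H10 \<Omega> \<and> Q_nonneg \<Omega> Pe a \<xi>)"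

definition objective ::
  "plane set \<Rightarrow> ((plane \<Rightarrow> real) \<Rightarrow> real) \<Rightarrow> real \<times> (plane \<Rightarrow> real) \<Rightarrow> real" where
  "objective \<Omega> f = (\<lambda>(a, \<xi>).
     f \<xi> - 1/4 * (LINT x|lebesgue_on \<Omega>. (norm (grad \<Omega> \<xi> x))\<^sup>2) - a)"

end

theory Submission
  imports Defs
begin

text \<open>
  The admissible set is convex, the objective is concave in \<open>(a, \<xi>)\<close>, and the parallelogram identity
  for the Dirichlet norm measures its concavity exactly. Hence the \<open>\<xi>\<close>-components of a maximizing
  sequence are Cauchy in \<open>H10\<close> by Poincare's inequality, the numbers \<open>a\<close> then converge as well, and two
  maximizers coincide. The supremum is finite because a test function \<open>\<psi>\<close> and \<open>\<theta> = 0\<close> in the quadratic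
  form force \<open>a \<ge> 0\<close>.

  The limit is feasible because \<open>\<xi> \<mapsto> advection \<Omega> \<xi> \<psi> \<theta>\<close> is well defined and continuous. This is a
  form of Wente's inequality up to the boundary. A partition of unity reduces it to functions on a set
  \<open>D\<close> with \<open>D + C \<subseteq> D\<close> for a cone \<open>C\<close> spanned by \<open>e\<close> and \<open>f\<close>. There the three functions are smoothed at all
  dyadic scales \<open>h = 2\<^sup>-\<^sup>k\<close> by averages over parallelograms of size \<open>h\<close> inside the cone, so that neither
  supports nor values outside \<open>D\<close> matter. In the telescoping sum over the scales the antisymmetry of
  the Jacobian moves all derivatives away from the differences of consecutive smoothings. Those
  differences are square summable with weight \<open>h\<^sup>-\<^sup>2\<close>, and the fourth powers of the averaged
  gradients are summable with weight \<open>h\<^sup>2\<close>, both uniformly in terms of the Dirichlet norms.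
\<close>

text \<open>The functions \<psi> do not vanish on the boundary, so they cannot be extended by zero;
  they are approximated by functions smooth on the whole plane whose size outside \<Omega> is
  uncontrolled. Bounds for \<psi> may therefore use values in \<Omega> only, and this forces
  averages taken forwards into a cone. A one-sided average differs from its function by a term of
  first order in h, whose square over h^2 is not summable over dyadic scales; combining two averages
  removes it. Fourth powers stand in for the duality of Hardy space and BMO: each term of the
  telescoping sum is a difference times two gradients, and Young's inequality with weight h^(-2)
  splits it into the two kinds of summable quantity. Only boundedness on bounded sets of functions
  is proved, without an explicit trilinear constant; homogeneity in \<eta> then gives the Lipschitz
  bound by which \<open>advection\<close> extends. The estimates are carried out for continuously
  differentiable functions, a class stable under averages and simple cutoffs, and Sobolev functions
  are reached by density.\<close>

lemma nn_integral_shift: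
  fixes f :: "'a::euclidean_space \<Rightarrow> ennreal"
  assumes [measurable]: "f \<in> borel_measurable borel"
  shows "(\<integral>\<^sup>+x. f (x + a) \<partial>lborel) = (\<integral>\<^sup>+x. f x \<partial>lborel)"
proof -
  have "(\<integral>\<^sup>+x. f x \<partial>lborel) = (\<integral>\<^sup>+x. f x \<partial>distr lborel borel ((+) a))"
    by (simp add: lborel_distr_plus)
  also have "\<dots> = (\<integral>\<^sup>+x. f (a + x) \<partial>lborel)"
    by (rule nn_integral_distr) auto
  finally show ?thesis by (simp add: add.commute)
qed

lemma integral_shift:
  fixes f :: "'a::euclidean_space \<Rightarrow> real"
  assumes [measurable]: "f \<in> borel_measurable borel"
  shows "(\<integral>x. f (x + a) \<partial>lborel) = (\<integral>x. f x \<partial>lborel)"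
proof -
  have "(\<integral>x. f x \<partial>lborel) = (\<integral>x. f x \<partial>distr lborel borel ((+) a))"
    by (simp add: lborel_distr_plus)
  also have "\<dots> = (\<integral>x. f (a + x) \<partial>lborel)"
    by (rule integral_distr) auto
  finally show ?thesis by (simp add: add.commute)
qed

section \<open>Continuous functions with bounded support\<close>

definition Cc :: "('a::euclidean_space \<Rightarrow> 'b::real_normed_vector) \<Rightarrow> bool" where
  "Cc u \<longleftrightarrow> continuous_on UNIV u \<and> bounded {x. u x \<noteq> 0}"

lemma Cc_borel [measurable_dest]: "Cc u \<Longrightarrow> u \<in> borel_measurable borel"
  by (auto simp: Cc_def borel_measurable_continuous_onI)

lemma Cc_supportE:
  assumes "Cc u" obtains R where "{x. u x \<noteq> 0} \<subseteq> cball 0 R"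
proof -
  obtain r where "{x. u x \<noteq> 0} \<subseteq> ball 0 r"
    using assms bounded_subset_ballD unfolding Cc_def by blast
  then show ?thesis using that ball_subset_cball by (meson order_trans)
qed

lemma Cc_integrable:
  fixes u :: "'a::euclidean_space \<Rightarrow> 'b::euclidean_space"
  assumes "Cc u" shows "integrable lborel u"
proof -
  obtain R where R: "{x. u x \<noteq> 0} \<subseteq> cball 0 R"
    using Cc_supportE[OF assms] by blast
  have "integrable lborel (\<lambda>x. indicator (cball 0 R) x *\<^sub>R u x)"
    using assms by (intro borel_integrable_compact) (auto simp: Cc_def intro: continuous_on_subset)
  moreover have "indicator (cball 0 R) x *\<^sub>R u x = u x" for x
    using R by (auto simp: indicator_def)
  ultimately show ?thesis by simp
qed

lemma Cc_bounded:
  fixes u :: "'a::euclidean_space \<Rightarrow> 'b::real_normed_vector"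
  assumes "Cc u" obtains B where "\<And>x. norm (u x) \<le> B" "B > 0"
proof -
  obtain R where R: "{x. u x \<noteq> 0} \<subseteq> cball 0 R"
    using Cc_supportE[OF assms] by blast
  have "compact (u ` cball 0 R)"
    using assms by (intro compact_continuous_image) (auto simp: Cc_def intro: continuous_on_subset)
  then obtain B where B: "B > 0" "\<And>y. y \<in> u ` cball 0 R \<Longrightarrow> norm y \<le> B"
    using bounded_pos compact_imp_bounded by metis
  have "norm (u x) \<le> B" for x
    using B R by (cases "u x = 0") auto
  then show ?thesis using that B by blast
qed

lemma Cc_compose_zero:
  fixes u :: "'a::euclidean_space \<Rightarrow> 'b::real_normed_vector"
  assumes "Cc u" "continuous_on UNIV v" "\<And>x. u x = 0 \<Longrightarrow> v x = 0"
  shows "Cc v"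
  using assms unfolding Cc_def by (metis (mono_tags, lifting) Collect_mono bounded_subset)

lemma Cc_shift:
  assumes "Cc u" shows "Cc (\<lambda>x. u (x + a))"
proof -
  have "{x. u (x + a) \<noteq> 0} = (\<lambda>x. x - a) ` {x. u x \<noteq> 0}"
    by (auto simp: image_iff) (metis add_diff_cancel)
  then show ?thesis
    using assms by (auto simp: Cc_def intro!: continuous_on_compose2[of UNIV u] continuous_intros
        bounded_translation_minus)
qed

lemma Cc_add:
  assumes "Cc u" "Cc v" shows "Cc (\<lambda>x. u x + v x)"
proof -
  have "bounded ({x. u x \<noteq> 0} \<union> {x. v x \<noteq> 0})" using assms by (simp add: Cc_def)
  moreover have "{x. u x + v x \<noteq> 0} \<subseteq> {x. u x \<noteq> 0} \<union> {x. v x \<noteq> 0}" by auto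
  ultimately have "bounded {x. u x + v x \<noteq> 0}" by (rule bounded_subset)
  then show ?thesis
    using assms by (auto simp: Cc_def intro!: continuous_intros)
qed

lemma Cc_cmult:
  assumes "Cc (u :: _ \<Rightarrow> 'b::euclidean_space)" shows "Cc (\<lambda>x. c *\<^sub>R u x)"
  by (rule Cc_compose_zero[OF assms]) (use assms in \<open>auto simp: Cc_def intro!: continuous_intros\<close>)

lemma Cc_diff:
  assumes "Cc (u :: _ \<Rightarrow> 'b::euclidean_space)" "Cc v" shows "Cc (\<lambda>x. u x - v x)"
  using Cc_add[OF assms(1) Cc_cmult[OF assms(2), of "-1"]] by simp

lemma bounded_integral_tendsto:
  fixes f :: "nat \<Rightarrow> 'a::euclidean_space \<Rightarrow> real"
  assumes m: "\<And>n. f n \<in> borel_measurable borel" and g: "g \<in> borel_measurable borel"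
    and z: "\<And>n x. x \<notin> cball 0 R \<Longrightarrow> f n x = 0"
    and b: "\<And>n x. x \<in> cball 0 R \<Longrightarrow> \<bar>f n x\<bar> \<le> B"
    and l: "\<And>x. (\<lambda>n. f n x) \<longlonglongrightarrow> g x"
  shows "(\<lambda>n. \<integral>x. f n x \<partial>lborel) \<longlonglongrightarrow> (\<integral>x. g x \<partial>lborel)"
proof (rule integral_dominated_convergence)
  show "integrable lborel (\<lambda>x. indicator (cball 0 R) x *\<^sub>R B)"
    by (intro borel_integrable_compact) auto
  show "AE x in lborel. norm (f n x) \<le> indicator (cball 0 R) x *\<^sub>R B" for n
    using z[of _ n] b[of _ n] by (intro AE_I2) (auto simp: indicator_def)
qed (use assms in auto)

subsection \<open>Averages along segments\<close>

text \<open>One-sided: only the points between x and \<open>x + e\<close> enter. The mean is taken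
  over the parameter, not over arc length, so \<open>e = 0\<close> returns u itself.\<close>

definition avg :: "'a::euclidean_space \<Rightarrow> ('a \<Rightarrow> 'b::euclidean_space) \<Rightarrow> 'a \<Rightarrow> 'b" where
  "avg e u x = integral {0..1} (\<lambda>r. u (x + r *\<^sub>R e))"

text \<open>The parameter moves the function as well as the direction, so the result can be
  iterated; convergence for step sizes tending to 0 is later read off as continuity at 0.\<close>

lemma avg_continuous_param:
  fixes U :: "'c::topological_space \<Rightarrow> 'a::euclidean_space \<Rightarrow> 'b::euclidean_space"
  assumes "continuous_on UNIV (\<lambda>(t, x). U t x)" "continuous_on UNIV e"
  shows "continuous_on UNIV (\<lambda>(t, x). avg (e t) (U t) x)"
proof -
  have c: "continuous_on (UNIV \<times> cbox 0 1) (\<lambda>(p, r::real). case p of (t, x) \<Rightarrow> U t (x + r *\<^sub>R e t))"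
    unfolding split_beta
    by (intro continuous_on_compose2[OF assms(1)[unfolded split_beta], where f = "\<lambda>p. (fst (fst p), snd (fst p) + snd p *\<^sub>R e (fst (fst p)))", simplified]
        continuous_intros continuous_on_compose2[OF assms(2)]) auto
  show ?thesis
    using integral_continuous_on_param[OF c] by (simp add: avg_def split_beta)
qed

lemma continuous_on_avg:
  assumes "continuous_on UNIV u" shows "continuous_on UNIV (avg e u)"
proof -
  have "continuous_on UNIV (\<lambda>(t::real, x). avg e u x)"
    using assms by (intro avg_continuous_param)
      (auto simp: split_beta intro!: continuous_on_compose2[OF assms] continuous_intros)
  from continuous_on_compose2[OF this, of UNIV "\<lambda>x. (0, x)"] show ?thesis
    by (simp add: continuous_intros)
qed

lemma segment_integrable:
  fixes u :: "'a::euclidean_space \<Rightarrow> 'b::euclidean_space"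
  assumes "continuous_on UNIV u" shows "(\<lambda>r. u (x + r *\<^sub>R e)) integrable_on {0..1}"
  by (intro integrable_continuous_interval continuous_on_compose2[OF assms] continuous_intros) auto

lemma avg_bound:
  assumes "continuous_on UNIV u" "\<And>r. 0 \<le> r \<Longrightarrow> r \<le> 1 \<Longrightarrow> norm (u (x + r *\<^sub>R e)) \<le> B"
  shows "norm (avg e u x) \<le> B"
proof -
  have "0 \<le> B" by (rule order_trans[OF norm_ge_zero assms(2)[of 0]]) auto
  then have "norm (avg e u x) \<le> B * Henstock_Kurzweil_Integration.content {0..1::real}"
    unfolding avg_def
    by (rule has_integral_bound_real[OF _ finite.emptyI integrable_integral[OF segment_integrable[OF assms(1)]]])
      (use assms(2) in auto)
  then show ?thesis by simp
qed

lemma avg_eq_0: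
  assumes "\<And>r. 0 \<le> r \<Longrightarrow> r \<le> 1 \<Longrightarrow> u (x + r *\<^sub>R e) = 0"
  shows "avg e u x = 0"
  using assms integral_cong[of "{0..1}" "\<lambda>r. u (x + r *\<^sub>R e)" "\<lambda>_. 0"] unfolding avg_def by auto

lemma Cc_avg:
  assumes "Cc u" shows "Cc (avg e u)"
proof -
  obtain R where R: "{x. u x \<noteq> 0} \<subseteq> cball 0 R"
    using Cc_supportE[OF assms] by blast
  have "{x. avg e u x \<noteq> 0} \<subseteq> cball 0 (R + norm e)"
  proof
    fix x assume "x \<in> {x. avg e u x \<noteq> 0}"
    then obtain r where r: "0 \<le> r" "r \<le> 1" "u (x + r *\<^sub>R e) \<noteq> 0" using avg_eq_0 by blast
    then have "norm (x + r *\<^sub>R e) \<le> R" using R by auto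
    moreover have "norm (r *\<^sub>R e) \<le> norm e" using r by (simp add: mult_left_le_one_le)
    moreover have "norm x \<le> norm (x + r *\<^sub>R e) + norm (r *\<^sub>R e)"
      by (metis add_diff_cancel_right' norm_triangle_ineq4)
    ultimately show "x \<in> cball 0 (R + norm e)" by simp
  qed
  then show ?thesis
    using assms continuous_on_avg bounded_subset[OF bounded_cball] unfolding Cc_def by blast
qed

lemma avg_tendsto:
  assumes "continuous_on UNIV u" "s \<longlonglongrightarrow> 0"
  shows "(\<lambda>n. avg (s n *\<^sub>R e) u x) \<longlonglongrightarrow> u x"
proof -
  have "continuous_on UNIV (\<lambda>(t::real, x). avg (t *\<^sub>R e) u x)"
    using assms by (intro avg_continuous_param)
      (auto simp: split_beta intro!: continuous_on_compose2[OF assms(1)] continuous_intros)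
  then have "continuous_on UNIV (\<lambda>t::real. avg (t *\<^sub>R e) u x)"
    using continuous_on_compose2[of UNIV "\<lambda>(t::real, x). avg (t *\<^sub>R e) u x" UNIV "\<lambda>t. (t, x)"]
    by (simp add: continuous_intros)
  then have "isCont (\<lambda>t::real. avg (t *\<^sub>R e) u x) 0"
    by (simp add: continuous_on_eq_continuous_at)
  then have "(\<lambda>n. avg (s n *\<^sub>R e) u x) \<longlonglongrightarrow> avg (0 *\<^sub>R e) u x"
    by (rule isCont_tendsto_compose[OF _ assms(2)])
  then show ?thesis by (simp add: avg_def)
qed

lemma avg_as_integral:
  assumes "continuous_on UNIV u"
  shows "avg e u x = (\<integral>r. indicator {0..1} r *\<^sub>R u (x + r *\<^sub>R e) \<partial>lborel)"
proof -
  have "set_integrable lborel {0..1} (\<lambda>r. u (x + r *\<^sub>R e))"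
    unfolding set_integrable_def
    by (intro borel_integrable_compact continuous_on_compose2[OF assms] continuous_intros) auto
  from set_borel_integral_eq_integral(2)[OF this] show ?thesis
    by (simp add: avg_def set_lebesgue_integral_def)
qed

lemma integral_avg:
  fixes u :: "'a::euclidean_space \<Rightarrow> real"
  assumes "Cc u" shows "(\<integral>x. avg e u x \<partial>lborel) = (\<integral>x. u x \<partial>lborel)"
proof -
  have cu: "continuous_on UNIV u" using assms by (simp add: Cc_def)
  note [measurable] = Cc_borel[OF assms]
  let ?F = "\<lambda>p::'a \<times> real. indicator {0..1} (snd p) *\<^sub>R u (fst p + snd p *\<^sub>R e)"
  obtain R where R: "{x. u x \<noteq> 0} \<subseteq> cball 0 R"
    using Cc_supportE[OF assms] by blast
  \<comment> \<open>For r in the unit interval the integrand vanishes unless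
    \<open>norm x \<le> R + norm e\<close>, so cutting off to the compact set \<open>?K\<close>
    changes nothing, and continuity gives the integrability that Fubini's theorem asks for.\<close>
  let ?K = "cball (0::'a) (R + norm e) \<times> {0..1::real}"
  have K: "integrable lborel (\<lambda>p. indicator ?K p *\<^sub>R u (fst p + snd p *\<^sub>R e))"
    by (intro borel_integrable_compact continuous_on_compose2[OF cu] continuous_intros compact_Times) auto
  have "indicator ?K p *\<^sub>R u (fst p + snd p *\<^sub>R e) = ?F p" for p
  proof (cases "p \<in> ?K")
    case False
    show ?thesis
    proof (cases "snd p \<in> {0..1} \<and> u (fst p + snd p *\<^sub>R e) \<noteq> 0")
      case True
      then have "norm (fst p + snd p *\<^sub>R e) \<le> R" using R by auto
      moreover have "norm (snd p *\<^sub>R e) \<le> norm e" using True by (simp add: mult_left_le_one_le)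
      moreover have "norm (fst p) \<le> norm (fst p + snd p *\<^sub>R e) + norm (snd p *\<^sub>R e)"
        by (metis add_diff_cancel_right' norm_triangle_ineq4)
      ultimately have "p \<in> ?K" using True by (cases p) auto
      then show ?thesis using False by simp
    next
      case F: False
      then show ?thesis using False by (cases p) (auto simp: indicator_def)
    qed
  qed (cases p, auto simp: indicator_def)
  then have I: "integrable (lborel \<Otimes>\<^sub>M lborel) ?F"
    unfolding lborel_prod using K by presburger
  have "(\<integral>x. avg e u x \<partial>lborel) = (\<integral>x. (\<integral>r. ?F (x, r) \<partial>lborel) \<partial>lborel)"
    using avg_as_integral[OF cu] by simp
  also have "\<dots> = (\<integral>r. (\<integral>x. ?F (x, r) \<partial>lborel) \<partial>lborel)"
    by (rule lborel_pair.Fubini_integral[symmetric]) (use I in \<open>simp add: case_prod_unfold\<close>)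
  also have "\<dots> = (\<integral>r. indicator {0..1} r * (\<integral>x. u (x + r *\<^sub>R e) \<partial>lborel) \<partial>lborel)"
    by simp
  also have "\<dots> = (\<integral>r. indicator {0..1::real} r * (\<integral>x. u x \<partial>lborel) \<partial>lborel)"
    by (subst integral_shift) simp_all
  finally show ?thesis by simp
qed

subsection \<open>Continuously differentiable functions\<close>

text \<open>The gradient is carried as an argument: averages and products then come with explicit
  formulas for it.\<close>

definition C1 :: "('a::euclidean_space \<Rightarrow> real) \<Rightarrow> ('a \<Rightarrow> 'a) \<Rightarrow> bool" where
  "C1 u g \<longleftrightarrow> (\<forall>x. GDERIV u x :> g x) \<and> continuous_on UNIV g"

definition C1c :: "('a::euclidean_space \<Rightarrow> real) \<Rightarrow> ('a \<Rightarrow> 'a) \<Rightarrow> bool" where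
  "C1c u g \<longleftrightarrow> C1 u g \<and> bounded {x. u x \<noteq> 0}"

lemma C1_continuous: "C1 u g \<Longrightarrow> continuous_on UNIV u"
  by (auto simp: C1_def gderiv_def intro!: continuous_at_imp_continuous_on has_derivative_continuous)

lemma C1_gradient_continuous: "C1 u g \<Longrightarrow> continuous_on UNIV g"
  by (simp add: C1_def)

lemma C1_diff: "C1 u g \<Longrightarrow> C1 v h \<Longrightarrow> C1 (\<lambda>x. u x - v x) (\<lambda>x. g x - h x)"
  by (auto simp: C1_def intro!: GDERIV_diff continuous_intros)

lemma C1_cmult: "C1 u g \<Longrightarrow> C1 (\<lambda>x. c * u x) (\<lambda>x. c *\<^sub>R g x)"
  using GDERIV_mult[OF GDERIV_const, of u _ _ c]
  by (auto simp: C1_def intro!: continuous_intros)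

lemma C1_mult: "C1 u g \<Longrightarrow> C1 v h \<Longrightarrow> C1 (\<lambda>x. u x * v x) (\<lambda>x. u x *\<^sub>R h x + v x *\<^sub>R g x)"
  using C1_continuous[of u g] C1_continuous[of v h]
  by (auto simp: C1_def intro!: GDERIV_mult continuous_intros)

lemma C1_shift: "C1 u g \<Longrightarrow> C1 (\<lambda>x. u (x + a)) (\<lambda>x. g (x + a))"
proof -
  assume u: "C1 u g"
  have "((\<lambda>x. u (x + a)) has_derivative (\<lambda>h. h \<bullet> g (x + a))) (at x)" for x
    by (rule has_derivative_compose[of "\<lambda>x. x + a" "\<lambda>h. h" x UNIV u "\<lambda>h. h \<bullet> g (x + a)", simplified])
      (use u in \<open>auto simp: C1_def gderiv_def intro!: derivative_eq_intros\<close>)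
  moreover have "continuous_on UNIV (\<lambda>x. g (x + a))"
    using u by (auto simp: C1_def intro!: continuous_on_compose2[of UNIV g] continuous_intros)
  ultimately show ?thesis by (simp add: C1_def gderiv_def)
qed

lemma C1_avg:
  fixes u :: "'a::euclidean_space \<Rightarrow> real"
  assumes "C1 u g" shows "C1 (avg e u) (avg e g)"
proof -
  note cu = C1_continuous[OF assms] and cg = C1_gradient_continuous[OF assms]
  \<comment> \<open>\<open>leibniz_rule\<close> expects the derivative as a bounded linear map,
    hence the passage through \<open>blinfun_inner_left\<close>, which commutes with the
    integral.\<close>
  have "((\<lambda>x. integral (cbox 0 1) (\<lambda>r. u (x + r *\<^sub>R e))) has_derivative
      blinfun_apply (integral (cbox 0 1) (\<lambda>r. blinfun_inner_left (g (x0 + r *\<^sub>R e))))) (at x0 within UNIV)" for x0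
  proof (rule leibniz_rule[where fx = "\<lambda>x r. blinfun_inner_left (g (x + r *\<^sub>R e))"])
    fix x and r :: real
    show "((\<lambda>x. u (x + r *\<^sub>R e)) has_derivative blinfun_apply (blinfun_inner_left (g (x + r *\<^sub>R e)))) (at x within UNIV)"
      using C1_shift[OF assms, of "r *\<^sub>R e"] by (simp add: C1_def gderiv_def inner_commute)
  next
    show "continuous_on (UNIV \<times> cbox 0 1) (\<lambda>(x, r). blinfun_inner_left (g (x + r *\<^sub>R e)))"
      unfolding split_beta
      by (intro continuous_on_compose2[OF bounded_linear.continuous_on[OF bounded_linear_blinfun_inner_left continuous_on_id, of UNIV]]
          continuous_on_compose2[OF cg] continuous_intros) auto
  qed (use segment_integrable[OF cu] in auto)
  moreover have "blinfun_apply (integral (cbox 0 1) (\<lambda>r. blinfun_inner_left (g (x0 + r *\<^sub>R e)))) = (\<lambda>h. h \<bullet> avg e g x0)" for x0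
  proof -
    have "integral (cbox 0 1) (blinfun_inner_left \<circ> (\<lambda>r. g (x0 + r *\<^sub>R e)))
        = blinfun_inner_left (integral (cbox 0 1) (\<lambda>r. g (x0 + r *\<^sub>R e)))"
      by (rule integral_linear[OF _ bounded_linear_blinfun_inner_left]) (use segment_integrable[OF cg] in auto)
    then show ?thesis by (auto simp: o_def avg_def inner_commute)
  qed
  ultimately show ?thesis
    using continuous_on_avg[OF cg] by (simp add: C1_def gderiv_def avg_def[abs_def])
qed

lemma C1_gradient_0:
  assumes "C1 u g" "open S" "x \<in> S" "\<And>y. y \<in> S \<Longrightarrow> u y = 0"
  shows "g x = 0"
proof -
  have "(u has_derivative (\<lambda>h. h \<bullet> g x)) (at x)" using assms(1) by (simp add: C1_def gderiv_def)
  moreover have "(u has_derivative (\<lambda>h. 0)) (at x)"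
    by (rule has_derivative_transform_within_open[OF _ assms(2,3), of "\<lambda>_. 0"]) (use assms(4) in auto)
  ultimately have "(\<lambda>h. h \<bullet> g x) = (\<lambda>h. 0)" by (rule has_derivative_unique)
  then have "g x \<bullet> g x = 0" by meson
  then show ?thesis by simp
qed

lemma C1_gradient_support:
  assumes "C1 u g" shows "{x. g x \<noteq> 0} \<subseteq> closure {x. u x \<noteq> 0}"
  using C1_gradient_0[OF assms, of "- closure {x. u x \<noteq> 0}"] closure_subset[of "{x. u x \<noteq> 0}"] by blast

lemma C1c_C1: "C1c u g \<Longrightarrow> C1 u g" by (simp add: C1c_def)

lemma C1c_Cc: "C1c u g \<Longrightarrow> Cc u"
  using C1_continuous by (auto simp: C1c_def Cc_def)

lemma C1c_gradient_Cc: "C1c u g \<Longrightarrow> Cc g"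
  unfolding C1c_def Cc_def using C1_gradient_support bounded_subset bounded_closure C1_gradient_continuous by metis

lemma C1c_iff: "C1c u g \<longleftrightarrow> C1 u g \<and> Cc u"
  using C1_continuous by (auto simp: C1c_def Cc_def)

lemma C1c_avg: "C1c u g \<Longrightarrow> C1c (avg e u) (avg e g)"
  using C1_avg Cc_avg by (auto simp: C1c_iff)

lemma C1c_diff: "C1c u g \<Longrightarrow> C1c v h \<Longrightarrow> C1c (\<lambda>x. u x - v x) (\<lambda>x. g x - h x)"
  using C1_diff Cc_diff by (auto simp: C1c_iff)

lemma C1c_cmult: "C1c u g \<Longrightarrow> C1c (\<lambda>x. c * u x) (\<lambda>x. c *\<^sub>R g x)"
  using C1_cmult Cc_cmult[of u c] by (auto simp: C1c_iff)

lemma C1c_mult: "C1c u g \<Longrightarrow> C1 v h \<Longrightarrow> C1c (\<lambda>x. u x * v x) (\<lambda>x. u x *\<^sub>R h x + v x *\<^sub>R g x)"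
  unfolding C1c_iff
  by (auto intro: C1_mult intro!: Cc_compose_zero[of u "\<lambda>x. u x * v x"] continuous_intros C1_continuous)

text \<open>The fundamental theorem of calculus along the segment. Finite differences become
  averages, so every bound for averages bounds differences as well.\<close>

lemma C1_increment:
  assumes "C1 u g" shows "u (x + e) - u x = avg e (\<lambda>y. g y \<bullet> e) x"
proof -
  have "((\<lambda>r. g (x + r *\<^sub>R e) \<bullet> e) has_integral u (x + 1 *\<^sub>R e) - u (x + 0 *\<^sub>R e)) {0..1}"
  proof (rule fundamental_theorem_of_calculus)
    fix r :: real
    have "((\<lambda>r. u (x + r *\<^sub>R e)) has_derivative (\<lambda>h. (h *\<^sub>R e) \<bullet> g (x + r *\<^sub>R e))) (at r within {0..1})"
    proof (rule has_derivative_compose[of "\<lambda>r. x + r *\<^sub>R e" "\<lambda>h. h *\<^sub>R e"])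
      show "((\<lambda>r. x + r *\<^sub>R e) has_derivative (\<lambda>h. h *\<^sub>R e)) (at r within {0..1})"
        by (auto intro!: derivative_eq_intros)
      show "(u has_derivative (\<lambda>h. h \<bullet> g (x + r *\<^sub>R e))) (at (x + r *\<^sub>R e))"
        using assms by (simp add: C1_def gderiv_def)
    qed
    then show "((\<lambda>r. u (x + r *\<^sub>R e)) has_vector_derivative g (x + r *\<^sub>R e) \<bullet> e) (at r within {0..1})"
      by (simp add: has_vector_derivative_def inner_commute)
  qed simp
  then show ?thesis by (simp add: avg_def integral_unique)
qed

subsection \<open>Integration by parts\<close>

text \<open>Averaging preserves the integral, the average of the directional derivative is the
  increment \<open>u (x + e) - u x\<close>, and translation invariance makes the integral of that
  0.\<close>

lemma integral_directional_derivative: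
  assumes "C1c u g" shows "(\<integral>x. g x \<bullet> e \<partial>lborel) = 0"
proof -
  have ge: "Cc (\<lambda>x. g x \<bullet> e)"
    by (rule Cc_compose_zero[OF C1c_gradient_Cc[OF assms]])
      (use assms in \<open>auto intro!: continuous_intros simp: C1c_def C1_def\<close>)
  have i: "integrable lborel u" "integrable lborel (\<lambda>x. u (x + e))"
    using Cc_integrable Cc_shift C1c_Cc[OF assms] by blast+
  have "(\<integral>x. g x \<bullet> e \<partial>lborel) = (\<integral>x. avg e (\<lambda>x. g x \<bullet> e) x \<partial>lborel)"
    using integral_avg[OF ge] by simp
  also have "\<dots> = (\<integral>x. u (x + e) - u x \<partial>lborel)"
    using C1_increment[OF C1c_C1[OF assms]] by simp
  also have "\<dots> = 0"
    using i integral_shift[OF Cc_borel[OF C1c_Cc[OF assms]], of e] by simp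
  finally show ?thesis .
qed

lemma integral_by_parts:
  assumes "C1c u g" "C1 v h"
  shows "(\<integral>x. u x * (h x \<bullet> e) \<partial>lborel) = - (\<integral>x. (g x \<bullet> e) * v x \<partial>lborel)"
proof -
  note c = C1_continuous[OF assms(2)] C1_gradient_continuous[OF assms(2)]
    C1_continuous[OF C1c_C1[OF assms(1)]] C1_gradient_continuous[OF C1c_C1[OF assms(1)]]
  have 1: "Cc (\<lambda>x. u x * (h x \<bullet> e))"
    by (rule Cc_compose_zero[OF C1c_Cc[OF assms(1)]])
      (auto intro!: continuous_intros c)
  have 2: "Cc (\<lambda>x. (g x \<bullet> e) * v x)"
    by (rule Cc_compose_zero[OF C1c_gradient_Cc[OF assms(1)]])
      (auto intro!: continuous_intros c)
  have "0 = (\<integral>x. (u x *\<^sub>R h x + v x *\<^sub>R g x) \<bullet> e \<partial>lborel)"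
    using integral_directional_derivative[OF C1c_mult[OF assms]] by simp
  also have "\<dots> = (\<integral>x. u x * (h x \<bullet> e) + (g x \<bullet> e) * v x \<partial>lborel)"
    by (simp add: inner_add_left mult.commute)
  also have "\<dots> = (\<integral>x. u x * (h x \<bullet> e) \<partial>lborel) + (\<integral>x. (g x \<bullet> e) * v x \<partial>lborel)"
    using Cc_integrable[OF 1] Cc_integrable[OF 2] by simp
  finally show ?thesis by simp
qed

text \<open>The difference quotients replace the missing second derivatives.\<close>

lemma integral_swap_derivatives:
  fixes u :: "'a::euclidean_space \<Rightarrow> real"
  assumes u: "C1c u g" and v: "C1 v h"
  shows "(\<integral>x. (g x \<bullet> d) * (h x \<bullet> e) \<partial>lborel) = (\<integral>x. (g x \<bullet> e) * (h x \<bullet> d) \<partial>lborel)"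
proof -
  define s where "s = (\<lambda>n. inverse (real (Suc n)))"
  have s0: "s \<longlonglongrightarrow> 0" and sp: "\<And>n. s n > 0" and s1: "\<And>n. s n \<le> 1"
    unfolding s_def using LIMSEQ_inverse_real_of_nat by (auto simp: inverse_le_1_iff)
  have sm0: "(\<lambda>n. - s n) \<longlonglongrightarrow> 0" using tendsto_minus[OF s0] by simp
  note cu = C1c_Cc[OF u] and cg = C1c_gradient_Cc[OF u]
  note cont = C1_continuous[OF v] C1_gradient_continuous[OF v] C1_continuous[OF C1c_C1[OF u]] C1_gradient_continuous[OF C1c_C1[OF u]]
  obtain B where B: "\<And>x. norm (g x) \<le> B" "B > 0" using Cc_bounded[OF cg] by blast
  obtain R where R: "{x. u x \<noteq> 0} \<subseteq> cball 0 R" using Cc_supportE[OF cu] by blast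
  obtain R' where R': "{x. g x \<noteq> 0} \<subseteq> cball 0 R'" using Cc_supportE[OF cg] by blast
  \<comment> \<open>A compact set containing all points at which h is evaluated below, including
    those shifted backwards by at most \<open>norm d\<close>.\<close>
  define K where "K = cball (0::'a) (max R R' + norm d + norm d)"
  have "compact (h ` K)" unfolding K_def
    using cont by (intro compact_continuous_image) (auto intro: continuous_on_subset)
  then obtain H where H: "H > 0" "\<And>x. x \<in> K \<Longrightarrow> norm (h x) \<le> H"
    using bounded_pos compact_imp_bounded by (metis image_eqI)
  \<comment> \<open>Forward difference quotients of u and backward ones of v in direction d, written
    as averages so that their bounds and limits come from \<open>avg_bound\<close> and
    \<open>avg_tendsto\<close>.\<close>
  define q where "q = (\<lambda>n. avg (s n *\<^sub>R d) (\<lambda>x. g x \<bullet> d))"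
  define p where "p = (\<lambda>n. avg (- s n *\<^sub>R d) (\<lambda>x. h x \<bullet> d))"
  have cgd: "continuous_on UNIV (\<lambda>x. g x \<bullet> d)" and chd: "continuous_on UNIV (\<lambda>x. h x \<bullet> d)"
    and che: "continuous_on UNIV (\<lambda>x. h x \<bullet> e)" and cge: "continuous_on UNIV (\<lambda>x. g x \<bullet> e)"
    using cont by (auto intro!: continuous_intros)
  have q: "s n * q n x = u (x + s n *\<^sub>R d) - u x" for n x
    using C1_increment[OF C1c_C1[OF u], of x "s n *\<^sub>R d"] unfolding q_def avg_def by simp
  have p: "s n * p n x = v x - v (x + - s n *\<^sub>R d)" for n x
    using C1_increment[OF v, of x "- s n *\<^sub>R d"] unfolding p_def avg_def by simp
  have seg: "norm (x + r *\<^sub>R (- s n *\<^sub>R d)) \<le> norm x + norm d" if "0 \<le> r" "r \<le> 1" for r n x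
  proof -
    have "norm (r *\<^sub>R (- s n *\<^sub>R d)) \<le> 1 * (1 * norm d)"
      using that sp[of n] s1[of n] by (simp add: abs_mult mult_le_one mult_left_le_one_le mult_nonneg_nonneg flip: mult.assoc)
    then show ?thesis using norm_triangle_ineq[of x "r *\<^sub>R (- s n *\<^sub>R d)"] by simp
  qed
  \<comment> \<open>The discrete form of the claim: a translation moves the difference in direction
    d from u to h, and integration by parts moves the derivative in direction e from v to u.\<close>
  have eq: "(\<integral>x. q n x * (h x \<bullet> e) \<partial>lborel) = (\<integral>x. (g x \<bullet> e) * p n x \<partial>lborel)" for n
  proof -
    have c1: "Cc (\<lambda>x. u (x + s n *\<^sub>R d) * (h x \<bullet> e))"
      by (rule Cc_compose_zero[OF Cc_shift[OF cu, of "s n *\<^sub>R d"]])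
        (auto intro!: continuous_intros continuous_on_compose2[OF cont(3)] che)
    have c2: "Cc (\<lambda>x. u x * (h x \<bullet> e))"
      by (rule Cc_compose_zero[OF cu]) (auto intro!: continuous_intros cont che)
    have c3: "Cc (\<lambda>x. u x * (h (x + - s n *\<^sub>R d) \<bullet> e))"
      by (rule Cc_compose_zero[OF cu]) (auto intro!: continuous_intros cont continuous_on_compose2[OF cont(2)])
    have "s n * (\<integral>x. q n x * (h x \<bullet> e) \<partial>lborel) = (\<integral>x. (s n * q n x) * (h x \<bullet> e) \<partial>lborel)"
      by (simp add: mult.assoc)
    also have "\<dots> = (\<integral>x. u (x + s n *\<^sub>R d) * (h x \<bullet> e) \<partial>lborel) - (\<integral>x. u x * (h x \<bullet> e) \<partial>lborel)"
      unfolding q using Cc_integrable[OF c1] Cc_integrable[OF c2] by (simp add: left_diff_distrib)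
    also have "(\<integral>x. u (x + s n *\<^sub>R d) * (h x \<bullet> e) \<partial>lborel) = (\<integral>x. u x * (h (x + - s n *\<^sub>R d) \<bullet> e) \<partial>lborel)"
      using integral_shift[OF Cc_borel[OF c1], of "- s n *\<^sub>R d"] by simp
    also have "(\<integral>x. u x * (h (x + - s n *\<^sub>R d) \<bullet> e) \<partial>lborel) - (\<integral>x. u x * (h x \<bullet> e) \<partial>lborel)
        = - (\<integral>x. u x * ((h x - h (x + - s n *\<^sub>R d)) \<bullet> e) \<partial>lborel)"
      using Cc_integrable[OF c3] Cc_integrable[OF c2] by (simp add: inner_diff_left right_diff_distrib)
    also have "\<dots> = (\<integral>x. (g x \<bullet> e) * (v x - v (x + - s n *\<^sub>R d)) \<partial>lborel)"
      using integral_by_parts[OF u C1_diff[OF v C1_shift[OF v, of "- s n *\<^sub>R d"]]] by simp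
    also have "\<dots> = s n * (\<integral>x. (g x \<bullet> e) * p n x \<partial>lborel)"
      unfolding p[symmetric] by (simp add: mult.left_commute)
    finally show ?thesis using sp[of n] by simp
  qed
  have "(\<lambda>n. \<integral>x. q n x * (h x \<bullet> e) \<partial>lborel) \<longlonglongrightarrow> (\<integral>x. (g x \<bullet> d) * (h x \<bullet> e) \<partial>lborel)"
  proof (rule bounded_integral_tendsto)
    show "(\<lambda>x. q n x * (h x \<bullet> e)) \<in> borel_measurable borel" for n
      unfolding q_def by (intro borel_measurable_continuous_onI continuous_intros continuous_on_avg cgd che)
    show "(\<lambda>x. (g x \<bullet> d) * (h x \<bullet> e)) \<in> borel_measurable borel"
      by (intro borel_measurable_continuous_onI continuous_intros cgd che)
    show "q n x * (h x \<bullet> e) = 0" if "x \<notin> cball 0 (R + norm d)" for n x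
    proof -
      have "norm (s n *\<^sub>R d) \<le> norm d" using sp[of n] s1[of n] by (simp add: mult_left_le_one_le)
      then have "x + s n *\<^sub>R d \<notin> cball 0 R"
        using that norm_triangle_ineq4[of "x + s n *\<^sub>R d" "s n *\<^sub>R d"] by (auto simp del: norm_scaleR)
      moreover have "x \<notin> cball 0 R" using that norm_ge_zero[of d] by (auto simp del: norm_ge_zero)
      ultimately have "u (x + s n *\<^sub>R d) = 0" "u x = 0" using R by blast+
      then have "s n * q n x = 0" unfolding q by simp
      then show ?thesis using sp[of n] by simp
    qed
    show "\<bar>q n x * (h x \<bullet> e)\<bar> \<le> (B * norm d) * (H * norm e)" if "x \<in> cball 0 (R + norm d)" for n x
    proof -
      have "norm (q n x) \<le> B * norm d" unfolding q_def
        by (rule avg_bound[OF cgd]) (metis B(1) Cauchy_Schwarz_ineq2 mult_right_mono norm_ge_zero order_trans real_norm_def)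
      moreover have "x \<in> K" unfolding K_def using that norm_ge_zero[of d] by (auto simp del: norm_ge_zero)
      then have "\<bar>h x \<bullet> e\<bar> \<le> H * norm e"
        by (metis H(2) Cauchy_Schwarz_ineq2 mult_right_mono norm_ge_zero order_trans)
      ultimately show ?thesis unfolding abs_mult by (intro mult_mono) auto
    qed
    show "(\<lambda>n. q n x * (h x \<bullet> e)) \<longlonglongrightarrow> (g x \<bullet> d) * (h x \<bullet> e)" for x
      unfolding q_def by (intro tendsto_intros avg_tendsto cgd s0)
  qed
  moreover have "(\<lambda>n. \<integral>x. (g x \<bullet> e) * p n x \<partial>lborel) \<longlonglongrightarrow> (\<integral>x. (g x \<bullet> e) * (h x \<bullet> d) \<partial>lborel)"
  proof (rule bounded_integral_tendsto)
    show "(\<lambda>x. (g x \<bullet> e) * p n x) \<in> borel_measurable borel" for n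
      unfolding p_def by (intro borel_measurable_continuous_onI continuous_intros continuous_on_avg cge chd)
    show "(\<lambda>x. (g x \<bullet> e) * (h x \<bullet> d)) \<in> borel_measurable borel"
      by (intro borel_measurable_continuous_onI continuous_intros cge chd)
    show "(g x \<bullet> e) * p n x = 0" if "x \<notin> cball 0 R'" for n x
    proof -
      have "g x = 0" using R' that by blast
      then show ?thesis by simp
    qed
    show "\<bar>(g x \<bullet> e) * p n x\<bar> \<le> (B * norm e) * (H * norm d)" if "x \<in> cball 0 R'" for n x
    proof -
      have "norm (p n x) \<le> H * norm d" unfolding p_def
      proof (rule avg_bound[OF chd])
        fix r :: real assume r: "0 \<le> r" "r \<le> 1"
        have "x + r *\<^sub>R (- s n *\<^sub>R d) \<in> K" unfolding K_def
          using seg[OF r, of x n] that max.cobounded2[of R' R] norm_ge_zero[of d]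
          by (simp del: norm_ge_zero)
        then show "norm (h (x + r *\<^sub>R (- s n *\<^sub>R d)) \<bullet> d) \<le> H * norm d"
          by (metis H(2) Cauchy_Schwarz_ineq2 mult_right_mono norm_ge_zero order_trans real_norm_def)
      qed
      moreover have "\<bar>g x \<bullet> e\<bar> \<le> B * norm e"
        by (metis B(1) Cauchy_Schwarz_ineq2 mult_right_mono norm_ge_zero order_trans)
      ultimately show ?thesis unfolding abs_mult by (intro mult_mono) auto
    qed
    show "(\<lambda>n. (g x \<bullet> e) * p n x) \<longlonglongrightarrow> (g x \<bullet> e) * (h x \<bullet> d)" for x
      unfolding p_def by (intro tendsto_intros avg_tendsto chd sm0)
  qed
  ultimately show ?thesis unfolding eq using LIMSEQ_unique by blast
qed

text \<open>Minus the determinant of \<open>(a, b)\<close>: the inner product of b with a turned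
  clockwise by a right angle. Applied to two gradients it is the Jacobian in the advection
  term.\<close>

definition cross2 :: "plane \<Rightarrow> plane \<Rightarrow> real" where
  "cross2 a b = a $ 2 * b $ 1 - a $ 1 * b $ 2"

text \<open>Lagrange's identity: the squares of \<open>cross2 a b\<close> and of the inner product
  add up to the squared product of the norms.\<close>

lemma abs_cross2_le: "\<bar>cross2 a b\<bar> \<le> norm a * norm b"
proof (rule power2_le_imp_le)
  have "\<bar>cross2 a b\<bar>\<^sup>2 + (a \<bullet> b)\<^sup>2 = (norm a * norm b)\<^sup>2"
    unfolding cross2_def power_mult_distrib power2_norm_eq_inner
    by (simp add: inner_vec_def sum_2 power2_eq_square algebra_simps)
  then show "\<bar>cross2 a b\<bar>\<^sup>2 \<le> (norm a * norm b)\<^sup>2" using zero_le_power2[of "a \<bullet> b"] by linarith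
qed auto

lemma continuous_on_cross2 [continuous_intros]:
  "continuous_on S f \<Longrightarrow> continuous_on S g \<Longrightarrow> continuous_on S (\<lambda>x. cross2 (f x) (g x))"
  unfolding cross2_def by (intro continuous_intros)

text \<open>By the product rule the two sides differ by the integral of the Jacobian of
  \<open>u v\<close> and w, which vanishes because the derivatives in the two coordinate directions
  may be swapped.\<close>

lemma integral_cross2_antisym:
  assumes u: "C1c u gu" and v: "C1 v gv" and w: "C1 w gw"
  shows "(\<integral>x. u x * cross2 (gv x) (gw x) \<partial>lborel) = - (\<integral>x. v x * cross2 (gu x) (gw x) \<partial>lborel)"
proof -
  note c = C1_continuous[OF v] C1_gradient_continuous[OF v] C1_gradient_continuous[OF w]
    C1_continuous[OF C1c_C1[OF u]] C1_gradient_continuous[OF C1c_C1[OF u]]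
  have i1: "integrable lborel (\<lambda>x. u x * cross2 (gv x) (gw x))"
    by (rule Cc_integrable, rule Cc_compose_zero[OF C1c_Cc[OF u]]) (auto intro!: continuous_intros c)
  have i2: "integrable lborel (\<lambda>x. v x * cross2 (gu x) (gw x))"
    by (rule Cc_integrable, rule Cc_compose_zero[OF C1c_gradient_Cc[OF u]])
      (auto intro!: continuous_intros c simp: cross2_def)
  let ?g = "\<lambda>x. u x *\<^sub>R gv x + v x *\<^sub>R gu x"
  have uv: "C1c (\<lambda>x. u x * v x) ?g" by (rule C1c_mult[OF u v])
  have j: "integrable lborel (\<lambda>x. (?g x \<bullet> axis i 1) * (gw x \<bullet> axis k 1))" for i k
    by (rule Cc_integrable, rule Cc_compose_zero[OF C1c_gradient_Cc[OF uv]])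
      (auto intro!: continuous_intros c)
  have "(\<integral>x. u x * cross2 (gv x) (gw x) \<partial>lborel) + (\<integral>x. v x * cross2 (gu x) (gw x) \<partial>lborel)
     = (\<integral>x. (?g x \<bullet> axis 2 1) * (gw x \<bullet> axis 1 1) - (?g x \<bullet> axis 1 1) * (gw x \<bullet> axis 2 1) \<partial>lborel)"
    unfolding Bochner_Integration.integral_add[OF i1 i2, symmetric]
    by (rule Bochner_Integration.integral_cong) (auto simp: cross2_def inner_axis algebra_simps)
  also have "\<dots> = 0"
    unfolding Bochner_Integration.integral_diff[OF j j]
    using integral_swap_derivatives[OF uv w, of "axis 2 1" "axis 1 1"] by simp
  finally show ?thesis by simp
qed

subsection \<open>Averages of nonnegative functions\<close>

text \<open>The average with values in \<open>ennreal\<close>, where Tonelli's theorem applies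
  without integrability conditions.\<close>

definition navg :: "'a::euclidean_space \<Rightarrow> ('a \<Rightarrow> ennreal) \<Rightarrow> 'a \<Rightarrow> ennreal" where
  "navg e f x = (\<integral>\<^sup>+r\<in>{0..1}. f (x + r *\<^sub>R e) \<partial>lborel)"

lemma borel_measurable_navg [measurable]:
  assumes [measurable]: "f \<in> borel_measurable borel"
  shows "navg e f \<in> borel_measurable borel"
  unfolding navg_def by measurable

lemma navg_mono: "(\<And>r. 0 \<le> r \<Longrightarrow> r \<le> 1 \<Longrightarrow> f (x + r *\<^sub>R e) \<le> g (x + r *\<^sub>R e)) \<Longrightarrow> navg e f x \<le> navg e g x"
  unfolding navg_def by (intro nn_integral_mono) (auto simp: indicator_def)

lemma norm_avg_le_navg:
  assumes "continuous_on UNIV v"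
  shows "ennreal (norm (avg e v x)) \<le> navg e (\<lambda>y. ennreal (norm (v y))) x"
proof -
  have [measurable]: "v \<in> borel_measurable borel" using assms by (rule borel_measurable_continuous_onI)
  have "set_integrable lborel {0..1} (\<lambda>r. v (x + r *\<^sub>R e))"
    unfolding set_integrable_def
    by (intro borel_integrable_compact continuous_on_compose2[OF assms] continuous_intros) auto
  then have "ennreal (norm (avg e v x)) \<le> (\<integral>\<^sup>+r. norm (indicator {0..1} r *\<^sub>R v (x + r *\<^sub>R e)) \<partial>lborel)"
    unfolding avg_as_integral[OF assms] set_integrable_def by (rule integral_norm_bound_ennreal)
  also have "\<dots> = navg e (\<lambda>y. ennreal (norm (v y))) x"
    unfolding navg_def by (intro nn_integral_cong) (auto simp: indicator_def)
  finally show ?thesis .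
qed

text \<open>Jensen's inequality, as Cauchy--Schwarz on the unit interval.\<close>

lemma navg_square_le:
  assumes [measurable]: "f \<in> borel_measurable borel"
  shows "(navg e f x)\<^sup>2 \<le> navg e (\<lambda>y. (f y)\<^sup>2) x"
proof -
  have "(\<integral>\<^sup>+r. (f (x + r *\<^sub>R e) * indicator {0..1} r) * indicator {0..1} r \<partial>lborel)\<^sup>2
     \<le> (\<integral>\<^sup>+r. (f (x + r *\<^sub>R e) * indicator {0..1} r)\<^sup>2 \<partial>lborel) * (\<integral>\<^sup>+r. (indicator {0..1::real} r)\<^sup>2 \<partial>lborel)"
    by (rule Cauchy_Schwarz_nn_integral) auto
  also have "(\<integral>\<^sup>+r. (indicator {0..1::real} r)\<^sup>2 \<partial>lborel) = (\<integral>\<^sup>+r. indicator {0..1::real} r \<partial>lborel)"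
    by (intro nn_integral_cong) (auto simp: indicator_def)
  also have "\<dots> = 1" by simp
  finally have "(\<integral>\<^sup>+r. (f (x + r *\<^sub>R e) * indicator {0..1} r) * indicator {0..1} r \<partial>lborel)\<^sup>2
     \<le> (\<integral>\<^sup>+r. (f (x + r *\<^sub>R e) * indicator {0..1} r)\<^sup>2 \<partial>lborel)" by simp
  moreover have "(f (x + r *\<^sub>R e) * indicator {0..1} r) * indicator {0..1} r = f (x + r *\<^sub>R e) * indicator {0..1} r"
    "(f (x + r *\<^sub>R e) * indicator {0..1} r)\<^sup>2 = (f (x + r *\<^sub>R e))\<^sup>2 * indicator {0..1} r" for r
    by (auto simp: indicator_def)
  ultimately show ?thesis unfolding navg_def by simp
qed

lemma nn_set_integral_shift_le:
  fixes f :: "'a::euclidean_space \<Rightarrow> ennreal"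
  assumes [measurable]: "f \<in> borel_measurable borel" "D \<in> sets borel"
    and D: "\<And>x. x \<in> D \<Longrightarrow> x + a \<in> D"
  shows "(\<integral>\<^sup>+x\<in>D. f (x + a) \<partial>lborel) \<le> (\<integral>\<^sup>+x\<in>D. f x \<partial>lborel)"
proof -
  have "(\<integral>\<^sup>+x\<in>D. f (x + a) \<partial>lborel) \<le> (\<integral>\<^sup>+x. f (x + a) * indicator D (x + a) \<partial>lborel)"
    by (intro nn_integral_mono) (auto simp: indicator_def D)
  also have "\<dots> = (\<integral>\<^sup>+x\<in>D. f x \<partial>lborel)"
    by (rule nn_integral_shift[of "\<lambda>x. f x * indicator D x"]) auto
  finally show ?thesis .
qed

text \<open>The model is the region above a Lipschitz graph, with e pointing upwards more steeply
  than the graph.\<close>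

definition forward_closed :: "'a::euclidean_space \<Rightarrow> 'a set \<Rightarrow> bool" where
  "forward_closed e D \<longleftrightarrow> D \<in> sets borel \<and> (\<forall>x\<in>D. \<forall>s\<ge>0. x + s *\<^sub>R e \<in> D)"

lemma forward_closed_UNIV [simp]: "forward_closed e UNIV"
  by (simp add: forward_closed_def)

lemma forward_closed_scale: "forward_closed e D \<Longrightarrow> c \<ge> 0 \<Longrightarrow> forward_closed (c *\<^sub>R e) D"
  by (auto simp: forward_closed_def)

lemma forward_closedD:
  assumes "forward_closed e D" shows "D \<in> sets borel" "x \<in> D \<Longrightarrow> 0 \<le> s \<Longrightarrow> x + s *\<^sub>R e \<in> D" "x \<in> D \<Longrightarrow> x + e \<in> D"
proof -
  show "D \<in> sets borel" "x \<in> D \<Longrightarrow> 0 \<le> s \<Longrightarrow> x + s *\<^sub>R e \<in> D"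
    using assms by (auto simp: forward_closed_def)
  show "x \<in> D \<Longrightarrow> x + e \<in> D" using assms unfolding forward_closed_def by (metis scaleR_one zero_le_one)
qed

text \<open>Tonelli: for each r the translation by \<open>r *\<^sub>R e\<close> maps D into itself,
  and the part of D that is not reached only helps.\<close>

lemma nn_integral_navg_le:
  assumes [measurable]: "f \<in> borel_measurable borel" and D: "forward_closed e D"
  shows "(\<integral>\<^sup>+x\<in>D. navg e f x \<partial>lborel) \<le> (\<integral>\<^sup>+x\<in>D. f x \<partial>lborel)"
proof -
  have [measurable]: "D \<in> sets borel" by (rule forward_closedD[OF D])
  have "(\<integral>\<^sup>+x\<in>D. navg e f x \<partial>lborel)
      = (\<integral>\<^sup>+x. (\<integral>\<^sup>+r. f (x + r *\<^sub>R e) * indicator {0..1} r * indicator D x \<partial>lborel) \<partial>lborel)"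
    unfolding navg_def by (simp add: nn_integral_multc)
  also have "\<dots> = (\<integral>\<^sup>+r. (\<integral>\<^sup>+x. f (x + r *\<^sub>R e) * indicator {0..1} r * indicator D x \<partial>lborel) \<partial>lborel)"
    by (rule lborel_pair.Fubini') measurable
  also have "\<dots> = (\<integral>\<^sup>+r. (\<integral>\<^sup>+x\<in>D. f (x + r *\<^sub>R e) \<partial>lborel) * indicator {0..1} r \<partial>lborel)"
    by (intro nn_integral_cong, subst nn_integral_multc[symmetric]) (auto simp: ac_simps)
  also have "\<dots> \<le> (\<integral>\<^sup>+r. (\<integral>\<^sup>+x\<in>D. f x \<partial>lborel) * indicator {0..1::real} r \<partial>lborel)"
  proof (rule nn_integral_mono)
    fix r :: real
    show "(\<integral>\<^sup>+x\<in>D. f (x + r *\<^sub>R e) \<partial>lborel) * indicator {0..1} r \<le> (\<integral>\<^sup>+x\<in>D. f x \<partial>lborel) * indicator {0..1::real} r"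
    proof (cases "r \<in> {0..1}")
      case True
      then show ?thesis
        using nn_set_integral_shift_le[of f D "r *\<^sub>R e"] forward_closedD(2)[OF D] by simp
    qed simp
  qed
  also have "\<dots> = (\<integral>\<^sup>+x\<in>D. f x \<partial>lborel)" by (simp add: nn_integral_cmult)
  finally show ?thesis .
qed

lemma nn_integral_avg_square_le:
  fixes v :: "'a::euclidean_space \<Rightarrow> 'b::euclidean_space"
  assumes v: "continuous_on UNIV v" and D: "forward_closed e D"
  shows "(\<integral>\<^sup>+x\<in>D. ennreal ((norm (avg e v x))\<^sup>2) \<partial>lborel) \<le> (\<integral>\<^sup>+x\<in>D. ennreal ((norm (v x))\<^sup>2) \<partial>lborel)"
proof -
  have [measurable]: "v \<in> borel_measurable borel" using v by (rule borel_measurable_continuous_onI)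
  have "ennreal ((norm (avg e v x))\<^sup>2) \<le> navg e (\<lambda>y. ennreal ((norm (v y))\<^sup>2)) x" for x
  proof -
    have "ennreal ((norm (avg e v x))\<^sup>2) = (ennreal (norm (avg e v x)))\<^sup>2" by (simp add: ennreal_power)
    also have "\<dots> \<le> (navg e (\<lambda>y. ennreal (norm (v y))) x)\<^sup>2"
      by (intro power_mono norm_avg_le_navg v) auto
    also have "\<dots> \<le> navg e (\<lambda>y. (ennreal (norm (v y)))\<^sup>2) x" by (rule navg_square_le) simp
    finally show ?thesis by (simp add: ennreal_power)
  qed
  then have "(\<integral>\<^sup>+x\<in>D. ennreal ((norm (avg e v x))\<^sup>2) \<partial>lborel) \<le> (\<integral>\<^sup>+x\<in>D. navg e (\<lambda>y. ennreal ((norm (v y))\<^sup>2)) x \<partial>lborel)"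
    by (intro nn_integral_mono mult_right_mono) auto
  also have "\<dots> \<le> (\<integral>\<^sup>+x\<in>D. ennreal ((norm (v x))\<^sup>2) \<partial>lborel)"
    by (rule nn_integral_navg_le[OF _ D]) measurable
  finally show ?thesis .
qed

lemma nn_integral_increment_square_le:
  assumes u: "C1 u g" and D: "forward_closed e D"
  shows "(\<integral>\<^sup>+x\<in>D. ennreal ((u (x + e) - u x)\<^sup>2) \<partial>lborel) \<le> (\<integral>\<^sup>+x\<in>D. ennreal ((g x \<bullet> e)\<^sup>2) \<partial>lborel)"
  using nn_integral_avg_square_le[of "\<lambda>x. g x \<bullet> e", OF _ D] C1_gradient_continuous[OF u]
  by (simp add: C1_increment[OF u] continuous_intros)

subsection \<open>The second order one-sided average\<close>

text \<open>Richardson extrapolation: the terms of first order in \<open>e\<close> cancel in \<open>sm e u - u\<close>, as they would for a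
  symmetric average.\<close>

definition sm :: "'a::euclidean_space \<Rightarrow> ('a \<Rightarrow> 'b::euclidean_space) \<Rightarrow> 'a \<Rightarrow> 'b" where
  "sm e u x = 2 *\<^sub>R avg e u x - avg (2 *\<^sub>R e) u x"

definition diff2 :: "'a::euclidean_space \<Rightarrow> ('a \<Rightarrow> real) \<Rightarrow> 'a \<Rightarrow> real" where
  "diff2 e u x = 2 * u (x + e) - u x - u (x + 2 *\<^sub>R e)"

text \<open>With \<open>w\<^sub>j = (u (\<cdot> + 2\<^sup>j e) - u) / 2\<^sup>j\<close> the average of \<open>w\<^sub>j\<close> and its translate by \<open>2\<^sup>j e\<close> is
  \<open>w\<^bsub>j+1\<^esub>\<close> and their difference is a second difference of \<open>u\<close>, so the parallelogram identity telescopes.\<close>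

lemma sum_diff2_le:
  fixes N :: nat
  assumes u: "C1 u g" and D: "forward_closed e D"
  shows "(\<Sum>j<N. \<integral>\<^sup>+x\<in>D. ennreal ((diff2 (2^j *\<^sub>R e) u x)\<^sup>2 / (4 * 4^j)) \<partial>lborel) \<le> (\<integral>\<^sup>+x\<in>D. ennreal ((g x \<bullet> e)\<^sup>2) \<partial>lborel)"
proof -
  have [measurable]: "u \<in> borel_measurable borel" using C1_continuous[OF u] by (rule borel_measurable_continuous_onI)
  have [measurable]: "D \<in> sets borel" by (rule forward_closedD[OF D])
  define w where "w = (\<lambda>j x. (u (x + 2^j *\<^sub>R e) - u x) / 2^j)"
  have [measurable]: "w j \<in> borel_measurable borel" for j unfolding w_def by measurable
  have [measurable]: "diff2 a u \<in> borel_measurable borel" for a unfolding diff2_def by measurable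
  define I where "I = (\<lambda>j. \<integral>\<^sup>+x\<in>D. ennreal ((w j x)\<^sup>2) \<partial>lborel)"
  define a where "a = (\<lambda>j. \<integral>\<^sup>+x\<in>D. ennreal ((diff2 (2^j *\<^sub>R e) u x)\<^sup>2 / (4 * 4^j)) \<partial>lborel)"
  \<comment> \<open>D is forward closed, so the translated term of the identity below contributes at
    most half of \<open>I j\<close>; the energy \<open>I j\<close> thus drops by at least
    \<open>a j\<close> from each scale to the next.\<close>
  have step: "a j + I (Suc j) \<le> I j" for j
  proof -
    \<comment> \<open>With p and q the quotient \<open>w j\<close> at x and at its translate, this
      reads \<open>((p - q) / 2)^2 + ((p + q) / 2)^2 = p^2 / 2 + q^2 / 2\<close>; the divisor
      \<open>4 * 4^j\<close> normalises the second difference \<open>2^j * (p - q)\<close>.\<close>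
    have pw: "(diff2 (2^j *\<^sub>R e) u x)\<^sup>2 / (4 * 4^j) + (w (Suc j) x)\<^sup>2 = (w j x)\<^sup>2 / 2 + (w j (x + 2^j *\<^sub>R e))\<^sup>2 / 2" for x
    proof -
      define p q where "p = w j x" and "q = w j (x + 2^j *\<^sub>R e)"
      have e2: "x + 2^j *\<^sub>R e + 2^j *\<^sub>R e = x + (2 * 2^j) *\<^sub>R e"
        by (simp add: add.assoc flip: scaleR_left_distrib)
      have 1: "w (Suc j) x = (p + q) / 2"
        unfolding p_def q_def w_def e2 by (simp add: field_simps)
      have 2: "diff2 (2^j *\<^sub>R e) u x = 2^j * (p - q)"
        unfolding p_def q_def w_def e2 diff2_def by (simp add: field_simps)
      have 4: "(4::real)^j = 2^j * 2^j" by (simp flip: power_mult_distrib)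
      have "(diff2 (2^j *\<^sub>R e) u x)\<^sup>2 / (4 * 4^j) = (p - q)\<^sup>2 / 4"
        unfolding 2 4 power_mult_distrib by (simp add: power2_eq_square)
      then show ?thesis unfolding 1 p_def[symmetric] q_def[symmetric]
        by (simp add: power2_eq_square field_simps)
    qed
    have pw': "ennreal ((diff2 (2^j *\<^sub>R e) u x)\<^sup>2 / (4 * 4^j)) + ennreal ((w (Suc j) x)\<^sup>2)
        = ennreal (1/2) * ennreal ((w j x)\<^sup>2) + ennreal (1/2) * ennreal ((w j (x + 2^j *\<^sub>R e))\<^sup>2)" for x
    proof -
      have "ennreal ((diff2 (2^j *\<^sub>R e) u x)\<^sup>2 / (4 * 4^j)) + ennreal ((w (Suc j) x)\<^sup>2)
          = ennreal ((w j x)\<^sup>2 / 2 + (w j (x + 2^j *\<^sub>R e))\<^sup>2 / 2)"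
        by (subst ennreal_plus[symmetric]) (simp_all only: pw zero_le_divide_iff zero_le_power2 zero_le_mult_iff, auto)
      also have "\<dots> = ennreal (1/2 * (w j x)\<^sup>2) + ennreal (1/2 * (w j (x + 2^j *\<^sub>R e))\<^sup>2)"
        by (subst ennreal_plus[symmetric]) auto
      finally show ?thesis by (simp only: ennreal_mult' zero_le_divide_1_iff zero_le_numeral)
    qed
    have "a j + I (Suc j) = (\<integral>\<^sup>+x\<in>D. (ennreal ((diff2 (2^j *\<^sub>R e) u x)\<^sup>2 / (4 * 4^j)) + ennreal ((w (Suc j) x)\<^sup>2)) \<partial>lborel)"
      unfolding a_def I_def by (subst nn_integral_add[symmetric]) (auto simp: distrib_right)
    also have "\<dots> = (\<integral>\<^sup>+x\<in>D. (ennreal (1/2) * ennreal ((w j x)\<^sup>2) + ennreal (1/2) * ennreal ((w j (x + 2^j *\<^sub>R e))\<^sup>2)) \<partial>lborel)"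
      by (simp only: pw')
    also have "\<dots> = ennreal (1/2) * I j + ennreal (1/2) * (\<integral>\<^sup>+x\<in>D. ennreal ((w j (x + 2^j *\<^sub>R e))\<^sup>2) \<partial>lborel)"
      unfolding I_def by (simp add: distrib_right nn_integral_add nn_integral_cmult mult.assoc)
    also have "\<dots> \<le> ennreal (1/2) * I j + ennreal (1/2) * I j"
      unfolding I_def
      by (intro add_left_mono mult_left_mono nn_set_integral_shift_le[of "\<lambda>x. ennreal ((w j x)\<^sup>2)"] forward_closedD(2)[OF D]) auto
    also have "\<dots> = I j"
    proof -
      have "ennreal (1/2) + ennreal (1/2) = 1" by (subst ennreal_plus[symmetric]) auto
      then show ?thesis by (simp only: distrib_right[symmetric] mult_1)
    qed
    finally show ?thesis .
  qed
  have "(\<Sum>j<N. a j) + I N \<le> I 0"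
  proof (induction N)
    case (Suc N)
    have "(\<Sum>j<Suc N. a j) + I (Suc N) = (\<Sum>j<N. a j) + (a N + I (Suc N))" by (simp add: ac_simps)
    also have "\<dots> \<le> (\<Sum>j<N. a j) + I N" by (intro add_left_mono step)
    finally show ?case using Suc by order
  qed simp
  then have "(\<Sum>j<N. a j) \<le> I 0" by (metis le_iff_add order_trans)
  also have "I 0 \<le> (\<integral>\<^sup>+x\<in>D. ennreal ((g x \<bullet> e)\<^sup>2) \<partial>lborel)"
    unfolding I_def w_def using nn_integral_increment_square_le[OF u D] by simp
  finally show ?thesis unfolding a_def .
qed

text \<open>The second average runs over the points \<open>x + 2 r e\<close>; for each r the two
  integrands combine with \<open>u x\<close> into a second difference.\<close>

lemma sm_minus_eq:
  assumes "continuous_on UNIV u"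
  shows "sm e u x - u x = integral {0..1} (\<lambda>r. diff2 (r *\<^sub>R e) u x)"
proof -
  note i = segment_integrable[OF assms]
  have 2: "(\<lambda>r. u (x + 2 *\<^sub>R r *\<^sub>R e)) integrable_on {0..1}"
    using i[of x "2 *\<^sub>R e"] by (simp add: mult.commute)
  have c: "(\<lambda>r::real. u x) integrable_on {0..1}" by (rule integrable_const_ivl)
  have d: "diff2 (r *\<^sub>R e) u x = (2 * u (x + r *\<^sub>R e) - u x) - u (x + 2 *\<^sub>R r *\<^sub>R e)" for r
    by (simp add: diff2_def)
  have i2: "(\<lambda>r. 2 * u (x + r *\<^sub>R e)) integrable_on {0..1}"
    using i by (simp add: integrable_on_mult_right)
  have "integral {0..1} (\<lambda>r. diff2 (r *\<^sub>R e) u x)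
     = (2 * integral {0..1} (\<lambda>r. u (x + r *\<^sub>R e)) - u x) - integral {0..1} (\<lambda>r. u (x + 2 *\<^sub>R r *\<^sub>R e))"
    unfolding d by (subst integral_diff[OF integrable_diff[OF i2 c] 2], subst integral_diff[OF i2 c]) simp
  then show ?thesis
    by (simp add: sm_def avg_def mult.commute)
qed

text \<open>The smoothing error is a mean over r of second differences with step
  \<open>r * (1/2)^k\<close>. For fixed r these steps form a dyadic sequence, so after Jensen's
  inequality the sum over k is the one of \<open>sum_diff2_le\<close>, read from the finest step
  upwards.\<close>

lemma sum_sm_minus_le:
  fixes u :: "'a::euclidean_space \<Rightarrow> real"
  assumes u: "C1 u g" and D: "forward_closed e D"
  shows "(\<Sum>k<N. 4^k * (\<integral>\<^sup>+x\<in>D. ennreal ((sm ((1/2)^k *\<^sub>R e) u x - u x)\<^sup>2) \<partial>lborel)) \<le> 4 * (\<integral>\<^sup>+x\<in>D. ennreal ((g x \<bullet> e)\<^sup>2) \<partial>lborel)"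
proof -
  note cu = C1_continuous[OF u]
  have [measurable]: "u \<in> borel_measurable borel" using cu by (rule borel_measurable_continuous_onI)
  have [measurable]: "g \<in> borel_measurable borel" using C1_gradient_continuous[OF u] by (rule borel_measurable_continuous_onI)
  have [measurable]: "D \<in> sets borel" by (rule forward_closedD[OF D])
  let ?G = "\<integral>\<^sup>+x\<in>D. ennreal ((g x \<bullet> e)\<^sup>2) \<partial>lborel"
  have pw: "ennreal ((sm a u x - u x)\<^sup>2) \<le> (\<integral>\<^sup>+r\<in>{0..1}. ennreal ((diff2 (r *\<^sub>R a) u x)\<^sup>2) \<partial>lborel)" for a x
  proof -
    define v where "v = (\<lambda>r::real. diff2 (r *\<^sub>R a) u x)"
    have cv: "continuous_on UNIV v" unfolding v_def diff2_def
      by (intro continuous_intros continuous_on_compose2[OF cu]) auto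
    \<comment> \<open>A mean over r is itself an average, of a function on the real line at the
      point 0, so \<open>navg_square_le\<close> serves here too.\<close>
    have "sm a u x - u x = avg 1 v 0" unfolding avg_def v_def using sm_minus_eq[OF cu, of a x] by simp
    then have "ennreal ((sm a u x - u x)\<^sup>2) = (ennreal (norm (avg 1 v 0)))\<^sup>2" by (simp add: ennreal_power)
    also have "\<dots> \<le> (navg 1 (\<lambda>y. ennreal (norm (v y))) 0)\<^sup>2"
      by (intro power_mono norm_avg_le_navg cv) auto
    also have "\<dots> \<le> navg 1 (\<lambda>y. (ennreal (norm (v y)))\<^sup>2) 0"
      using borel_measurable_continuous_onI[OF cv] by (intro navg_square_le) measurable
    finally show ?thesis by (simp add: ennreal_power navg_def v_def)
  qed
  have md: "(\<lambda>(r::real, x). diff2 ((r * c) *\<^sub>R e) u x) \<in> borel_measurable (borel \<Otimes>\<^sub>M borel)" for c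
    unfolding diff2_def split_beta by measurable
  have [measurable]: "(\<lambda>p::real \<times> 'a. diff2 ((fst p * c) *\<^sub>R e) u (snd p)) \<in> borel_measurable (borel \<Otimes>\<^sub>M borel)" for c
    unfolding diff2_def by measurable
  have [measurable]: "diff2 a u \<in> borel_measurable borel" for a unfolding diff2_def by measurable
  define J where "J = (\<lambda>k r. \<integral>\<^sup>+x\<in>D. ennreal ((diff2 ((r * (1/2)^k) *\<^sub>R e) u x)\<^sup>2) \<partial>lborel)"
  have [measurable]: "J k \<in> borel_measurable borel" for k unfolding J_def by measurable
  have "(\<Sum>k<N. 4^k * (\<integral>\<^sup>+x\<in>D. ennreal ((sm ((1/2)^k *\<^sub>R e) u x - u x)\<^sup>2) \<partial>lborel))
      \<le> (\<Sum>k<N. 4^k * (\<integral>\<^sup>+r\<in>{0..1}. J k r \<partial>lborel))"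
  proof (intro sum_mono mult_left_mono)
    fix k
    have "(\<integral>\<^sup>+x\<in>D. ennreal ((sm ((1/2)^k *\<^sub>R e) u x - u x)\<^sup>2) \<partial>lborel)
      \<le> (\<integral>\<^sup>+x\<in>D. (\<integral>\<^sup>+r\<in>{0..1}. ennreal ((diff2 ((r * (1/2)^k) *\<^sub>R e) u x)\<^sup>2) \<partial>lborel) \<partial>lborel)"
      using pw[of "(1/2)^k *\<^sub>R e"] by (intro nn_integral_mono mult_right_mono) auto
    also have "\<dots> = (\<integral>\<^sup>+x. (\<integral>\<^sup>+r. ennreal ((diff2 ((r * (1/2)^k) *\<^sub>R e) u x)\<^sup>2) * indicator {0..1} r * indicator D x \<partial>lborel) \<partial>lborel)"
      by (subst nn_integral_multc) (auto simp: diff2_def)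
    also have "\<dots> = (\<integral>\<^sup>+r. (\<integral>\<^sup>+x. ennreal ((diff2 ((r * (1/2)^k) *\<^sub>R e) u x)\<^sup>2) * indicator {0..1} r * indicator D x \<partial>lborel) \<partial>lborel)"
      by (rule lborel_pair.Fubini') (unfold diff2_def, measurable)
    also have "\<dots> = (\<integral>\<^sup>+r\<in>{0..1}. J k r \<partial>lborel)"
      unfolding J_def by (intro nn_integral_cong, subst nn_integral_multc[symmetric]) (auto simp: ac_simps)
    finally show "(\<integral>\<^sup>+x\<in>D. ennreal ((sm ((1/2)^k *\<^sub>R e) u x - u x)\<^sup>2) \<partial>lborel) \<le> (\<integral>\<^sup>+r\<in>{0..1}. J k r \<partial>lborel)" .
  qed simp
  also have "\<dots> = (\<integral>\<^sup>+r\<in>{0..1}. (\<Sum>k<N. 4^k * J k r) \<partial>lborel)"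
    by (simp add: sum_distrib_right nn_integral_sum nn_integral_cmult mult.assoc)
  also have "\<dots> \<le> (\<integral>\<^sup>+r\<in>{0..1::real}. 4 * ?G \<partial>lborel)"
  proof (intro nn_integral_mono)
    fix r :: real
    show "(\<Sum>k<N. 4^k * J k r) * indicator {0..1} r \<le> 4 * ?G * indicator {0..1} r"
    proof (cases "r \<in> {0..1} \<and> N > 0")
      case True
      then obtain M where N: "N = Suc M" by (cases N) auto
      \<comment> \<open>The finest step. Reversing the summation by \<open>k = M - j\<close> turns
        the k-th step into \<open>2^j\<close> times \<open>e'\<close>, as
        \<open>sum_diff2_le\<close> wants it, and the weights match since
        \<open>4^k = 4^N / (4 * 4^j)\<close>.\<close>
      define e' where "e' = (r * (1/2)^M) *\<^sub>R e"
      have "(\<Sum>k<N. 4^k * J k r) = (\<Sum>j<N. 4^(M - j) * J (M - j) r)"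
        unfolding N using sum.nat_diff_reindex[of "\<lambda>k. 4^k * J k r" "Suc M"] by simp
      also have "\<dots> = (\<Sum>j<N. 4^N * (\<integral>\<^sup>+x\<in>D. ennreal ((diff2 (2^j *\<^sub>R e') u x)\<^sup>2 / (4 * 4^j)) \<partial>lborel))"
      proof (rule sum.cong[OF refl])
        fix j assume "j \<in> {..<N}"
        then have j: "j \<le> M" by (simp add: N)
        have p: "(1/2::real)^(M - j) = (1/2)^M * 2^j"
          using j by (simp add: power_diff power_one_over field_simps)
        have q: "(4::real)^(M - j) = 4^N / (4 * 4^j)"
          using j by (simp add: power_diff N)
        have "4^(M - j) * J (M - j) r = (\<integral>\<^sup>+x\<in>D. ennreal (4^(M - j)) * ennreal ((diff2 (2^j *\<^sub>R e') u x)\<^sup>2) \<partial>lborel)"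
          unfolding J_def p e'_def
          by (subst nn_integral_cmult[symmetric]) (auto simp: ennreal_power[symmetric] mult.assoc mult.commute mult.left_commute)
        also have "\<dots> = (\<integral>\<^sup>+x\<in>D. ennreal (4^N) * ennreal ((diff2 (2^j *\<^sub>R e') u x)\<^sup>2 / (4 * 4^j)) \<partial>lborel)"
          unfolding q by (simp add: ennreal_mult'[symmetric])
        also have "\<dots> = 4^N * (\<integral>\<^sup>+x\<in>D. ennreal ((diff2 (2^j *\<^sub>R e') u x)\<^sup>2 / (4 * 4^j)) \<partial>lborel)"
          by (subst nn_integral_cmult[symmetric]) (auto simp: ennreal_power[symmetric] mult.assoc)
        finally show "4^(M - j) * J (M - j) r = 4^N * (\<integral>\<^sup>+x\<in>D. ennreal ((diff2 (2^j *\<^sub>R e') u x)\<^sup>2 / (4 * 4^j)) \<partial>lborel)" .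
      qed
      also have "\<dots> \<le> 4^N * (\<integral>\<^sup>+x\<in>D. ennreal ((g x \<bullet> e')\<^sup>2) \<partial>lborel)"
        unfolding sum_distrib_left[symmetric] e'_def
        by (intro mult_left_mono sum_diff2_le[OF u] forward_closed_scale[OF D]) (use True in auto)
      also have "\<dots> = (\<integral>\<^sup>+x\<in>D. ennreal (4^N * (g x \<bullet> e')\<^sup>2) \<partial>lborel)"
        by (subst nn_integral_cmult[symmetric]) (auto simp: ennreal_power[symmetric] mult.assoc ennreal_mult)
      also have "\<dots> \<le> (\<integral>\<^sup>+x\<in>D. (ennreal 4 * ennreal ((g x \<bullet> e)\<^sup>2)) \<partial>lborel)"
      proof (intro nn_integral_mono mult_right_mono)
        fix x
        \<comment> \<open>N exceeds M by one, and this is where the factor 4 of the statement comes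
          from.\<close>
        have "(4::real)^N * ((1/2)^M)\<^sup>2 = 4"
          by (simp add: N power_one_over power_mult_distrib flip: power_mult) (simp add: power_mult mult.commute[of M])
        then have "4^N * (g x \<bullet> e')\<^sup>2 = 4 * (r\<^sup>2 * (g x \<bullet> e)\<^sup>2)"
          unfolding e'_def inner_scaleR_right power_mult_distrib by (simp add: mult.assoc mult.left_commute)
        also have "\<dots> \<le> 4 * (g x \<bullet> e)\<^sup>2"
          using True by (simp add: mult_left_le_one_le power_le_one)
        finally show "ennreal (4^N * (g x \<bullet> e')\<^sup>2) \<le> ennreal 4 * ennreal ((g x \<bullet> e)\<^sup>2)"
          by (simp add: ennreal_mult'[symmetric] ennreal_leI del: ennreal_numeral)
      qed auto
      also have "\<dots> = 4 * ?G" by (subst nn_integral_cmult[symmetric]) (auto simp: mult.assoc)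
      finally show ?thesis using True by simp
    qed auto
  qed
  also have "\<dots> = 4 * ?G" by (simp add: nn_integral_cmult)
  finally show ?thesis .
qed

subsection \<open>A bound for averages over squares of dyadic size\<close>

definition square :: "nat \<Rightarrow> (real \<times> real) set" where
  "square k = cbox (- ((1/2)^k), - ((1/2)^k)) ((1/2)^k, (1/2)^k)"

lemma square_sets [measurable, simp]: "square k \<in> sets borel"
  by (simp add: square_def)

lemma square_antimono: "j \<le> k \<Longrightarrow> square k \<subseteq> square j"
  unfolding square_def by (rule subset_box_imp) (auto simp: Basis_prod_def power_decreasing)

lemma emeasure_square: "emeasure lborel (square k) = ennreal (4 * (1/4)^k)"
  unfolding square_def by (subst emeasure_lborel_cbox_eq)
    (auto simp: Basis_prod_def prod.union_disjoint power_one_over field_simps simp flip: power_mult_distrib)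

text \<open>The squares are nested, so \<open>4 * (1/4)^(max k m)\<close> is the area of the smaller
  of two of them. Up to \<open>k = m\<close> the terms grow geometrically, beyond it they decay
  geometrically; both parts are comparable to the term \<open>k = m\<close>.\<close>

lemma sum_square_overlap_le:
  "(\<Sum>k<N. 2^k * (4 * (1/4::real)^(max k m))) \<le> 12 * (1/2)^m"
proof -
  define S where "S = (\<lambda>N. \<Sum>k<N. 2^k * (1/4::real)^(max k m))"
  have "S N \<le> 2^N * (1/4)^m" if "N \<le> Suc m" for N
    using that
  proof (induction N)
    case (Suc N)
    then have "max N m = m" by simp
    then show ?case using Suc by (simp add: S_def)
  qed (simp add: S_def)
  note 1 = this
  have e: "2^N * (1/4::real)^N = (1/2)^N" for N by (simp flip: power_mult_distrib)
  have "S (Suc m + n) \<le> 3 * (1/2)^m - 2 * (1/2)^(Suc m + n)" for n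
  proof (induction n)
    case 0
    show ?case using 1[of "Suc m"] e[of m] by simp
  next
    case (Suc n)
    have "S (Suc m + Suc n) = S (Suc m + n) + (1/2)^(Suc m + n)"
      using e[of "Suc m + n"] by (simp add: S_def max_def)
    then show ?case using Suc by simp
  qed
  note 2 = this
  have "S N \<le> 3 * (1/2)^m"
  proof (cases "N \<le> Suc m")
    case True
    then have "2^N * (1/4::real)^m \<le> 2^(Suc m) * (1/4)^m" by (intro mult_right_mono power_increasing) auto
    also have "\<dots> = 2 * (1/2)^m" using e[of m] by simp
    finally have "S N \<le> 2 * (1/2)^m" using 1[OF True] by linarith
    moreover have "0 \<le> (1/2::real)^m" by simp
    ultimately show ?thesis by linarith
  next
    case False
    then obtain n where N: "N = Suc m + n" by (metis le_Suc_ex nat_le_linear)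
    moreover have "0 \<le> (1/2::real)^(Suc m + n)" by simp
    ultimately show ?thesis using 2[of n] unfolding N by linarith
  qed
  then have "4 * S N \<le> 12 * (1/2)^m" by simp
  then show ?thesis by (simp add: S_def sum_distrib_left mult_ac)
qed

text \<open>A discrete Hardy inequality: Cauchy--Schwarz with the weight \<open>p = \<Sum>\<^sub>k 2\<^sup>k 1\<^bsub>square k\<^esub>\<close>, which behaves
  like the inverse of the distance to the origin.\<close>

lemma hardy_square:
  fixes H :: "real \<times> real \<Rightarrow> ennreal"
  assumes [measurable]: "H \<in> borel_measurable borel"
  shows "(\<Sum>m<N. 4^m * (\<integral>\<^sup>+q\<in>square m. H q \<partial>lborel)\<^sup>2) \<le> 12 * (\<integral>\<^sup>+q. (H q)\<^sup>2 \<partial>lborel)"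
proof -
  define p :: "real \<times> real \<Rightarrow> real" where "p = (\<lambda>q. \<Sum>k<N. 2^k * indicator (square k) q)"
  have [measurable]: "p \<in> borel_measurable borel" unfolding p_def by measurable
  have p0: "p q \<ge> 0" for q unfolding p_def by (intro sum_nonneg) auto
  have pp: "p q > 0" if "q \<in> square m" "m < N" for q m
  proof -
    have "0 < (2::real)^m * indicator (square m) q" using that by simp
    also have "\<dots> \<le> p q" unfolding p_def using that by (intro member_le_sum) auto
    finally show ?thesis .
  qed
  \<comment> \<open>The counterpart of the fact that the inverse distance to the origin has an
    integral of order h over a square of side h.\<close>
  have ip: "(\<integral>\<^sup>+q\<in>square m. ennreal (p q) \<partial>lborel) \<le> ennreal (12 * (1/2)^m)" for m
  proof -
    have "(\<integral>\<^sup>+q\<in>square m. ennreal (p q) \<partial>lborel) = (\<integral>\<^sup>+q. (\<Sum>k<N. ennreal (2^k) * indicator (square (max k m)) q) \<partial>lborel)"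
    proof (rule nn_integral_cong)
      fix q
      have "indicator (square k) q * indicator (square m) q = (indicator (square (max k m)) q :: ennreal)" for k
        using square_antimono[of k m] square_antimono[of m k]
        by (cases "k \<le> m") (auto simp: indicator_def max_def)
      note A = this
      have B: "ennreal (p q) = (\<Sum>k<N. ennreal (2^k) * indicator (square k) q)"
        unfolding p_def by (subst sum_ennreal[symmetric]) (auto simp: ennreal_mult' ennreal_indicator)
      show "ennreal (p q) * indicator (square m) q = (\<Sum>k<N. ennreal (2^k) * indicator (square (max k m)) q)"
        by (simp only: B sum_distrib_right mult.assoc A)
    qed
    also have "\<dots> = (\<Sum>k<N. (\<integral>\<^sup>+q. ennreal (2^k) * indicator (square (max k m)) q \<partial>lborel))"
      by (rule nn_integral_sum) measurable
    also have "\<dots> = (\<Sum>k<N. ennreal (2^k) * emeasure lborel (square (max k m)))"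
      by (intro sum.cong refl nn_integral_cmult_indicator) simp
    also have "\<dots> = ennreal (\<Sum>k<N. 2^k * (4 * (1/4::real)^(max k m)))"
      by (subst sum_ennreal[symmetric]) (auto simp: emeasure_square ennreal_mult')
    also have "\<dots> \<le> ennreal (12 * (1/2)^m)" using sum_square_overlap_le by (rule ennreal_leI)
    finally show ?thesis .
  qed
  \<comment> \<open>Cauchy--Schwarz for the factors \<open>sqrt p\<close> and
    \<open>H / sqrt p\<close>; since \<open>m < N\<close>, the summand \<open>k = m\<close> makes p
    positive on \<open>square m\<close>.\<close>
  have cs: "(\<integral>\<^sup>+q\<in>square m. H q \<partial>lborel)\<^sup>2 \<le> ennreal (12 * (1/2)^m) * (\<integral>\<^sup>+q\<in>square m. ennreal (1 / p q) * (H q)\<^sup>2 \<partial>lborel)" if m: "m < N" for m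
  proof -
    let ?f = "\<lambda>q. ennreal (sqrt (p q)) * indicator (square m) q"
    let ?g = "\<lambda>q. ennreal (1 / sqrt (p q)) * H q * indicator (square m) q"
    have "(\<integral>\<^sup>+q\<in>square m. H q \<partial>lborel) = (\<integral>\<^sup>+q. ?f q * ?g q \<partial>lborel)"
    proof (rule nn_integral_cong)
      fix q
      show "H q * indicator (square m) q = ?f q * ?g q"
      proof (cases "q \<in> square m")
        case True
        have "ennreal (sqrt (p q)) * ennreal (1 / sqrt (p q)) = 1"
          using pp[OF True m] by (subst ennreal_mult[symmetric]) auto
        then show ?thesis using True by (simp add: mult.assoc[symmetric])
      qed simp
    qed
    also have "(\<integral>\<^sup>+q. ?f q * ?g q \<partial>lborel)\<^sup>2 \<le> (\<integral>\<^sup>+q. (?f q)\<^sup>2 \<partial>lborel) * (\<integral>\<^sup>+q. (?g q)\<^sup>2 \<partial>lborel)"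
      by (rule Cauchy_Schwarz_nn_integral) auto
    also have "(\<integral>\<^sup>+q. (?f q)\<^sup>2 \<partial>lborel) = (\<integral>\<^sup>+q\<in>square m. ennreal (p q) \<partial>lborel)"
      using p0 by (intro nn_integral_cong) (auto simp: indicator_def ennreal_power)
    also have "(\<integral>\<^sup>+q. (?g q)\<^sup>2 \<partial>lborel) = (\<integral>\<^sup>+q\<in>square m. ennreal (1 / p q) * (H q)\<^sup>2 \<partial>lborel)"
      using p0 by (intro nn_integral_cong) (auto simp: indicator_def ennreal_power power_mult_distrib power_divide)
    finally show ?thesis using ip[of m] by (meson mult_right_mono order_trans zero_le)
  qed
  have "(\<Sum>m<N. 4^m * (\<integral>\<^sup>+q\<in>square m. H q \<partial>lborel)\<^sup>2)
     \<le> (\<Sum>m<N. 4^m * (ennreal (12 * (1/2)^m) * (\<integral>\<^sup>+q\<in>square m. ennreal (1 / p q) * (H q)\<^sup>2 \<partial>lborel)))"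
    by (intro sum_mono mult_left_mono cs) auto
  also have "\<dots> = (\<Sum>m<N. 12 * (\<integral>\<^sup>+q. ennreal (2^m * indicator (square m) q) * (ennreal (1 / p q) * (H q)\<^sup>2) \<partial>lborel))"
  proof (rule sum.cong[OF refl])
    fix m
    have a: "(4::ennreal)^m * ennreal (12 * (1/2)^m) = 12 * ennreal (2^m)"
    proof -
      have "(4::ennreal)^m * ennreal (12 * (1/2)^m) = ennreal (4^m * (12 * (1/2)^m))"
        by (subst ennreal_mult) (auto simp flip: ennreal_power)
      also have "(4::real)^m * (12 * (1/2)^m) = 12 * 2^m" by (simp add: power_divide flip: power_mult_distrib) (simp add: field_simps flip: power_mult_distrib)
      also have "ennreal (12 * 2^m) = 12 * ennreal (2^m)" by (subst ennreal_mult) auto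
      finally show ?thesis .
    qed
    have b: "ennreal (2^m) * (\<integral>\<^sup>+q\<in>square m. ennreal (1 / p q) * (H q)\<^sup>2 \<partial>lborel)
       = (\<integral>\<^sup>+q. ennreal (2^m * indicator (square m) q) * (ennreal (1 / p q) * (H q)\<^sup>2) \<partial>lborel)"
      by (subst nn_integral_cmult[symmetric]) (auto intro!: nn_integral_cong simp: indicator_def)
    show "4^m * (ennreal (12 * (1/2)^m) * (\<integral>\<^sup>+q\<in>square m. ennreal (1 / p q) * (H q)\<^sup>2 \<partial>lborel))
       = 12 * (\<integral>\<^sup>+q. ennreal (2^m * indicator (square m) q) * (ennreal (1 / p q) * (H q)\<^sup>2) \<partial>lborel)"
      by (subst mult.assoc[symmetric], subst a, subst mult.assoc, subst b) (rule refl)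
  qed
  \<comment> \<open>The factors \<open>4^m\<close> and \<open>(1/2)^m\<close> have left the weight
    \<open>2^m\<close>; summed over m against the indicators of the squares it restores p, which
    cancels \<open>1 / p\<close>.\<close>
  also have "\<dots> = 12 * (\<integral>\<^sup>+q. ennreal (p q) * (ennreal (1 / p q) * (H q)\<^sup>2) \<partial>lborel)"
  proof -
    have "(\<Sum>m<N. (\<integral>\<^sup>+q. ennreal (2^m * indicator (square m) q) * (ennreal (1 / p q) * (H q)\<^sup>2) \<partial>lborel))
      = (\<integral>\<^sup>+q. (\<Sum>m<N. ennreal (2^m * indicator (square m) q) * (ennreal (1 / p q) * (H q)\<^sup>2)) \<partial>lborel)"
      by (rule nn_integral_sum[symmetric]) measurable
    also have "\<dots> = (\<integral>\<^sup>+q. ennreal (p q) * (ennreal (1 / p q) * (H q)\<^sup>2) \<partial>lborel)"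
    proof (rule nn_integral_cong)
      fix q
      have "(\<Sum>m<N. ennreal (2^m * indicator (square m) q)) = ennreal (p q)"
        unfolding p_def by (rule sum_ennreal) auto
      then show "(\<Sum>m<N. ennreal (2^m * indicator (square m) q) * (ennreal (1 / p q) * (H q)\<^sup>2))
        = ennreal (p q) * (ennreal (1 / p q) * (H q)\<^sup>2)"
        by (simp only: sum_distrib_right[symmetric])
    qed
    finally show ?thesis by (simp only: sum_distrib_left[symmetric])
  qed
  also have "\<dots> \<le> 12 * (\<integral>\<^sup>+q. (H q)\<^sup>2 \<partial>lborel)"
  proof (intro mult_left_mono nn_integral_mono)
    fix q
    show "ennreal (p q) * (ennreal (1 / p q) * (H q)\<^sup>2) \<le> (H q)\<^sup>2"
    proof (cases "p q = 0")
      case False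
      then have "ennreal (p q) * ennreal (1 / p q) = 1" using p0[of q] by (subst ennreal_mult[symmetric]) auto
      then show ?thesis by (simp add: mult.assoc[symmetric])
    qed simp
  qed simp
  finally show ?thesis .
qed

subsection \<open>Oblique coordinates in the plane\<close>

definition oblique :: "plane \<Rightarrow> plane \<Rightarrow> real \<times> real \<Rightarrow> plane" where
  "oblique e f q = fst q *\<^sub>R e + snd q *\<^sub>R f"

lemma oblique_linear: "linear (oblique e f)"
  unfolding oblique_def by (auto simp: linear_iff algebra_simps)

lemma oblique_measurable [measurable]: "oblique e f \<in> borel_measurable borel"
  unfolding oblique_def[abs_def] by (intro borel_measurable_continuous_onI continuous_intros)

text \<open>Cramer's rule; the determinant \<open>?d\<close> is \<open>- cross2 e f\<close>.\<close>

lemma oblique_inverse: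
  assumes "cross2 e f \<noteq> 0"
  obtains M where "linear M" "\<And>q. M (oblique e f q) = q" "\<And>z. oblique e f (M z) = z"
proof
  let ?d = "e$1 * f$2 - e$2 * f$1"
  let ?M = "\<lambda>z::plane. ((z$1 * f$2 - z$2 * f$1) / ?d, (e$1 * z$2 - e$2 * z$1) / ?d)"
  have d: "?d \<noteq> 0" using assms by (simp add: cross2_def algebra_simps)
  show "linear ?M" by (auto simp: linear_iff field_simps add_divide_distrib diff_divide_distrib)
  show "?M (oblique e f q) = q" for q
  proof -
    have "(oblique e f q)$1 * f$2 - (oblique e f q)$2 * f$1 = fst q * ?d"
      "e$1 * (oblique e f q)$2 - e$2 * (oblique e f q)$1 = snd q * ?d"
      unfolding oblique_def by (simp_all add: algebra_simps)
    then show ?thesis using d by (simp add: prod_eq_iff)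
  qed
  show "oblique e f (?M z) = z" for z
  proof -
    have "(z$1 * f$2 - z$2 * f$1) * e$1 + (e$1 * z$2 - e$2 * z$1) * f$1 = z$1 * ?d"
      "(z$1 * f$2 - z$2 * f$1) * e$2 + (e$1 * z$2 - e$2 * z$1) * f$2 = z$2 * ?d"
      by (simp_all add: algebra_simps)
    then show ?thesis using d
      by (simp add: oblique_def vec_eq_iff forall_2 add_divide_distrib[symmetric])
  qed
qed

text \<open>The push-forward of Lebesgue measure is translation invariant, hence a finite multiple of Lebesgue
  measure; Tonelli's theorem for the two measures gives the constant without computing it.\<close>

lemma nn_integral_oblique_le:
  assumes ef: "cross2 e f \<noteq> 0"
  obtains c :: real where "c \<ge> 0"
    "\<And>F :: plane \<Rightarrow> ennreal. F \<in> borel_measurable borel \<Longrightarrow> (\<integral>\<^sup>+q. F (oblique e f q) \<partial>lborel) \<le> ennreal c * (\<integral>\<^sup>+z. F z \<partial>lborel)"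
proof -
  obtain M where M: "linear M" "\<And>q. M (oblique e f q) = q" "\<And>z. oblique e f (M z) = z"
    using oblique_inverse[OF ef] by blast
  let ?L = "oblique e f"
  define \<phi> :: "plane \<Rightarrow> ennreal" where "\<phi> = indicator (ball 0 1)"
  have [measurable]: "\<phi> \<in> borel_measurable borel" unfolding \<phi>_def by (rule borel_measurable_indicator) simp
  let ?v = "emeasure lborel (ball (0::plane) 1)"
  have v0: "?v \<noteq> 0" using open_not_negligible[of "ball (0::plane) 1"]
    by (simp add: negligible_iff_null_sets null_sets_def)
  have vfin: "?v < \<infinity>" by (rule emeasure_bounded_finite) simp
  define C where "C = (\<integral>\<^sup>+q. \<phi> (- ?L q) \<partial>lborel)"
  \<comment> \<open>The preimage of the unit ball under \<open>?L\<close> is bounded because the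
    inverse M is a bounded linear map.\<close>
  have Cfin: "C < \<infinity>"
  proof -
    obtain K where K: "\<And>z. norm (M z) \<le> K * norm z"
      using linear_bounded[OF M(1)] by blast
    have sub: "{q. ?L q \<in> ball 0 1} \<subseteq> cball 0 \<bar>K\<bar>"
    proof
      fix q assume "q \<in> {q. ?L q \<in> ball 0 1}"
      then have n: "norm (?L q) \<le> 1" by simp
      have "norm q \<le> K * norm (?L q)" using K[of "?L q"] M(2) by simp
      also have "\<dots> \<le> \<bar>K\<bar> * 1" using n by (intro mult_mono) auto
      finally show "q \<in> cball 0 \<bar>K\<bar>" by simp
    qed
    have "C \<le> (\<integral>\<^sup>+q. indicator (cball (0::real \<times> real) \<bar>K\<bar>) q \<partial>lborel)"
      unfolding C_def using sub by (intro nn_integral_mono) (auto simp: indicator_def \<phi>_def)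
    also have "\<dots> < \<infinity>" using emeasure_bounded_finite[of "cball (0::real \<times> real) \<bar>K\<bar>"] by simp
    finally show ?thesis .
  qed
  \<comment> \<open>The function \<open>\<phi> (z - ?L q) * F (?L q)\<close> is integrated in both
    orders. Over z first, translation invariance in the plane gives the left side; over q first, the
    substitution \<open>q + M z\<close> frees \<phi> from z and gives the right side.\<close>
  have main: "?v * (\<integral>\<^sup>+q. F (?L q) \<partial>lborel) = C * (\<integral>\<^sup>+z. F z \<partial>lborel)" if [measurable]: "F \<in> borel_measurable borel" for F :: "plane \<Rightarrow> ennreal"
  proof -
    have "?v * (\<integral>\<^sup>+q. F (?L q) \<partial>lborel) = (\<integral>\<^sup>+q. (\<integral>\<^sup>+z. \<phi> (z + - ?L q) * F (?L q) \<partial>lborel) \<partial>lborel)"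
    proof -
      have "(\<integral>\<^sup>+z. \<phi> (z + - ?L q) * F (?L q) \<partial>lborel) = ?v * F (?L q)" for q
      proof -
        have "(\<integral>\<^sup>+z. \<phi> (z + - ?L q) * F (?L q) \<partial>lborel)
          = (\<integral>\<^sup>+z. \<phi> (z + - ?L q) \<partial>lborel) * F (?L q)"
          by (rule nn_integral_multc) measurable
        also have "(\<integral>\<^sup>+z. \<phi> (z + - ?L q) \<partial>lborel) = ?v"
          using nn_integral_shift[of \<phi> "- ?L q"] \<open>\<phi> \<in> borel_measurable borel\<close> by (simp add: \<phi>_def)
        finally show ?thesis .
      qed
      then show ?thesis by (simp add: nn_integral_cmult)
    qed
    also have "\<dots> = (\<integral>\<^sup>+z. (\<integral>\<^sup>+q. \<phi> (z + - ?L q) * F (?L q) \<partial>lborel) \<partial>lborel)"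
      by (rule lborel_pair.Fubini') measurable
    also have "\<dots> = (\<integral>\<^sup>+z. (\<integral>\<^sup>+q. \<phi> (- ?L q) * F (?L q + z) \<partial>lborel) \<partial>lborel)"
    proof (rule nn_integral_cong)
      fix z
      have "(\<integral>\<^sup>+q. \<phi> (z + - ?L q) * F (?L q) \<partial>lborel)
        = (\<integral>\<^sup>+q. \<phi> (z + - ?L (q + M z)) * F (?L (q + M z)) \<partial>lborel)"
        by (rule nn_integral_shift[symmetric]) measurable
      also have "\<dots> = (\<integral>\<^sup>+q. \<phi> (- ?L q) * F (?L q + z) \<partial>lborel)"
        by (simp add: linear_add[OF oblique_linear] M(3))
      finally show "(\<integral>\<^sup>+q. \<phi> (z + - ?L q) * F (?L q) \<partial>lborel)
        = (\<integral>\<^sup>+q. \<phi> (- ?L q) * F (?L q + z) \<partial>lborel)" .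
    qed
    also have "\<dots> = (\<integral>\<^sup>+q. (\<integral>\<^sup>+z. \<phi> (- ?L q) * F (?L q + z) \<partial>lborel) \<partial>lborel)"
      by (rule lborel_pair.Fubini'[symmetric]) measurable
    also have "\<dots> = (\<integral>\<^sup>+q. \<phi> (- ?L q) * (\<integral>\<^sup>+z. F z \<partial>lborel) \<partial>lborel)"
    proof (rule nn_integral_cong)
      fix q
      show "(\<integral>\<^sup>+z. \<phi> (- ?L q) * F (?L q + z) \<partial>lborel) = \<phi> (- ?L q) * (\<integral>\<^sup>+z. F z \<partial>lborel)"
        using nn_integral_shift[of F "?L q"] by (subst nn_integral_cmult) (auto simp: add.commute)
    qed
    also have "\<dots> = C * (\<integral>\<^sup>+z. F z \<partial>lborel)" unfolding C_def by (rule nn_integral_multc) measurable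
    finally show ?thesis .
  qed
  define c where "c = enn2real (C / ?v)"
  have "C / ?v < \<infinity>" using Cfin v0 by (simp add: ennreal_divide_eq_top_iff less_top[symmetric])
  then have c: "ennreal c = C / ?v" unfolding c_def by simp
  have "(\<integral>\<^sup>+q. F (?L q) \<partial>lborel) = ennreal c * (\<integral>\<^sup>+z. F z \<partial>lborel)" if "F \<in> borel_measurable borel" for F :: "plane \<Rightarrow> ennreal"
  proof -
    have "(\<integral>\<^sup>+q. F (?L q) \<partial>lborel) = (?v * (\<integral>\<^sup>+q. F (?L q) \<partial>lborel)) / ?v"
      by (subst mult.commute, rule ennreal_mult_divide_eq[symmetric]) (use v0 vfin in auto)
    also have "\<dots> = ennreal c * (\<integral>\<^sup>+z. F z \<partial>lborel)"
      unfolding main[OF that] c by (simp add: divide_ennreal_def mult_ac)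
    finally show ?thesis .
  qed
  then show ?thesis using that[of c] by (simp add: c_def)
qed

definition bavg :: "plane \<Rightarrow> plane \<Rightarrow> real \<Rightarrow> (plane \<Rightarrow> ennreal) \<Rightarrow> plane \<Rightarrow> ennreal" where
  "bavg e f h F x = (\<integral>\<^sup>+q\<in>cbox (0,0) (1,1). F (x + h *\<^sub>R oblique e f q) \<partial>lborel)"

lemma borel_measurable_bavg [measurable]:
  assumes [measurable]: "F \<in> borel_measurable borel"
  shows "bavg e f h F \<in> borel_measurable borel"
  unfolding bavg_def by measurable

lemma emeasure_unit_square [simp]: "emeasure lborel (cbox (0::real,0::real) (1,1)) = 1"
  by (subst emeasure_lborel_cbox_eq) (auto simp: Basis_prod_def prod.union_disjoint)

lemma navg_navg_eq_bavg:
  assumes [measurable]: "F \<in> borel_measurable borel"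
  shows "navg (h *\<^sub>R e) (navg (h *\<^sub>R f) F) x = bavg e f h F x"
proof -
  have "navg (h *\<^sub>R e) (navg (h *\<^sub>R f) F) x
     = (\<integral>\<^sup>+r. (\<integral>\<^sup>+s. F (x + h *\<^sub>R oblique e f (r, s)) * indicator (cbox (0,0) (1,1)) (r, s) \<partial>lborel) \<partial>lborel)"
    unfolding navg_def
  proof (rule nn_integral_cong)
    fix r :: real
    have "(\<integral>\<^sup>+s\<in>{0..1}. F (x + r *\<^sub>R h *\<^sub>R e + s *\<^sub>R h *\<^sub>R f) \<partial>lborel) * indicator {0..1} r
      = (\<integral>\<^sup>+s. F (x + r *\<^sub>R h *\<^sub>R e + s *\<^sub>R h *\<^sub>R f) * indicator {0..1} s * indicator {0..1} r \<partial>lborel)"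
      by (rule nn_integral_multc[symmetric]) measurable
    also have "\<dots> = (\<integral>\<^sup>+s. F (x + h *\<^sub>R oblique e f (r, s)) * indicator (cbox (0,0) (1,1)) (r, s) \<partial>lborel)"
      by (intro nn_integral_cong) (auto simp: indicator_def oblique_def algebra_simps)
    finally show "(\<integral>\<^sup>+s\<in>{0..1}. F (x + r *\<^sub>R h *\<^sub>R e + s *\<^sub>R h *\<^sub>R f) \<partial>lborel) * indicator {0..1} r
      = (\<integral>\<^sup>+s. F (x + h *\<^sub>R oblique e f (r, s)) * indicator (cbox (0,0) (1,1)) (r, s) \<partial>lborel)" .
  qed
  also have "\<dots> = bavg e f h F x"
    unfolding bavg_def lborel_prod[symmetric]
    by (rule lborel.nn_integral_fst) (simp add: lborel_prod)
  finally show ?thesis .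
qed

lemma bavg_square_le:
  assumes [measurable]: "F \<in> borel_measurable borel"
  shows "(bavg e f h F x)\<^sup>2 \<le> bavg e f h (\<lambda>y. (F y)\<^sup>2) x"
proof -
  let ?U = "cbox (0::real,0::real) (1,1)"
  let ?f = "\<lambda>q. F (x + h *\<^sub>R oblique e f q) * indicator ?U q"
  have "(\<integral>\<^sup>+q. ?f q * indicator ?U q \<partial>lborel)\<^sup>2 \<le> (\<integral>\<^sup>+q. (?f q)\<^sup>2 \<partial>lborel) * (\<integral>\<^sup>+q. (indicator ?U q)\<^sup>2 \<partial>lborel)"
    by (rule Cauchy_Schwarz_nn_integral) measurable
  also have "(\<integral>\<^sup>+q. (indicator ?U q :: ennreal)\<^sup>2 \<partial>lborel) = (\<integral>\<^sup>+q. indicator ?U q \<partial>lborel)"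
    by (intro nn_integral_cong) (auto simp: indicator_def)
  also have "\<dots> = 1" by simp
  finally have "(\<integral>\<^sup>+q. ?f q * indicator ?U q \<partial>lborel)\<^sup>2 \<le> (\<integral>\<^sup>+q. (?f q)\<^sup>2 \<partial>lborel)" by simp
  moreover have "?f q * indicator ?U q = ?f q" "(?f q)\<^sup>2 = (F (x + h *\<^sub>R oblique e f q))\<^sup>2 * indicator ?U q" for q
    by (auto simp: indicator_def)
  ultimately show ?thesis unfolding bavg_def by simp
qed

lemma nn_integral_dyadic_scale:
  fixes G :: "real \<times> real \<Rightarrow> ennreal"
  assumes [measurable]: "G \<in> borel_measurable borel"
  shows "(\<integral>\<^sup>+q. G ((1/2)^k *\<^sub>R q) \<partial>lborel) = 4^k * (\<integral>\<^sup>+q. G q \<partial>lborel)"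
proof -
  let ?c = "(1/2::real)^k"
  have "(\<integral>\<^sup>+q. G q \<partial>lborel) = (\<integral>\<^sup>+q. G q \<partial>density (distr lborel borel (\<lambda>x. 0 + ?c *\<^sub>R x)) (\<lambda>_. ennreal (\<bar>?c\<bar>^DIM(real \<times> real))))"
    by (subst lborel_affine[of ?c 0]) auto
  also have "\<bar>?c\<bar>^DIM(real \<times> real) = (1/4)^k"
    by (simp add: power2_eq_square flip: power_mult_distrib)
  also have "(\<integral>\<^sup>+q. G q \<partial>density (distr lborel borel (\<lambda>x. 0 + ?c *\<^sub>R x)) (\<lambda>_. ennreal ((1/4)^k)))
      = ennreal ((1/4)^k) * (\<integral>\<^sup>+q. G (?c *\<^sub>R q) \<partial>lborel)"
    by (subst nn_integral_density) (auto simp: nn_integral_distr nn_integral_cmult)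
  finally have *: "(\<integral>\<^sup>+q. G q \<partial>lborel) = ennreal ((1/4)^k) * (\<integral>\<^sup>+q. G (?c *\<^sub>R q) \<partial>lborel)" .
  have "4^k * ennreal ((1/4)^k) = ennreal (4^k * (1/4)^k)"
    by (subst ennreal_mult) (auto simp flip: ennreal_power)
  also have "(4::real)^k * (1/4)^k = 1" by (simp flip: power_mult_distrib)
  finally show ?thesis unfolding * by (simp add: mult.assoc[symmetric])
qed

text \<open>Jensen's inequality replaces two of the four factors by the average of
  \<open>F^2\<close>. After a translation to the averaged point y, the other two are averages over
  parallelograms containing y, hence at most \<open>P k y\<close>. For fixed y,
  \<open>hardy_square\<close> bounds the sum of \<open>(1/4)^k * (P k y)^2\<close> by a multiple of
  the integral of \<open>F^2\<close>, uniformly in y; integration against \<open>F^2\<close>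
  produces the square of that integral.\<close>

lemma sum_bavg_fourth_le:
  assumes ef: "cross2 e f \<noteq> 0"
  obtains C :: real where "C \<ge> 0"
    "\<And>F N. F \<in> borel_measurable borel \<Longrightarrow>
      (\<Sum>k<N. ennreal ((1/4)^k) * (\<integral>\<^sup>+x. (bavg e f ((1/2)^k) F x)^4 \<partial>lborel)) \<le> ennreal C * (\<integral>\<^sup>+x. (F x)\<^sup>2 \<partial>lborel)\<^sup>2"
proof -
  obtain c where c: "c \<ge> 0"
    "\<And>F :: plane \<Rightarrow> ennreal. F \<in> borel_measurable borel \<Longrightarrow> (\<integral>\<^sup>+q. F (oblique e f q) \<partial>lborel) \<le> ennreal c * (\<integral>\<^sup>+z. F z \<partial>lborel)"
    using nn_integral_oblique_le[OF ef] by blast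
  let ?L = "oblique e f"
  let ?U = "cbox (0::real,0::real) (1,1)"
  let ?V = "cbox (-1::real,-1::real) (1,1)"
  have "(\<Sum>k<N. ennreal ((1/4)^k) * (\<integral>\<^sup>+x. (bavg e f ((1/2)^k) F x)^4 \<partial>lborel)) \<le> ennreal (12 * c) * (\<integral>\<^sup>+x. (F x)\<^sup>2 \<partial>lborel)\<^sup>2"
    if [measurable]: "F \<in> borel_measurable borel" for F N
  proof -
    \<comment> \<open>The doubled square \<open>?V\<close> gives a parallelogram centred at y which
      contains every parallelogram of the same scale whose average involves y.\<close>
    define P where "P = (\<lambda>k y. \<integral>\<^sup>+q\<in>?V. F (y + (1/2)^k *\<^sub>R ?L q) \<partial>lborel)"
    have [measurable]: "P k \<in> borel_measurable borel" for k unfolding P_def by measurable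
    have P: "(\<Sum>k<N. ennreal ((1/4)^k) * (P k y)\<^sup>2) \<le> ennreal (12 * c) * (\<integral>\<^sup>+x. (F x)\<^sup>2 \<partial>lborel)" for y
    proof -
      let ?H = "\<lambda>q. F (y + ?L q)"
      have sc: "P k y = 4^k * (\<integral>\<^sup>+q\<in>square k. ?H q \<partial>lborel)" for k
      proof -
        have "q \<in> ?V \<longleftrightarrow> (1/2)^k *\<^sub>R q \<in> square k" for q
        proof -
          have "- ((1/2)^k) \<le> (1/2)^k * a \<longleftrightarrow> -1 \<le> a" "(1/2)^k * a \<le> (1/2)^k \<longleftrightarrow> a \<le> 1" for a :: real
            by (simp_all add: field_simps power_one_over)
          then show ?thesis by (cases q) (auto simp: square_def)
        qed
        then have "P k y = (\<integral>\<^sup>+q. ?H ((1/2)^k *\<^sub>R q) * indicator (square k) ((1/2)^k *\<^sub>R q) \<partial>lborel)"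
          unfolding P_def linear_scale[OF oblique_linear] by (intro nn_integral_cong) (simp add: indicator_def)
        also have "\<dots> = 4^k * (\<integral>\<^sup>+q\<in>square k. ?H q \<partial>lborel)"
          by (rule nn_integral_dyadic_scale[of "\<lambda>q. ?H q * indicator (square k) q"]) measurable
        finally show ?thesis .
      qed
      \<comment> \<open>Rescaling the parallelogram to \<open>square k\<close> costs
        \<open>4^k\<close>; squared and weighted by \<open>(1/4)^k\<close> this is exactly the
        weight in \<open>hardy_square\<close>.\<close>
      have q: "ennreal ((1/4)^k) * (4^k)\<^sup>2 = (4::ennreal)^k" for k
      proof -
        have "ennreal ((1/4)^k) * (4^k)\<^sup>2 = ennreal ((1/4)^k * (4^k)\<^sup>2)"
          by (subst ennreal_mult) (auto simp flip: ennreal_power)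
        also have "(1/4::real)^k * (4^k)\<^sup>2 = 4^k" by (simp add: power2_eq_square power_one_over)
        finally show ?thesis by (simp flip: ennreal_power)
      qed
      have "(\<Sum>k<N. ennreal ((1/4)^k) * (P k y)\<^sup>2) = (\<Sum>k<N. 4^k * (\<integral>\<^sup>+q\<in>square k. ?H q \<partial>lborel)\<^sup>2)"
        unfolding sc power_mult_distrib mult.assoc[symmetric] q ..
      also have "\<dots> \<le> 12 * (\<integral>\<^sup>+q. (?H q)\<^sup>2 \<partial>lborel)" by (rule hardy_square) measurable
      also have "\<dots> \<le> 12 * (ennreal c * (\<integral>\<^sup>+z. (F (y + z))\<^sup>2 \<partial>lborel))"
        by (intro mult_left_mono c(2)) auto
      also have "(\<integral>\<^sup>+z. (F (y + z))\<^sup>2 \<partial>lborel) = (\<integral>\<^sup>+x. (F x)\<^sup>2 \<partial>lborel)"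
        using nn_integral_shift[of "\<lambda>z. (F z)\<^sup>2" y] by (simp add: add.commute)
      finally show ?thesis using c(1) by (simp add: ennreal_mult' mult.assoc)
    qed
    have B: "(\<integral>\<^sup>+x. (bavg e f ((1/2)^k) F x)^4 \<partial>lborel) \<le> (\<integral>\<^sup>+y. (F y)\<^sup>2 * (P k y)\<^sup>2 \<partial>lborel)" for k
    proof -
      let ?h = "(1/2::real)^k"
      let ?B = "bavg e f ?h F"
      have "(\<integral>\<^sup>+x. (?B x)^4 \<partial>lborel) \<le> (\<integral>\<^sup>+x. (?B x)\<^sup>2 * bavg e f ?h (\<lambda>y. (F y)\<^sup>2) x \<partial>lborel)"
      proof (rule nn_integral_mono)
        fix x
        have "(?B x)^4 = (?B x)\<^sup>2 * (?B x)\<^sup>2" by (simp flip: power_add)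
        also have "\<dots> \<le> (?B x)\<^sup>2 * bavg e f ?h (\<lambda>y. (F y)\<^sup>2) x" by (intro mult_left_mono bavg_square_le) auto
        finally show "(?B x)^4 \<le> (?B x)\<^sup>2 * bavg e f ?h (\<lambda>y. (F y)\<^sup>2) x" .
      qed
      also have "\<dots> = (\<integral>\<^sup>+x. (\<integral>\<^sup>+q. (?B x)\<^sup>2 * ((F (x + ?h *\<^sub>R ?L q))\<^sup>2 * indicator ?U q) \<partial>lborel) \<partial>lborel)"
        unfolding bavg_def[of e f ?h "\<lambda>y. (F y)\<^sup>2"] by (intro nn_integral_cong nn_integral_cmult[symmetric]) measurable
      also have "\<dots> = (\<integral>\<^sup>+q. (\<integral>\<^sup>+x. (?B x)\<^sup>2 * ((F (x + ?h *\<^sub>R ?L q))\<^sup>2 * indicator ?U q) \<partial>lborel) \<partial>lborel)"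
        by (rule lborel_pair.Fubini') measurable
      also have "\<dots> = (\<integral>\<^sup>+q. (\<integral>\<^sup>+y. (?B (y + - (?h *\<^sub>R ?L q)))\<^sup>2 * ((F y)\<^sup>2 * indicator ?U q) \<partial>lborel) \<partial>lborel)"
      proof (rule nn_integral_cong)
        fix q
        show "(\<integral>\<^sup>+x. (?B x)\<^sup>2 * ((F (x + ?h *\<^sub>R ?L q))\<^sup>2 * indicator ?U q) \<partial>lborel)
          = (\<integral>\<^sup>+y. (?B (y + - (?h *\<^sub>R ?L q)))\<^sup>2 * ((F y)\<^sup>2 * indicator ?U q) \<partial>lborel)"
          using nn_integral_shift[of "\<lambda>x. (?B x)\<^sup>2 * ((F (x + ?h *\<^sub>R ?L q))\<^sup>2 * indicator ?U q)" "- (?h *\<^sub>R ?L q)"] by simp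
      qed
      also have "\<dots> \<le> (\<integral>\<^sup>+q. (\<integral>\<^sup>+y. (F y)\<^sup>2 * (P k y)\<^sup>2 * indicator ?U q \<partial>lborel) \<partial>lborel)"
      proof (intro nn_integral_mono)
        fix q y
        show "(?B (y + - (?h *\<^sub>R ?L q)))\<^sup>2 * ((F y)\<^sup>2 * indicator ?U q) \<le> (F y)\<^sup>2 * (P k y)\<^sup>2 * indicator ?U q"
        proof (cases "q \<in> ?U")
          case True
          \<comment> \<open>Seen from y, the points of the parallelogram have coordinates
            \<open>p - q\<close> with p and q in \<open>?U\<close>, hence in
            \<open>?V\<close>.\<close>
          have "?B (y + - (?h *\<^sub>R ?L q)) = (\<integral>\<^sup>+p. F (y + ?h *\<^sub>R ?L (p + - q)) * indicator ?U p \<partial>lborel)"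
            unfolding bavg_def linear_add[OF oblique_linear] linear_neg[OF oblique_linear]
            by (intro nn_integral_cong) (simp add: algebra_simps)
          also have "\<dots> = (\<integral>\<^sup>+p. F (y + ?h *\<^sub>R ?L p) * indicator ?U (p + q) \<partial>lborel)"
            using nn_integral_shift[of "\<lambda>p. F (y + ?h *\<^sub>R ?L (p + - q)) * indicator ?U p" q] by simp
          also have "\<dots> \<le> P k y" unfolding P_def
          proof (rule nn_integral_mono)
            fix p
            have "p + q \<in> ?U \<Longrightarrow> p \<in> ?V" using True by (cases p; cases q) auto
            then show "F (y + ?h *\<^sub>R ?L p) * indicator ?U (p + q) \<le> F (y + ?h *\<^sub>R ?L p) * indicator ?V p"
              by (intro mult_left_mono) (auto simp: indicator_def)
          qed
          finally have "?B (y + - (?h *\<^sub>R ?L q)) \<le> P k y" .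
          then show ?thesis using True by (simp add: mult.commute mult_left_mono power_mono)
        qed simp
      qed
      also have "\<dots> = (\<integral>\<^sup>+y. (F y)\<^sup>2 * (P k y)\<^sup>2 \<partial>lborel)"
        by (simp add: nn_integral_multc nn_integral_cmult)
      finally show ?thesis .
    qed
    have "(\<Sum>k<N. ennreal ((1/4)^k) * (\<integral>\<^sup>+x. (bavg e f ((1/2)^k) F x)^4 \<partial>lborel))
       \<le> (\<Sum>k<N. ennreal ((1/4)^k) * (\<integral>\<^sup>+y. (F y)\<^sup>2 * (P k y)\<^sup>2 \<partial>lborel))"
      by (intro sum_mono mult_left_mono B) auto
    also have "\<dots> = (\<Sum>k<N. (\<integral>\<^sup>+y. ennreal ((1/4)^k) * ((F y)\<^sup>2 * (P k y)\<^sup>2) \<partial>lborel))"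
      by (intro sum.cong refl nn_integral_cmult[symmetric]) measurable
    also have "\<dots> = (\<integral>\<^sup>+y. (\<Sum>k<N. ennreal ((1/4)^k) * ((F y)\<^sup>2 * (P k y)\<^sup>2)) \<partial>lborel)"
      by (rule nn_integral_sum[symmetric]) measurable
    also have "\<dots> = (\<integral>\<^sup>+y. (F y)\<^sup>2 * (\<Sum>k<N. ennreal ((1/4)^k) * (P k y)\<^sup>2) \<partial>lborel)"
      by (intro nn_integral_cong) (simp add: sum_distrib_left mult.left_commute)
    also have "\<dots> \<le> (\<integral>\<^sup>+y. (F y)\<^sup>2 * (ennreal (12 * c) * (\<integral>\<^sup>+x. (F x)\<^sup>2 \<partial>lborel)) \<partial>lborel)"
      by (intro nn_integral_mono mult_left_mono P) auto
    also have "\<dots> = ennreal (12 * c) * (\<integral>\<^sup>+x. (F x)\<^sup>2 \<partial>lborel)\<^sup>2"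
      by (subst nn_integral_multc) (auto simp: power2_eq_square mult_ac)
    finally show ?thesis .
  qed
  then show ?thesis using that[of "12 * c"] c(1) by simp
qed

subsection \<open>Estimates for the smoothed functions\<close>

text \<open>The shorter segment is half of the longer one, and F is nonnegative.\<close>

lemma navg_le_double:
  assumes [measurable]: "F \<in> borel_measurable borel"
  shows "navg e F x \<le> 2 * navg (2 *\<^sub>R e) F x"
proof -
  have "navg e F x = ennreal \<bar>2\<bar> * (\<integral>\<^sup>+r. F (x + (0 + 2 * r) *\<^sub>R e) * indicator {0..1} (0 + 2 * r) \<partial>lborel)"
    unfolding navg_def by (rule nn_integral_real_affine) auto
  also have "\<dots> \<le> ennreal \<bar>2\<bar> * navg (2 *\<^sub>R e) F x"
    unfolding navg_def by (intro mult_left_mono nn_integral_mono) (auto simp: indicator_def mult.commute)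
  finally show ?thesis by simp
qed

lemma norm_sm_le_navg:
  assumes "continuous_on UNIV v"
  shows "ennreal (norm (sm e v x)) \<le> 5 * navg (2 *\<^sub>R e) (\<lambda>y. ennreal (norm (v y))) x"
proof -
  have [measurable]: "v \<in> borel_measurable borel" using assms by (rule borel_measurable_continuous_onI)
  let ?n = "\<lambda>y. ennreal (norm (v y))"
  have "norm (sm e v x) \<le> 2 * norm (avg e v x) + norm (avg (2 *\<^sub>R e) v x)"
    unfolding sm_def using norm_triangle_ineq4[of "2 *\<^sub>R avg e v x" "avg (2 *\<^sub>R e) v x"] by simp
  then have "ennreal (norm (sm e v x)) \<le> ennreal (2 * norm (avg e v x) + norm (avg (2 *\<^sub>R e) v x))"
    by (rule ennreal_leI)
  also have "\<dots> = 2 * ennreal (norm (avg e v x)) + ennreal (norm (avg (2 *\<^sub>R e) v x))"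
    by (simp add: ennreal_mult')
  \<comment> \<open>Both averages are compared with the one over the longer segment, so that a
    single one remains: \<open>2 * 2 + 1 = 5\<close>.\<close>
  also have "\<dots> \<le> 2 * (2 * navg (2 *\<^sub>R e) ?n x) + navg (2 *\<^sub>R e) ?n x"
    by (intro add_mono mult_left_mono order_trans[OF norm_avg_le_navg[OF assms] navg_le_double] norm_avg_le_navg[OF assms]) auto
  also have "\<dots> = 5 * navg (2 *\<^sub>R e) ?n x"
  proof -
    have "(5::ennreal) = 2 * 2 + 1" by simp
    then show ?thesis by (simp only: distrib_right mult.assoc mult_1_left)
  qed
  finally show ?thesis .
qed

lemma continuous_on_sm:
  assumes "continuous_on UNIV u" shows "continuous_on UNIV (sm e u)"
  unfolding sm_def[abs_def] by (intro continuous_intros continuous_on_avg assms)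

lemma C1c_sm: "C1c u g \<Longrightarrow> C1c (sm e u) (sm e g)"
  unfolding sm_def[abs_def] using C1c_diff[OF C1c_cmult[OF C1c_avg[of u g e], of 2] C1c_avg[of u g "2 *\<^sub>R e"]] by simp

lemma avg_diff:
  assumes "continuous_on UNIV u" "continuous_on UNIV v"
  shows "avg e (\<lambda>x. u x - v x) x = avg e u x - avg e v x"
  unfolding avg_def
  by (rule Henstock_Kurzweil_Integration.integral_diff[OF segment_integrable[OF assms(1)] segment_integrable[OF assms(2)]])

lemma sm_diff:
  assumes "continuous_on UNIV u" "continuous_on UNIV v"
  shows "sm e (\<lambda>x. u x - v x) x = sm e u x - sm e v x"
  unfolding sm_def avg_diff[OF assms] by (simp add: scaleR_diff_right)

lemma nn_integral_sm_square_le: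
  fixes w :: "'a::euclidean_space \<Rightarrow> real"
  assumes w: "continuous_on UNIV w" and D: "forward_closed e D"
  shows "(\<integral>\<^sup>+x\<in>D. ennreal ((sm e w x)\<^sup>2) \<partial>lborel) \<le> 10 * (\<integral>\<^sup>+x\<in>D. ennreal ((w x)\<^sup>2) \<partial>lborel)"
proof -
  have [measurable]: "w \<in> borel_measurable borel" using w by (rule borel_measurable_continuous_onI)
  have [measurable]: "D \<in> sets borel" by (rule forward_closedD[OF D])
  have [measurable]: "avg a w \<in> borel_measurable borel" for a using continuous_on_avg[OF w] by (rule borel_measurable_continuous_onI)
  have D2: "forward_closed (2 *\<^sub>R e) D" using forward_closed_scale[OF D, of 2] by simp
  have "ennreal ((sm e w x)\<^sup>2) \<le> ennreal 8 * ennreal ((avg e w x)\<^sup>2) + ennreal 2 * ennreal ((avg (2 *\<^sub>R e) w x)\<^sup>2)" for x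
  proof -
    have "(sm e w x)\<^sup>2 \<le> 8 * (avg e w x)\<^sup>2 + 2 * (avg (2 *\<^sub>R e) w x)\<^sup>2"
      unfolding sm_def using zero_le_power2[of "2 * avg e w x + avg (2 *\<^sub>R e) w x"]
      by (simp add: power2_eq_square algebra_simps)
    then have "ennreal ((sm e w x)\<^sup>2) \<le> ennreal (8 * (avg e w x)\<^sup>2 + 2 * (avg (2 *\<^sub>R e) w x)\<^sup>2)" by (rule ennreal_leI)
    then show ?thesis by (simp add: ennreal_mult')
  qed
  then have "(\<integral>\<^sup>+x\<in>D. ennreal ((sm e w x)\<^sup>2) \<partial>lborel)
     \<le> (\<integral>\<^sup>+x\<in>D. (ennreal 8 * ennreal ((avg e w x)\<^sup>2) + ennreal 2 * ennreal ((avg (2 *\<^sub>R e) w x)\<^sup>2)) \<partial>lborel)"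
    by (intro nn_integral_mono mult_right_mono) auto
  also have "\<dots> = ennreal 8 * (\<integral>\<^sup>+x\<in>D. ennreal ((avg e w x)\<^sup>2) \<partial>lborel) + ennreal 2 * (\<integral>\<^sup>+x\<in>D. ennreal ((avg (2 *\<^sub>R e) w x)\<^sup>2) \<partial>lborel)"
    by (simp only: distrib_right mult.assoc) (simp add: nn_integral_add nn_integral_cmult del: ennreal_numeral)
  also have "\<dots> \<le> ennreal 8 * (\<integral>\<^sup>+x\<in>D. ennreal ((w x)\<^sup>2) \<partial>lborel) + ennreal 2 * (\<integral>\<^sup>+x\<in>D. ennreal ((w x)\<^sup>2) \<partial>lborel)"
    using nn_integral_avg_square_le[OF w D] nn_integral_avg_square_le[OF w D2]
    by (intro add_mono mult_left_mono) auto
  also have "\<dots> = ennreal (8 + 2) * (\<integral>\<^sup>+x\<in>D. ennreal ((w x)\<^sup>2) \<partial>lborel)"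
    by (subst ennreal_plus) (simp_all only: distrib_right zero_le_numeral)
  finally show ?thesis by simp
qed

text \<open>Smoothing over parallelograms at scale \<open>(1/2)^k\<close>, one application of
  \<open>sm\<close> for each edge of the cone. Replacing both e and f by their negatives gives the
  backward smoothing.\<close>

definition smk :: "plane \<Rightarrow> plane \<Rightarrow> nat \<Rightarrow> (plane \<Rightarrow> 'b::euclidean_space) \<Rightarrow> plane \<Rightarrow> 'b" where
  "smk e f k u = sm ((1/2)^k *\<^sub>R e) (sm ((1/2)^k *\<^sub>R f) u)"

lemma C1c_smk: "C1c u g \<Longrightarrow> C1c (smk e f k u) (smk e f k g)"
  unfolding smk_def by (intro C1c_sm)

lemma continuous_on_smk: "continuous_on UNIV u \<Longrightarrow> continuous_on UNIV (smk e f k u)"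
  unfolding smk_def by (intro continuous_on_sm)

lemma norm_sm_le:
  assumes "continuous_on UNIV u" "\<And>x. norm (u x) \<le> B" shows "norm (sm e u x) \<le> 3 * B"
proof -
  have "norm (avg e u x) \<le> B" "norm (avg (2 *\<^sub>R e) u x) \<le> B" using assms by (auto intro!: avg_bound)
  then show ?thesis
    unfolding sm_def using norm_triangle_ineq4[of "2 *\<^sub>R avg e u x" "avg (2 *\<^sub>R e) u x"] by simp
qed

lemma norm_smk_le:
  assumes "continuous_on UNIV u" "\<And>x. norm (u x) \<le> B" shows "norm (smk e f k u x) \<le> 9 * B"
proof -
  have "norm (smk e f k u x) \<le> 3 * (3 * B)" unfolding smk_def
    by (intro norm_sm_le continuous_on_sm assms)
  then show ?thesis by simp
qed

lemma sm_eq_0: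
  assumes "\<And>r. 0 \<le> r \<Longrightarrow> r \<le> 2 \<Longrightarrow> u (x + r *\<^sub>R e) = 0" shows "sm e u x = 0"
proof -
  have "avg e u x = 0" "avg (2 *\<^sub>R e) u x = 0" using assms by (auto intro!: avg_eq_0)
  then show ?thesis by (simp add: sm_def)
qed

lemma smk_eq_0:
  assumes "\<And>r s. 0 \<le> r \<Longrightarrow> r \<le> 2 \<Longrightarrow> 0 \<le> s \<Longrightarrow> s \<le> 2 \<Longrightarrow> u (x + r *\<^sub>R e + s *\<^sub>R f) = 0"
  shows "smk e f k u x = 0"
  unfolding smk_def
proof (intro sm_eq_0)
  fix r s :: real assume rs: "0 \<le> r" "r \<le> 2" "0 \<le> s" "s \<le> 2"
  have "r * (1/2)^k \<le> 2 * 1" "s * (1/2)^k \<le> 2 * 1" using rs by (intro mult_mono power_le_one; simp)+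
  then show "u (x + r *\<^sub>R (1/2)^k *\<^sub>R e + s *\<^sub>R (1/2)^k *\<^sub>R f) = 0"
    using assms[of "r * (1/2)^k" "s * (1/2)^k"] rs by simp
qed

lemma sm_continuous_param:
  fixes U :: "'c::topological_space \<Rightarrow> 'a::euclidean_space \<Rightarrow> 'b::euclidean_space"
  assumes "continuous_on UNIV (\<lambda>(t, x). U t x)" "continuous_on UNIV e"
  shows "continuous_on UNIV (\<lambda>(t, x). sm (e t) (U t) x)"
proof -
  have "continuous_on UNIV (\<lambda>t. 2 *\<^sub>R e t)" by (intro continuous_intros assms)
  then show ?thesis
    using avg_continuous_param[OF assms(1,2)] avg_continuous_param[OF assms(1), of "\<lambda>t. 2 *\<^sub>R e t"]
    unfolding sm_def[abs_def] split_beta by (intro continuous_intros)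
qed

text \<open>At step size 0 both averages in \<open>sm\<close> return the function and the
  coefficients \<open>2 - 1\<close> give it back; joint continuity does the rest.\<close>

lemma smk_tendsto:
  assumes u: "continuous_on UNIV u" shows "(\<lambda>k. smk e f k u x) \<longlonglongrightarrow> u x"
proof -
  have "continuous_on UNIV (\<lambda>(t::real, x). u x)"
    unfolding split_beta by (intro continuous_on_compose2[OF u] continuous_intros) auto
  then have "continuous_on UNIV (\<lambda>(t::real, x). sm (t *\<^sub>R e) (sm (t *\<^sub>R f) u) x)"
    by (intro sm_continuous_param continuous_intros)
  from continuous_on_compose2[OF this, of UNIV "\<lambda>t. (t, x)"]
  have "continuous_on UNIV (\<lambda>t::real. sm (t *\<^sub>R e) (sm (t *\<^sub>R f) u) x)" by (simp add: continuous_intros)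
  then have c: "isCont (\<lambda>t::real. sm (t *\<^sub>R e) (sm (t *\<^sub>R f) u) x) 0" by (simp add: continuous_on_eq_continuous_at)
  have "(\<lambda>k. (1/2::real)^k) \<longlonglongrightarrow> 0" by (rule LIMSEQ_power_zero) simp
  from isCont_tendsto_compose[OF c this] show ?thesis
    by (simp add: smk_def sm_def avg_def scaleR_2)
qed

lemma nn_set_integral_square_add_le:
  fixes p q :: "'a::euclidean_space \<Rightarrow> real"
  assumes [measurable]: "p \<in> borel_measurable borel" "q \<in> borel_measurable borel" "D \<in> sets borel"
  shows "(\<integral>\<^sup>+x\<in>D. ennreal ((p x + q x)\<^sup>2) \<partial>lborel) \<le> 2 * (\<integral>\<^sup>+x\<in>D. ennreal ((p x)\<^sup>2) \<partial>lborel) + 2 * (\<integral>\<^sup>+x\<in>D. ennreal ((q x)\<^sup>2) \<partial>lborel)"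
proof -
  have "ennreal ((p x + q x)\<^sup>2) \<le> 2 * ennreal ((p x)\<^sup>2) + 2 * ennreal ((q x)\<^sup>2)" for x
  proof -
    have "(p x + q x)\<^sup>2 \<le> 2 * (p x)\<^sup>2 + 2 * (q x)\<^sup>2"
      using zero_le_power2[of "p x - q x"] by (simp add: power2_eq_square algebra_simps)
    then have "ennreal ((p x + q x)\<^sup>2) \<le> ennreal (2 * (p x)\<^sup>2 + 2 * (q x)\<^sup>2)" by (rule ennreal_leI)
    then show ?thesis by (simp add: ennreal_mult')
  qed
  then have "(\<integral>\<^sup>+x\<in>D. ennreal ((p x + q x)\<^sup>2) \<partial>lborel) \<le> (\<integral>\<^sup>+x\<in>D. (2 * ennreal ((p x)\<^sup>2) + 2 * ennreal ((q x)\<^sup>2)) \<partial>lborel)"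
    by (intro nn_integral_mono mult_right_mono) auto
  also have "\<dots> = (\<integral>\<^sup>+x. 2 * (ennreal ((p x)\<^sup>2) * indicator D x) + 2 * (ennreal ((q x)\<^sup>2) * indicator D x) \<partial>lborel)"
    by (simp only: distrib_right mult.assoc)
  also have "\<dots> = 2 * (\<integral>\<^sup>+x\<in>D. ennreal ((p x)\<^sup>2) \<partial>lborel) + 2 * (\<integral>\<^sup>+x\<in>D. ennreal ((q x)\<^sup>2) \<partial>lborel)"
    by (subst nn_integral_add) (auto simp: nn_integral_cmult)
  finally show ?thesis .
qed

lemma sum_smk_minus_le:
  assumes u: "C1 u g" and e: "forward_closed e D" and f: "forward_closed f D"
  shows "(\<Sum>k<N. 4^k * (\<integral>\<^sup>+x\<in>D. ennreal ((smk e f k u x - u x)\<^sup>2) \<partial>lborel))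
    \<le> ennreal (8 * (norm e)\<^sup>2 + 80 * (norm f)\<^sup>2) * (\<integral>\<^sup>+x\<in>D. ennreal ((norm (g x))\<^sup>2) \<partial>lborel)"
proof -
  note cu = C1_continuous[OF u]
  have [measurable]: "D \<in> sets borel" by (rule forward_closedD[OF e])
  have [measurable]: "g \<in> borel_measurable borel" using C1_gradient_continuous[OF u] by (rule borel_measurable_continuous_onI)
  define A where "A = (\<lambda>e k. 4^k * (\<integral>\<^sup>+x\<in>D. ennreal ((sm ((1/2)^k *\<^sub>R e) u x - u x)\<^sup>2) \<partial>lborel))"
  let ?G = "\<integral>\<^sup>+x\<in>D. ennreal ((norm (g x))\<^sup>2) \<partial>lborel"
  have G: "(\<integral>\<^sup>+x\<in>D. ennreal ((g x \<bullet> e)\<^sup>2) \<partial>lborel) \<le> ennreal ((norm e)\<^sup>2) * ?G" for e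
  proof -
    have "(g x \<bullet> e)\<^sup>2 \<le> (norm e)\<^sup>2 * (norm (g x))\<^sup>2" for x
      using Cauchy_Schwarz_ineq[of "g x" e] by (simp add: power2_norm_eq_inner mult.commute)
    then have "(\<integral>\<^sup>+x\<in>D. ennreal ((g x \<bullet> e)\<^sup>2) \<partial>lborel) \<le> (\<integral>\<^sup>+x. ennreal ((norm e)\<^sup>2) * (ennreal ((norm (g x))\<^sup>2) * indicator D x) \<partial>lborel)"
      by (intro nn_integral_mono) (auto simp: indicator_def ennreal_mult'[symmetric] intro!: ennreal_leI)
    then show ?thesis by (simp add: nn_integral_cmult)
  qed
  have step: "4^k * (\<integral>\<^sup>+x\<in>D. ennreal ((smk e f k u x - u x)\<^sup>2) \<partial>lborel) \<le> 2 * A e k + 20 * A f k" for k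
  proof -
    let ?a = "(1/2)^k *\<^sub>R e" and ?b = "(1/2)^k *\<^sub>R f"
    let ?w = "\<lambda>x. sm ?b u x - u x"
    have cw: "continuous_on UNIV ?w" by (intro continuous_intros continuous_on_sm cu)
    have m: "(\<lambda>x. sm ?a u x - u x) \<in> borel_measurable borel" "sm ?a ?w \<in> borel_measurable borel"
      by (intro borel_measurable_continuous_onI continuous_intros continuous_on_sm cu)+
    \<comment> \<open>The error is split by direction. To the second summand only the L2 bound of
      \<open>sm\<close> is applied, so the constants become \<open>2 * 4 = 8\<close> for e and
      \<open>2 * 10 * 4 = 80\<close> for f.\<close>
    have d: "smk e f k u x - u x = (sm ?a u x - u x) + sm ?a ?w x" for x
      unfolding smk_def using sm_diff[OF continuous_on_sm[OF cu] cu, of ?a ?b] by simp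
    have "(\<integral>\<^sup>+x\<in>D. ennreal ((smk e f k u x - u x)\<^sup>2) \<partial>lborel)
       \<le> 2 * (\<integral>\<^sup>+x\<in>D. ennreal ((sm ?a u x - u x)\<^sup>2) \<partial>lborel) + 2 * (\<integral>\<^sup>+x\<in>D. ennreal ((sm ?a ?w x)\<^sup>2) \<partial>lborel)"
      unfolding d by (intro nn_set_integral_square_add_le m) simp
    also have "\<dots> \<le> 2 * (\<integral>\<^sup>+x\<in>D. ennreal ((sm ?a u x - u x)\<^sup>2) \<partial>lborel) + 2 * (10 * (\<integral>\<^sup>+x\<in>D. ennreal ((?w x)\<^sup>2) \<partial>lborel))"
      by (intro add_left_mono mult_left_mono nn_integral_sm_square_le[OF cw] forward_closed_scale[OF e]) auto
    finally have "4^k * (\<integral>\<^sup>+x\<in>D. ennreal ((smk e f k u x - u x)\<^sup>2) \<partial>lborel)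
      \<le> 4^k * (2 * (\<integral>\<^sup>+x\<in>D. ennreal ((sm ?a u x - u x)\<^sup>2) \<partial>lborel) + 2 * (10 * (\<integral>\<^sup>+x\<in>D. ennreal ((?w x)\<^sup>2) \<partial>lborel)))"
      by (rule mult_left_mono) simp
    also have "\<dots> = 2 * A e k + 20 * A f k" 
    proof -
      have "c * (2 * a + 2 * (10 * b)) = 2 * (c * a) + 20 * (c * b)" for a b c :: ennreal
      proof -
        have "2 * (10 * b) = 20 * b" by (simp add: mult.assoc[symmetric])
        then show ?thesis by (simp only: distrib_left mult.left_commute[of c])
      qed
      then show ?thesis unfolding A_def .
    qed
    finally show ?thesis .
  qed
  have "(\<Sum>k<N. 4^k * (\<integral>\<^sup>+x\<in>D. ennreal ((smk e f k u x - u x)\<^sup>2) \<partial>lborel)) \<le> (\<Sum>k<N. 2 * A e k + 20 * A f k)"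
    by (intro sum_mono step)
  also have "\<dots> = 2 * (\<Sum>k<N. A e k) + 20 * (\<Sum>k<N. A f k)" by (simp add: sum.distrib sum_distrib_left)
  also have "\<dots> \<le> 2 * (4 * (ennreal ((norm e)\<^sup>2) * ?G)) + 20 * (4 * (ennreal ((norm f)\<^sup>2) * ?G))"
    unfolding A_def
    by (intro add_mono mult_left_mono order_trans[OF sum_sm_minus_le[OF u e]] order_trans[OF sum_sm_minus_le[OF u f]] G) auto
  also have "\<dots> = ennreal (8 * (norm e)\<^sup>2 + 80 * (norm f)\<^sup>2) * ?G"
    by (simp add: ennreal_mult' distrib_right mult.assoc[symmetric])
  finally show ?thesis .
qed

lemma navg_cmult: "F \<in> borel_measurable borel \<Longrightarrow> navg e (\<lambda>y. c * F y) x = c * navg e F x"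
  unfolding navg_def by (simp add: mult.assoc nn_integral_cmult)

text \<open>\<open>norm_sm_le_navg\<close>, used in both directions, bounds the smoothing by
  \<open>5 * 5 = 25\<close> times an average of \<open>norm v\<close> over the parallelogram with
  doubled edges. A point of D sees only points of D, so v may be cut off outside D, and
  \<open>sum_bavg_fourth_le\<close> on the plane applies.\<close>

lemma sum_smk_fourth_le:
  assumes ef: "cross2 e f \<noteq> 0"
  obtains C :: real where "C \<ge> 0"
    "\<And>(v :: plane \<Rightarrow> plane) D N. continuous_on UNIV v \<Longrightarrow> forward_closed e D \<Longrightarrow> forward_closed f D \<Longrightarrow>
      (\<Sum>k<N. ennreal ((1/4)^k) * (\<integral>\<^sup>+x\<in>D. ennreal ((norm (smk e f k v x))^4) \<partial>lborel))
        \<le> ennreal C * (\<integral>\<^sup>+x\<in>D. ennreal ((norm (v x))\<^sup>2) \<partial>lborel)\<^sup>2"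
proof -
  have "cross2 (2 *\<^sub>R e) (2 *\<^sub>R f) \<noteq> 0" using ef by (simp add: cross2_def)
  then obtain C where C: "C \<ge> 0" "\<And>F N. F \<in> borel_measurable borel \<Longrightarrow>
      (\<Sum>k<N. ennreal ((1/4)^k) * (\<integral>\<^sup>+x. (bavg (2 *\<^sub>R e) (2 *\<^sub>R f) ((1/2)^k) F x)^4 \<partial>lborel)) \<le> ennreal C * (\<integral>\<^sup>+x. (F x)\<^sup>2 \<partial>lborel)\<^sup>2"
    using sum_bavg_fourth_le by blast
  have "(\<Sum>k<N. ennreal ((1/4)^k) * (\<integral>\<^sup>+x\<in>D. ennreal ((norm (smk e f k v x))^4) \<partial>lborel))
        \<le> ennreal (25^4 * C) * (\<integral>\<^sup>+x\<in>D. ennreal ((norm (v x))\<^sup>2) \<partial>lborel)\<^sup>2"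
    if v: "continuous_on UNIV v" and e: "forward_closed e D" and f: "forward_closed f D"
    for v :: "plane \<Rightarrow> plane" and D N
  proof -
    have [measurable]: "D \<in> sets borel" by (rule forward_closedD[OF e])
    have [measurable]: "v \<in> borel_measurable borel" using v by (rule borel_measurable_continuous_onI)
    define F where "F = (\<lambda>y. ennreal (norm (v y)) * indicator D y)"
    have [measurable]: "F \<in> borel_measurable borel" unfolding F_def by measurable
    let ?B = "\<lambda>k. bavg (2 *\<^sub>R e) (2 *\<^sub>R f) ((1/2)^k) F"
    have pw: "ennreal (norm (smk e f k v x)) \<le> 25 * ?B k x" if x: "x \<in> D" for k x
    proof -
      let ?h = "(1/2::real)^k"
      have "ennreal (norm (smk e f k v x)) \<le> 5 * navg (2 *\<^sub>R ?h *\<^sub>R e) (\<lambda>y. ennreal (norm (sm (?h *\<^sub>R f) v y))) x"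
        unfolding smk_def by (rule norm_sm_le_navg[OF continuous_on_sm[OF v]])
      also have "\<dots> \<le> 5 * navg (2 *\<^sub>R ?h *\<^sub>R e) (\<lambda>y. 5 * navg (2 *\<^sub>R ?h *\<^sub>R f) F y) x"
      proof (intro mult_left_mono navg_mono)
        fix r :: real assume r: "0 \<le> r" "r \<le> 1"
        let ?y = "x + r *\<^sub>R 2 *\<^sub>R ?h *\<^sub>R e"
        have y: "?y \<in> D" using forward_closedD(2)[OF e x, of "r * (2 * ?h)"] r by simp
        have "ennreal (norm (sm (?h *\<^sub>R f) v ?y)) \<le> 5 * navg (2 *\<^sub>R ?h *\<^sub>R f) (\<lambda>y. ennreal (norm (v y))) ?y"
          by (rule norm_sm_le_navg[OF v])
        also have "\<dots> \<le> 5 * navg (2 *\<^sub>R ?h *\<^sub>R f) F ?y"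
        proof (intro mult_left_mono navg_mono)
          fix s :: real assume s: "0 \<le> s" "s \<le> 1"
          have "?y + s *\<^sub>R 2 *\<^sub>R ?h *\<^sub>R f \<in> D" using forward_closedD(2)[OF f y, of "s * (2 * ?h)"] s by simp
          then show "ennreal (norm (v (?y + s *\<^sub>R 2 *\<^sub>R ?h *\<^sub>R f))) \<le> F (?y + s *\<^sub>R 2 *\<^sub>R ?h *\<^sub>R f)"
            unfolding F_def by simp
        qed simp
        finally show "ennreal (norm (sm (?h *\<^sub>R f) v ?y)) \<le> 5 * navg (2 *\<^sub>R ?h *\<^sub>R f) F ?y" .
      qed simp
      also have "\<dots> = 25 * navg (2 *\<^sub>R ?h *\<^sub>R e) (navg (2 *\<^sub>R ?h *\<^sub>R f) F) x"
        by (subst navg_cmult) (auto simp: mult.assoc[symmetric])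
      also have "navg (2 *\<^sub>R ?h *\<^sub>R e) (navg (2 *\<^sub>R ?h *\<^sub>R f) F) x = ?B k x"
        using navg_navg_eq_bavg[of F ?h "2 *\<^sub>R e" "2 *\<^sub>R f" x] by (simp add: mult.commute)
      finally show ?thesis .
    qed
    have k: "(\<integral>\<^sup>+x\<in>D. ennreal ((norm (smk e f k v x))^4) \<partial>lborel) \<le> 25^4 * (\<integral>\<^sup>+x. (?B k x)^4 \<partial>lborel)" for k
    proof -
      have "(\<integral>\<^sup>+x\<in>D. ennreal ((norm (smk e f k v x))^4) \<partial>lborel) \<le> (\<integral>\<^sup>+x. 25^4 * (?B k x)^4 \<partial>lborel)"
      proof (rule nn_integral_mono)
        fix x
        have "ennreal ((norm (smk e f k v x))^4) \<le> 25^4 * (?B k x)^4" if "x \<in> D"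
          using power_mono[OF pw[OF that, of k], of 4] by (simp add: ennreal_power power_mult_distrib)
        then show "ennreal ((norm (smk e f k v x))^4) * indicator D x \<le> 25^4 * (?B k x)^4"
          by (auto simp: indicator_def)
      qed
      then show ?thesis by (simp add: nn_integral_cmult)
    qed
    have "(\<Sum>k<N. ennreal ((1/4)^k) * (\<integral>\<^sup>+x\<in>D. ennreal ((norm (smk e f k v x))^4) \<partial>lborel))
      \<le> (\<Sum>k<N. ennreal ((1/4)^k) * (25^4 * (\<integral>\<^sup>+x. (?B k x)^4 \<partial>lborel)))"
      by (intro sum_mono mult_left_mono k) auto
    also have "\<dots> = 25^4 * (\<Sum>k<N. ennreal ((1/4)^k) * (\<integral>\<^sup>+x. (?B k x)^4 \<partial>lborel))"
      by (simp add: sum_distrib_left mult_ac)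
    also have "\<dots> \<le> 25^4 * (ennreal C * (\<integral>\<^sup>+x. (F x)\<^sup>2 \<partial>lborel)\<^sup>2)" by (intro mult_left_mono C) auto
    also have "(\<integral>\<^sup>+x. (F x)\<^sup>2 \<partial>lborel) = (\<integral>\<^sup>+x\<in>D. ennreal ((norm (v x))\<^sup>2) \<partial>lborel)"
      unfolding F_def by (intro nn_integral_cong) (auto simp: indicator_def ennreal_power)
    also have "25^4 * (ennreal C * (\<integral>\<^sup>+x\<in>D. ennreal ((norm (v x))\<^sup>2) \<partial>lborel)\<^sup>2)
      = ennreal (25^4 * C) * (\<integral>\<^sup>+x\<in>D. ennreal ((norm (v x))\<^sup>2) \<partial>lborel)\<^sup>2"
      using C(1) by (simp add: ennreal_mult' mult.assoc)
    finally show ?thesis .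
  qed
  then show ?thesis using that[of "25^4 * C"] C(1) by simp
qed

section \<open>The telescoping sum over the scales\<close>

lemma integral_cross2_bound:
  fixes p :: "plane \<Rightarrow> real" and q r :: "plane \<Rightarrow> plane"
  assumes [measurable]: "p \<in> borel_measurable borel" "q \<in> borel_measurable borel" "r \<in> borel_measurable borel" "D \<in> sets borel"
    and z: "\<And>x. x \<notin> D \<Longrightarrow> p x * cross2 (q x) (r x) = 0"
  shows "ennreal \<bar>\<integral>x. p x * cross2 (q x) (r x) \<partial>lborel\<bar> \<le> 4^k * (\<integral>\<^sup>+x\<in>D. ennreal ((p x)\<^sup>2) \<partial>lborel)
    + ennreal ((1/4)^k) * (\<integral>\<^sup>+x\<in>D. ennreal ((norm (q x))^4) \<partial>lborel) + ennreal ((1/4)^k) * (\<integral>\<^sup>+x\<in>D. ennreal ((norm (r x))^4) \<partial>lborel)"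
    (is "_ \<le> ?R")
proof -
  \<comment> \<open>Young's inequality with the weight \<open>4^k\<close>, the inverse square of the
    scale: \<open>|p| |q| |r|\<close> is at most \<open>t p^2\<close> plus
    \<open>|q|^2 |r|^2 / t\<close>, and the last product is split into fourth powers.\<close>
  define t where "t = (4::real)^k"
  have t: "t > 0" "(1/4)^k = 1/t" by (auto simp: t_def power_one_over)
  have R0: "0 \<le> ?R" by simp
  show ?thesis
  proof (cases "integrable lborel (\<lambda>x. p x * cross2 (q x) (r x))")
    case True
    have "ennreal \<bar>\<integral>x. p x * cross2 (q x) (r x) \<partial>lborel\<bar> \<le> (\<integral>\<^sup>+x. norm (p x * cross2 (q x) (r x)) \<partial>lborel)"
      using integral_norm_bound_ennreal[OF True] by simp
    also have "\<dots> \<le> (\<integral>\<^sup>+x. ennreal t * (ennreal ((p x)\<^sup>2) * indicator D x)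
        + ennreal (1/t) * (ennreal ((norm (q x))^4) * indicator D x) + ennreal (1/t) * (ennreal ((norm (r x))^4) * indicator D x) \<partial>lborel)"
    proof (rule nn_integral_mono)
      fix x
      show "ennreal (norm (p x * cross2 (q x) (r x))) \<le> ennreal t * (ennreal ((p x)\<^sup>2) * indicator D x)
        + ennreal (1/t) * (ennreal ((norm (q x))^4) * indicator D x) + ennreal (1/t) * (ennreal ((norm (r x))^4) * indicator D x)"
      proof (cases "x \<in> D")
        case True
        let ?a = "\<bar>p x\<bar>" and ?b = "norm (q x)" and ?c = "norm (r x)"
        have "norm (p x * cross2 (q x) (r x)) \<le> ?a * (?b * ?c)"
          by (simp add: abs_mult abs_cross2_le mult_left_mono)
        also have "\<dots> = (sqrt t * ?a) * (?b * ?c / sqrt t)" using t by simp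
        also have "\<dots> \<le> (sqrt t * ?a)\<^sup>2 + (?b * ?c / sqrt t)\<^sup>2"
        proof -
          have "2 * (sqrt t * ?a) * (?b * ?c / sqrt t) \<le> (sqrt t * ?a)\<^sup>2 + (?b * ?c / sqrt t)\<^sup>2" by (rule sum_squares_bound)
          moreover have "0 \<le> (sqrt t * ?a) * (?b * ?c / sqrt t)" using t by simp
          ultimately show ?thesis by linarith
        qed
        also have "\<dots> = t * (p x)\<^sup>2 + 1/t * (?b\<^sup>2 * ?c\<^sup>2)"
          using t by (simp add: power_mult_distrib power_divide)
        also have "\<dots> \<le> t * (p x)\<^sup>2 + 1/t * (?b^4 + ?c^4)"
        proof -
          have "2 * ?b\<^sup>2 * ?c\<^sup>2 \<le> (?b\<^sup>2)\<^sup>2 + (?c\<^sup>2)\<^sup>2" by (rule sum_squares_bound)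
          moreover have "(?b\<^sup>2)\<^sup>2 = ?b^4" "(?c\<^sup>2)\<^sup>2 = ?c^4" by (simp_all flip: power_mult)
          moreover have "0 \<le> ?b\<^sup>2 * ?c\<^sup>2" by simp
          ultimately have "?b\<^sup>2 * ?c\<^sup>2 \<le> ?b^4 + ?c^4" by linarith
          then show ?thesis using t by (intro add_left_mono mult_left_mono) auto
        qed
        also have "\<dots> = t * (p x)\<^sup>2 + 1/t * ?b^4 + 1/t * ?c^4" by (simp add: distrib_left)
        finally have "ennreal (norm (p x * cross2 (q x) (r x))) \<le> ennreal (t * (p x)\<^sup>2 + 1/t * ?b^4 + 1/t * ?c^4)"
          by (rule ennreal_leI)
        also have "\<dots> = ennreal t * ennreal ((p x)\<^sup>2) + ennreal (1/t) * ennreal (?b^4) + ennreal (1/t) * ennreal (?c^4)"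
          using t by (simp add: ennreal_mult'[symmetric])
        finally show ?thesis using True by simp
      qed (use z in simp)
    qed
    also have "\<dots> = ennreal t * (\<integral>\<^sup>+x\<in>D. ennreal ((p x)\<^sup>2) \<partial>lborel)
      + ennreal (1/t) * (\<integral>\<^sup>+x\<in>D. ennreal ((norm (q x))^4) \<partial>lborel) + ennreal (1/t) * (\<integral>\<^sup>+x\<in>D. ennreal ((norm (r x))^4) \<partial>lborel)"
      by (simp add: nn_integral_add nn_integral_cmult)
    also have "ennreal t = 4^k" by (simp add: t_def flip: ennreal_power)
    finally show ?thesis unfolding t(2) .
  next
    case False
    \<comment> \<open>Without integrability the integral on the left is 0 by convention.\<close>
    then show ?thesis using R0 by (simp add: not_integrable_integral_eq)
  qed
qed

lemma dyadic_diff_square_le: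
  fixes w :: "nat \<Rightarrow> plane \<Rightarrow> real"
  assumes [measurable]: "\<And>k. w k \<in> borel_measurable borel" "u \<in> borel_measurable borel" "D \<in> sets borel"
  defines "A \<equiv> \<lambda>k. 4^k * (\<integral>\<^sup>+x\<in>D. ennreal ((w k x - u x)\<^sup>2) \<partial>lborel)"
  shows "4^k * (\<integral>\<^sup>+x\<in>D. ennreal ((w (Suc k) x - w k x)\<^sup>2) \<partial>lborel) \<le> 2 * A (Suc k) + 2 * A k"
proof -
  have "(\<integral>\<^sup>+x\<in>D. ennreal ((w (Suc k) x - w k x)\<^sup>2) \<partial>lborel) = (\<integral>\<^sup>+x\<in>D. ennreal (((w (Suc k) x - u x) + (u x - w k x))\<^sup>2) \<partial>lborel)"
    by simp
  also have "\<dots> \<le> 2 * (\<integral>\<^sup>+x\<in>D. ennreal ((w (Suc k) x - u x)\<^sup>2) \<partial>lborel) + 2 * (\<integral>\<^sup>+x\<in>D. ennreal ((u x - w k x)\<^sup>2) \<partial>lborel)"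
    by (rule nn_set_integral_square_add_le) measurable
  finally have "4^k * (\<integral>\<^sup>+x\<in>D. ennreal ((w (Suc k) x - w k x)\<^sup>2) \<partial>lborel)
    \<le> 4^k * (2 * (\<integral>\<^sup>+x\<in>D. ennreal ((w (Suc k) x - u x)\<^sup>2) \<partial>lborel) + 2 * (\<integral>\<^sup>+x\<in>D. ennreal ((u x - w k x)\<^sup>2) \<partial>lborel))"
    by (rule mult_left_mono) simp
  also have "\<dots> = 2 * (4^k * (\<integral>\<^sup>+x\<in>D. ennreal ((w (Suc k) x - u x)\<^sup>2) \<partial>lborel)) + 2 * A k"
    unfolding A_def by (simp add: distrib_left mult_ac power2_commute)
  also have "4^k * (\<integral>\<^sup>+x\<in>D. ennreal ((w (Suc k) x - u x)\<^sup>2) \<partial>lborel) \<le> A (Suc k)"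
  proof -
    have "(4::ennreal)^k * 1 \<le> 4^k * 4" by (intro mult_left_mono) auto
    then show ?thesis unfolding A_def by (intro mult_right_mono) (auto simp: mult.commute)
  qed
  finally show ?thesis by (simp add: add_right_mono mult_left_mono)
qed

lemma cross2_diff_left: "cross2 (a - b) c = cross2 a c - cross2 b c"
  and cross2_diff_right: "cross2 a (b - c) = cross2 a b - cross2 a c"
  and cross2_commute: "cross2 a b = - cross2 b a"
  and cross2_zero [simp]: "cross2 0 a = 0" "cross2 a 0 = 0"
  by (simp_all add: cross2_def algebra_simps)

text \<open>The three functions are exchanged one at a time. In the exchange of v and of w the
  difference first sits under a gradient; antisymmetry moves that gradient to u, so that every
  difference stands undifferentiated beside two gradients of smoothed functions.\<close>

lemma integral_cross2_step:
  assumes u: "C1c u gu" "C1c u' gu'" and v: "C1c v gv" "C1c v' gv'" and w: "C1c w gw" "C1c w' gw'"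
  shows "(\<integral>x. u' x * cross2 (gv' x) (gw' x) \<partial>lborel) - (\<integral>x. u x * cross2 (gv x) (gw x) \<partial>lborel)
    = (\<integral>x. (u' x - u x) * cross2 (gv' x) (gw' x) \<partial>lborel) - (\<integral>x. (v' x - v x) * cross2 (gu x) (gw' x) \<partial>lborel)
      + (\<integral>x. (w' x - w x) * cross2 (gu x) (gv x) \<partial>lborel)"
proof -
  have i: "integrable lborel (\<lambda>x. a x * cross2 (gb x) (gc x))" if "C1c a ga" "C1c b gb" "C1c c gc" for a ga b gb c gc
    by (rule Cc_integrable, rule Cc_compose_zero[OF C1c_Cc[OF that(1)]])
      (use that C1_continuous C1_gradient_continuous in \<open>auto simp: C1c_def intro!: continuous_intros\<close>)
  have 1: "(\<integral>x. (u' x - u x) * cross2 (gv' x) (gw' x) \<partial>lborel)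
     = (\<integral>x. u' x * cross2 (gv' x) (gw' x) \<partial>lborel) - (\<integral>x. u x * cross2 (gv' x) (gw' x) \<partial>lborel)"
    using i[OF u(2) v(2) w(2)] i[OF u(1) v(2) w(2)] by (simp add: left_diff_distrib)
  have "- (\<integral>x. (v' x - v x) * cross2 (gu x) (gw' x) \<partial>lborel) = (\<integral>x. u x * cross2 (gv' x - gv x) (gw' x) \<partial>lborel)"
    using integral_cross2_antisym[OF u(1) C1c_C1[OF C1c_diff[OF v(2) v(1)]] C1c_C1[OF w(2)]] by simp
  also have "\<dots> = (\<integral>x. u x * cross2 (gv' x) (gw' x) \<partial>lborel) - (\<integral>x. u x * cross2 (gv x) (gw' x) \<partial>lborel)"
    using i[OF u(1) v(2) w(2)] i[OF u(1) v(1) w(2)] by (simp add: cross2_diff_left right_diff_distrib)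
  finally have 2: "- (\<integral>x. (v' x - v x) * cross2 (gu x) (gw' x) \<partial>lborel)
     = (\<integral>x. u x * cross2 (gv' x) (gw' x) \<partial>lborel) - (\<integral>x. u x * cross2 (gv x) (gw' x) \<partial>lborel)" .
  have "(\<integral>x. (w' x - w x) * cross2 (gu x) (gv x) \<partial>lborel) = - (\<integral>x. u x * cross2 (gw' x - gw x) (gv x) \<partial>lborel)"
    using integral_cross2_antisym[OF u(1) C1c_C1[OF C1c_diff[OF w(2) w(1)]] C1c_C1[OF v(1)]] by simp
  also have "\<dots> = (\<integral>x. u x * cross2 (gv x) (gw' x - gw x) \<partial>lborel)"
    unfolding cross2_commute[of "gw' _ - gw _"] by simp
  also have "\<dots> = (\<integral>x. u x * cross2 (gv x) (gw' x) \<partial>lborel) - (\<integral>x. u x * cross2 (gv x) (gw x) \<partial>lborel)"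
    using i[OF u(1) v(1) w(2)] i[OF u(1) v(1) w(1)] by (simp add: cross2_diff_right right_diff_distrib)
  finally show ?thesis using 1 2 by linarith
qed

lemma integral_smk_tendsto:
  assumes u: "C1c u gu" and v: "C1c v gv" and w: "C1c w gw"
  shows "(\<lambda>k. \<integral>x. smk a b k u x * cross2 (smk c d k gv x) (smk a b k gw x) \<partial>lborel)
    \<longlonglongrightarrow> (\<integral>x. u x * cross2 (gv x) (gw x) \<partial>lborel)"
proof -
  note cu = C1_continuous[OF C1c_C1[OF u]] and cv = C1_gradient_continuous[OF C1c_C1[OF v]]
    and cw = C1_gradient_continuous[OF C1c_C1[OF w]]
  obtain U where U: "\<And>x. norm (u x) \<le> U" "U > 0" using Cc_bounded[OF C1c_Cc[OF u]] by blast
  obtain V where V: "\<And>x. norm (gv x) \<le> V" "V > 0" using Cc_bounded[OF C1c_gradient_Cc[OF v]] by blast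
  obtain W where W: "\<And>x. norm (gw x) \<le> W" "W > 0" using Cc_bounded[OF C1c_gradient_Cc[OF w]] by blast
  obtain R where R: "{x. u x \<noteq> 0} \<subseteq> cball 0 R" using Cc_supportE[OF C1c_Cc[OF u]] by blast
  show ?thesis
  proof (rule bounded_integral_tendsto)
    show "(\<lambda>x. smk a b k u x * cross2 (smk c d k gv x) (smk a b k gw x)) \<in> borel_measurable borel" for k
      by (intro borel_measurable_continuous_onI continuous_intros continuous_on_smk cu cv cw)
    show "(\<lambda>x. u x * cross2 (gv x) (gw x)) \<in> borel_measurable borel"
      by (intro borel_measurable_continuous_onI continuous_intros cu cv cw)
    show "smk a b k u x * cross2 (smk c d k gv x) (smk a b k gw x) = 0" if "x \<notin> cball 0 (R + 2 * norm a + 2 * norm b)" for k x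
    proof -
      have "smk a b k u x = 0"
      proof (rule smk_eq_0)
        fix r s :: real assume rs: "0 \<le> r" "r \<le> 2" "0 \<le> s" "s \<le> 2"
        have "norm (r *\<^sub>R a) \<le> 2 * norm a" "norm (s *\<^sub>R b) \<le> 2 * norm b" using rs by (auto intro: mult_right_mono)
        moreover have "norm x \<le> norm (x + r *\<^sub>R a + s *\<^sub>R b) + norm (r *\<^sub>R a) + norm (s *\<^sub>R b)"
          using norm_triangle_ineq4[of "x + r *\<^sub>R a + s *\<^sub>R b" "s *\<^sub>R b"] norm_triangle_ineq4[of "x + r *\<^sub>R a" "r *\<^sub>R a"] by simp
        moreover have "R + 2 * norm a + 2 * norm b < norm x" using that by simp
        ultimately have "x + r *\<^sub>R a + s *\<^sub>R b \<notin> cball 0 R" unfolding mem_cball_0 by linarith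
        then show "u (x + r *\<^sub>R a + s *\<^sub>R b) = 0" using R by blast
      qed
      then show ?thesis by simp
    qed
    show "\<bar>smk a b k u x * cross2 (smk c d k gv x) (smk a b k gw x)\<bar> \<le> (9 * U) * ((9 * V) * (9 * W))" for k x
    proof -
      have "\<bar>smk a b k u x\<bar> \<le> 9 * U" using norm_smk_le[OF cu U(1), of a b k x] by simp
      moreover have "\<bar>cross2 (smk c d k gv x) (smk a b k gw x)\<bar> \<le> (9 * V) * (9 * W)"
        by (rule order_trans[OF abs_cross2_le mult_mono]) (use norm_smk_le[OF cv V(1)] norm_smk_le[OF cw W(1)] V(2) in auto)
      ultimately show ?thesis unfolding abs_mult using U(2) by (intro mult_mono) auto
    qed
    show "(\<lambda>k. smk a b k u x * cross2 (smk c d k gv x) (smk a b k gw x)) \<longlonglongrightarrow> u x * cross2 (gv x) (gw x)" for x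
      unfolding cross2_def by (intro tendsto_intros smk_tendsto cu cv cw)
  qed
qed

text \<open>A point of D met when going backwards from x would, by going forwards again, put x
  itself into D.\<close>

lemma forward_closed_smk_eq_0:
  assumes e: "forward_closed e D" and f: "forward_closed f D" and z: "\<And>y. y \<notin> D \<Longrightarrow> u y = 0" and x: "x \<notin> D"
  shows "smk (- e) (- f) k u x = 0"
proof (rule smk_eq_0, rule z, rule notI)
  fix r s :: real assume rs: "0 \<le> r" "0 \<le> s" and i: "x + r *\<^sub>R - e + s *\<^sub>R - f \<in> D"
  have "x + r *\<^sub>R - e + s *\<^sub>R - f + r *\<^sub>R e + s *\<^sub>R f \<in> D"
    by (intro forward_closedD(2)[OF f] forward_closedD(2)[OF e] i rs)
  then show False using x by simp
qed

text \<open>The functions vanishing outside \<open>D\<close> are averaged backwards, which preserves their supports, and the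
  remaining one is averaged forwards, which uses only its values in \<open>D\<close>.\<close>

lemma cone_estimate:
  assumes ef: "cross2 e f \<noteq> 0" and e: "forward_closed e D" and f: "forward_closed f D" and M: "M \<ge> 0"
  obtains W :: real where
    "\<And>u gu v gv w gw. \<lbrakk>C1c u gu; C1c v gv; C1c w gw; \<And>x. x \<notin> D \<Longrightarrow> u x = 0; \<And>x. x \<notin> D \<Longrightarrow> gu x = 0; \<And>x. x \<notin> D \<Longrightarrow> gw x = 0; \<And>x. x \<notin> D \<Longrightarrow> w x = 0;
      (\<integral>\<^sup>+x. ennreal ((u x)\<^sup>2) \<partial>lborel) \<le> ennreal M; (\<integral>\<^sup>+x. ennreal ((norm (gu x))\<^sup>2) \<partial>lborel) \<le> ennreal M;
      (\<integral>\<^sup>+x\<in>D. ennreal ((norm (gv x))\<^sup>2) \<partial>lborel) \<le> ennreal M; (\<integral>\<^sup>+x. ennreal ((norm (gw x))\<^sup>2) \<partial>lborel) \<le> ennreal M\<rbrakk>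
      \<Longrightarrow> \<bar>\<integral>x. u x * cross2 (gv x) (gw x) \<partial>lborel\<bar> \<le> W"
proof -
  have D [measurable]: "D \<in> sets borel" by (rule forward_closedD[OF e])
  have ef': "cross2 (- e) (- f) \<noteq> 0" using ef by (simp add: cross2_def)
  obtain C where C: "C \<ge> 0" "\<And>(v :: plane \<Rightarrow> plane) D N. continuous_on UNIV v \<Longrightarrow> forward_closed e D \<Longrightarrow> forward_closed f D \<Longrightarrow>
      (\<Sum>k<N. ennreal ((1/4)^k) * (\<integral>\<^sup>+x\<in>D. ennreal ((norm (smk e f k v x))^4) \<partial>lborel))
        \<le> ennreal C * (\<integral>\<^sup>+x\<in>D. ennreal ((norm (v x))\<^sup>2) \<partial>lborel)\<^sup>2"
    using sum_smk_fourth_le[OF ef] by blast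
  obtain C' where C': "C' \<ge> 0" "\<And>(v :: plane \<Rightarrow> plane) D N. continuous_on UNIV v \<Longrightarrow> forward_closed (- e) D \<Longrightarrow> forward_closed (- f) D \<Longrightarrow>
      (\<Sum>k<N. ennreal ((1/4)^k) * (\<integral>\<^sup>+x\<in>D. ennreal ((norm (smk (- e) (- f) k v x))^4) \<partial>lborel))
        \<le> ennreal C' * (\<integral>\<^sup>+x\<in>D. ennreal ((norm (v x))\<^sup>2) \<partial>lborel)\<^sup>2"
    using sum_smk_fourth_le[OF ef'] by blast
  define K where "K = 8 * (norm e)\<^sup>2 + 80 * (norm f)\<^sup>2"
  have K: "K \<ge> 0" by (simp add: K_def)
  \<comment> \<open>The budget for all scales together: three sums of squared smoothing errors, the
    fourth powers of \<open>gv\<close> with the constant C of the forward averages, and those of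
    \<open>gu\<close> and \<open>gw\<close> with the constant C' of the backward ones.\<close>
  define L where "L = 3 * (K * M) + (C + 2 * C') * M\<^sup>2"
  have L: "L \<ge> 0" using K M C(1) C'(1) by (simp add: L_def)
  have "\<bar>\<integral>x. u x * cross2 (gv x) (gw x) \<partial>lborel\<bar> \<le> 76 * L + 2 * M"
    if u: "C1c u gu" and v: "C1c v gv" and w: "C1c w gw" and uD: "\<And>x. x \<notin> D \<Longrightarrow> u x = 0" and guD: "\<And>x. x \<notin> D \<Longrightarrow> gu x = 0"
      and gwD: "\<And>x. x \<notin> D \<Longrightarrow> gw x = 0" and wD: "\<And>x. x \<notin> D \<Longrightarrow> w x = 0"
      and uM: "(\<integral>\<^sup>+x. ennreal ((u x)\<^sup>2) \<partial>lborel) \<le> ennreal M" and guM: "(\<integral>\<^sup>+x. ennreal ((norm (gu x))\<^sup>2) \<partial>lborel) \<le> ennreal M"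
      and gvM: "(\<integral>\<^sup>+x\<in>D. ennreal ((norm (gv x))\<^sup>2) \<partial>lborel) \<le> ennreal M" and gwM: "(\<integral>\<^sup>+x. ennreal ((norm (gw x))\<^sup>2) \<partial>lborel) \<le> ennreal M"
    for u gu v gv w gw
  proof -
    define uk guk wk gwk where "uk = (\<lambda>k. smk (- e) (- f) k u)" and "guk = (\<lambda>k. smk (- e) (- f) k gu)"
      and "wk = (\<lambda>k. smk (- e) (- f) k w)" and "gwk = (\<lambda>k. smk (- e) (- f) k gw)"
    define vk gvk where "vk = (\<lambda>k. smk e f k v)" and "gvk = (\<lambda>k. smk e f k gv)"
    have uk: "C1c (uk k) (guk k)" and vk: "C1c (vk k) (gvk k)" and wk: "C1c (wk k) (gwk k)" for k
      unfolding uk_def guk_def vk_def gvk_def wk_def gwk_def using u v w by (auto intro: C1c_smk)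
    have ukD: "uk k x = 0" and gukD: "guk k x = 0" and wkD: "wk k x = 0" and gwkD: "gwk k x = 0" if "x \<notin> D" for k x
      unfolding uk_def guk_def wk_def gwk_def using that uD guD wD gwD by (auto intro!: forward_closed_smk_eq_0[OF e f])
    have [measurable]: "uk k \<in> borel_measurable borel" "guk k \<in> borel_measurable borel" "vk k \<in> borel_measurable borel"
      "gvk k \<in> borel_measurable borel" "wk k \<in> borel_measurable borel" "gwk k \<in> borel_measurable borel" for k
      using Cc_borel C1c_Cc C1c_gradient_Cc uk vk wk by blast+
    have [measurable]: "u \<in> borel_measurable borel" "v \<in> borel_measurable borel" "w \<in> borel_measurable borel"
      using Cc_borel C1c_Cc u v w by blast+
    define T where "T = (\<lambda>k. \<integral>x. uk k x * cross2 (gvk k x) (gwk k x) \<partial>lborel)"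
    define A where "A = (\<lambda>(p::nat \<Rightarrow> plane \<Rightarrow> real) q k. 4^k * (\<integral>\<^sup>+x\<in>D. ennreal ((p k x - q x)\<^sup>2) \<partial>lborel))"
    define B where "B = (\<lambda>(p::nat \<Rightarrow> plane \<Rightarrow> plane) k. ennreal ((1/4)^k) * (\<integral>\<^sup>+x\<in>D. ennreal ((norm (p k x))^4) \<partial>lborel))"
    define Wk where "Wk = (\<lambda>k. A uk u k + A vk v k + A wk w k + B guk k + B gvk k + B gwk k)"
    have le: "A uk u k \<le> Wk k" "A vk v k \<le> Wk k" "A wk w k \<le> Wk k" "B guk k \<le> Wk k" "B gvk k \<le> Wk k" "B gwk k \<le> Wk k" for k
      unfolding Wk_def by (simp_all add: add_increasing add_increasing2)
    have SA: "(\<Sum>k<N. A uk u k) \<le> ennreal (K * M)" "(\<Sum>k<N. A wk w k) \<le> ennreal (K * M)" "(\<Sum>k<N. A vk v k) \<le> ennreal (K * M)" for N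
    proof -
      \<comment> \<open>D need not be closed under backward steps. For the backward averages the
        whole plane takes its place, on which u and w are controlled.\<close>
      have *: "(\<Sum>k<N. A (\<lambda>k. smk (- e) (- f) k q) q k) \<le> ennreal (K * M)"
        if q: "C1 q gq" "(\<integral>\<^sup>+x. ennreal ((norm (gq x))\<^sup>2) \<partial>lborel) \<le> ennreal M" for q gq
      proof -
        have "(\<Sum>k<N. A (\<lambda>k. smk (- e) (- f) k q) q k) \<le> (\<Sum>k<N. 4^k * (\<integral>\<^sup>+x\<in>UNIV. ennreal ((smk (- e) (- f) k q x - q x)\<^sup>2) \<partial>lborel))"
          unfolding A_def by (intro sum_mono mult_left_mono nn_integral_mono) (auto simp: indicator_def)
        also have "\<dots> \<le> ennreal K * (\<integral>\<^sup>+x\<in>UNIV. ennreal ((norm (gq x))\<^sup>2) \<partial>lborel)"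
          using sum_smk_minus_le[OF q(1), of "- e" UNIV "- f" N] by (simp add: K_def)
        also have "\<dots> \<le> ennreal K * ennreal M" using q(2) by (intro mult_left_mono) auto
        finally show ?thesis using K by (simp add: ennreal_mult')
      qed
      show "(\<Sum>k<N. A uk u k) \<le> ennreal (K * M)" unfolding uk_def by (rule *[OF C1c_C1[OF u] guM])
      show "(\<Sum>k<N. A wk w k) \<le> ennreal (K * M)" unfolding wk_def by (rule *[OF C1c_C1[OF w] gwM])
      have "(\<Sum>k<N. A vk v k) \<le> ennreal K * (\<integral>\<^sup>+x\<in>D. ennreal ((norm (gv x))\<^sup>2) \<partial>lborel)"
        unfolding A_def vk_def K_def by (rule sum_smk_minus_le[OF C1c_C1[OF v] e f])
      also have "\<dots> \<le> ennreal K * ennreal M" using gvM by (intro mult_left_mono) auto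
      finally show "(\<Sum>k<N. A vk v k) \<le> ennreal (K * M)" using K by (simp add: ennreal_mult')
    qed
    have SB: "(\<Sum>k<N. B guk k) \<le> ennreal (C' * M\<^sup>2)" "(\<Sum>k<N. B gwk k) \<le> ennreal (C' * M\<^sup>2)" "(\<Sum>k<N. B gvk k) \<le> ennreal (C * M\<^sup>2)" for N
    proof -
      have *: "(\<Sum>k<N. B (\<lambda>k. smk (- e) (- f) k q) k) \<le> ennreal (C' * M\<^sup>2)"
        if q: "continuous_on UNIV q" "(\<integral>\<^sup>+x. ennreal ((norm (q x))\<^sup>2) \<partial>lborel) \<le> ennreal M" for q
      proof -
        have "(\<Sum>k<N. B (\<lambda>k. smk (- e) (- f) k q) k) \<le> (\<Sum>k<N. ennreal ((1/4)^k) * (\<integral>\<^sup>+x\<in>UNIV. ennreal ((norm (smk (- e) (- f) k q x))^4) \<partial>lborel))"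
          unfolding B_def by (intro sum_mono mult_left_mono nn_integral_mono) (auto simp: indicator_def)
        also have "\<dots> \<le> ennreal C' * (\<integral>\<^sup>+x\<in>UNIV. ennreal ((norm (q x))\<^sup>2) \<partial>lborel)\<^sup>2"
          using C'(2)[OF q(1), of UNIV N] by simp
        also have "\<dots> \<le> ennreal C' * (ennreal M)\<^sup>2" using q(2) by (intro mult_left_mono power_mono) auto
        finally show ?thesis using C'(1) M by (simp add: ennreal_mult' ennreal_power)
      qed
      show "(\<Sum>k<N. B guk k) \<le> ennreal (C' * M\<^sup>2)" unfolding guk_def
        by (rule *[OF C1_gradient_continuous[OF C1c_C1[OF u]] guM])
      show "(\<Sum>k<N. B gwk k) \<le> ennreal (C' * M\<^sup>2)" unfolding gwk_def
        by (rule *[OF C1_gradient_continuous[OF C1c_C1[OF w]] gwM])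
      have "(\<Sum>k<N. B gvk k) \<le> ennreal C * (\<integral>\<^sup>+x\<in>D. ennreal ((norm (gv x))\<^sup>2) \<partial>lborel)\<^sup>2"
        unfolding B_def gvk_def by (rule C(2)[OF C1_gradient_continuous[OF C1c_C1[OF v]] e f])
      also have "\<dots> \<le> ennreal C * (ennreal M)\<^sup>2" using gvM by (intro mult_left_mono power_mono) auto
      finally show "(\<Sum>k<N. B gvk k) \<le> ennreal (C * M\<^sup>2)" using C(1) M by (simp add: ennreal_mult' ennreal_power)
    qed
    have SW: "(\<Sum>k<N. Wk k) \<le> ennreal L" for N
    proof -
      have "(\<Sum>k<N. Wk k) \<le> ennreal (K * M) + ennreal (K * M) + ennreal (K * M) + ennreal (C' * M\<^sup>2) + ennreal (C * M\<^sup>2) + ennreal (C' * M\<^sup>2)"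
        unfolding Wk_def sum.distrib by (intro add_mono SA SB)
      also have "\<dots> = ennreal L"
        unfolding L_def using K M C(1) C'(1) by (simp add: algebra_simps flip: ennreal_plus)
      finally show ?thesis .
    qed
    define wr where "wr = (\<lambda>k. enn2real (Wk k))"
    have wr: "Wk k = ennreal (wr k)" "wr k \<ge> 0" for k
    proof -
      have "Wk k \<le> (\<Sum>j<Suc k. Wk j)" by (simp add: add_increasing)
      also have "\<dots> < top" using SW[of "Suc k"] by (rule order.strict_trans1) simp
      finally show "Wk k = ennreal (wr k)" "wr k \<ge> 0" by (simp_all add: wr_def)
    qed
    have Swr: "(\<Sum>k<N. wr k) \<le> L" for N
    proof -
      have "ennreal (\<Sum>k<N. wr k) = (\<Sum>k<N. Wk k)" unfolding wr(1) using wr(2) by (simp add: sum_ennreal)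
      then have "ennreal (\<Sum>k<N. wr k) \<le> ennreal L" using SW[of N] by (simp only:)
      then show ?thesis using L ennreal_le_iff by blast
    qed
    have Lwr: "wr k \<le> L" for k
      using Swr[of "Suc k"] sum_nonneg[of "{..<k}" wr] wr(2) by simp
    \<comment> \<open>Three integrals from \<open>integral_cross2_step\<close>, each bounded through
      \<open>integral_cross2_bound\<close> by three terms of size at most \<open>4 * Z\<close>:
      \<open>3 * 3 * 4 = 36\<close>.\<close>
    have step: "\<bar>T (Suc k) - T k\<bar> \<le> 36 * (wr k + wr (Suc k))" for k
    proof -
      define Z where "Z = Wk k + Wk (Suc k)"
      have V: "12 * Z = ennreal (12 * (wr k + wr (Suc k)))"
        using wr(2)[of k] wr(2)[of "Suc k"] by (simp add: Z_def wr(1) ennreal_mult')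
      have V1: "X \<le> Wk k \<Longrightarrow> X \<le> Z" "X \<le> Wk (Suc k) \<Longrightarrow> X \<le> Z" for X
        by (simp_all add: Z_def add_increasing add_increasing2)
      have V4: "X \<le> Z \<Longrightarrow> X \<le> 4 * Z" for X
      proof -
        have "1 * Z \<le> 4 * Z" by (intro mult_right_mono) auto
        then show "X \<le> Z \<Longrightarrow> X \<le> 4 * Z" by simp
      qed
      have bnd: "\<bar>\<integral>x. p x * cross2 (q x) (r x) \<partial>lborel\<bar> \<le> 12 * (wr k + wr (Suc k))"
        if "p \<in> borel_measurable borel" "q \<in> borel_measurable borel" "r \<in> borel_measurable borel"
          "\<And>x. x \<notin> D \<Longrightarrow> p x * cross2 (q x) (r x) = 0"
          "4^k * (\<integral>\<^sup>+x\<in>D. ennreal ((p x)\<^sup>2) \<partial>lborel) \<le> 4 * Z"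
          "ennreal ((1/4)^k) * (\<integral>\<^sup>+x\<in>D. ennreal ((norm (q x))^4) \<partial>lborel) \<le> 4 * Z"
          "ennreal ((1/4)^k) * (\<integral>\<^sup>+x\<in>D. ennreal ((norm (r x))^4) \<partial>lborel) \<le> 4 * Z" for p q r
      proof -
        have "ennreal \<bar>\<integral>x. p x * cross2 (q x) (r x) \<partial>lborel\<bar> \<le> 4 * Z + 4 * Z + 4 * Z"
          by (rule order_trans, rule integral_cross2_bound[where k = k and D = D])
            (use that(1-4) in \<open>auto intro!: add_mono that(5-7) simp del: distrib_left_numeral\<close>)
        also have "\<dots> = 12 * Z"
        proof -
          have "12 = (4 + 4 + 4 :: ennreal)" by simp
          then show ?thesis by (simp only: distrib_right)
        qed
        finally have "ennreal \<bar>\<integral>x. p x * cross2 (q x) (r x) \<partial>lborel\<bar> \<le> ennreal (12 * (wr k + wr (Suc k)))" unfolding V .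
        moreover have "0 \<le> 12 * (wr k + wr (Suc k))" using wr(2)[of k] wr(2)[of "Suc k"] by simp
        ultimately show ?thesis using ennreal_le_iff by blast
      qed
      have d: "4^k * (\<integral>\<^sup>+x\<in>D. ennreal ((p (Suc k) x - p k x)\<^sup>2) \<partial>lborel) \<le> 4 * Z"
        if "\<And>k. p k \<in> borel_measurable borel" "q \<in> borel_measurable borel" "A p q k \<le> Wk k" "A p q (Suc k) \<le> Wk (Suc k)" for p q
      proof -
        have "4^k * (\<integral>\<^sup>+x\<in>D. ennreal ((p (Suc k) x - p k x)\<^sup>2) \<partial>lborel) \<le> 2 * A p q (Suc k) + 2 * A p q k"
          unfolding A_def by (rule dyadic_diff_square_le[OF that(1,2) D])
        also have "\<dots> \<le> 2 * Z + 2 * Z" by (intro add_mono mult_left_mono V1 that) auto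
        also have "\<dots> = 4 * Z"
        proof -
          have "4 = (2 + 2 :: ennreal)" by simp
          then show ?thesis by (simp only: distrib_right)
        qed
        finally show ?thesis .
      qed
      \<comment> \<open>The gradient is smoothed at scale \<open>Suc k\<close> but weighted as at
        scale k; the two weights differ by the factor 4.\<close>
      have g1: "ennreal ((1/4)^k) * (\<integral>\<^sup>+x\<in>D. ennreal ((norm (p (Suc k) x))^4) \<partial>lborel) \<le> 4 * Z" if "B p (Suc k) \<le> Wk (Suc k)" for p
      proof -
        have "ennreal ((1/4)^k) = ennreal (4 * (1/4)^Suc k)" by simp
        also have "\<dots> = 4 * ennreal ((1/4)^Suc k)" by (subst ennreal_mult) auto
        finally have "ennreal ((1/4)^k) * (\<integral>\<^sup>+x\<in>D. ennreal ((norm (p (Suc k) x))^4) \<partial>lborel) = 4 * B p (Suc k)"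
          unfolding B_def by (simp only: mult.assoc)
        also have "\<dots> \<le> 4 * Z" by (intro mult_left_mono V1 that) auto
        finally show ?thesis .
      qed
      have g0: "ennreal ((1/4)^k) * (\<integral>\<^sup>+x\<in>D. ennreal ((norm (p k x))^4) \<partial>lborel) \<le> 4 * Z" if "B p k \<le> Wk k" for p
        using that unfolding B_def by (intro V4 V1)
      have "\<bar>\<integral>x. (uk (Suc k) x - uk k x) * cross2 (gvk (Suc k) x) (gwk (Suc k) x) \<partial>lborel\<bar> \<le> 12 * (wr k + wr (Suc k))"
        by (rule bnd) (auto simp: ukD intro!: d[of uk u] g1[of gvk] g1[of gwk] le)
      moreover have "\<bar>\<integral>x. (vk (Suc k) x - vk k x) * cross2 (guk k x) (gwk (Suc k) x) \<partial>lborel\<bar> \<le> 12 * (wr k + wr (Suc k))"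
        by (rule bnd) (auto simp: gukD intro!: d[of vk v] g0[of guk] g1[of gwk] le)
      moreover have "\<bar>\<integral>x. (wk (Suc k) x - wk k x) * cross2 (guk k x) (gvk k x) \<partial>lborel\<bar> \<le> 12 * (wr k + wr (Suc k))"
        by (rule bnd) (auto simp: gukD intro!: d[of wk w] g0[of guk] g0[of gvk] le)
      ultimately show ?thesis
        unfolding T_def using integral_cross2_step[OF uk[of k] uk[of "Suc k"] vk[of k] vk[of "Suc k"] wk[of k] wk[of "Suc k"]] by linarith
    qed
    \<comment> \<open>At the coarsest scale there is no difference to exploit: the smoothed u is
      bounded by its distance to u and by the L2 bound M of u itself.\<close>
    have T0: "\<bar>T 0\<bar> \<le> 4 * L + 2 * M"
    proof -
      have uD2: "(\<integral>\<^sup>+x\<in>D. ennreal ((u x)\<^sup>2) \<partial>lborel) \<le> ennreal M"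
        by (rule order_trans[OF nn_integral_mono uM]) (auto simp: indicator_def)
      have "(\<integral>\<^sup>+x\<in>D. ennreal ((uk 0 x)\<^sup>2) \<partial>lborel) = (\<integral>\<^sup>+x\<in>D. ennreal (((uk 0 x - u x) + u x)\<^sup>2) \<partial>lborel)" by simp
      also have "\<dots> \<le> 2 * (\<integral>\<^sup>+x\<in>D. ennreal ((uk 0 x - u x)\<^sup>2) \<partial>lborel) + 2 * (\<integral>\<^sup>+x\<in>D. ennreal ((u x)\<^sup>2) \<partial>lborel)"
        by (rule nn_set_integral_square_add_le) measurable
      also have "\<dots> \<le> 2 * Wk 0 + 2 * ennreal M"
        using le(1)[of 0] uD2 by (intro add_mono mult_left_mono) (auto simp: A_def)
      finally have 1: "(\<integral>\<^sup>+x\<in>D. ennreal ((uk 0 x)\<^sup>2) \<partial>lborel) \<le> 2 * Wk 0 + 2 * ennreal M" .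
      have "ennreal \<bar>T 0\<bar> \<le> 4^0 * (\<integral>\<^sup>+x\<in>D. ennreal ((uk 0 x)\<^sup>2) \<partial>lborel)
        + ennreal ((1/4)^0) * (\<integral>\<^sup>+x\<in>D. ennreal ((norm (gvk 0 x))^4) \<partial>lborel) + ennreal ((1/4)^0) * (\<integral>\<^sup>+x\<in>D. ennreal ((norm (gwk 0 x))^4) \<partial>lborel)"
        unfolding T_def by (rule integral_cross2_bound) (auto simp: ukD)
      also have "\<dots> \<le> (2 * Wk 0 + 2 * ennreal M) + Wk 0 + Wk 0"
        using 1 le(5,6)[of 0] by (intro add_mono) (auto simp: B_def)
      also have "\<dots> = ennreal (4 * wr 0 + 2 * M)"
        using wr(2)[of 0] M by (simp add: wr(1) ennreal_mult'[symmetric] flip: ennreal_plus ennreal_numeral)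
      finally have "ennreal \<bar>T 0\<bar> \<le> ennreal (4 * wr 0 + 2 * M)" .
      moreover have "0 \<le> 4 * wr 0 + 2 * M" using wr(2)[of 0] M by simp
      ultimately have "\<bar>T 0\<bar> \<le> 4 * wr 0 + 2 * M" using ennreal_le_iff by blast
      then show ?thesis using Lwr[of 0] by linarith
    qed
    \<comment> \<open>The sum of \<open>wr\<close> enters twice, at k and at \<open>Suc k\<close>,
      each time bounded by L; together with the start this makes
      \<open>36 * 2 + 4 = 76\<close>.\<close>
    have "\<bar>T N\<bar> \<le> 76 * L + 2 * M" for N
    proof -
      have "\<bar>T N - T 0\<bar> = \<bar>\<Sum>k<N. T (Suc k) - T k\<bar>" by (simp add: sum_lessThan_telescope)
      also have "\<dots> \<le> (\<Sum>k<N. 36 * (wr k + wr (Suc k)))" by (rule order_trans[OF sum_abs sum_mono]) (rule step)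
      also have "\<dots> = 36 * ((\<Sum>k<N. wr k) + (\<Sum>k<N. wr (Suc k)))" by (simp add: sum_distrib_left sum.distrib)
      also have "(\<Sum>k<N. wr (Suc k)) \<le> (\<Sum>k<Suc N. wr k)"
        unfolding sum.lessThan_Suc_shift[of wr N] using wr(2)[of 0] by simp
      also have "36 * ((\<Sum>k<N. wr k) + (\<Sum>k<Suc N. wr k)) \<le> 36 * (L + L)" by (intro mult_left_mono add_mono Swr) simp
      finally show ?thesis using T0 by (simp add: add_left_mono)
    qed
    moreover have "T \<longlonglongrightarrow> (\<integral>x. u x * cross2 (gv x) (gw x) \<partial>lborel)"
      unfolding T_def uk_def gvk_def gwk_def by (rule integral_smk_tendsto[OF u v w])
    ultimately show ?thesis
      by (intro LIMSEQ_le_const2[OF tendsto_rabs]) auto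
  qed
  then show ?thesis by (rule that)
qed

subsection \<open>Localisation in a Lipschitz domain\<close>

lemma DERIV_pos_part_square: "DERIV (\<lambda>y::real. (max 0 y)\<^sup>2) y :> 2 * max 0 y"
proof -
  consider "y > 0" | "y < 0" | "y = 0" by linarith
  then show ?thesis
  proof cases
    case 1
    have "DERIV (\<lambda>y::real. y\<^sup>2) y :> 2 * y" by (auto intro!: derivative_eq_intros)
    then have "((\<lambda>y. (max 0 y)\<^sup>2) has_field_derivative 2 * y) (at y)"
      by (rule has_field_derivative_transform_within_open[OF _ open_greaterThan[of 0]]) (use 1 in auto)
    then show ?thesis using 1 by simp
  next
    case 2
    have "DERIV (\<lambda>y::real. 0) y :> 0" by simp
    then have "((\<lambda>y. (max 0 y)\<^sup>2) has_field_derivative 0) (at y)"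
      by (rule has_field_derivative_transform_within_open[OF _ open_lessThan[of 0]]) (use 2 in auto)
    then show ?thesis using 2 by simp
  next
    case 3
    have "((\<lambda>h::real. max 0 h) \<longlongrightarrow> max 0 0) (at 0)" by (intro tendsto_intros)
    moreover have "\<forall>\<^sub>F h::real in at 0. max 0 h = (max 0 h)\<^sup>2 / h"
      by (auto simp: eventually_at max_def power2_eq_square intro!: exI[of _ 1])
    ultimately have "((\<lambda>h::real. (max 0 h)\<^sup>2 / h) \<longlongrightarrow> max 0 0) (at 0)"
      by (rule Lim_transform_eventually)
    then show ?thesis using 3 by (simp add: has_field_derivative_iff)
  qed
qed

lemma C1_pos_part_square: "C1 u g \<Longrightarrow> C1 (\<lambda>x. (max 0 (u x))\<^sup>2) (\<lambda>x. (2 * max 0 (u x)) *\<^sub>R g x)"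
  using C1_continuous[of u g] GDERIV_DERIV_compose[OF _ DERIV_pos_part_square]
  by (auto simp: C1_def intro!: continuous_intros)

lemma C1_const: "C1 (\<lambda>x. c) (\<lambda>x. 0)"
  by (simp add: C1_def GDERIV_const)

lemma C1_norm_square: "C1 (\<lambda>x. (norm (x - p))\<^sup>2) (\<lambda>x. 2 *\<^sub>R (x - p))"
  unfolding C1_def gderiv_def power2_norm_eq_inner
  by (auto intro!: derivative_eq_intros continuous_intros simp: inner_commute algebra_simps)

text \<open>Let m be the squared positive part and y a quadratic function that is at least 1 on the
  inner ball and at most 0 outside the outer one. Then \<open>m y\<close> is at least 1 on the inner
  ball and 0 outside the outer one, and the second application in \<open>1 - m (1 - m y)\<close>
  confines the values to the unit interval. The bound for \<open>1 - a\<close> serves the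
  complementary piece of a partition.\<close>

lemma cutoff_function:
  fixes p :: "'a::euclidean_space"
  assumes "0 < s" "s < t"
  obtains a ga where "C1c a ga" "\<And>x. x \<in> ball p s \<Longrightarrow> a x = 1" "\<And>x. a x \<noteq> 0 \<Longrightarrow> x \<in> ball p t"
    "\<And>x. \<bar>a x\<bar> \<le> 1" "\<And>x. \<bar>1 - a x\<bar> \<le> 1"
proof -
  define c where "c = 1 / (t\<^sup>2 - s\<^sup>2)"
  have "s\<^sup>2 < t\<^sup>2" using assms by (intro power_strict_mono) auto
  then have c: "c > 0" by (simp add: c_def)
  define y where "y = (\<lambda>x::'a. c * (t\<^sup>2 - (norm (x - p))\<^sup>2))"
  define m where "m = (\<lambda>y::real. (max 0 y)\<^sup>2)"
  define a where "a = (\<lambda>x. 1 - m (1 - m (y x)))"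
  obtain ga where a: "C1 a ga"
    unfolding a_def m_def y_def
    using C1_diff[OF C1_const C1_pos_part_square[OF C1_diff[OF C1_const C1_pos_part_square[OF C1_cmult[OF C1_diff[OF C1_const C1_norm_square]]]]]]
    by blast
  have one: "a x = 1" if "x \<in> ball p s" for x
  proof -
    have "norm (x - p) \<le> s" using that by (simp add: dist_norm norm_minus_commute)
    then have "(norm (x - p))\<^sup>2 \<le> s\<^sup>2" by (intro power_mono) auto
    then have "c * (t\<^sup>2 - s\<^sup>2) \<le> y x" unfolding y_def using c by (intro mult_left_mono) auto
    then have "1 \<le> y x" using \<open>s\<^sup>2 < t\<^sup>2\<close> by (simp add: c_def)
    then have "1 \<le> m (y x)" by (simp add: m_def one_le_power)
    moreover have "m z = 0" if "z \<le> 0" for z using that by (simp add: m_def)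
    ultimately have "m (1 - m (y x)) = 0" by simp
    then show ?thesis by (simp add: a_def)
  qed
  have supp: "x \<in> ball p t" if "a x \<noteq> 0" for x
  proof (rule ccontr)
    assume "x \<notin> ball p t"
    then have "t \<le> norm (x - p)" by (simp add: dist_norm norm_minus_commute)
    then have "t\<^sup>2 \<le> (norm (x - p))\<^sup>2" using assms by (intro power_mono) auto
    then have "y x \<le> 0" unfolding y_def using c by (simp add: mult_nonneg_nonpos)
    then show False using that by (simp add: a_def m_def)
  qed
  have "0 \<le> m z" for z by (simp add: m_def)
  moreover have "m z \<le> 1" if "z \<le> 1" for z using that by (simp add: m_def power_le_one max_def)
  ultimately have "0 \<le> m (1 - m (y x))" "m (1 - m (y x)) \<le> 1" for x by simp_all
  then have b: "\<bar>a x\<bar> \<le> 1" "\<bar>1 - a x\<bar> \<le> 1" for x unfolding a_def by (simp_all add: abs_le_iff add_increasing)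
  have "bounded {x. a x \<noteq> 0}" by (rule bounded_subset[OF bounded_ball[of p t]]) (use supp in blast)
  then show ?thesis using that[of a ga] a one supp b by (simp add: C1c_def)
qed

section \<open>Energy bounds, multiplication by cutoffs and the cone condition\<close>

definition h1_le :: "plane set \<Rightarrow> real \<Rightarrow> (plane \<Rightarrow> real) \<Rightarrow> (plane \<Rightarrow> plane) \<Rightarrow> bool" where
  "h1_le \<Omega> M u g \<longleftrightarrow> (\<integral>\<^sup>+x\<in>\<Omega>. ennreal ((u x)\<^sup>2) \<partial>lborel) \<le> ennreal M \<and> (\<integral>\<^sup>+x\<in>\<Omega>. ennreal ((norm (g x))\<^sup>2) \<partial>lborel) \<le> ennreal M"

definition supported_in :: "plane set \<Rightarrow> (plane \<Rightarrow> real) \<Rightarrow> (plane \<Rightarrow> plane) \<Rightarrow> bool" where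
  "supported_in \<Omega> u g \<longleftrightarrow> C1c u g \<and> closure {x. u x \<noteq> 0} \<subseteq> \<Omega>"

lemma supported_in_eq_0:
  assumes "supported_in \<Omega> u g" "x \<notin> \<Omega>" shows "u x = 0" "g x = 0"
proof -
  have "{x. u x \<noteq> 0} \<subseteq> \<Omega>" "{x. g x \<noteq> 0} \<subseteq> \<Omega>"
    using assms(1) closure_subset[of "{x. u x \<noteq> 0}"] C1_gradient_support[OF C1c_C1, of u g] unfolding supported_in_def by blast+
  then show "u x = 0" "g x = 0" using assms(2) by blast+
qed

lemma supported_in_mult:
  assumes "supported_in \<Omega> u g" "C1 a ga"
  shows "supported_in \<Omega> (\<lambda>x. a x * u x) (\<lambda>x. u x *\<^sub>R ga x + a x *\<^sub>R g x)"
proof -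
  have "C1c (\<lambda>x. u x * a x) (\<lambda>x. u x *\<^sub>R ga x + a x *\<^sub>R g x)"
    using C1c_mult[of u g a ga] assms by (simp add: supported_in_def)
  moreover have "closure {x. a x * u x \<noteq> 0} \<subseteq> closure {x. u x \<noteq> 0}" by (rule closure_mono) auto
  ultimately show ?thesis using assms(1) by (auto simp: supported_in_def mult.commute)
qed

text \<open>Product rule and \<open>(p + q)^2 \<le> 2 p^2 + 2 q^2\<close>. The set S may differ from
  \<Omega> as long as u or the cutoff vanishes on the part of S outside \<Omega>; this carries
  bounds from \<Omega> to D and to the whole plane.\<close>

lemma nn_integral_product_gradient_le:
  fixes a u :: "plane \<Rightarrow> real"
  assumes c: "C1 a ga" "C1 u g" and S: "S \<in> sets borel" "\<Omega> \<in> sets borel"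
    and a: "\<And>x. \<bar>a x\<bar> \<le> 1" "\<And>x. norm (ga x) \<le> A"
    and z: "\<And>x. x \<in> S \<Longrightarrow> x \<notin> \<Omega> \<Longrightarrow> (u x = 0 \<and> g x = 0) \<or> (a x = 0 \<and> ga x = 0)"
    and u: "h1_le \<Omega> M u g" and M: "M \<ge> 0"
  shows "h1_le S ((2 + 2 * A\<^sup>2) * M) (\<lambda>x. a x * u x) (\<lambda>x. u x *\<^sub>R ga x + a x *\<^sub>R g x)"
proof -
  have [measurable]: "a \<in> borel_measurable borel" "ga \<in> borel_measurable borel" "u \<in> borel_measurable borel" "g \<in> borel_measurable borel"
    using c by (auto intro!: borel_measurable_continuous_onI dest: C1_continuous C1_gradient_continuous)
  note [measurable] = S
  have a2: "(a x)\<^sup>2 \<le> 1" for x using a(1)[of x] by (simp add: abs_square_le_1)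
  have "(\<integral>\<^sup>+x\<in>S. ennreal ((a x * u x)\<^sup>2) \<partial>lborel) \<le> (\<integral>\<^sup>+x\<in>\<Omega>. ennreal ((u x)\<^sup>2) \<partial>lborel)"
  proof (rule nn_integral_mono)
    fix x
    have "(a x * u x)\<^sup>2 \<le> (u x)\<^sup>2" using mult_right_mono[OF a2[of x], of "(u x)\<^sup>2"] by (simp add: power_mult_distrib)
    then show "ennreal ((a x * u x)\<^sup>2) * indicator S x \<le> ennreal ((u x)\<^sup>2) * indicator \<Omega> x"
      using z[of x] by (auto simp: indicator_def intro: ennreal_leI)
  qed
  also have "\<dots> \<le> ennreal M" using u by (simp add: h1_le_def)
  also have "\<dots> \<le> ennreal ((2 + 2 * A\<^sup>2) * M)"
    using mult_right_mono[of 1 "2 + 2 * A\<^sup>2" M] M by (intro ennreal_leI) simp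
  finally have 1: "(\<integral>\<^sup>+x\<in>S. ennreal ((a x * u x)\<^sup>2) \<partial>lborel) \<le> ennreal ((2 + 2 * A\<^sup>2) * M)" .
  have "(\<integral>\<^sup>+x\<in>S. ennreal ((norm (u x *\<^sub>R ga x + a x *\<^sub>R g x))\<^sup>2) \<partial>lborel)
     \<le> (\<integral>\<^sup>+x. ennreal (2 * A\<^sup>2) * (ennreal ((u x)\<^sup>2) * indicator \<Omega> x) + ennreal 2 * (ennreal ((norm (g x))\<^sup>2) * indicator \<Omega> x) \<partial>lborel)"
  proof (rule nn_integral_mono)
    fix x
    show "ennreal ((norm (u x *\<^sub>R ga x + a x *\<^sub>R g x))\<^sup>2) * indicator S x
      \<le> ennreal (2 * A\<^sup>2) * (ennreal ((u x)\<^sup>2) * indicator \<Omega> x) + ennreal 2 * (ennreal ((norm (g x))\<^sup>2) * indicator \<Omega> x)"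
    proof (cases "x \<in> S \<and> x \<in> \<Omega>")
      case True
      have "norm (u x *\<^sub>R ga x + a x *\<^sub>R g x) \<le> \<bar>u x\<bar> * A + 1 * norm (g x)"
        by (rule order_trans[OF norm_triangle_ineq]) (auto intro!: add_mono mult_mono mult_left_le_one_le a)
      then have "(norm (u x *\<^sub>R ga x + a x *\<^sub>R g x))\<^sup>2 \<le> (\<bar>u x\<bar> * A + norm (g x))\<^sup>2" by (intro power_mono) auto
      also have "\<dots> \<le> 2 * A\<^sup>2 * (u x)\<^sup>2 + 2 * (norm (g x))\<^sup>2"
        using zero_le_power2[of "\<bar>u x\<bar> * A - norm (g x)"] by (simp add: power2_eq_square algebra_simps)
      finally have "ennreal ((norm (u x *\<^sub>R ga x + a x *\<^sub>R g x))\<^sup>2) \<le> ennreal (2 * A\<^sup>2 * (u x)\<^sup>2 + 2 * (norm (g x))\<^sup>2)"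
        by (rule ennreal_leI)
      then show ?thesis using True by (simp add: ennreal_mult' mult.assoc)
    qed (use z[of x] in \<open>auto simp: indicator_def\<close>)
  qed
  also have "\<dots> = ennreal (2 * A\<^sup>2) * (\<integral>\<^sup>+x\<in>\<Omega>. ennreal ((u x)\<^sup>2) \<partial>lborel) + ennreal 2 * (\<integral>\<^sup>+x\<in>\<Omega>. ennreal ((norm (g x))\<^sup>2) \<partial>lborel)"
    by (simp add: nn_integral_add nn_integral_cmult del: ennreal_numeral)
  also have "\<dots> \<le> ennreal (2 * A\<^sup>2) * ennreal M + ennreal 2 * ennreal M"
    using u by (intro add_mono mult_left_mono) (auto simp: h1_le_def)
  also have "\<dots> = ennreal ((2 + 2 * A\<^sup>2) * M)"
    using M by (simp add: ennreal_mult'[symmetric] distrib_right add.commute flip: ennreal_plus del: ennreal_numeral)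
  finally show ?thesis using 1 by (simp add: h1_le_def)
qed

text \<open>At an interior point D is the plane. At a boundary point D is the full region above the
  local graph, which is never left in directions steeper than the Lipschitz constant L; the
  preimages under R of \<open>(1, L + 1)\<close> and \<open>(-1, L + 1)\<close> are two such
  directions.\<close>

lemma lipschitz_boundary_cone:
  assumes \<Omega>: "bounded_lipschitz_domain \<Omega>" and p: "p \<in> closure \<Omega>"
  obtains e f D r where "cross2 e f \<noteq> 0" "forward_closed e D" "forward_closed f D" "r > 0" "\<And>x. x \<in> ball p r \<Longrightarrow> x \<in> \<Omega> \<longleftrightarrow> x \<in> D"
proof (cases "p \<in> \<Omega>")
  case True
  then obtain r where "r > 0" "ball p r \<subseteq> \<Omega>" using \<Omega> by (auto simp: bounded_lipschitz_domain_def open_contains_ball)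
  then show ?thesis
    by (intro that[of "axis 1 1" "axis 2 1" UNIV r]) (auto simp: cross2_def axis_def)
next
  case False
  then have "p \<in> frontier \<Omega>" using p \<Omega> by (simp add: frontier_def bounded_lipschitz_domain_def interior_open)
  then obtain R :: "plane \<Rightarrow> plane" and \<gamma> :: "real \<Rightarrow> real" and L r where R: "orthogonal_transformation R" and \<gamma>: "L-lipschitz_on UNIV \<gamma>" and r: "r > 0"
    and iff: "\<And>x. x \<in> ball p r \<Longrightarrow> x \<in> \<Omega> \<longleftrightarrow> R (x - p) $ 2 > \<gamma> (R (x - p) $ 1)"
    using \<Omega> unfolding bounded_lipschitz_domain_def lipschitz_boundary_def by blast
  define D where "D = {x. R (x - p) $ 2 > \<gamma> (R (x - p) $ 1)}"
  have L0: "L \<ge> 0" using \<gamma> by (rule lipschitz_on_nonneg)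
  have lin: "linear R" and inner: "R a \<bullet> R b = a \<bullet> b" for a b using R by (auto simp: orthogonal_transformation_def)
  have surj: "surj R" using R by (rule orthogonal_transformation_surj)
  have cR: "continuous_on UNIV (\<lambda>x. R (x - p))"
    by (intro continuous_on_compose2[OF linear_continuous_on[OF lin[unfolded linear_conv_bounded_linear]]] continuous_intros) auto
  have "open D" unfolding D_def
    by (intro open_Collect_less continuous_on_compose2[OF lipschitz_on_continuous_on[OF \<gamma>]] continuous_intros cR) auto
  then have Db: "D \<in> sets borel" by simp
  have fwd: "forward_closed e D" if e: "R e $ 2 = L + 1" "\<bar>R e $ 1\<bar> = 1" for e
    unfolding forward_closed_def
  proof (intro conjI ballI allI impI)
    fix x and s :: real assume x: "x \<in> D" and s: "0 \<le> s"
    have eq: "R (x + s *\<^sub>R e - p) = R (x - p) + s *\<^sub>R R e"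
      using linear_add[OF lin, of "x - p" "s *\<^sub>R e"] linear_scale[OF lin, of s e] by (simp add: algebra_simps)
    have "\<bar>\<gamma> (R (x - p) $ 1 + s * R e $ 1) - \<gamma> (R (x - p) $ 1)\<bar> \<le> L * \<bar>s * R e $ 1\<bar>"
      using lipschitz_onD[OF \<gamma>, of "R (x - p) $ 1 + s * R e $ 1" "R (x - p) $ 1"] by (simp add: dist_real_def)
    also have "\<dots> = L * s" using s e(2) by (simp add: abs_mult)
    also have "\<dots> \<le> s * (L + 1)" using s by (simp add: algebra_simps)
    finally have "\<gamma> (R (x - p) $ 1 + s * R e $ 1) \<le> \<gamma> (R (x - p) $ 1) + s * (L + 1)" by linarith
    also have "\<dots> < R (x - p) $ 2 + s * (L + 1)" using x by (simp add: D_def)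
    finally show "x + s *\<^sub>R e \<in> D" unfolding D_def mem_Collect_eq eq using e(1) by simp
  qed (rule Db)
  obtain e f where e: "R e = vector [1, L + 1]" and f: "R f = vector [-1, L + 1]" using surj by (metis surjD)
  \<comment> \<open>Lagrange's identity expresses \<open>cross2\<close> through inner products,
    which R preserves whether it is a rotation or a reflection.\<close>
  have "(cross2 e f)\<^sup>2 + (e \<bullet> f)\<^sup>2 = (e \<bullet> e) * (f \<bullet> f)"
    unfolding cross2_def by (simp add: inner_vec_def sum_2 power2_eq_square algebra_simps)
  moreover have "e \<bullet> f = (L + 1)\<^sup>2 - 1" "e \<bullet> e = (L + 1)\<^sup>2 + 1" "f \<bullet> f = (L + 1)\<^sup>2 + 1"
    using inner[of e f] inner[of e e] inner[of f f] unfolding e f by (simp_all add: inner_vec_def[of "vector _"] sum_2 power2_eq_square)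
  ultimately have "(cross2 e f)\<^sup>2 = ((L + 1)\<^sup>2 + 1) * ((L + 1)\<^sup>2 + 1) - ((L + 1)\<^sup>2 - 1)\<^sup>2" by simp
  also have "\<dots> = 4 * (L + 1)\<^sup>2" by (simp add: power2_eq_square algebra_simps)
  also have "\<dots> > 0" using L0 by simp
  finally have "cross2 e f \<noteq> 0" by auto
  then show ?thesis using that[of e f D r] fwd[of e] fwd[of f] e f r iff by (simp add: D_def)
qed

text \<open>S restricts the support of u only. A single constant for all functions of energy at most
  M replaces a trilinear inequality, so that M and W may change freely from step to step.\<close>

definition wente_bound :: "plane set \<Rightarrow> plane set \<Rightarrow> real \<Rightarrow> real \<Rightarrow> bool" where
  "wente_bound \<Omega> S M W \<longleftrightarrow> (\<forall>u gu v gv w gw. supported_in \<Omega> u gu \<longrightarrow> C1 v gv \<longrightarrow> supported_in \<Omega> w gw \<longrightarrow>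
      h1_le \<Omega> M u gu \<longrightarrow> h1_le \<Omega> M v gv \<longrightarrow> h1_le \<Omega> M w gw \<longrightarrow> {x. u x \<noteq> 0} \<subseteq> S \<longrightarrow>
      \<bar>\<integral>x. u x * cross2 (gv x) (gw x) \<partial>lborel\<bar> \<le> W)"

lemma wente_boundD:
  assumes "wente_bound \<Omega> S M W" "supported_in \<Omega> u gu" "C1 v gv" "supported_in \<Omega> w gw"
    "h1_le \<Omega> M u gu" "h1_le \<Omega> M v gv" "h1_le \<Omega> M w gw" "{x. u x \<noteq> 0} \<subseteq> S"
  shows "\<bar>\<integral>x. u x * cross2 (gv x) (gw x) \<partial>lborel\<bar> \<le> W"
  using assms unfolding wente_bound_def by blast

text \<open>Since u is supported near p, multiplying v and w by a cutoff b that is 1 near p leaves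
  the integral unchanged; afterwards all functions live where \<Omega> and D agree, and
  \<open>cone_estimate\<close> applies. The radii \<open>r/3 < r/2 < 2*r/3 < r\<close> leave room
  for closures of supports.\<close>

lemma local_estimate:
  assumes \<Omega>: "bounded_lipschitz_domain \<Omega>" and p: "p \<in> closure \<Omega>"
  obtains s where "s > 0" "\<And>M. M \<ge> 0 \<Longrightarrow> \<exists>W. wente_bound \<Omega> (ball p s) M W"
proof -
  obtain e f D r where ef: "cross2 e f \<noteq> 0" "forward_closed e D" "forward_closed f D" and r: "r > 0"
    and iff: "\<And>x. x \<in> ball p r \<Longrightarrow> x \<in> \<Omega> \<longleftrightarrow> x \<in> D" using lipschitz_boundary_cone[OF \<Omega> p] by metis
  have \<Omega>b: "\<Omega> \<in> sets borel" using \<Omega> by (simp add: bounded_lipschitz_domain_def)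
  have D: "D \<in> sets borel" by (rule forward_closedD[OF ef(2)])
  define s where "s = r / 3"
  obtain b gb where b: "C1c b gb" "\<And>x. x \<in> ball p (r/2) \<Longrightarrow> b x = 1" "\<And>x. b x \<noteq> 0 \<Longrightarrow> x \<in> ball p (2*r/3)"
    "\<And>x. \<bar>b x\<bar> \<le> 1" "\<And>x. \<bar>1 - b x\<bar> \<le> 1"
  proof -
    have "0 < r/2" "r/2 < 2*r/3" using r by auto
    from cutoff_function[OF this, of p] that show ?thesis .
  qed
  obtain A where A: "\<And>x. norm (gb x) \<le> A" using Cc_bounded[OF C1c_gradient_Cc[OF b(1)]] by blast
  have gb: "gb x = 0" if "x \<notin> ball p r" for x
  proof -
    have "closure {x. b x \<noteq> 0} \<subseteq> cball p (2*r/3)" by (rule closure_minimal) (use b(3) in force)+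
    also have "\<dots> \<subseteq> ball p r" using r by auto
    finally show ?thesis using C1_gradient_support[OF C1c_C1[OF b(1)]] that by blast
  qed
  have b0: "b x = 0" if "x \<notin> ball p r" for x using b(3)[of x] that r by (cases "b x = 0") auto
  have "\<exists>W. wente_bound \<Omega> (ball p s) M W" if M: "M \<ge> 0" for M
  proof -
    define M' where "M' = (2 + 2 * A\<^sup>2) * M"
    have MM: "M \<le> M'" using mult_right_mono[of 1 "2 + 2 * A\<^sup>2" M] M by (simp add: M'_def)
    then have M': "M' \<ge> 0" using M by simp
    obtain W where W: "\<And>u gu v gv w gw. \<lbrakk>C1c u gu; C1c v gv; C1c w gw; \<And>x. x \<notin> D \<Longrightarrow> u x = 0; \<And>x. x \<notin> D \<Longrightarrow> gu x = 0; \<And>x. x \<notin> D \<Longrightarrow> gw x = 0; \<And>x. x \<notin> D \<Longrightarrow> w x = 0;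
      (\<integral>\<^sup>+x. ennreal ((u x)\<^sup>2) \<partial>lborel) \<le> ennreal M'; (\<integral>\<^sup>+x. ennreal ((norm (gu x))\<^sup>2) \<partial>lborel) \<le> ennreal M';
      (\<integral>\<^sup>+x\<in>D. ennreal ((norm (gv x))\<^sup>2) \<partial>lborel) \<le> ennreal M'; (\<integral>\<^sup>+x. ennreal ((norm (gw x))\<^sup>2) \<partial>lborel) \<le> ennreal M'\<rbrakk>
      \<Longrightarrow> \<bar>\<integral>x. u x * cross2 (gv x) (gw x) \<partial>lborel\<bar> \<le> W"
      using cone_estimate[OF ef M'] by blast
    have "\<bar>\<integral>x. u x * cross2 (gv x) (gw x) \<partial>lborel\<bar> \<le> W"
      if u: "supported_in \<Omega> u gu" and v: "C1 v gv" and w: "supported_in \<Omega> w gw"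
        and hu: "h1_le \<Omega> M u gu" and hv: "h1_le \<Omega> M v gv" and hw: "h1_le \<Omega> M w gw" and us: "{x. u x \<noteq> 0} \<subseteq> ball p s"
      for u gu v gv w gw
    proof -
      let ?v = "\<lambda>x. b x * v x" and ?gv = "\<lambda>x. v x *\<^sub>R gb x + b x *\<^sub>R gv x"
      let ?w = "\<lambda>x. b x * w x" and ?gw = "\<lambda>x. w x *\<^sub>R gb x + b x *\<^sub>R gw x"
      have u0: "u x = 0" if "x \<notin> ball p s" for x using us that by blast
      have gu0: "gu x = 0" if "x \<notin> ball p r" for x
      proof -
        have "closure {x. u x \<noteq> 0} \<subseteq> cball p s" by (rule closure_minimal) (use us in force)+
        also have "\<dots> \<subseteq> ball p r" using r by (auto simp: s_def)
        finally show ?thesis using C1_gradient_support[OF C1c_C1] u that unfolding supported_in_def by blast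
      qed
      have sr: "x \<in> ball p s \<Longrightarrow> x \<in> ball p r" for x using r by (auto simp: s_def)
      have hv': "h1_le D M' ?v ?gv" unfolding M'_def
        by (rule nn_integral_product_gradient_le[OF C1c_C1[OF b(1)] v D \<Omega>b b(4) A _ hv M]) (use gb b0 iff in blast)
      have hw': "h1_le UNIV M' ?w ?gw" unfolding M'_def
        by (rule nn_integral_product_gradient_le[OF C1c_C1[OF b(1)] _ _ \<Omega>b b(4) A _ hw M])
          (use supported_in_eq_0[OF w] w in \<open>auto simp: supported_in_def C1c_def\<close>)
      have iu: "(\<integral>\<^sup>+x\<in>\<Omega>. ennreal ((u x)\<^sup>2) \<partial>lborel) = (\<integral>\<^sup>+x. ennreal ((u x)\<^sup>2) \<partial>lborel)"
        "(\<integral>\<^sup>+x\<in>\<Omega>. ennreal ((norm (gu x))\<^sup>2) \<partial>lborel) = (\<integral>\<^sup>+x. ennreal ((norm (gu x))\<^sup>2) \<partial>lborel)"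
        by (intro nn_integral_cong; use supported_in_eq_0[OF u] in \<open>auto simp: indicator_def\<close>)+
      \<comment> \<open>b is constant on the ball of radius \<open>r/2\<close>, so its gradient
        vanishes there and the product rule reproduces \<open>gv\<close> and
        \<open>gw\<close>.\<close>
      have eq: "u x * cross2 (gv x) (gw x) = u x * cross2 (?gv x) (?gw x)" for x
      proof (cases "x \<in> ball p s")
        case True
        have in2: "x \<in> ball p (r/2)" using True r by (auto simp: s_def)
        have "gb x = 0"
          using C1_gradient_0[of "\<lambda>x. b x - 1" "\<lambda>x. gb x - 0" "ball p (r/2)" x] C1_diff[OF C1c_C1[OF b(1)] C1_const] in2 b(2) by simp
        then show ?thesis using b(2)[OF in2] by simp
      qed (simp add: u0)
      have "\<bar>\<integral>x. u x * cross2 (?gv x) (?gw x) \<partial>lborel\<bar> \<le> W"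
      proof (rule W[where w = ?w and v = ?v and gu = gu])
        show "C1c u gu" using u by (simp add: supported_in_def)
        show "C1c ?v ?gv" using C1c_mult[OF b(1) v] by (simp add: add.commute)
        show "C1c ?w ?gw" using supported_in_mult[OF w C1c_C1[OF b(1)]] by (simp add: supported_in_def)
        show "u x = 0" if "x \<notin> D" for x using u0[of x] supported_in_eq_0[OF u, of x] iff[of x] sr[of x] that by blast
        show "gu x = 0" if "x \<notin> D" for x using gu0[of x] supported_in_eq_0[OF u, of x] iff[of x] that by blast
        show "?w x = 0" if "x \<notin> D" for x
          using b0[of x] supported_in_eq_0[OF w, of x] iff[of x] that by (cases "x \<in> ball p r") auto
        show "?gw x = 0" if "x \<notin> D" for x
          using b0[of x] gb[of x] supported_in_eq_0[OF w, of x] iff[of x] that by (cases "x \<in> ball p r") auto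
        show "(\<integral>\<^sup>+x. ennreal ((u x)\<^sup>2) \<partial>lborel) \<le> ennreal M'" "(\<integral>\<^sup>+x. ennreal ((norm (gu x))\<^sup>2) \<partial>lborel) \<le> ennreal M'"
          using hu iu MM ennreal_leI[OF MM] by (auto simp: h1_le_def intro: order_trans)
        show "(\<integral>\<^sup>+x\<in>D. ennreal ((norm (?gv x))\<^sup>2) \<partial>lborel) \<le> ennreal M'" using hv' by (simp add: h1_le_def)
        show "(\<integral>\<^sup>+x. ennreal ((norm (?gw x))\<^sup>2) \<partial>lborel) \<le> ennreal M'" using hw' by (simp add: h1_le_def)
      qed
      moreover have "(\<integral>x. u x * cross2 (gv x) (gw x) \<partial>lborel) = (\<integral>x. u x * cross2 (?gv x) (?gw x) \<partial>lborel)"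
        by (intro Bochner_Integration.integral_cong refl eq)
      ultimately show ?thesis by presburger
    qed
    then have "wente_bound \<Omega> (ball p s) M W" unfolding wente_bound_def by blast
    then show ?thesis by blast
  qed
  then show ?thesis using that[of s] r by (simp add: s_def)
qed

text \<open>Compactness of the closure and induction over a finite cover: with a cutoff a for one
  ball, \<open>a u\<close> is supported in that ball and \<open>(1 - a) u\<close> in the remaining
  ones.\<close>

theorem wente_estimate:
  assumes \<Omega>: "bounded_lipschitz_domain \<Omega>" and M: "M \<ge> 0"
  obtains W where "\<And>u gu v gv w gw. \<lbrakk>supported_in \<Omega> u gu; C1 v gv; supported_in \<Omega> w gw; h1_le \<Omega> M u gu; h1_le \<Omega> M v gv; h1_le \<Omega> M w gw\<rbrakk>
    \<Longrightarrow> \<bar>\<integral>x. u x * cross2 (gv x) (gw x) \<partial>lborel\<bar> \<le> W"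
proof -
  \<comment> \<open>The quantifier over M belongs to the induction statement because each cutoff
    enlarges the energy bound of u from M to M'.\<close>
  define good where "good = (\<lambda>S. \<forall>M\<ge>0. \<exists>W. wente_bound \<Omega> S M W)"
  have \<Omega>b: "\<Omega> \<in> sets borel" using \<Omega> by (simp add: bounded_lipschitz_domain_def)
  have "\<forall>p\<in>closure \<Omega>. \<exists>s. s > 0 \<and> good (ball p s)"
  proof
    fix p assume p: "p \<in> closure \<Omega>"
    obtain s where "s > 0" "\<And>M. M \<ge> 0 \<Longrightarrow> \<exists>W. wente_bound \<Omega> (ball p s) M W"
      by (rule local_estimate[OF \<Omega> p]) blast
    then show "\<exists>s. s > 0 \<and> good (ball p s)" unfolding good_def by blast
  qed
  then obtain s where s: "\<And>p. p \<in> closure \<Omega> \<Longrightarrow> s p > 0" "\<And>p. p \<in> closure \<Omega> \<Longrightarrow> good (ball p (s p))" by metis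
  have c: "compact (closure \<Omega>)" using \<Omega> by (simp add: bounded_lipschitz_domain_def)
  \<comment> \<open>Half radii: the cutoff will be 1 on the half ball, which removes it from the
    support of \<open>(1 - a) u\<close>, and will vanish outside the full ball, on which the local
    bound is available.\<close>
  have cov: "closure \<Omega> \<subseteq> (\<Union>p\<in>closure \<Omega>. ball p (s p / 2))" using s(1) by fastforce
  obtain I where I: "I \<subseteq> closure \<Omega>" "finite I" "closure \<Omega> \<subseteq> (\<Union>p\<in>I. ball p (s p / 2))"
    by (rule compactE_image[OF c _ cov]) auto
  have "good (\<Union>p\<in>I. ball p (s p / 2))" using I(2,1)
  proof (induction I rule: finite_induct)
    case empty
    have "wente_bound \<Omega> {} M 0" for M unfolding wente_bound_def by auto
    then show ?case by (auto simp: good_def)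
  next
    case (insert p I)
    then have p: "p \<in> closure \<Omega>" and IH: "good (\<Union>p\<in>I. ball p (s p / 2))" by auto
    obtain a ga where a: "C1c a ga" "\<And>x. x \<in> ball p (s p / 2) \<Longrightarrow> a x = 1" "\<And>x. a x \<noteq> 0 \<Longrightarrow> x \<in> ball p (s p)" "\<And>x. \<bar>a x\<bar> \<le> 1" "\<And>x. \<bar>1 - a x\<bar> \<le> 1"
    proof -
      have "0 < s p / 2" "s p / 2 < s p" using s(1)[OF p] by auto
      from cutoff_function[OF this, of p] that show ?thesis .
    qed
    show ?case unfolding good_def
    proof (intro allI impI)
      fix M :: real assume M: "0 \<le> M"
      obtain A where A: "\<And>x. norm (ga x) \<le> A" using Cc_bounded[OF C1c_gradient_Cc[OF a(1)]] by blast
      define M' where "M' = (2 + 2 * A\<^sup>2) * M"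
      have MM: "M \<le> M'" using mult_right_mono[of 1 "2 + 2 * A\<^sup>2" M] M by (simp add: M'_def)
      then have M': "M' \<ge> 0" using M by simp
      have mono: "h1_le \<Omega> M v gv \<Longrightarrow> h1_le \<Omega> M' v gv" for v gv
        using ennreal_leI[OF MM] by (auto simp: h1_le_def intro: order_trans)
      obtain W1 where W1: "wente_bound \<Omega> (ball p (s p)) M' W1" using s(2)[OF p] M' unfolding good_def by blast
      obtain W2 where W2: "wente_bound \<Omega> (\<Union>p\<in>I. ball p (s p / 2)) M' W2" using IH M' unfolding good_def by blast
      have "\<bar>\<integral>x. u x * cross2 (gv x) (gw x) \<partial>lborel\<bar> \<le> W1 + W2"
        if u: "supported_in \<Omega> u gu" and v: "C1 v gv" and w: "supported_in \<Omega> w gw"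
          and hu: "h1_le \<Omega> M u gu" and hv: "h1_le \<Omega> M v gv" and hw: "h1_le \<Omega> M w gw"
          and us: "{x. u x \<noteq> 0} \<subseteq> (\<Union>p\<in>insert p I. ball p (s p / 2))" for u gu v gv w gw
      proof -
        have cu: "C1 u gu" using u by (simp add: supported_in_def C1c_def)
        let ?u1 = "\<lambda>x. a x * u x" and ?g1 = "\<lambda>x. u x *\<^sub>R ga x + a x *\<^sub>R gu x"
        let ?u2 = "\<lambda>x. (1 - a x) * u x" and ?g2 = "\<lambda>x. u x *\<^sub>R (0 - ga x) + (1 - a x) *\<^sub>R gu x"
        have c2: "C1 (\<lambda>x. 1 - a x) (\<lambda>x. 0 - ga x)" by (rule C1_diff[OF C1_const C1c_C1[OF a(1)]])
        have s1: "supported_in \<Omega> ?u1 ?g1" by (rule supported_in_mult[OF u C1c_C1[OF a(1)]])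
        have s2: "supported_in \<Omega> ?u2 ?g2" by (rule supported_in_mult[OF u c2])
        have h1: "h1_le \<Omega> M' ?u1 ?g1" unfolding M'_def
          by (rule nn_integral_product_gradient_le[OF C1c_C1[OF a(1)] cu \<Omega>b \<Omega>b a(4) A _ hu M]) simp
        have h2: "h1_le \<Omega> M' ?u2 ?g2" unfolding M'_def
          by (rule nn_integral_product_gradient_le[OF c2 cu \<Omega>b \<Omega>b a(5) _ _ hu M]) (use A in simp_all)
        have b1: "\<bar>\<integral>x. ?u1 x * cross2 (gv x) (gw x) \<partial>lborel\<bar> \<le> W1"
          by (rule wente_boundD[OF W1 s1 v w h1 mono[OF hv] mono[OF hw]]) (use a(3) in auto)
        have b2: "\<bar>\<integral>x. ?u2 x * cross2 (gv x) (gw x) \<partial>lborel\<bar> \<le> W2"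
          by (rule wente_boundD[OF W2 s2 v w h2 mono[OF hv] mono[OF hw]]) (use a(2) us in force)
        have i: "integrable lborel (\<lambda>x. q x * cross2 (gv x) (gw x))" if "supported_in \<Omega> q gq" for q gq
        proof -
          have "C1c q gq" using that by (simp add: supported_in_def)
          then show ?thesis
            using w v by (intro Cc_integrable Cc_compose_zero[OF C1c_Cc[of q gq]])
              (auto simp: supported_in_def C1c_def intro!: continuous_intros dest: C1_continuous C1_gradient_continuous)
        qed
        have "(\<integral>x. u x * cross2 (gv x) (gw x) \<partial>lborel) = (\<integral>x. ?u1 x * cross2 (gv x) (gw x) + ?u2 x * cross2 (gv x) (gw x) \<partial>lborel)"
          by (intro Bochner_Integration.integral_cong) (auto simp: algebra_simps)
        also have "\<dots> = (\<integral>x. ?u1 x * cross2 (gv x) (gw x) \<partial>lborel) + (\<integral>x. ?u2 x * cross2 (gv x) (gw x) \<partial>lborel)"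
          by (rule Bochner_Integration.integral_add[OF i[OF s1] i[OF s2]])
        finally show ?thesis using b1 b2 by linarith
      qed
      then have "wente_bound \<Omega> (\<Union>p\<in>insert p I. ball p (s p / 2)) M (W1 + W2)" unfolding wente_bound_def by blast
      then show "\<exists>W. wente_bound \<Omega> (\<Union>p\<in>insert p I. ball p (s p / 2)) M W" by blast
    qed
  qed
  then obtain W where W: "wente_bound \<Omega> (\<Union>p\<in>I. ball p (s p / 2)) M W"
    using M unfolding good_def by blast
  have "{x. u x \<noteq> 0} \<subseteq> (\<Union>p\<in>I. ball p (s p / 2))" if "supported_in \<Omega> u gu" for u gu
    using supported_in_eq_0[OF that] closure_subset[of \<Omega>] I(3) by blast
  then show ?thesis using that[of W] wente_boundD[OF W] by blast
qed

subsection \<open>Smooth functions\<close>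

lemma C_diff_Suc_imp: "C_diff (Suc k) u \<Longrightarrow> C_diff k u"
proof (induction k arbitrary: u)
  case 0
  then show ?case by (auto simp: differentiable_imp_continuous_on)
next
  case (Suc k)
  then show ?case by (metis C_diff.simps(2))
qed

lemma C_diff_SucI:
  assumes "\<And>x. (u has_derivative (\<lambda>h. u' h x)) (at x)" "\<And>h. C_diff k (u' h)"
  shows "C_diff (Suc k) u"
proof -
  have "frechet_derivative u (at x) = (\<lambda>h. u' h x)" for x using assms(1) by (rule frechet_derivative_at[symmetric])
  moreover have "u differentiable_on UNIV" using assms(1) by (auto simp: differentiable_on_def differentiable_def)
  ultimately show ?thesis using assms(2) by simp
qed

lemma C_diff_SucD:
  assumes "C_diff (Suc k) u"
  shows "(u has_derivative frechet_derivative u (at x)) (at x)" "C_diff k (\<lambda>x. frechet_derivative u (at x) h)"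
  using assms by (auto simp: differentiable_on_def frechet_derivative_works)

lemma C_diff_add: "C_diff k u \<Longrightarrow> C_diff k v \<Longrightarrow> C_diff k (\<lambda>x. u x + v x)"
proof (induction k arbitrary: u v)
  case 0
  then show ?case by (auto intro: continuous_intros)
next
  case (Suc k)
  show ?case
    by (rule C_diff_SucI[where u' = "\<lambda>h x. frechet_derivative u (at x) h + frechet_derivative v (at x) h"])
      (use Suc.IH C_diff_SucD[OF Suc.prems(1)] C_diff_SucD[OF Suc.prems(2)] in \<open>auto intro: has_derivative_add\<close>)
qed

lemma C_diff_mult: "C_diff k u \<Longrightarrow> C_diff k v \<Longrightarrow> C_diff k (\<lambda>x. u x * v x)"
proof (induction k arbitrary: u v)
  case 0
  then show ?case by (auto intro: continuous_intros)
next
  case (Suc k)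
  show ?case
  proof (rule C_diff_SucI[where u' = "\<lambda>h x. u x * frechet_derivative v (at x) h + frechet_derivative u (at x) h * v x"])
    show "((\<lambda>x. u x * v x) has_derivative (\<lambda>h. u x * frechet_derivative v (at x) h + frechet_derivative u (at x) h * v x)) (at x)" for x
      by (rule has_derivative_mult C_diff_SucD Suc.prems)+
    show "C_diff k (\<lambda>x. u x * frechet_derivative v (at x) h + frechet_derivative u (at x) h * v x)" for h
      by (rule C_diff_add[OF Suc.IH[OF C_diff_Suc_imp[OF Suc.prems(1)] C_diff_SucD(2)[OF Suc.prems(2)]]
            Suc.IH[OF C_diff_SucD(2)[OF Suc.prems(1)] C_diff_Suc_imp[OF Suc.prems(2)]]])
  qed
qed

lemma C_diff_const: "C_diff k (\<lambda>x. c)"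
proof (induction k arbitrary: c)
  case (Suc k)
  show ?case by (rule C_diff_SucI[where u' = "\<lambda>h x. 0"]) (use Suc in auto)
qed simp

lemma smooth_add: "smooth u \<Longrightarrow> smooth v \<Longrightarrow> smooth (\<lambda>x. u x + v x)"
  and smooth_mult: "smooth u \<Longrightarrow> smooth v \<Longrightarrow> smooth (\<lambda>x. u x * v x)"
  and smooth_const: "smooth (\<lambda>x. c)"
  by (simp_all add: smooth_def C_diff_add C_diff_mult C_diff_const)

definition gradient :: "(plane \<Rightarrow> real) \<Rightarrow> plane \<Rightarrow> plane" where
  "gradient u x = (\<chi> i. frechet_derivative u (at x) (axis i 1))"

lemma smooth_C1:
  assumes "smooth u" shows "C1 u (gradient u)"
proof -
  have 1: "C_diff (Suc 0) u" using assms by (simp add: smooth_def del: C_diff.simps)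
  have "frechet_derivative u (at x) h = h \<bullet> gradient u x" for x h
  proof -
    have l: "linear (frechet_derivative u (at x))" using C_diff_SucD(1)[OF 1, of x] by (rule has_derivative_linear)
    have "h = h $ 1 *\<^sub>R axis 1 1 + h $ 2 *\<^sub>R axis 2 1" by (simp add: vec_eq_iff forall_2 axis_def)
    then have "frechet_derivative u (at x) h = h $ 1 * frechet_derivative u (at x) (axis 1 1) + h $ 2 * frechet_derivative u (at x) (axis 2 1)"
      using linear_add[OF l, of "h $ 1 *\<^sub>R axis 1 1" "h $ 2 *\<^sub>R axis 2 1"] linear_scale[OF l] by simp
    then show ?thesis by (simp add: gradient_def inner_vec_def sum_2)
  qed
  then have "frechet_derivative u (at x) = (\<lambda>h. h \<bullet> gradient u x)" for x by blast
  then have "GDERIV u x :> gradient u x" for x using C_diff_SucD(1)[OF 1, of x] by (simp add: gderiv_def)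
  moreover have "continuous_on UNIV (gradient u)"
    unfolding gradient_def[abs_def] using C_diff_SucD(2)[OF 1] by (intro continuous_on_vec_lambda) simp
  ultimately show ?thesis by (simp add: C1_def)
qed

text \<open>This family, with the polynomial in \<open>1/t\<close> as a parameter, is closed under
  differentiation, so one induction gives smoothness of all its members.\<close>

definition flat_exp :: "real \<Rightarrow> real poly \<Rightarrow> real \<Rightarrow> real" where
  "flat_exp c p t = (if t > 0 then poly p (1/t) * exp (- c / t) else 0)"

lemma poly_mult_exp_tendsto_0:
  assumes c: "c > (0::real)" shows "((\<lambda>s. poly p s * exp (- c * s)) \<longlongrightarrow> 0) at_top"
proof -
  have m: "((\<lambda>s. s^i * exp (- c * s)) \<longlongrightarrow> 0) at_top" for i
  proof -
    have "filterlim (\<lambda>s. c * s) at_top at_top"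
      using c by (intro filterlim_tendsto_pos_mult_at_top[OF tendsto_const] filterlim_ident)
    from filterlim_compose[OF tendsto_power_div_exp_0 this]
    have "((\<lambda>s. (1 / c^i) * ((c * s)^i / exp (c * s))) \<longlongrightarrow> (1 / c^i) * 0) at_top" by (intro tendsto_intros)
    moreover have "(1 / c^i) * ((c * s)^i / exp (c * s)) = s^i * exp (- c * s)" for s
      using c by (simp add: power_mult_distrib exp_minus field_simps)
    ultimately show ?thesis by simp
  qed
  have "((\<lambda>s. \<Sum>i\<le>degree p. coeff p i * (s^i * exp (- c * s))) \<longlongrightarrow> (\<Sum>i\<le>degree p. coeff p i * 0)) at_top"
    by (intro tendsto_intros m)
  then show ?thesis by (simp add: poly_altdef sum_distrib_right mult.assoc)
qed

text \<open>In the variable \<open>s = 1/t\<close> the derivative is \<open>- s^2\<close> times the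
  one in s; \<open>[:0, 0, 1:]\<close> is the factor \<open>s^2\<close>. At \<open>t = 0\<close> the
  exponential decay beats every power of \<open>1/t\<close>.\<close>

lemma DERIV_flat_exp:
  assumes c: "c > 0"
  shows "DERIV (flat_exp c p) t :> flat_exp c ((smult c p - pderiv p) * [:0, 0, 1:]) t"
proof -
  consider "t > 0" | "t < 0" | "t = 0" by linarith
  then show ?thesis
  proof cases
    case 1
    have "DERIV (\<lambda>t. poly p (1/t) * exp (- c / t)) t :> flat_exp c ((smult c p - pderiv p) * [:0, 0, 1:]) t"
      using 1 by (auto intro!: derivative_eq_intros DERIV_chain2[OF poly_DERIV] simp: flat_exp_def field_simps power2_eq_square)
    then show ?thesis
      by (rule has_field_derivative_transform_within_open[OF _ open_greaterThan[of 0]]) (use 1 in \<open>auto simp: flat_exp_def\<close>)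
  next
    case 2
    have "DERIV (\<lambda>t::real. 0::real) t :> 0" by simp
    then have "DERIV (flat_exp c p) t :> 0"
      by (rule has_field_derivative_transform_within_open[OF _ open_lessThan[of 0]]) (use 2 in \<open>auto simp: flat_exp_def\<close>)
    then show ?thesis using 2 by (simp add: flat_exp_def)
  next
    case 3
    have "((\<lambda>h. flat_exp c p h / h) \<longlongrightarrow> 0) (at_right 0)"
    proof -
      have "((\<lambda>h::real. poly (p * [:0, 1:]) (inverse h) * exp (- c * inverse h)) \<longlongrightarrow> 0) (at_right 0)"
        by (rule filterlim_compose[OF poly_mult_exp_tendsto_0[OF c] filterlim_inverse_at_top_right])
      moreover have "\<forall>\<^sub>F h::real in at_right 0. poly (p * [:0, 1:]) (inverse h) * exp (- c * inverse h) = flat_exp c p h / h"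
        unfolding eventually_at_filter by (auto simp: flat_exp_def field_simps)
      ultimately show ?thesis by (rule Lim_transform_eventually)
    qed
    moreover have "((\<lambda>h. flat_exp c p h / h) \<longlongrightarrow> 0) (at_left 0)"
    proof -
      have "\<forall>\<^sub>F h::real in at_left 0. 0 = flat_exp c p h / h"
        unfolding eventually_at_filter by (auto simp: flat_exp_def)
      then show ?thesis by (rule Lim_transform_eventually[OF tendsto_const])
    qed
    ultimately have "((\<lambda>h. flat_exp c p h / h) \<longlongrightarrow> 0) (at 0)" by (simp add: filterlim_at_split)
    then show ?thesis using 3 by (simp add: has_field_derivative_iff flat_exp_def)
  qed
qed

text \<open>Induction over the order with the polynomial generalised: each directional derivative is
  another member of the family times a constant.\<close>

lemma smooth_flat_exp:
  assumes c: "c > 0" shows "smooth (\<lambda>x. flat_exp c p (a * x $ i + b))"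
proof -
  have "C_diff k (\<lambda>x. flat_exp c p (a * x $ i + b))" for k
  proof (induction k arbitrary: p)
    case 0
    have "continuous_on UNIV (flat_exp c p)"
      using DERIV_flat_exp[OF c] by (intro continuous_at_imp_continuous_on) (blast intro: DERIV_isCont)
    then show ?case by (auto intro!: continuous_on_compose2[of UNIV "flat_exp c p"] continuous_intros)
  next
    case (Suc k)
    let ?q = "(smult c p - pderiv p) * [:0, 0, 1:]"
    show ?case
    proof (rule C_diff_SucI[where u' = "\<lambda>h x. flat_exp c ?q (a * x $ i + b) * (a * h $ i)"])
      fix x :: plane
      have l: "((\<lambda>x::plane. a * x $ i + b) has_derivative (\<lambda>h. a * h $ i)) (at x)"
        by (auto intro!: derivative_eq_intros bounded_linear_imp_has_derivative bounded_linear_vec_nth)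
      have "(flat_exp c p has_derivative (\<lambda>y. flat_exp c ?q (a * x $ i + b) * y)) (at (a * x $ i + b))"
        using DERIV_flat_exp[OF c] by (simp add: has_field_derivative_def)
      from has_derivative_compose[OF l this]
      show "((\<lambda>x. flat_exp c p (a * x $ i + b)) has_derivative (\<lambda>h. flat_exp c ?q (a * x $ i + b) * (a * h $ i))) (at x)" .
    next
      show "C_diff k (\<lambda>x. flat_exp c ?q (a * x $ i + b) * (a * h $ i))" for h
        by (intro C_diff_mult Suc C_diff_const)
    qed
  qed
  then show ?thesis by (simp add: smooth_def)
qed

text \<open>One flat factor for each side of the box. The decay constant \<open>1 / Suc n\<close>
  tends to 0, so these test functions converge to the indicator of the open box and take the role of
  mollified indicators.\<close>

definition box_bump :: "plane \<Rightarrow> plane \<Rightarrow> nat \<Rightarrow> plane \<Rightarrow> real" where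
  "box_bump a b n x = flat_exp (1 / Suc n) 1 (x $ 1 - a $ 1) * flat_exp (1 / Suc n) 1 (b $ 1 - x $ 1)
     * (flat_exp (1 / Suc n) 1 (x $ 2 - a $ 2) * flat_exp (1 / Suc n) 1 (b $ 2 - x $ 2))"

lemma mem_box_plane: "x \<in> box a b \<longleftrightarrow> a $ 1 < x $ 1 \<and> x $ 1 < b $ 1 \<and> a $ 2 < x $ 2 \<and> x $ 2 < (b::plane) $ 2"
  by (auto simp: mem_box_cart forall_2)

lemma flat_exp_1_bounds: "c > 0 \<Longrightarrow> 0 \<le> flat_exp c 1 t \<and> flat_exp c 1 t \<le> 1"
  by (auto simp: flat_exp_def)

lemma flat_exp_1_eq_0: "flat_exp c 1 t = 0 \<longleftrightarrow> t \<le> 0"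
  by (auto simp: flat_exp_def)

lemma box_bump_bounds: "0 \<le> box_bump a b n x" "box_bump a b n x \<le> 1"
proof -
  have f: "0 \<le> flat_exp (1 / Suc n) 1 t" "flat_exp (1 / Suc n) 1 t \<le> 1" for t
    using flat_exp_1_bounds[of "1 / Suc n" t] by auto
  show "0 \<le> box_bump a b n x" unfolding box_bump_def by (intro mult_nonneg_nonneg f)
  show "box_bump a b n x \<le> 1" unfolding box_bump_def by (intro mult_le_one mult_nonneg_nonneg f)
qed

lemma box_bump_eq_0: "box_bump a b n x = 0 \<longleftrightarrow> x \<notin> box a b"
  by (auto simp: box_bump_def flat_exp_1_eq_0 mem_box_plane)

lemma box_bump_tendsto: "(\<lambda>n. box_bump a b n x) \<longlonglongrightarrow> indicator (box a b) x"
proof (cases "x \<in> box a b")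
  case True
  have f: "(\<lambda>n. flat_exp (1 / Suc n) 1 t) \<longlonglongrightarrow> 1" if "t > 0" for t
  proof -
    have "(\<lambda>n. exp (- (1 / real (Suc n)) / t)) \<longlonglongrightarrow> exp (- 0 / t)"
      using LIMSEQ_Suc[OF lim_1_over_n[where ?'a = real]] that by (intro tendsto_intros) auto
    then show ?thesis using that by (simp add: flat_exp_def)
  qed
  have "(\<lambda>n. box_bump a b n x) \<longlonglongrightarrow> 1 * 1 * (1 * 1)"
    unfolding box_bump_def using True by (intro tendsto_mult f) (auto simp: mem_box_plane)
  then show ?thesis using True by simp
next
  case False
  then have "box_bump a b n x = 0" for n using box_bump_eq_0 by blast
  then show ?thesis using False by simp
qed

lemma smooth_box_bump: "smooth (box_bump a b n)"
proof -
  have "smooth (\<lambda>x. flat_exp (1 / Suc n) 1 (1 * x $ i + - a $ i))" "smooth (\<lambda>x. flat_exp (1 / Suc n) 1 (- 1 * x $ i + b $ i))" for i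
    by (intro smooth_flat_exp; simp)+
  then show ?thesis unfolding box_bump_def[abs_def] by (intro smooth_mult) (simp_all add: algebra_simps)
qed

lemma box_bump_test_function:
  assumes "cbox a b \<subseteq> \<Omega>" shows "box_bump a b n \<in> test_functions \<Omega>"
proof -
  have "{x. box_bump a b n x \<noteq> 0} = box a b" using box_bump_eq_0 by blast
  moreover have "closure (box a b) \<subseteq> cbox a b" by (rule closure_minimal) (auto simp: box_subset_cbox)
  moreover have "compact (closure (box a b))" by (simp add: bounded_box)
  ultimately show ?thesis using assms smooth_box_bump by (auto simp: test_functions_def)
qed

subsection \<open>The fundamental lemma of the calculus of variations\<close>

lemma box_Int_box_plane:
  fixes a b c d :: plane
  defines "e \<equiv> vector [max (a $ 1) (c $ 1), max (a $ 2) (c $ 2)]" and "f \<equiv> vector [min (b $ 1) (d $ 1), min (b $ 2) (d $ 2)]"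
  shows "box a b \<inter> box c d = box e f" "cbox e f \<subseteq> cbox a b"
  unfolding e_def f_def by (auto simp: mem_box_plane mem_box_cart forall_2)

text \<open>Dynkin's theorem: the open boxes are an intersection-stable generator of the Borel sets.
  The condition on the support makes one box carry the total integral, which settles
  complements.\<close>

lemma AE_zero_if_box_integrals_zero:
  fixes F :: "plane \<Rightarrow> real"
  assumes F: "integrable lborel F" and z: "\<And>c d. set_lebesgue_integral lborel (box c d) F = 0"
    and supp: "\<And>x. x \<notin> box a b \<Longrightarrow> F x = 0"
  shows "AE x in lborel. F x = 0"
proof (rule sigma_finite_measure.density_zero[OF sigma_finite_lborel F])
  have si: "set_integrable lborel A F" if "A \<in> sets borel" for A
    unfolding set_integrable_def using that by (intro integrable_mult_indicator F) simp
  have tot: "(\<integral>x. F x \<partial>lborel) = 0"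
  proof -
    have "F x = indicator (box a b) x *\<^sub>R F x" for x using supp[of x] by (auto simp: indicator_def)
    then show ?thesis using z[of a b] unfolding set_lebesgue_integral_def by presburger
  qed
  fix A :: "plane set" assume "A \<in> sets lborel"
  then have A: "A \<in> sigma_sets UNIV (range (\<lambda>(a, b). box a b))" by (simp add: borel_eq_box)
  have sets: "B \<in> sets borel" if "B \<in> sigma_sets UNIV (range (\<lambda>(a, b). box a b))" for B :: "plane set"
    using that by (simp add: borel_eq_box)
  have st: "Int_stable (range (\<lambda>(a, b). box a b :: plane set))"
  proof (rule Int_stableI)
    fix A B :: "plane set" assume "A \<in> range (\<lambda>(a, b). box a b)" "B \<in> range (\<lambda>(a, b). box a b)"
    then obtain a b c d where "A = box a b" "B = box c d" by auto
    then have "A \<inter> B = (\<lambda>(a, b). box a b) (vector [max (a $ 1) (c $ 1), max (a $ 2) (c $ 2)], vector [min (b $ 1) (d $ 1), min (b $ 2) (d $ 2)])"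
      using box_Int_box_plane(1)[of a b c d] by simp
    then show "A \<inter> B \<in> range (\<lambda>(a, b). box a b)" by (rule range_eqI)
  qed
  show "set_lebesgue_integral lborel A F = 0"
  proof (rule sigma_sets_induct_disjoint[OF st _ A])
    show "range (\<lambda>(a, b). box a b) \<subseteq> Pow UNIV" by simp
    show "set_lebesgue_integral lborel B F = 0" if "B \<in> range (\<lambda>(a, b). box a b)" for B using that z by auto
    show "set_lebesgue_integral lborel {} F = 0" by (simp add: set_lebesgue_integral_def)
    show "set_lebesgue_integral lborel (UNIV - B) F = 0"
      if "B \<in> sigma_sets UNIV (range (\<lambda>(a, b). box a b))" "set_lebesgue_integral lborel B F = 0" for B
    proof -
      have "set_lebesgue_integral lborel (UNIV - B) F = (\<integral>x. F x - indicator B x *\<^sub>R F x \<partial>lborel)"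
        unfolding set_lebesgue_integral_def by (intro Bochner_Integration.integral_cong) (auto simp: indicator_def)
      also have "\<dots> = 0"
        using F si[OF sets[OF that(1)]] that(2) tot unfolding set_integrable_def set_lebesgue_integral_def by simp
      finally show ?thesis .
    qed
    show "set_lebesgue_integral lborel (\<Union>i. B i) F = 0"
      if "disjoint_family B" "range B \<subseteq> sigma_sets UNIV (range (\<lambda>(a, b). box a b))" "\<And>i. set_lebesgue_integral lborel (B i) F = 0" for B :: "nat \<Rightarrow> plane set"
    proof -
      have B: "B i \<in> sets borel" for i using that(2) sets by blast
      have "set_lebesgue_integral lborel (\<Union>i. B i) F = (\<Sum>i. set_lebesgue_integral lborel (B i) F)"
        by (rule lebesgue_integral_countable_add) (use B that(1) si in \<open>auto simp: disjoint_family_on_def\<close>)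
      then show ?thesis using that(3) by simp
    qed
  qed
qed

text \<open>The bumps converge to box indicators, so G has integral 0 over every open box whose
  closed box lies in \<Omega>. Dynkin's theorem then makes G vanish almost everywhere on each such
  box, and countably many of them cover \<Omega>.\<close>

lemma fundamental_lemma:
  assumes \<Omega>: "open \<Omega>" and G: "G \<in> borel_measurable (lebesgue_on \<Omega>)" and G2: "integrable (lebesgue_on \<Omega>) (\<lambda>x. (G x)\<^sup>2)"
    and z: "\<And>\<phi>. \<phi> \<in> test_functions \<Omega> \<Longrightarrow> (\<integral>x. G x * \<phi> x \<partial>lebesgue_on \<Omega>) = 0"
  shows "AE x in lebesgue_on \<Omega>. G x = 0"
proof -
  have \<Omega>b: "\<Omega> \<in> sets borel" using \<Omega> by simp
  have \<Omega>l: "\<Omega> \<in> sets lebesgue" using \<Omega>b sets_completionI_sets[of \<Omega> lborel] by simp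
  define G0 where "G0 = (\<lambda>x. if x \<in> \<Omega> then G x else 0)"
  have G0m: "G0 \<in> borel_measurable lebesgue" unfolding G0_def using borel_measurable_if_I[OF G \<Omega>l] by simp
  \<comment> \<open>A Borel version of the zero extension of G moves the argument from
    \<open>lebesgue\<close> to \<open>lborel\<close>, where Dynkin's theorem is applied.\<close>
  then obtain G1 where G1 [measurable]: "G1 \<in> borel_measurable lborel" and ae: "AE x in lborel. G0 x = G1 x"
    using completion_ex_borel_measurable_real by blast
  have ael: "AE x in lebesgue. G0 x = G1 x" using ae by (rule AE_completion)
  have "integrable lebesgue (\<lambda>x. (G0 x)\<^sup>2)"
  proof -
    have "integrable lebesgue (\<lambda>x. if x \<in> \<Omega> then (G x)\<^sup>2 else 0)" 
      by (rule iffD2[OF Lebesgue_Measure.integrable_restrict_UNIV[OF \<Omega>l] G2])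
    moreover have "(\<lambda>x. if x \<in> \<Omega> then (G x)\<^sup>2 else 0) = (\<lambda>x. (G0 x)\<^sup>2)" by (auto simp: G0_def)
    ultimately show ?thesis by (simp only:)
  qed
  then have "integrable lebesgue (\<lambda>x. (G1 x)\<^sup>2)"
  proof (rule iffD1[OF integrable_cong_AE, rotated -1])
    show "(\<lambda>x. (G0 x)\<^sup>2) \<in> borel_measurable lebesgue" "(\<lambda>x. (G1 x)\<^sup>2) \<in> borel_measurable lebesgue"
      using G0m measurable_completion[OF G1] by (auto intro: borel_measurable_power)
    show "AE x in lebesgue. (G0 x)\<^sup>2 = (G1 x)\<^sup>2" using ael by eventually_elim simp
  qed
  then have G12: "integrable lborel (\<lambda>x. (G1 x)\<^sup>2)" by (subst (asm) integrable_completion) auto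
  \<comment> \<open>The dominating function: \<open>|G1| \<le> G1^2 + 1\<close>, where the constant
    is needed on a bounded box only.\<close>
  have ii: "integrable lborel (\<lambda>x. (G1 x)\<^sup>2 + indicator (cbox e f) x)" for e f
    by (intro Bochner_Integration.integrable_add G12 integrable_real_indicator) (use emeasure_bounded_finite[OF bounded_cbox] in auto)
  have zb: "(\<integral>x. G1 x * indicator (box e f) x \<partial>lborel) = 0" if ef: "cbox e f \<subseteq> \<Omega>" for e f
  proof -
    have 0: "(\<integral>x. G1 x * box_bump e f n x \<partial>lborel) = 0" for n
    proof -
      have m: "box_bump e f n \<in> borel_measurable borel"
        using C1_continuous[OF smooth_C1[OF smooth_box_bump]] by (rule borel_measurable_continuous_onI)
      have "(\<integral>x. G1 x * box_bump e f n x \<partial>lborel) = (\<integral>x. G1 x * box_bump e f n x \<partial>lebesgue)"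
        using m by (intro integral_completion[symmetric]) auto
      also have "\<dots> = (\<integral>x. G0 x * box_bump e f n x \<partial>lebesgue)"
        using ael m G1 \<open>G0 \<in> borel_measurable lebesgue\<close> by (intro integral_cong_AE) (auto intro!: borel_measurable_times intro: measurable_completion)
      also have "\<dots> = (\<integral>x. indicator \<Omega> x *\<^sub>R (G x * box_bump e f n x) \<partial>lebesgue)"
        by (intro Bochner_Integration.integral_cong) (auto simp: G0_def)
      also have "\<dots> = (\<integral>x. G x * box_bump e f n x \<partial>lebesgue_on \<Omega>)"
        using \<Omega>l by (intro integral_restrict_space[symmetric]) auto
      also have "\<dots> = 0" by (rule z[OF box_bump_test_function[OF ef]])
      finally show ?thesis .
    qed
    have "(\<lambda>n. \<integral>x. G1 x * box_bump e f n x \<partial>lborel) \<longlonglongrightarrow> (\<integral>x. G1 x * indicator (box e f) x \<partial>lborel)"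
    proof (rule integral_dominated_convergence)
      show "integrable lborel (\<lambda>x. (G1 x)\<^sup>2 + indicator (cbox e f) x)" by (rule ii)
      show "AE x in lborel. (\<lambda>n. G1 x * box_bump e f n x) \<longlonglongrightarrow> G1 x * indicator (box e f) x"
        by (intro AE_I2 tendsto_intros box_bump_tendsto)
      show "AE x in lborel. norm (G1 x * box_bump e f n x) \<le> (G1 x)\<^sup>2 + indicator (cbox e f) x" for n
      proof (intro AE_I2)
        fix x
        show "norm (G1 x * box_bump e f n x) \<le> (G1 x)\<^sup>2 + indicator (cbox e f) x"
        proof (cases "x \<in> box e f")
          case True
          have "\<bar>G1 x\<bar> * \<bar>box_bump e f n x\<bar> \<le> \<bar>G1 x\<bar> * 1" using box_bump_bounds[of e f n x] by (intro mult_left_mono) auto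
          also have "\<dots> \<le> (G1 x)\<^sup>2 + 1"
            using zero_le_power2[of "\<bar>G1 x\<bar> - 1"] by (simp add: power2_eq_square algebra_simps)
          finally show ?thesis using True box_subset_cbox[of e f] by (auto simp: abs_mult)
        next
          case False
          then have "box_bump e f n x = 0" using box_bump_eq_0 by blast
          then show ?thesis by simp
        qed
      qed
      show "(\<lambda>x. G1 x * box_bump e f n x) \<in> borel_measurable lborel" for n
        using borel_measurable_continuous_onI[OF C1_continuous[OF smooth_C1[OF smooth_box_bump]]] by measurable
    qed measurable
    then show ?thesis unfolding 0 using LIMSEQ_const_iff by metis
  qed
  have boxAE: "AE x in lborel. x \<in> box a b \<longrightarrow> G1 x = 0" if ab: "cbox a b \<subseteq> \<Omega>" for a b
  proof -
    define F where "F = (\<lambda>x. indicator (box a b) x * G1 x)"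
    have iF: "integrable lborel F"
    proof (rule Bochner_Integration.integrable_bound)
      show "integrable lborel (\<lambda>x. (G1 x)\<^sup>2 + indicator (cbox a b) x)" by (rule ii)
      show "F \<in> borel_measurable lborel" unfolding F_def by measurable
      show "AE x in lborel. norm (F x) \<le> norm ((G1 x)\<^sup>2 + indicator (cbox a b) x)"
      proof (intro AE_I2)
        fix x
        have "\<bar>G1 x\<bar> \<le> (G1 x)\<^sup>2 + 1" using zero_le_power2[of "\<bar>G1 x\<bar> - 1"] by (simp add: power2_eq_square algebra_simps)
        then show "norm (F x) \<le> norm ((G1 x)\<^sup>2 + indicator (cbox a b) x)"
          using box_subset_cbox[of a b] by (auto simp: F_def indicator_def)
      qed
    qed
    have "AE x in lborel. F x = 0"
    proof (rule AE_zero_if_box_integrals_zero[OF iF])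
      fix c d :: plane
      define e f :: plane where "e = vector [max (a $ 1) (c $ 1), max (a $ 2) (c $ 2)]" and "f = vector [min (b $ 1) (d $ 1), min (b $ 2) (d $ 2)]"
      have "box a b \<inter> box c d = box e f" "cbox e f \<subseteq> cbox a b" unfolding e_def f_def by (rule box_Int_box_plane)+
      then have "indicator (box c d) x *\<^sub>R F x = G1 x * indicator (box e f) x" for x by (auto simp: F_def indicator_def)
      then show "set_lebesgue_integral lborel (box c d) F = 0"
        unfolding set_lebesgue_integral_def using zb[of e f] \<open>cbox e f \<subseteq> cbox a b\<close> ab by simp
    next
      show "F x = 0" if "x \<notin> box a b" for x using that by (simp add: F_def)
    qed
    then show ?thesis by (rule AE_mp) (auto simp: F_def indicator_def)
  qed
  define \<B> where "\<B> = {box a b |a b. cbox a b \<subseteq> \<Omega>}"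
  \<comment> \<open>Every box brings its own null set, and only countably many of these may be
    united.\<close>
  have "\<exists>\<B>'\<subseteq>\<B>. countable \<B>' \<and> \<Union>\<B>' = \<Union>\<B>" by (rule Lindelof[of \<B>]) (auto simp: \<B>_def open_box)
  then obtain \<B>' where B': "\<B>' \<subseteq> \<B>" "countable \<B>'" "\<Union>\<B>' = \<Union>\<B>" by blast
  have cov: "\<Omega> \<subseteq> \<Union>\<B>"
  proof
    fix x assume "x \<in> \<Omega>"
    then obtain a b where "x \<in> box a b" "cbox a b \<subseteq> \<Omega>"
      using open_contains_cbox[OF \<Omega>, of x] by metis
    then show "x \<in> \<Union>\<B>" unfolding \<B>_def by blast
  qed
  have "AE x in lborel. \<forall>B\<in>\<B>'. x \<in> B \<longrightarrow> G1 x = 0"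
    unfolding AE_ball_countable[OF B'(2)] using B'(1) boxAE unfolding \<B>_def by blast
  with ae have "AE x in lborel. x \<in> \<Omega> \<longrightarrow> G x = 0"
  proof eventually_elim
    case (elim x)
    then show ?case using cov B'(3) by (auto simp: G0_def)
  qed
  then have "AE x in lebesgue. x \<in> \<Omega> \<longrightarrow> G x = 0" by (rule AE_completion)
  then show ?thesis using \<Omega>l by (subst AE_restrict_space_iff) auto
qed

subsection \<open>Square integrable functions\<close>

lemma L2_measurable: "u \<in> L2 \<Omega> \<Longrightarrow> u \<in> borel_measurable (lebesgue_on \<Omega>)"
  by (simp add: L2_def)

lemma L2_integrable: "u \<in> L2 \<Omega> \<Longrightarrow> integrable (lebesgue_on \<Omega>) (\<lambda>x. (norm (u x))\<^sup>2)"
  by (simp add: L2_def)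

lemma L2_mult_integrable:
  assumes "u \<in> L2 \<Omega>" "v \<in> L2 \<Omega>" shows "integrable (lebesgue_on \<Omega>) (\<lambda>x. norm (u x) * norm (v x))"
proof (rule Bochner_Integration.integrable_bound)
  show "integrable (lebesgue_on \<Omega>) (\<lambda>x. (norm (u x))\<^sup>2 + (norm (v x))\<^sup>2)" using assms by (simp add: L2_integrable)
  show "(\<lambda>x. norm (u x) * norm (v x)) \<in> borel_measurable (lebesgue_on \<Omega>)"
    using L2_measurable[OF assms(1)] L2_measurable[OF assms(2)] by measurable
  show "AE x in lebesgue_on \<Omega>. norm (norm (u x) * norm (v x)) \<le> norm ((norm (u x))\<^sup>2 + (norm (v x))\<^sup>2)"
  proof (rule AE_I2)
    fix x
    have "norm (u x) * norm (v x) \<le> (norm (u x))\<^sup>2 + (norm (v x))\<^sup>2"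
      using sum_squares_bound[of "norm (u x)" "norm (v x)"] mult_nonneg_nonneg[of "norm (u x)" "norm (v x)"]
      unfolding mult.assoc by (smt (verit) norm_ge_zero)
    then show "norm (norm (u x) * norm (v x)) \<le> norm ((norm (u x))\<^sup>2 + (norm (v x))\<^sup>2)" by simp
  qed
qed

lemma L2_norm_power2: "(L2_norm \<Omega> u)\<^sup>2 = (\<integral>x. (norm (u x))\<^sup>2 \<partial>lebesgue_on \<Omega>)"
  by (simp add: L2_norm_def)

lemma L2_norm_nonneg [simp]: "0 \<le> L2_norm \<Omega> u"
  by (simp add: L2_norm_def)

lemma L2_cauchy_schwarz:
  assumes "u \<in> L2 \<Omega>" "v \<in> L2 \<Omega>"
  shows "(\<integral>x. norm (u x) * norm (v x) \<partial>lebesgue_on \<Omega>) \<le> L2_norm \<Omega> u * L2_norm \<Omega> v"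
proof (rule power2_le_imp_le)
  note m = L2_measurable[OF assms(1)] L2_measurable[OF assms(2)]
  let ?I = "\<integral>x. norm (u x) * norm (v x) \<partial>lebesgue_on \<Omega>"
  have "ennreal (?I\<^sup>2) = (ennreal ?I)\<^sup>2" by (simp add: ennreal_power integral_nonneg_AE)
  also have "ennreal ?I = (\<integral>\<^sup>+x. ennreal (norm (u x)) * ennreal (norm (v x)) \<partial>lebesgue_on \<Omega>)"
    by (subst nn_integral_eq_integral[OF L2_mult_integrable[OF assms], symmetric]) (auto simp: ennreal_mult)
  also have "\<dots>\<^sup>2 \<le> (\<integral>\<^sup>+x. (ennreal (norm (u x)))\<^sup>2 \<partial>lebesgue_on \<Omega>) * (\<integral>\<^sup>+x. (ennreal (norm (v x)))\<^sup>2 \<partial>lebesgue_on \<Omega>)"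
    by (rule Cauchy_Schwarz_nn_integral) (use m in measurable)
  also have "\<dots> = ennreal ((L2_norm \<Omega> u)\<^sup>2) * ennreal ((L2_norm \<Omega> v)\<^sup>2)"
    unfolding L2_norm_power2 by (simp add: ennreal_power nn_integral_eq_integral L2_integrable assms)
  also have "\<dots> = ennreal ((L2_norm \<Omega> u * L2_norm \<Omega> v)\<^sup>2)" by (simp add: ennreal_mult power_mult_distrib)
  finally show "?I\<^sup>2 \<le> (L2_norm \<Omega> u * L2_norm \<Omega> v)\<^sup>2" by simp
qed simp

lemma L2_cauchy_schwarz_inner:
  assumes "u \<in> L2 \<Omega>" "v \<in> L2 \<Omega>"
  shows "integrable (lebesgue_on \<Omega>) (\<lambda>x. u x \<bullet> v x)" "\<bar>\<integral>x. u x \<bullet> v x \<partial>lebesgue_on \<Omega>\<bar> \<le> L2_norm \<Omega> u * L2_norm \<Omega> v"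
proof -
  show i: "integrable (lebesgue_on \<Omega>) (\<lambda>x. u x \<bullet> v x)"
    by (rule Bochner_Integration.integrable_bound[OF L2_mult_integrable[OF assms]])
      (use L2_measurable[OF assms(1)] L2_measurable[OF assms(2)] Cauchy_Schwarz_ineq2 in auto)
  have "\<bar>\<integral>x. u x \<bullet> v x \<partial>lebesgue_on \<Omega>\<bar> \<le> (\<integral>x. \<bar>u x \<bullet> v x\<bar> \<partial>lebesgue_on \<Omega>)"
    by (rule integral_abs_bound)
  also have "\<dots> \<le> (\<integral>x. norm (u x) * norm (v x) \<partial>lebesgue_on \<Omega>)"
    by (intro integral_mono integrable_abs i L2_mult_integrable assms Cauchy_Schwarz_ineq2)
  also have "\<dots> \<le> L2_norm \<Omega> u * L2_norm \<Omega> v" by (rule L2_cauchy_schwarz[OF assms])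
  finally show "\<bar>\<integral>x. u x \<bullet> v x \<partial>lebesgue_on \<Omega>\<bar> \<le> L2_norm \<Omega> u * L2_norm \<Omega> v" .
qed

lemma L2_add:
  assumes "u \<in> L2 \<Omega>" "v \<in> L2 \<Omega>" shows "(\<lambda>x. u x + v x) \<in> L2 \<Omega>"
proof -
  have "integrable (lebesgue_on \<Omega>) (\<lambda>x. (norm (u x))\<^sup>2 + 2 * (u x \<bullet> v x) + (norm (v x))\<^sup>2)"
    using L2_cauchy_schwarz_inner(1)[OF assms] L2_integrable assms by (intro Bochner_Integration.integrable_add) auto
  then show ?thesis
    using L2_measurable[OF assms(1)] L2_measurable[OF assms(2)]
    by (simp add: L2_def power2_norm_eq_inner inner_add_left inner_add_right inner_commute algebra_simps)
qed

lemma L2_scaleR: "u \<in> L2 \<Omega> \<Longrightarrow> (\<lambda>x. c *\<^sub>R u x) \<in> L2 \<Omega>"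
  by (auto simp: L2_def power_mult_distrib intro: borel_measurable_scaleR)

lemma L2_norm_scaleR: "L2_norm \<Omega> (\<lambda>x. c *\<^sub>R u x) = \<bar>c\<bar> * L2_norm \<Omega> u"
  by (simp add: L2_norm_def power_mult_distrib real_sqrt_mult)

lemma L2_diff: "u \<in> L2 \<Omega> \<Longrightarrow> v \<in> L2 \<Omega> \<Longrightarrow> (\<lambda>x. u x - v x) \<in> L2 \<Omega>"
  using L2_add[OF _ L2_scaleR[of v \<Omega> "-1"], of u] by simp

lemma L2_norm_add_power2:
  assumes "u \<in> L2 \<Omega>" "v \<in> L2 \<Omega>"
  shows "(L2_norm \<Omega> (\<lambda>x. u x + v x))\<^sup>2 = (L2_norm \<Omega> u)\<^sup>2 + 2 * (\<integral>x. u x \<bullet> v x \<partial>lebesgue_on \<Omega>) + (L2_norm \<Omega> v)\<^sup>2"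
proof -
  have "(norm (u x + v x))\<^sup>2 = (norm (u x))\<^sup>2 + 2 * (u x \<bullet> v x) + (norm (v x))\<^sup>2" for x
    by (simp add: power2_norm_eq_inner inner_add_left inner_add_right inner_commute)
  then show ?thesis
    unfolding L2_norm_power2
    using L2_cauchy_schwarz_inner(1)[OF assms] L2_integrable[OF assms(1)] L2_integrable[OF assms(2)] by simp
qed

lemma L2_triangle:
  assumes "u \<in> L2 \<Omega>" "v \<in> L2 \<Omega>"
  shows "L2_norm \<Omega> (\<lambda>x. u x + v x) \<le> L2_norm \<Omega> u + L2_norm \<Omega> v"
proof (rule power2_le_imp_le)
  show "(L2_norm \<Omega> (\<lambda>x. u x + v x))\<^sup>2 \<le> (L2_norm \<Omega> u + L2_norm \<Omega> v)\<^sup>2"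
    unfolding L2_norm_add_power2[OF assms] power2_sum using L2_cauchy_schwarz_inner(2)[OF assms] by linarith
qed simp

lemma L2_triangle_diff:
  assumes "u \<in> L2 \<Omega>" "v \<in> L2 \<Omega>"
  shows "L2_norm \<Omega> (\<lambda>x. u x - v x) \<le> L2_norm \<Omega> u + L2_norm \<Omega> v"
  using L2_triangle[OF assms(1) L2_scaleR[OF assms(2), of "-1"]] L2_norm_scaleR[of \<Omega> "-1" v] by simp

lemma L2_norm_cong_AE:
  assumes "AE x in lebesgue_on \<Omega>. u x = v x" "u \<in> borel_measurable (lebesgue_on \<Omega>)" "v \<in> borel_measurable (lebesgue_on \<Omega>)"
  shows "L2_norm \<Omega> u = L2_norm \<Omega> v"
  unfolding L2_norm_def using assms by (intro arg_cong[of _ _ sqrt] integral_cong_AE) auto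

lemma L2_norm_eq_0_AE:
  assumes "u \<in> L2 \<Omega>" "L2_norm \<Omega> u = 0" shows "AE x in lebesgue_on \<Omega>. u x = 0"
proof -
  have "(\<integral>x. (norm (u x))\<^sup>2 \<partial>lebesgue_on \<Omega>) = 0" using assms(2) by (simp add: L2_norm_def)
  then have "AE x in lebesgue_on \<Omega>. (norm (u x))\<^sup>2 = 0"
    by (subst (asm) integral_nonneg_eq_0_iff_AE) (use L2_integrable[OF assms(1)] in auto)
  then show ?thesis by simp
qed

text \<open>Along a subsequence with \<open>L2_norm\<close> increments at most \<open>(1/4)\<^sup>k\<close> the series of \<open>4\<^sup>k\<close> times the squared
  increments converges almost everywhere, so the increments are summable pointwise.\<close>

lemma L2_complete:
  fixes u :: "nat \<Rightarrow> plane \<Rightarrow> 'b::euclidean_space"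
  assumes u: "\<And>n. u n \<in> L2 \<Omega>"
    and cauchy: "\<And>e. e > 0 \<Longrightarrow> \<exists>N. \<forall>m\<ge>N. \<forall>n\<ge>N. L2_norm \<Omega> (\<lambda>x. u m x - u n x) < e"
  obtains v where "v \<in> L2 \<Omega>" "(\<lambda>n. L2_norm \<Omega> (\<lambda>x. u n x - v x)) \<longlonglongrightarrow> 0"
proof -
  let ?M = "lebesgue_on \<Omega>"
  have "\<forall>k. \<exists>N. \<forall>m\<ge>N. \<forall>n\<ge>N. L2_norm \<Omega> (\<lambda>x. u m x - u n x) < (1/4)^k" using cauchy by simp
  then obtain R where R: "\<And>k m n. m \<ge> R k \<Longrightarrow> n \<ge> R k \<Longrightarrow> L2_norm \<Omega> (\<lambda>x. u m x - u n x) < (1/4)^k" by metis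
  \<comment> \<open>The thresholds \<open>R k\<close> need not be monotone; their partial sums
    dominate all earlier ones.\<close>
  define r where "r = (\<lambda>k. \<Sum>i\<le>k. R i)"
  have rR: "r j \<ge> R k" if "k \<le> j" for k j unfolding r_def using that by (intro member_le_sum) auto
  define w where "w = (\<lambda>k. u (r k))"
  have m [measurable]: "u n \<in> borel_measurable ?M" for n using L2_measurable[OF u] .
  have wm [measurable]: "w n \<in> borel_measurable ?M" for n unfolding w_def by (rule m)
  have nn: "(\<integral>\<^sup>+x. ennreal ((norm (f x))\<^sup>2) \<partial>?M) = ennreal ((L2_norm \<Omega> f)\<^sup>2)" if "f \<in> L2 \<Omega>" for f :: "plane \<Rightarrow> 'b"
    unfolding L2_norm_power2 using L2_integrable[OF that] by (intro nn_integral_eq_integral) auto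
  have small: "(\<integral>\<^sup>+x. ennreal ((norm (u n x - w j x))\<^sup>2) \<partial>?M) \<le> ennreal (((1/4)^k)\<^sup>2)" if "n \<ge> R k" "k \<le> j" for n j k
  proof -
    have "L2_norm \<Omega> (\<lambda>x. u n x - w j x) \<le> (1/4)^k" unfolding w_def using R[OF that(1) rR[OF that(2)]] by simp
    then show ?thesis unfolding w_def using L2_diff[OF u u] by (subst nn) (auto intro!: ennreal_leI power_mono)
  qed
  have "(\<integral>\<^sup>+x. (\<Sum>k. ennreal (4^k * (norm (w (Suc k) x - w k x))\<^sup>2)) \<partial>?M) = (\<Sum>k. \<integral>\<^sup>+x. ennreal (4^k * (norm (w (Suc k) x - w k x))\<^sup>2) \<partial>?M)"
    by (rule nn_integral_suminf) measurable
  also have "\<dots> \<le> (\<Sum>k. ennreal ((1/4)^k))"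
  proof (intro suminf_le summableI)
    fix k
    have "(\<integral>\<^sup>+x. ennreal (4^k * (norm (w (Suc k) x - w k x))\<^sup>2) \<partial>?M) = ennreal (4^k) * (\<integral>\<^sup>+x. ennreal ((norm (u (r (Suc k)) x - w k x))\<^sup>2) \<partial>?M)"
      unfolding w_def by (subst nn_integral_cmult[symmetric]) (auto simp: ennreal_mult')
    also have "\<dots> \<le> ennreal (4^k) * ennreal (((1/4)^k)\<^sup>2)"
      by (intro mult_left_mono small rR) auto
    also have "\<dots> = ennreal (4^k * ((1/4)^k)\<^sup>2)" by (simp add: ennreal_mult')
    also have "(4::real)^k * ((1/4)^k)\<^sup>2 = (1/4)^k" by (simp add: power2_eq_square power_one_over)
    finally show "(\<integral>\<^sup>+x. ennreal (4^k * (norm (w (Suc k) x - w k x))\<^sup>2) \<partial>?M) \<le> ennreal ((1/4)^k)" .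
  qed
  also have "\<dots> = ennreal (\<Sum>k. (1/4::real)^k)" by (rule suminf_ennreal2) (auto simp: summable_geometric)
  finally have fin: "(\<integral>\<^sup>+x. (\<Sum>k. ennreal (4^k * (norm (w (Suc k) x - w k x))\<^sup>2)) \<partial>?M) < \<infinity>"
    by (rule order.strict_trans1) simp
  have "AE x in ?M. (\<Sum>k. ennreal (4^k * (norm (w (Suc k) x - w k x))\<^sup>2)) \<noteq> \<infinity>"
    by (rule nn_integral_noteq_infinite) (use fin in auto)
  then have conv: "AE x in ?M. convergent (\<lambda>k. w k x)"
  proof eventually_elim
    case (elim x)
    define S where "S = (\<Sum>k. ennreal (4^k * (norm (w (Suc k) x - w k x))\<^sup>2))"
    have "S < top" using elim by (simp only: S_def less_top infinity_ennreal_def)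
    moreover define s where "s = enn2real S"
    ultimately have s: "S = ennreal s" "s \<ge> 0" by simp_all
    \<comment> \<open>A single term of the convergent series is at most its sum s; the square root
      turns the factor \<open>4^k\<close> into the geometric rate \<open>(1/2)^k\<close>.\<close>
    have b: "norm (w (Suc k) x - w k x) \<le> sqrt s * (1/2)^k" for k
    proof -
      have "(\<Sum>j\<in>{k}. ennreal (4^j * (norm (w (Suc j) x - w j x))\<^sup>2)) \<le> S" unfolding S_def by (rule sum_le_suminf) auto
      then have "4^k * (norm (w (Suc k) x - w k x))\<^sup>2 \<le> s" using s by simp
      moreover have "(4::real)^k = (2^k)\<^sup>2" by (simp add: power2_eq_square flip: power_mult_distrib)
      ultimately have "(2^k * norm (w (Suc k) x - w k x))\<^sup>2 \<le> s" by (simp only: power_mult_distrib)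
      then have "2^k * norm (w (Suc k) x - w k x) \<le> sqrt s" by (rule real_le_rsqrt)
      then show ?thesis by (simp add: power_one_over field_simps)
    qed
    have "summable (\<lambda>k. norm (w (Suc k) x - w k x))"
      by (rule summable_comparison_test'[of "\<lambda>k. sqrt s * (1/2)^k" 0]) (use b in \<open>auto intro!: summable_mult summable_geometric\<close>)
    then have "summable (\<lambda>k. w (Suc k) x - w k x)" by (rule summable_norm_cancel)
    then have "convergent (\<lambda>n. \<Sum>k<n. w (Suc k) x - w k x)" by (simp add: summable_iff_convergent)
    then have "convergent (\<lambda>n. w n x - w 0 x)" by (simp only: sum_lessThan_telescope[of "\<lambda>k. w k x"])
    then show ?case using convergent_add[OF _ convergent_const[of "w 0 x"], of "\<lambda>n. w n x - w 0 x"] by simp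
  qed
  define v where "v = (\<lambda>x. lim (\<lambda>k. w k x))"
  have vm [measurable]: "v \<in> borel_measurable ?M" unfolding v_def by measurable
  have lim: "AE x in ?M. (\<lambda>k. w k x) \<longlonglongrightarrow> v x" using conv unfolding v_def by eventually_elim (simp add: convergent_LIMSEQ_iff)
  \<comment> \<open>Fatou's lemma carries the Cauchy estimate to the pointwise limit of the
    subsequence. It yields convergence of the full sequence and, through
    \<open>v = u n - (u n - v)\<close>, square integrability of the limit.\<close>
  have fatou: "(\<integral>\<^sup>+x. ennreal ((norm (u n x - v x))\<^sup>2) \<partial>?M) \<le> ennreal (((1/4)^k)\<^sup>2)" if n: "n \<ge> R k" for n k
  proof -
    have "(\<integral>\<^sup>+x. ennreal ((norm (u n x - v x))\<^sup>2) \<partial>?M) = (\<integral>\<^sup>+x. liminf (\<lambda>j. ennreal ((norm (u n x - w j x))\<^sup>2)) \<partial>?M)"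
    proof (rule nn_integral_cong_AE)
      show "AE x in ?M. ennreal ((norm (u n x - v x))\<^sup>2) = liminf (\<lambda>j. ennreal ((norm (u n x - w j x))\<^sup>2))"
        using lim
      proof eventually_elim
        case (elim x)
        have "(\<lambda>j. ennreal ((norm (u n x - w j x))\<^sup>2)) \<longlonglongrightarrow> ennreal ((norm (u n x - v x))\<^sup>2)"
          by (intro tendsto_ennrealI tendsto_intros elim)
        then show ?case using lim_imp_Liminf[OF sequentially_bot] by metis
      qed
    qed
    also have "\<dots> \<le> liminf (\<lambda>j. \<integral>\<^sup>+x. ennreal ((norm (u n x - w j x))\<^sup>2) \<partial>?M)"
      by (rule nn_integral_liminf) measurable
    also have "\<dots> \<le> liminf (\<lambda>j. ennreal (((1/4)^k)\<^sup>2))"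
      by (rule Liminf_mono) (use small[OF n] in \<open>auto simp: eventually_sequentially intro: exI[of _ k]\<close>)
    also have "\<dots> = ennreal (((1/4)^k)\<^sup>2)" by (rule Liminf_const) simp
    finally show ?thesis .
  qed
  have uv: "(\<lambda>x. u n x - v x) \<in> L2 \<Omega>" if "n \<ge> R k" for n k
    unfolding L2_def using fatou[OF that] by (auto simp: integrable_iff_bounded intro: order.strict_trans1)
  have v: "v \<in> L2 \<Omega>" using L2_diff[OF u uv[OF order_refl], of "R 0" 0] by simp
  moreover have "(\<lambda>n. L2_norm \<Omega> (\<lambda>x. u n x - v x)) \<longlonglongrightarrow> 0"
  proof (rule LIMSEQ_I)
    fix e :: real assume "e > 0"
    then obtain k where k: "(1/4)^k < e" using real_arch_pow_inv[of e "1/4"] by auto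
    have "L2_norm \<Omega> (\<lambda>x. u n x - v x) < e" if n: "n \<ge> R k" for n
    proof -
      have "ennreal ((L2_norm \<Omega> (\<lambda>x. u n x - v x))\<^sup>2) \<le> ennreal (((1/4)^k)\<^sup>2)" using fatou[OF n] nn[OF uv[OF n]] by simp
      then have "(L2_norm \<Omega> (\<lambda>x. u n x - v x))\<^sup>2 \<le> ((1/4)^k)\<^sup>2" by simp
      then have "L2_norm \<Omega> (\<lambda>x. u n x - v x) \<le> (1/4)^k" by (rule power2_le_imp_le) simp
      then show ?thesis using k by simp
    qed
    then show "\<exists>N. \<forall>n\<ge>N. norm (L2_norm \<Omega> (\<lambda>x. u n x - v x) - 0) < e" by auto
  qed
  ultimately show ?thesis by (rule that)
qed

subsection \<open>Sobolev functions\<close>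

lemma test_function_smooth: "\<phi> \<in> test_functions \<Omega> \<Longrightarrow> smooth \<phi>"
  by (simp add: test_functions_def)

lemma test_function_supported:
  assumes "\<phi> \<in> test_functions \<Omega>" shows "supported_in \<Omega> \<phi> (gradient \<phi>)"
proof -
  have "bounded {x. \<phi> x \<noteq> 0}"
    using assms compact_imp_bounded bounded_subset closure_subset unfolding test_functions_def by blast
  then show ?thesis
    using assms smooth_C1[OF test_function_smooth[OF assms]] by (simp add: supported_in_def C1c_def test_functions_def)
qed

lemma test_functions_add:
  assumes "\<phi> \<in> test_functions \<Omega>" "\<psi> \<in> test_functions \<Omega>" shows "(\<lambda>x. \<phi> x + \<psi> x) \<in> test_functions \<Omega>"
proof -
  have "closure {x. \<phi> x + \<psi> x \<noteq> 0} \<subseteq> closure ({x. \<phi> x \<noteq> 0} \<union> {x. \<psi> x \<noteq> 0})" by (rule closure_mono) auto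
  then have s: "closure {x. \<phi> x + \<psi> x \<noteq> 0} \<subseteq> closure {x. \<phi> x \<noteq> 0} \<union> closure {x. \<psi> x \<noteq> 0}" by simp
  have "bounded ({x. \<phi> x \<noteq> 0} \<union> {x. \<psi> x \<noteq> 0})" using assms by (simp add: test_functions_def)
  then have "bounded {x. \<phi> x + \<psi> x \<noteq> 0}" by (rule bounded_subset) auto
  then show ?thesis using s assms smooth_add by (auto simp: test_functions_def)
qed

lemma test_functions_cmult:
  assumes "\<phi> \<in> test_functions \<Omega>" shows "(\<lambda>x. c * \<phi> x) \<in> test_functions \<Omega>"
proof -
  have s: "closure {x. c * \<phi> x \<noteq> 0} \<subseteq> closure {x. \<phi> x \<noteq> 0}" by (rule closure_mono) auto
  have "bounded {x. \<phi> x \<noteq> 0}" using assms by (simp add: test_functions_def)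
  then have "bounded {x. c * \<phi> x \<noteq> 0}" by (rule bounded_subset) auto
  then show ?thesis using s assms smooth_mult[OF smooth_const] by (auto simp: test_functions_def)
qed

section \<open>Weak gradients and Sobolev functions on a bounded open set\<close>

locale bounded_open =
  fixes \<Omega> :: "plane set"
  assumes open_domain: "open \<Omega>" and bounded_domain: "bounded \<Omega>"
begin

lemma domain_borel: "\<Omega> \<in> sets borel" using open_domain by simp

lemma domain_lebesgue: "\<Omega> \<in> sets lebesgue" using domain_borel by (simp add: sets_completionI_sets)

lemma integral_on_domain:
  fixes f :: "plane \<Rightarrow> real"
  assumes "f \<in> borel_measurable borel"
  shows "(\<integral>x. f x \<partial>lebesgue_on \<Omega>) = (\<integral>x. indicator \<Omega> x * f x \<partial>lborel)"
proof -
  have m: "(\<lambda>x. indicator \<Omega> x * f x) \<in> borel_measurable lborel"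
  proof -
    have "(\<lambda>x. indicator \<Omega> x * f x) \<in> borel_measurable borel"
      by (intro borel_measurable_times borel_measurable_indicator assms domain_borel)
    then show ?thesis by simp
  qed
  have "(\<integral>x. f x \<partial>lebesgue_on \<Omega>) = (\<integral>x. indicator \<Omega> x *\<^sub>R f x \<partial>lebesgue)"
    using domain_lebesgue by (intro integral_restrict_space) simp
  also have "\<dots> = (\<integral>x. indicator \<Omega> x * f x \<partial>lborel)" using integral_completion[OF m] by simp
  finally show ?thesis .
qed

lemma nn_integral_on_domain:
  assumes "f \<in> borel_measurable borel"
  shows "(\<integral>\<^sup>+x. f x \<partial>lebesgue_on \<Omega>) = (\<integral>\<^sup>+x\<in>\<Omega>. f x \<partial>lborel)"
proof -
  have "(\<integral>\<^sup>+x. f x \<partial>lebesgue_on \<Omega>) = (\<integral>\<^sup>+x. f x * indicator \<Omega> x \<partial>lebesgue)"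
    using domain_lebesgue by (intro nn_integral_restrict_space) simp
  then show ?thesis by (simp add: nn_integral_completion)
qed

lemma borel_measurable_on_domain: "f \<in> borel_measurable borel \<Longrightarrow> f \<in> borel_measurable (lebesgue_on \<Omega>)"
  by (intro measurable_restrict_space1 measurable_completion) simp

lemma continuous_L2:
  fixes f :: "plane \<Rightarrow> 'b::euclidean_space"
  assumes "continuous_on UNIV f" shows "f \<in> L2 \<Omega>"
proof -
  have m: "f \<in> borel_measurable borel" using assms by (rule borel_measurable_continuous_onI)
  have "compact (f ` closure \<Omega>)" using assms bounded_domain
    by (intro compact_continuous_image) (auto intro: continuous_on_subset)
  then obtain B where B: "\<And>x. x \<in> closure \<Omega> \<Longrightarrow> norm (f x) \<le> B" using compact_imp_bounded bounded_iff by (metis image_eqI)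
  have fin: "emeasure lborel \<Omega> < \<infinity>" using bounded_domain by (rule emeasure_bounded_finite)
  have "(\<integral>\<^sup>+x. ennreal ((norm (f x))\<^sup>2) \<partial>lebesgue_on \<Omega>) = (\<integral>\<^sup>+x\<in>\<Omega>. ennreal ((norm (f x))\<^sup>2) \<partial>lborel)"
    using m by (intro nn_integral_on_domain) measurable
  also have "\<dots> \<le> (\<integral>\<^sup>+x. ennreal (B\<^sup>2) * indicator \<Omega> x \<partial>lborel)"
    using B closure_subset[of \<Omega>] by (intro nn_integral_mono) (auto simp: indicator_def intro!: ennreal_leI power_mono)
  also have "\<dots> = ennreal (B\<^sup>2) * emeasure lborel \<Omega>" using domain_borel by (simp add: nn_integral_cmult_indicator)
  also have "\<dots> < \<infinity>" using fin by (simp add: ennreal_mult_less_top)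
  finally show ?thesis using borel_measurable_on_domain[OF m] by (simp add: L2_def integrable_iff_bounded)
qed

lemma test_L2:
  assumes "\<phi> \<in> test_functions \<Omega>" shows "\<phi> \<in> L2 \<Omega>" "gradient \<phi> \<in> L2 \<Omega>" "(\<lambda>x. gradient \<phi> x $ i) \<in> L2 \<Omega>"
  using smooth_C1[OF test_function_smooth[OF assms]]
  by (auto intro!: continuous_L2 continuous_intros dest: C1_continuous C1_gradient_continuous)

lemma L2_component: "G \<in> L2 \<Omega> \<Longrightarrow> (\<lambda>x. G x $ i) \<in> L2 \<Omega>" for G :: "plane \<Rightarrow> plane"
proof -
  assume G: "G \<in> L2 \<Omega>"
  have m: "(\<lambda>x. G x $ i) \<in> borel_measurable (lebesgue_on \<Omega>)"
    by (rule borel_measurable_continuous_on[OF _ L2_measurable[OF G]]) (intro continuous_intros)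
  have "integrable (lebesgue_on \<Omega>) (\<lambda>x. (norm (G x $ i))\<^sup>2)"
  proof (rule Bochner_Integration.integrable_bound[OF L2_integrable[OF G]])
    show "AE x in lebesgue_on \<Omega>. norm ((norm (G x $ i))\<^sup>2) \<le> norm ((norm (G x))\<^sup>2)"
      using component_le_norm_cart by (intro AE_I2) (auto intro!: power_mono simp: abs_le_square_iff[symmetric])
  qed (use m in measurable)
  then show ?thesis using m by (simp add: L2_def)
qed

lemma has_weak_gradient_iff:
  "has_weak_gradient \<Omega> u G \<longleftrightarrow> u \<in> L2 \<Omega> \<and> G \<in> L2 \<Omega> \<and>
     (\<forall>\<phi>\<in>test_functions \<Omega>. \<forall>i. (\<integral>x. u x * gradient \<phi> x $ i \<partial>lebesgue_on \<Omega>) = - (\<integral>x. G x $ i * \<phi> x \<partial>lebesgue_on \<Omega>))"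
  by (simp add: has_weak_gradient_def gradient_def)

lemma weak_pairing_integrable:
  assumes "\<phi> \<in> test_functions \<Omega>" "u \<in> L2 \<Omega>" "G \<in> L2 \<Omega>"
  shows "integrable (lebesgue_on \<Omega>) (\<lambda>x. u x * gradient \<phi> x $ i)" "integrable (lebesgue_on \<Omega>) (\<lambda>x. G x $ i * \<phi> x)"
  using L2_cauchy_schwarz_inner(1)[OF assms(2) test_L2(3)[OF assms(1)], of i] L2_cauchy_schwarz_inner(1)[OF L2_component[OF assms(3)] test_L2(1)[OF assms(1)], of i]
  by simp_all

lemma has_weak_gradient_add:
  assumes "has_weak_gradient \<Omega> u G" "has_weak_gradient \<Omega> v H"
  shows "has_weak_gradient \<Omega> (\<lambda>x. u x + v x) (\<lambda>x. G x + H x)"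
  unfolding has_weak_gradient_iff
proof (intro conjI ballI allI)
  have L: "u \<in> L2 \<Omega>" "G \<in> L2 \<Omega>" "v \<in> L2 \<Omega>" "H \<in> L2 \<Omega>" using assms by (auto simp: has_weak_gradient_iff)
  show "(\<lambda>x. u x + v x) \<in> L2 \<Omega>" "(\<lambda>x. G x + H x) \<in> L2 \<Omega>" using L by (auto intro: L2_add)
  fix \<phi> i assume p: "\<phi> \<in> test_functions \<Omega>"
  show "(\<integral>x. (u x + v x) * gradient \<phi> x $ i \<partial>lebesgue_on \<Omega>) = - (\<integral>x. (G x + H x) $ i * \<phi> x \<partial>lebesgue_on \<Omega>)"
    using weak_pairing_integrable[OF p L(1,2)] weak_pairing_integrable[OF p L(3,4)] assms p by (simp add: has_weak_gradient_iff distrib_right)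
qed

lemma has_weak_gradient_cmult:
  assumes "has_weak_gradient \<Omega> u G"
  shows "has_weak_gradient \<Omega> (\<lambda>x. c * u x) (\<lambda>x. c *\<^sub>R G x)"
  using assms L2_scaleR[of u \<Omega> c] L2_scaleR[of G \<Omega> c] by (simp add: has_weak_gradient_iff mult.assoc)

lemma has_weak_gradient_diff:
  assumes "has_weak_gradient \<Omega> u G" "has_weak_gradient \<Omega> v H"
  shows "has_weak_gradient \<Omega> (\<lambda>x. u x - v x) (\<lambda>x. G x - H x)"
  using has_weak_gradient_add[OF assms(1) has_weak_gradient_cmult[OF assms(2), of "-1"]] by simp

text \<open>Integration by parts on the plane produces no boundary term, since the test function has
  compact support in \<Omega>.\<close>

lemma C1_has_weak_gradient:
  assumes v: "C1 v h" shows "has_weak_gradient \<Omega> v h"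
  unfolding has_weak_gradient_iff
proof (intro conjI ballI allI)
  show "v \<in> L2 \<Omega>" "h \<in> L2 \<Omega>" using v by (auto intro!: continuous_L2 dest: C1_continuous C1_gradient_continuous)
  fix \<phi> i assume p: "\<phi> \<in> test_functions \<Omega>"
  note s = test_function_supported[OF p]
  have c: "C1c \<phi> (gradient \<phi>)" using s by (simp add: supported_in_def)
  note cc = C1_continuous[OF v] C1_gradient_continuous[OF v] C1_continuous[OF C1c_C1[OF c]] C1_gradient_continuous[OF C1c_C1[OF c]]
  have "(\<integral>x. v x * gradient \<phi> x $ i \<partial>lebesgue_on \<Omega>) = (\<integral>x. indicator \<Omega> x * (v x * gradient \<phi> x $ i) \<partial>lborel)"
    by (intro integral_on_domain borel_measurable_continuous_onI continuous_intros cc)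
  also have "\<dots> = (\<integral>x. (gradient \<phi> x \<bullet> axis i 1) * v x \<partial>lborel)"
    using supported_in_eq_0(2)[OF s] by (intro Bochner_Integration.integral_cong) (auto simp: indicator_def inner_axis)
  also have "\<dots> = - (\<integral>x. \<phi> x * (h x \<bullet> axis i 1) \<partial>lborel)"
    using integral_by_parts[OF c v, of "axis i 1"] by simp
  also have "(\<integral>x. \<phi> x * (h x \<bullet> axis i 1) \<partial>lborel) = (\<integral>x. indicator \<Omega> x * (h x $ i * \<phi> x) \<partial>lborel)"
    using supported_in_eq_0(1)[OF s] by (intro Bochner_Integration.integral_cong) (auto simp: indicator_def inner_axis)
  also have "\<dots> = (\<integral>x. h x $ i * \<phi> x \<partial>lebesgue_on \<Omega>)"
    by (intro integral_on_domain[symmetric] borel_measurable_continuous_onI continuous_intros cc)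
  finally show "(\<integral>x. v x * gradient \<phi> x $ i \<partial>lebesgue_on \<Omega>) = - (\<integral>x. h x $ i * \<phi> x \<partial>lebesgue_on \<Omega>)" .
qed

text \<open>The difference of two weak gradients is orthogonal to all test functions in each
  component and vanishes by \<open>fundamental_lemma\<close>. Thus norms of the chosen version
  \<open>grad\<close> can be computed with any weak gradient.\<close>

lemma weak_gradient_unique:
  assumes "has_weak_gradient \<Omega> u G" "has_weak_gradient \<Omega> v H" "AE x in lebesgue_on \<Omega>. u x = v x"
  shows "AE x in lebesgue_on \<Omega>. G x = H x"
proof -
  have L: "u \<in> L2 \<Omega>" "G \<in> L2 \<Omega>" "v \<in> L2 \<Omega>" "H \<in> L2 \<Omega>" using assms by (auto simp: has_weak_gradient_iff)
  have "AE x in lebesgue_on \<Omega>. G x $ i - H x $ i = 0" for i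
  proof (rule fundamental_lemma[OF open_domain])
    have d: "(\<lambda>x. G x $ i - H x $ i) \<in> L2 \<Omega>" using L by (intro L2_diff L2_component)
    then show "(\<lambda>x. G x $ i - H x $ i) \<in> borel_measurable (lebesgue_on \<Omega>)" "integrable (lebesgue_on \<Omega>) (\<lambda>x. (G x $ i - H x $ i)\<^sup>2)"
      by (simp_all add: L2_def)
    fix \<phi> assume p: "\<phi> \<in> test_functions \<Omega>"
    have "(\<integral>x. u x * gradient \<phi> x $ i \<partial>lebesgue_on \<Omega>) = (\<integral>x. v x * gradient \<phi> x $ i \<partial>lebesgue_on \<Omega>)"
      by (rule integral_cong_AE)
        (use assms(3) borel_measurable_integrable[OF weak_pairing_integrable(1)[OF p L(1,2)]] borel_measurable_integrable[OF weak_pairing_integrable(1)[OF p L(3,4)]] in auto)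
    then have "(\<integral>x. G x $ i * \<phi> x \<partial>lebesgue_on \<Omega>) = (\<integral>x. H x $ i * \<phi> x \<partial>lebesgue_on \<Omega>)"
      using assms(1,2) p unfolding has_weak_gradient_iff by simp
    then show "(\<integral>x. (G x $ i - H x $ i) * \<phi> x \<partial>lebesgue_on \<Omega>) = 0"
      using weak_pairing_integrable(2)[OF p L(1,2)] weak_pairing_integrable(2)[OF p L(3,4)] by (simp add: left_diff_distrib)
  qed
  from this[of 1] this[of 2] show ?thesis by eventually_elim (simp add: vec_eq_iff forall_2)
qed

lemma grad_works: "u \<in> H1 \<Omega> \<Longrightarrow> has_weak_gradient \<Omega> u (grad \<Omega> u)"
  unfolding H1_def grad_def using someI_ex[of "has_weak_gradient \<Omega> u"] by simp

lemma has_weak_gradient_H1: "has_weak_gradient \<Omega> u G \<Longrightarrow> u \<in> H1 \<Omega>"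
  by (auto simp: H1_def)

lemma grad_AE: "has_weak_gradient \<Omega> u G \<Longrightarrow> AE x in lebesgue_on \<Omega>. grad \<Omega> u x = G x"
  using weak_gradient_unique[OF grad_works[OF has_weak_gradient_H1]] by auto

lemma H1_L2: "u \<in> H1 \<Omega> \<Longrightarrow> u \<in> L2 \<Omega>" "u \<in> H1 \<Omega> \<Longrightarrow> grad \<Omega> u \<in> L2 \<Omega>"
  using grad_works by (auto simp: has_weak_gradient_iff)

lemma has_weak_gradient_L2: "has_weak_gradient \<Omega> u G \<Longrightarrow> u \<in> L2 \<Omega>" "has_weak_gradient \<Omega> u G \<Longrightarrow> G \<in> L2 \<Omega>"
  by (auto simp: has_weak_gradient_iff)

lemma L2_norm_grad: "has_weak_gradient \<Omega> u G \<Longrightarrow> L2_norm \<Omega> (grad \<Omega> u) = L2_norm \<Omega> G"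
  using L2_norm_cong_AE[OF grad_AE] H1_L2(2) L2_measurable has_weak_gradient_H1 has_weak_gradient_L2 by blast

lemma H1_norm_eq: "has_weak_gradient \<Omega> u G \<Longrightarrow> H1_norm \<Omega> u = sqrt ((L2_norm \<Omega> u)\<^sup>2 + (L2_norm \<Omega> G)\<^sup>2)"
  by (simp add: H1_norm_def L2_norm_grad)

text \<open>Makes the H1 norm an L2 norm with values in a product space, from which the triangle
  inequality and homogeneity are inherited.\<close>

lemma Pair_L2:
  fixes u :: "plane \<Rightarrow> real" and G :: "plane \<Rightarrow> plane"
  assumes "u \<in> L2 \<Omega>" "G \<in> L2 \<Omega>"
  shows "(\<lambda>x. (u x, G x)) \<in> L2 \<Omega>" "L2_norm \<Omega> (\<lambda>x. (u x, G x)) = sqrt ((L2_norm \<Omega> u)\<^sup>2 + (L2_norm \<Omega> G)\<^sup>2)"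
proof -
  have n: "(norm (a, b))\<^sup>2 = (norm a)\<^sup>2 + (norm b)\<^sup>2" for a :: real and b :: plane by (simp add: norm_Pair)
  show "(\<lambda>x. (u x, G x)) \<in> L2 \<Omega>"
    unfolding L2_def n mem_Collect_eq
    using L2_measurable[OF assms(1)] L2_measurable[OF assms(2)] L2_integrable[OF assms(1)] L2_integrable[OF assms(2)]
    by (auto intro: borel_measurable_Pair)
  show "L2_norm \<Omega> (\<lambda>x. (u x, G x)) = sqrt ((L2_norm \<Omega> u)\<^sup>2 + (L2_norm \<Omega> G)\<^sup>2)"
    unfolding L2_norm_power2 unfolding L2_norm_def n using L2_integrable[OF assms(1)] L2_integrable[OF assms(2)] by simp
qed

lemma H1_norm_eq_Pair: "has_weak_gradient \<Omega> u G \<Longrightarrow> H1_norm \<Omega> u = L2_norm \<Omega> (\<lambda>x. (u x, G x))"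
  using H1_norm_eq Pair_L2(2) has_weak_gradient_L2 by metis

end

lemma L2_inner_tendsto:
  assumes a: "\<And>n. a n \<in> L2 \<Omega>" "a' \<in> L2 \<Omega>" and b: "b \<in> L2 \<Omega>" and lim: "(\<lambda>n. L2_norm \<Omega> (\<lambda>x. a n x - a' x)) \<longlonglongrightarrow> 0"
  shows "(\<lambda>n. \<integral>x. a n x \<bullet> b x \<partial>lebesgue_on \<Omega>) \<longlonglongrightarrow> (\<integral>x. a' x \<bullet> b x \<partial>lebesgue_on \<Omega>)"
proof (rule Lim_transform_bound[THEN Lim_null[THEN iffD2]], rule always_eventually, rule allI)
  have "(\<lambda>n. L2_norm \<Omega> (\<lambda>x. a n x - a' x) * L2_norm \<Omega> b) \<longlonglongrightarrow> 0 * L2_norm \<Omega> b" by (intro tendsto_intros lim)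
  then show "(\<lambda>n. L2_norm \<Omega> (\<lambda>x. a n x - a' x) * L2_norm \<Omega> b) \<longlonglongrightarrow> 0" by simp
  fix n
  have "(\<integral>x. a n x \<bullet> b x \<partial>lebesgue_on \<Omega>) - (\<integral>x. a' x \<bullet> b x \<partial>lebesgue_on \<Omega>) = (\<integral>x. (a n x - a' x) \<bullet> b x \<partial>lebesgue_on \<Omega>)"
    using L2_cauchy_schwarz_inner(1)[OF a(1)[of n] b] L2_cauchy_schwarz_inner(1)[OF a(2) b] by (simp add: inner_diff_left)
  then show "norm ((\<integral>x. a n x \<bullet> b x \<partial>lebesgue_on \<Omega>) - (\<integral>x. a' x \<bullet> b x \<partial>lebesgue_on \<Omega>)) \<le> norm (L2_norm \<Omega> (\<lambda>x. a n x - a' x) * L2_norm \<Omega> b)"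
    using L2_cauchy_schwarz_inner(2)[OF L2_diff[OF a(1)[of n] a(2)] b] by (simp add: abs_mult)
qed

lemma L2_norm_tendsto:
  assumes a: "\<And>n. a n \<in> L2 \<Omega>" "a' \<in> L2 \<Omega>" and lim: "(\<lambda>n. L2_norm \<Omega> (\<lambda>x. a n x - a' x)) \<longlonglongrightarrow> 0"
  shows "(\<lambda>n. L2_norm \<Omega> (a n)) \<longlonglongrightarrow> L2_norm \<Omega> a'"
proof (rule Lim_transform_bound[THEN Lim_null[THEN iffD2]], rule always_eventually, rule allI)
  fix n
  have "L2_norm \<Omega> (a n) \<le> L2_norm \<Omega> (\<lambda>x. a n x - a' x) + L2_norm \<Omega> a'"
    using L2_triangle[OF L2_diff[OF a(1)[of n] a(2)] a(2)] by simp
  moreover have "L2_norm \<Omega> a' \<le> L2_norm \<Omega> (a n) + L2_norm \<Omega> (\<lambda>x. a n x - a' x)"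
    using L2_triangle_diff[OF a(1)[of n] L2_diff[OF a(1)[of n] a(2)]] by simp
  ultimately show "norm (L2_norm \<Omega> (a n) - L2_norm \<Omega> a') \<le> norm (L2_norm \<Omega> (\<lambda>x. a n x - a' x))" by simp
qed (rule lim)

context bounded_open
begin

lemma H1_add: "u \<in> H1 \<Omega> \<Longrightarrow> v \<in> H1 \<Omega> \<Longrightarrow> (\<lambda>x. u x + v x) \<in> H1 \<Omega>"
  by (rule has_weak_gradient_H1[OF has_weak_gradient_add[OF grad_works grad_works]])

lemma H1_diff: "u \<in> H1 \<Omega> \<Longrightarrow> v \<in> H1 \<Omega> \<Longrightarrow> (\<lambda>x. u x - v x) \<in> H1 \<Omega>"
  by (rule has_weak_gradient_H1[OF has_weak_gradient_diff[OF grad_works grad_works]])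

lemma H1_cmult: "u \<in> H1 \<Omega> \<Longrightarrow> (\<lambda>x. c * u x) \<in> H1 \<Omega>"
  by (rule has_weak_gradient_H1[OF has_weak_gradient_cmult[OF grad_works]])

lemma C1_H1: "C1 v h \<Longrightarrow> v \<in> H1 \<Omega>"
  by (rule has_weak_gradient_H1[OF C1_has_weak_gradient])

lemma H1_norm_zero [simp]: "H1_norm \<Omega> (\<lambda>x. 0) = 0"
  using H1_norm_eq[OF C1_has_weak_gradient[OF C1_const[of 0]]] by (simp add: L2_norm_def)

lemma H1_norm_nonneg [simp]: "0 \<le> H1_norm \<Omega> u"
  by (simp add: H1_norm_def)

lemma L2_norm_le_H1_norm: "L2_norm \<Omega> u \<le> H1_norm \<Omega> u" "L2_norm \<Omega> (grad \<Omega> u) \<le> H1_norm \<Omega> u"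
  by (simp_all add: H1_norm_def real_le_rsqrt)

lemma H1_norm_triangle:
  assumes "u \<in> H1 \<Omega>" "v \<in> H1 \<Omega>"
  shows "H1_norm \<Omega> (\<lambda>x. u x + v x) \<le> H1_norm \<Omega> u + H1_norm \<Omega> v"
  using L2_triangle[OF Pair_L2(1)[OF H1_L2[OF assms(1)]] Pair_L2(1)[OF H1_L2[OF assms(2)]]]
  by (simp add: H1_norm_eq_Pair[OF has_weak_gradient_add[OF grad_works[OF assms(1)] grad_works[OF assms(2)]]] H1_norm_eq_Pair[OF grad_works[OF assms(1)]]
      H1_norm_eq_Pair[OF grad_works[OF assms(2)]])

lemma H1_norm_cmult:
  assumes "u \<in> H1 \<Omega>" shows "H1_norm \<Omega> (\<lambda>x. c * u x) = \<bar>c\<bar> * H1_norm \<Omega> u"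
  using L2_norm_scaleR[of \<Omega> c "\<lambda>x. (u x, grad \<Omega> u x)"]
  by (simp add: H1_norm_eq_Pair[OF has_weak_gradient_cmult[OF grad_works[OF assms]]] H1_norm_eq_Pair[OF grad_works[OF assms]])

lemma H1_norm_minus_commute:
  assumes "u \<in> H1 \<Omega>" "v \<in> H1 \<Omega>" shows "H1_norm \<Omega> (\<lambda>x. u x - v x) = H1_norm \<Omega> (\<lambda>x. v x - u x)"
  using H1_norm_cmult[OF H1_diff[OF assms], of "-1"] by simp

lemma H1_norm_triangle3:
  assumes "u \<in> H1 \<Omega>" "v \<in> H1 \<Omega>" "w \<in> H1 \<Omega>"
  shows "H1_norm \<Omega> (\<lambda>x. u x - w x) \<le> H1_norm \<Omega> (\<lambda>x. u x - v x) + H1_norm \<Omega> (\<lambda>x. v x - w x)"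
  using H1_norm_triangle[OF H1_diff[OF assms(1,2)] H1_diff[OF assms(2,3)]] by simp

lemma L2_norm_grad_diff_le:
  assumes "has_weak_gradient \<Omega> u G" "has_weak_gradient \<Omega> v H"
  shows "L2_norm \<Omega> (\<lambda>x. G x - H x) \<le> H1_norm \<Omega> (\<lambda>x. u x - v x)"
  using L2_norm_grad[OF has_weak_gradient_diff[OF assms]] L2_norm_le_H1_norm(2)[of "\<lambda>x. u x - v x"] by simp

text \<open>The weak gradient is a closed operator: for a fixed test function both sides of its
  defining identity are continuous with respect to the L2 norm.\<close>

lemma H1_complete:
  assumes u: "\<And>n. u n \<in> H1 \<Omega>" and cauchy: "\<And>e. e > 0 \<Longrightarrow> \<exists>N. \<forall>m\<ge>N. \<forall>n\<ge>N. H1_norm \<Omega> (\<lambda>x. u m x - u n x) < e"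
  obtains v where "v \<in> H1 \<Omega>" "(\<lambda>n. H1_norm \<Omega> (\<lambda>x. u n x - v x)) \<longlonglongrightarrow> 0"
proof -
  have c1: "\<exists>N. \<forall>m\<ge>N. \<forall>n\<ge>N. L2_norm \<Omega> (\<lambda>x. u m x - u n x) < e" if e: "e > 0" for e
  proof -
    obtain N where N: "\<And>m n. m \<ge> N \<Longrightarrow> n \<ge> N \<Longrightarrow> H1_norm \<Omega> (\<lambda>x. u m x - u n x) < e" using cauchy[OF e] by blast
    then show ?thesis using L2_norm_le_H1_norm(1) by (intro exI[of _ N]) (blast intro: order.strict_trans1)
  qed
  have c2: "\<exists>N. \<forall>m\<ge>N. \<forall>n\<ge>N. L2_norm \<Omega> (\<lambda>x. grad \<Omega> (u m) x - grad \<Omega> (u n) x) < e" if e: "e > 0" for e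
  proof -
    obtain N where N: "\<And>m n. m \<ge> N \<Longrightarrow> n \<ge> N \<Longrightarrow> H1_norm \<Omega> (\<lambda>x. u m x - u n x) < e" using cauchy[OF e] by blast
    then show ?thesis using L2_norm_grad_diff_le[OF grad_works[OF u] grad_works[OF u]] by (intro exI[of _ N]) (blast intro: order.strict_trans1)
  qed
  obtain v where v: "v \<in> L2 \<Omega>" "(\<lambda>n. L2_norm \<Omega> (\<lambda>x. u n x - v x)) \<longlonglongrightarrow> 0"
    by (rule L2_complete[OF H1_L2(1)[OF u] c1])
  obtain G where G: "G \<in> L2 \<Omega>" "(\<lambda>n. L2_norm \<Omega> (\<lambda>x. grad \<Omega> (u n) x - G x)) \<longlonglongrightarrow> 0"
    by (rule L2_complete[OF H1_L2(2)[OF u] c2])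
  have w: "has_weak_gradient \<Omega> v G" unfolding has_weak_gradient_iff
  proof (intro conjI ballI allI v(1) G(1))
    fix \<phi> i assume p: "\<phi> \<in> test_functions \<Omega>"
    have "(\<lambda>n. \<integral>x. u n x * gradient \<phi> x $ i \<partial>lebesgue_on \<Omega>) \<longlonglongrightarrow> (\<integral>x. v x * gradient \<phi> x $ i \<partial>lebesgue_on \<Omega>)"
      using L2_inner_tendsto[OF H1_L2(1)[OF u] v(1) test_L2(3)[OF p] v(2), of i] by simp
    moreover have "(\<lambda>n. \<integral>x. u n x * gradient \<phi> x $ i \<partial>lebesgue_on \<Omega>) \<longlonglongrightarrow> - (\<integral>x. G x $ i * \<phi> x \<partial>lebesgue_on \<Omega>)"
    proof -
      have s: "F x \<bullet> (\<phi> x *\<^sub>R axis i 1) = F x $ i * \<phi> x" for F :: "plane \<Rightarrow> plane" and x by (simp add: inner_axis)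
      have "(\<lambda>x. \<phi> x *\<^sub>R axis i 1) \<in> L2 \<Omega>"
        using smooth_C1[OF test_function_smooth[OF p]] by (intro continuous_L2 continuous_intros C1_continuous)
      from L2_inner_tendsto[OF H1_L2(2)[OF u] G(1) this G(2)]
      have "(\<lambda>n. \<integral>x. grad \<Omega> (u n) x $ i * \<phi> x \<partial>lebesgue_on \<Omega>) \<longlonglongrightarrow> (\<integral>x. G x $ i * \<phi> x \<partial>lebesgue_on \<Omega>)" by (simp only: s)
      then have "(\<lambda>n. - (\<integral>x. grad \<Omega> (u n) x $ i * \<phi> x \<partial>lebesgue_on \<Omega>)) \<longlonglongrightarrow> - (\<integral>x. G x $ i * \<phi> x \<partial>lebesgue_on \<Omega>)" by (rule tendsto_minus)
      then show ?thesis using grad_works[OF u] p unfolding has_weak_gradient_iff by simp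
    qed
    ultimately show "(\<integral>x. v x * gradient \<phi> x $ i \<partial>lebesgue_on \<Omega>) = - (\<integral>x. G x $ i * \<phi> x \<partial>lebesgue_on \<Omega>)" by (rule LIMSEQ_unique)
  qed
  have "H1_norm \<Omega> (\<lambda>x. u n x - v x) = sqrt ((L2_norm \<Omega> (\<lambda>x. u n x - v x))\<^sup>2 + (L2_norm \<Omega> (\<lambda>x. grad \<Omega> (u n) x - G x))\<^sup>2)" for n
    by (rule H1_norm_eq[OF has_weak_gradient_diff[OF grad_works[OF u] w]])
  moreover have "(\<lambda>n. sqrt ((L2_norm \<Omega> (\<lambda>x. u n x - v x))\<^sup>2 + (L2_norm \<Omega> (\<lambda>x. grad \<Omega> (u n) x - G x))\<^sup>2)) \<longlonglongrightarrow> sqrt (0\<^sup>2 + 0\<^sup>2)"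
    by (intro tendsto_intros v(2) G(2))
  ultimately show ?thesis using that[OF has_weak_gradient_H1[OF w]] by simp
qed

section \<open>The closure of the test functions and Poincare's inequality\<close>

lemma H10_H1: "u \<in> H10 \<Omega> \<Longrightarrow> u \<in> H1 \<Omega>"
  by (simp add: H10_def)

lemma H10_approx:
  assumes "u \<in> H10 \<Omega>"
  obtains \<phi> where "\<And>n. \<phi> n \<in> test_functions \<Omega>" "(\<lambda>n. H1_norm \<Omega> (\<lambda>x. \<phi> n x - u x)) \<longlonglongrightarrow> 0"
proof -
  obtain \<phi> where p: "\<And>n. \<phi> n \<in> test_functions \<Omega>" "(\<lambda>n. H1_norm \<Omega> (\<lambda>x. u x - \<phi> n x)) \<longlonglongrightarrow> 0" using assms by (auto simp: H10_def)
  have "H1_norm \<Omega> (\<lambda>x. u x - \<phi> n x) = H1_norm \<Omega> (\<lambda>x. \<phi> n x - u x)" for n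
    by (rule H1_norm_minus_commute[OF H10_H1[OF assms] C1_H1[OF smooth_C1[OF test_function_smooth[OF p(1)]]]])
  then have "(\<lambda>n. H1_norm \<Omega> (\<lambda>x. \<phi> n x - u x)) \<longlonglongrightarrow> 0" using p(2) by presburger
  with p(1) show ?thesis by (rule that)
qed

lemma test_H1: "\<phi> \<in> test_functions \<Omega> \<Longrightarrow> \<phi> \<in> H1 \<Omega>"
  by (rule C1_H1[OF smooth_C1[OF test_function_smooth]])

lemma test_H10: "\<phi> \<in> test_functions \<Omega> \<Longrightarrow> \<phi> \<in> H10 \<Omega>"
  using test_H1 by (auto simp: H10_def intro!: exI[of _ "\<lambda>_. \<phi>"])

text \<open>A diagonal choice: one test function within \<open>1 / Suc n\<close> of each
  \<open>u n\<close> gives an approximating sequence for the limit.\<close>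

lemma H10_closed:
  assumes v: "v \<in> H1 \<Omega>" and u: "\<And>n. u n \<in> H10 \<Omega>" and lim: "(\<lambda>n. H1_norm \<Omega> (\<lambda>x. u n x - v x)) \<longlonglongrightarrow> 0"
  shows "v \<in> H10 \<Omega>"
proof -
  have "\<exists>\<phi>. \<phi> \<in> test_functions \<Omega> \<and> H1_norm \<Omega> (\<lambda>x. \<phi> x - u n x) < inverse (real (Suc n))" for n
  proof -
    obtain \<phi> where p: "\<And>n. \<phi> n \<in> test_functions \<Omega>" "(\<lambda>k. H1_norm \<Omega> (\<lambda>x. \<phi> k x - u n x)) \<longlonglongrightarrow> 0" using H10_approx[OF u[of n]] by blast
    have "\<forall>\<^sub>F k in sequentially. H1_norm \<Omega> (\<lambda>x. \<phi> k x - u n x) < inverse (real (Suc n))"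
      by (rule order_tendstoD(2)[OF p(2)]) simp
    then show ?thesis using p(1) eventually_happens'[OF sequentially_bot] by blast
  qed
  then obtain \<phi> where p: "\<And>n. \<phi> n \<in> test_functions \<Omega>" "\<And>n. H1_norm \<Omega> (\<lambda>x. \<phi> n x - u n x) < inverse (real (Suc n))" by metis
  have "(\<lambda>n. H1_norm \<Omega> (\<lambda>x. v x - \<phi> n x)) \<longlonglongrightarrow> 0"
  proof (rule tendsto_sandwich[OF _ _ tendsto_const])
    have "H1_norm \<Omega> (\<lambda>x. v x - \<phi> n x) \<le> inverse (real (Suc n)) + H1_norm \<Omega> (\<lambda>x. u n x - v x)" for n
      using H1_norm_triangle3[OF test_H1[OF p(1)[of n]] H10_H1[OF u[of n]] v] p(2)[of n] H1_norm_minus_commute[OF v test_H1[OF p(1)[of n]]] by linarith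
    then show "\<forall>\<^sub>F n in sequentially. H1_norm \<Omega> (\<lambda>x. v x - \<phi> n x) \<le> inverse (real (Suc n)) + H1_norm \<Omega> (\<lambda>x. u n x - v x)" by simp
    have "(\<lambda>n. inverse (real (Suc n)) + H1_norm \<Omega> (\<lambda>x. u n x - v x)) \<longlonglongrightarrow> 0 + 0" by (intro tendsto_add LIMSEQ_inverse_real_of_nat lim)
    then show "(\<lambda>n. inverse (real (Suc n)) + H1_norm \<Omega> (\<lambda>x. u n x - v x)) \<longlonglongrightarrow> 0" by simp
  qed simp
  then show ?thesis using v p(1) unfolding H10_def by blast
qed

lemma H10_combination:
  assumes u: "u \<in> H10 \<Omega>" and v: "v \<in> H10 \<Omega>" shows "(\<lambda>x. a * u x + b * v x) \<in> H10 \<Omega>"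
proof -
  obtain \<phi> where p: "\<And>n. \<phi> n \<in> test_functions \<Omega>" "(\<lambda>n. H1_norm \<Omega> (\<lambda>x. \<phi> n x - u x)) \<longlonglongrightarrow> 0" using H10_approx[OF u] by blast
  obtain \<psi> where q: "\<And>n. \<psi> n \<in> test_functions \<Omega>" "(\<lambda>n. H1_norm \<Omega> (\<lambda>x. \<psi> n x - v x)) \<longlonglongrightarrow> 0" using H10_approx[OF v] by blast
  have t: "(\<lambda>x. a * \<phi> n x + b * \<psi> n x) \<in> test_functions \<Omega>" for n by (intro test_functions_add test_functions_cmult p q)
  have "(\<lambda>n. H1_norm \<Omega> (\<lambda>x. (a * \<phi> n x + b * \<psi> n x) - (a * u x + b * v x))) \<longlonglongrightarrow> 0"
  proof (rule tendsto_sandwich[OF _ _ tendsto_const])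
    have "H1_norm \<Omega> (\<lambda>x. (a * \<phi> n x + b * \<psi> n x) - (a * u x + b * v x)) \<le> \<bar>a\<bar> * H1_norm \<Omega> (\<lambda>x. \<phi> n x - u x) + \<bar>b\<bar> * H1_norm \<Omega> (\<lambda>x. \<psi> n x - v x)" for n
    proof -
      note d = H1_diff[OF test_H1[OF p(1)[of n]] H10_H1[OF u]] H1_diff[OF test_H1[OF q(1)[of n]] H10_H1[OF v]]
      have "(\<lambda>x. (a * \<phi> n x + b * \<psi> n x) - (a * u x + b * v x)) = (\<lambda>x. a * (\<phi> n x - u x) + b * (\<psi> n x - v x))" by (simp add: algebra_simps)
      then show ?thesis using H1_norm_triangle[OF H1_cmult[OF d(1), of a] H1_cmult[OF d(2), of b]] by (simp add: H1_norm_cmult d)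
    qed
    then show "\<forall>\<^sub>F n in sequentially. H1_norm \<Omega> (\<lambda>x. (a * \<phi> n x + b * \<psi> n x) - (a * u x + b * v x))
      \<le> \<bar>a\<bar> * H1_norm \<Omega> (\<lambda>x. \<phi> n x - u x) + \<bar>b\<bar> * H1_norm \<Omega> (\<lambda>x. \<psi> n x - v x)" by simp
    have "(\<lambda>n. \<bar>a\<bar> * H1_norm \<Omega> (\<lambda>x. \<phi> n x - u x) + \<bar>b\<bar> * H1_norm \<Omega> (\<lambda>x. \<psi> n x - v x)) \<longlonglongrightarrow> \<bar>a\<bar> * 0 + \<bar>b\<bar> * 0"
      by (intro tendsto_intros p q)
    then show "(\<lambda>n. \<bar>a\<bar> * H1_norm \<Omega> (\<lambda>x. \<phi> n x - u x) + \<bar>b\<bar> * H1_norm \<Omega> (\<lambda>x. \<psi> n x - v x)) \<longlonglongrightarrow> 0" by simp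
  qed simp
  then show ?thesis using H1_add[OF H1_cmult[OF H10_H1[OF u], of a] H1_cmult[OF H10_H1[OF v], of b]]
    by (intro H10_closed[OF _ test_H10[OF t]])
qed

lemma H10_diff: "u \<in> H10 \<Omega> \<Longrightarrow> v \<in> H10 \<Omega> \<Longrightarrow> (\<lambda>x. u x - v x) \<in> H10 \<Omega>"
  using H10_combination[of u v 1 "-1"] by simp

lemma H10_cmult: "u \<in> H10 \<Omega> \<Longrightarrow> (\<lambda>x. c * u x) \<in> H10 \<Omega>"
  using H10_combination[of u u c 0] by simp

lemma zero_test: "(\<lambda>x. 0) \<in> test_functions \<Omega>"
  by (simp add: test_functions_def smooth_const)

lemma zero_H10: "(\<lambda>x. 0) \<in> H10 \<Omega>"
  by (rule test_H10[OF zero_test])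

text \<open>Translating by more than the diameter of \<open>\<Omega>\<close> separates a test function from its translate.\<close>

lemma poincare:
  obtains K where "K \<ge> 0" "\<And>u. u \<in> H10 \<Omega> \<Longrightarrow> H1_norm \<Omega> u \<le> K * L2_norm \<Omega> (grad \<Omega> u)"
proof -
  obtain R where R: "R > 0" "\<Omega> \<subseteq> ball 0 R" using bounded_subset_ballD[OF bounded_domain, of 0] by blast
  have test: "L2_norm \<Omega> \<phi> \<le> 2 * R * L2_norm \<Omega> (gradient \<phi>)" if p: "\<phi> \<in> test_functions \<Omega>" for \<phi>
  proof -
    note s = test_function_supported[OF p] and c = smooth_C1[OF test_function_smooth[OF p]]
    have [measurable]: "\<phi> \<in> borel_measurable borel" "gradient \<phi> \<in> borel_measurable borel"
      using C1_continuous[OF c] C1_gradient_continuous[OF c] by (auto intro: borel_measurable_continuous_onI)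
    let ?e = "(2 * R) *\<^sub>R axis 1 1 :: plane"
    have ne: "norm ?e = 2 * R" using R by (simp add: norm_axis_1)
    have nn: "ennreal ((L2_norm \<Omega> f)\<^sup>2) = (\<integral>\<^sup>+x. ennreal ((norm (f x))\<^sup>2) \<partial>lborel)"
      if "f \<in> L2 \<Omega>" "f \<in> borel_measurable borel" "\<And>x. x \<notin> \<Omega> \<Longrightarrow> f x = 0" for f :: "plane \<Rightarrow> 'c::euclidean_space"
    proof -
      have "ennreal ((L2_norm \<Omega> f)\<^sup>2) = (\<integral>\<^sup>+x. ennreal ((norm (f x))\<^sup>2) \<partial>lebesgue_on \<Omega>)"
        unfolding L2_norm_power2 using L2_integrable[OF that(1)] by (intro nn_integral_eq_integral[symmetric]) auto
      also have "\<dots> = (\<integral>\<^sup>+x\<in>\<Omega>. ennreal ((norm (f x))\<^sup>2) \<partial>lborel)" using that(2) by (intro nn_integral_on_domain) measurable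
      also have "\<dots> = (\<integral>\<^sup>+x. ennreal ((norm (f x))\<^sup>2) \<partial>lborel)" using that(3) by (intro nn_integral_cong) (auto simp: indicator_def)
      finally show ?thesis .
    qed
    have "ennreal ((L2_norm \<Omega> \<phi>)\<^sup>2) = (\<integral>\<^sup>+x. ennreal ((norm (\<phi> x))\<^sup>2) \<partial>lborel)"
      using supported_in_eq_0(1)[OF s] test_L2(1)[OF p] by (intro nn) auto
    \<comment> \<open>At most one of the two values is nonzero, so the squared increment dominates
      the squared value wherever the latter is not 0.\<close>
    also have "\<dots> \<le> (\<integral>\<^sup>+x. ennreal ((\<phi> (x + ?e) - \<phi> x)\<^sup>2) \<partial>lborel)"
    proof (intro nn_integral_mono ennreal_leI)
      fix x
      have "\<phi> (x + ?e) = 0" if "\<phi> x \<noteq> 0"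
      proof -
        have "x \<in> \<Omega>" using that supported_in_eq_0(1)[OF s, of x] by blast
        then have "x \<in> ball 0 R" using R(2) by blast
        then have "norm x < R" by simp
        then have "R < norm (x + ?e)" using norm_triangle_ineq4[of "x + ?e" x] ne by simp
        then have "x + ?e \<notin> ball 0 R" by simp
        then have "x + ?e \<notin> \<Omega>" using R(2) by blast
        then show ?thesis by (rule supported_in_eq_0(1)[OF s])
      qed
      then show "(norm (\<phi> x))\<^sup>2 \<le> (\<phi> (x + ?e) - \<phi> x)\<^sup>2" by (cases "\<phi> x = 0") auto
    qed
    also have "\<dots> \<le> (\<integral>\<^sup>+x. ennreal ((gradient \<phi> x \<bullet> ?e)\<^sup>2) \<partial>lborel)"
      using nn_integral_increment_square_le[OF c, of ?e UNIV] by simp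
    also have "\<dots> \<le> (\<integral>\<^sup>+x. ennreal ((2 * R)\<^sup>2) * ennreal ((norm (gradient \<phi> x))\<^sup>2) \<partial>lborel)"
    proof (intro nn_integral_mono)
      fix x
      have "(gradient \<phi> x \<bullet> ?e)\<^sup>2 \<le> (norm ?e * norm (gradient \<phi> x))\<^sup>2"
        using Cauchy_Schwarz_ineq2[of "gradient \<phi> x" ?e] by (metis abs_le_square_iff abs_mult abs_norm_cancel mult.commute)
      then show "ennreal ((gradient \<phi> x \<bullet> ?e)\<^sup>2) \<le> ennreal ((2 * R)\<^sup>2) * ennreal ((norm (gradient \<phi> x))\<^sup>2)"
        unfolding ne power_mult_distrib[of _ "norm _"] by (subst ennreal_mult[symmetric]) (auto intro: ennreal_leI)
    qed
    also have "\<dots> = ennreal ((2 * R)\<^sup>2) * ennreal ((L2_norm \<Omega> (gradient \<phi>))\<^sup>2)"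
      using supported_in_eq_0(2)[OF s] test_L2(2)[OF p] by (subst nn) (auto simp: nn_integral_cmult)
    also have "\<dots> = ennreal ((2 * R * L2_norm \<Omega> (gradient \<phi>))\<^sup>2)" by (simp add: ennreal_mult[symmetric] power_mult_distrib)
    finally have "(L2_norm \<Omega> \<phi>)\<^sup>2 \<le> (2 * R * L2_norm \<Omega> (gradient \<phi>))\<^sup>2" by simp
    then show ?thesis by (rule power2_le_imp_le) (use R(1) in simp)
  qed
  \<comment> \<open>By density; the additional 1 accounts for the gradient part of the H1
    norm.\<close>
  have "H1_norm \<Omega> u \<le> (2 * R + 1) * L2_norm \<Omega> (grad \<Omega> u)" if u: "u \<in> H10 \<Omega>" for u
  proof -
    obtain \<phi> where p: "\<And>n. \<phi> n \<in> test_functions \<Omega>" and lim: "(\<lambda>n. H1_norm \<Omega> (\<lambda>x. \<phi> n x - u x)) \<longlonglongrightarrow> 0" using H10_approx[OF u] by blast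
    note wp = C1_has_weak_gradient[OF smooth_C1[OF test_function_smooth[OF p]]] and wu = grad_works[OF H10_H1[OF u]]
    have "(\<lambda>n. L2_norm \<Omega> (\<lambda>x. \<phi> n x - u x)) \<longlonglongrightarrow> 0"
      by (rule tendsto_sandwich[OF _ _ tendsto_const lim]) (use L2_norm_le_H1_norm in auto)
    then have 1: "(\<lambda>n. L2_norm \<Omega> (\<phi> n)) \<longlonglongrightarrow> L2_norm \<Omega> u"
      by (intro L2_norm_tendsto test_L2(1)[OF p] H1_L2(1)[OF H10_H1[OF u]])
    have "(\<lambda>n. L2_norm \<Omega> (\<lambda>x. gradient (\<phi> n) x - grad \<Omega> u x)) \<longlonglongrightarrow> 0"
      by (rule tendsto_sandwich[OF _ _ tendsto_const lim]) (use L2_norm_grad_diff_le[OF wp wu] in auto)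
    then have 2: "(\<lambda>n. L2_norm \<Omega> (gradient (\<phi> n))) \<longlonglongrightarrow> L2_norm \<Omega> (grad \<Omega> u)"
      by (intro L2_norm_tendsto test_L2(2)[OF p] H1_L2(2)[OF H10_H1[OF u]])
    have 3: "L2_norm \<Omega> u \<le> 2 * R * L2_norm \<Omega> (grad \<Omega> u)"
      by (rule LIMSEQ_le[OF 1 tendsto_mult[OF tendsto_const 2]]) (use test[OF p] in auto)
    have "H1_norm \<Omega> u \<le> L2_norm \<Omega> u + L2_norm \<Omega> (grad \<Omega> u)"
      unfolding H1_norm_def by (rule sqrt_sum_squares_le_sum) auto
    then show ?thesis using 3 by (simp add: distrib_right)
  qed
  then show ?thesis using that[of "2 * R + 1"] R(1) by simp
qed

end

subsection \<open>The advection form\<close>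

lemma perp_grad_inner: "perp_grad \<Omega> \<psi> x \<bullet> grad \<Omega> \<theta> x = cross2 (grad \<Omega> \<psi> x) (grad \<Omega> \<theta> x)"
  by (simp add: perp_grad_def cross2_def inner_vec_def sum_2)

locale lipschitz_domain =
  fixes \<Omega> :: "plane set"
  assumes domain: "bounded_lipschitz_domain \<Omega>"
begin

sublocale bounded_open \<Omega>
  using domain by unfold_locales (auto simp: bounded_lipschitz_domain_def)

lemma H1_norm_le_imp_h1_le:
  assumes c: "C1 u g" and M: "H1_norm \<Omega> u \<le> M" shows "h1_le \<Omega> (M\<^sup>2) u g"
proof -
  note w = C1_has_weak_gradient[OF c]
  have [measurable]: "u \<in> borel_measurable borel" "g \<in> borel_measurable borel"
    using C1_continuous[OF c] C1_gradient_continuous[OF c] by (auto intro: borel_measurable_continuous_onI)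
  have "(\<integral>\<^sup>+x\<in>\<Omega>. ennreal ((u x)\<^sup>2) \<partial>lborel) = ennreal ((L2_norm \<Omega> u)\<^sup>2)"
    unfolding L2_norm_power2 using L2_integrable[OF has_weak_gradient_L2(1)[OF w]]
    by (subst nn_integral_eq_integral[symmetric]) (auto simp: nn_integral_on_domain)
  moreover have "(\<integral>\<^sup>+x\<in>\<Omega>. ennreal ((norm (g x))\<^sup>2) \<partial>lborel) = ennreal ((L2_norm \<Omega> g)\<^sup>2)"
    unfolding L2_norm_power2 using L2_integrable[OF has_weak_gradient_L2(2)[OF w]]
    by (subst nn_integral_eq_integral[symmetric]) (auto simp: nn_integral_on_domain)
  moreover have "L2_norm \<Omega> u \<le> M" "L2_norm \<Omega> g \<le> M"
    using L2_norm_le_H1_norm[of u] L2_norm_grad[OF w] M by linarith+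
  ultimately show ?thesis by (auto simp: h1_le_def intro!: ennreal_leI power_mono)
qed

lemma smooth_wente:
  obtains W where "\<And>\<eta> v \<theta>. \<lbrakk>\<eta> \<in> test_functions \<Omega>; smooth v; \<theta> \<in> test_functions \<Omega>; H1_norm \<Omega> \<eta> \<le> M; H1_norm \<Omega> v \<le> M; H1_norm \<Omega> \<theta> \<le> M\<rbrakk>
    \<Longrightarrow> \<bar>\<integral>x. \<eta> x * cross2 (gradient v x) (gradient \<theta> x) \<partial>lebesgue_on \<Omega>\<bar> \<le> W"
proof -
  have "0 \<le> M\<^sup>2" by simp
  obtain W where W: "\<And>u gu v gv w gw. \<lbrakk>supported_in \<Omega> u gu; C1 v gv; supported_in \<Omega> w gw; h1_le \<Omega> (M\<^sup>2) u gu; h1_le \<Omega> (M\<^sup>2) v gv; h1_le \<Omega> (M\<^sup>2) w gw\<rbrakk>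
    \<Longrightarrow> \<bar>\<integral>x. u x * cross2 (gv x) (gw x) \<partial>lborel\<bar> \<le> W"
    using wente_estimate[OF domain \<open>0 \<le> M\<^sup>2\<close>] by blast
  have "\<bar>\<integral>x. \<eta> x * cross2 (gradient v x) (gradient \<theta> x) \<partial>lebesgue_on \<Omega>\<bar> \<le> W"
    if e: "\<eta> \<in> test_functions \<Omega>" and v: "smooth v" and t: "\<theta> \<in> test_functions \<Omega>"
      and M: "H1_norm \<Omega> \<eta> \<le> M" "H1_norm \<Omega> v \<le> M" "H1_norm \<Omega> \<theta> \<le> M" for \<eta> v \<theta>
  proof -
    note c = smooth_C1[OF test_function_smooth[OF e]] smooth_C1[OF v] smooth_C1[OF test_function_smooth[OF t]]
    have "(\<integral>x. \<eta> x * cross2 (gradient v x) (gradient \<theta> x) \<partial>lebesgue_on \<Omega>)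
      = (\<integral>x. indicator \<Omega> x * (\<eta> x * cross2 (gradient v x) (gradient \<theta> x)) \<partial>lborel)"
      by (intro integral_on_domain borel_measurable_continuous_onI continuous_intros C1_continuous[OF c(1)] C1_gradient_continuous[OF c(2)] C1_gradient_continuous[OF c(3)])
    also have "\<dots> = (\<integral>x. \<eta> x * cross2 (gradient v x) (gradient \<theta> x) \<partial>lborel)"
      using supported_in_eq_0(1)[OF test_function_supported[OF e]] by (intro Bochner_Integration.integral_cong) (auto simp: indicator_def)
    finally show ?thesis
      using W[OF test_function_supported[OF e] c(2) test_function_supported[OF t] H1_norm_le_imp_h1_le[OF c(1) M(1)]
          H1_norm_le_imp_h1_le[OF c(2) M(2)] H1_norm_le_imp_h1_le[OF c(3) M(3)]] by simp
  qed
  then show ?thesis by (rule that)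
qed

text \<open>The integral of which \<open>advection\<close> is the extension, written with
  \<open>cross2\<close> and with the variable of extension last.\<close>

definition adv :: "(plane \<Rightarrow> real) \<Rightarrow> (plane \<Rightarrow> real) \<Rightarrow> (plane \<Rightarrow> real) \<Rightarrow> real" where
  "adv \<psi> \<theta> \<eta> = (\<integral>x. \<eta> x * cross2 (grad \<Omega> \<psi> x) (grad \<Omega> \<theta> x) \<partial>lebesgue_on \<Omega>)"

lemma cross2_measurable:
  assumes "a \<in> borel_measurable M" "b \<in> borel_measurable M" shows "(\<lambda>x. cross2 (a x) (b x)) \<in> borel_measurable M"
proof -
  have "(\<lambda>x. a x $ i) \<in> borel_measurable M" "(\<lambda>x. b x $ i) \<in> borel_measurable M" for i
    by (rule borel_measurable_continuous_on[OF _ assms(1)] borel_measurable_continuous_on[OF _ assms(2)], intro continuous_intros)+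
  then show ?thesis unfolding cross2_def by (intro borel_measurable_diff borel_measurable_times)
qed

lemma bounded_cross2_integral:
  assumes e: "\<eta> \<in> borel_measurable (lebesgue_on \<Omega>)" "AE x in lebesgue_on \<Omega>. \<bar>\<eta> x\<bar> \<le> B" and a: "a \<in> L2 \<Omega>" and b: "b \<in> L2 \<Omega>"
  shows "integrable (lebesgue_on \<Omega>) (\<lambda>x. \<eta> x * cross2 (a x) (b x))"
    "\<bar>\<integral>x. \<eta> x * cross2 (a x) (b x) \<partial>lebesgue_on \<Omega>\<bar> \<le> \<bar>B\<bar> * (L2_norm \<Omega> a * L2_norm \<Omega> b)"
proof -
  note ab = L2_mult_integrable[OF a b]
  have le: "AE x in lebesgue_on \<Omega>. \<bar>\<eta> x * cross2 (a x) (b x)\<bar> \<le> \<bar>B\<bar> * (norm (a x) * norm (b x))"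
    using e(2) by eventually_elim (auto simp: abs_mult intro!: mult_mono abs_cross2_le)
  show i: "integrable (lebesgue_on \<Omega>) (\<lambda>x. \<eta> x * cross2 (a x) (b x))"
  proof (rule Bochner_Integration.integrable_bound)
    show "integrable (lebesgue_on \<Omega>) (\<lambda>x. \<bar>B\<bar> * (norm (a x) * norm (b x)))" using ab by simp
    show "(\<lambda>x. \<eta> x * cross2 (a x) (b x)) \<in> borel_measurable (lebesgue_on \<Omega>)"
      by (intro borel_measurable_times e cross2_measurable L2_measurable a b)
    show "AE x in lebesgue_on \<Omega>. norm (\<eta> x * cross2 (a x) (b x)) \<le> norm (\<bar>B\<bar> * (norm (a x) * norm (b x)))"
      using le by eventually_elim simp
  qed
  have "\<bar>\<integral>x. \<eta> x * cross2 (a x) (b x) \<partial>lebesgue_on \<Omega>\<bar> \<le> (\<integral>x. \<bar>\<eta> x * cross2 (a x) (b x)\<bar> \<partial>lebesgue_on \<Omega>)" by (rule integral_abs_bound)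
  also have "\<dots> \<le> (\<integral>x. \<bar>B\<bar> * (norm (a x) * norm (b x)) \<partial>lebesgue_on \<Omega>)"
    by (intro integral_mono_AE integrable_abs i le) (use ab in simp)
  also have "\<dots> \<le> \<bar>B\<bar> * (L2_norm \<Omega> a * L2_norm \<Omega> b)" using L2_cauchy_schwarz[OF a b] by (simp add: mult_left_mono)
  finally show "\<bar>\<integral>x. \<eta> x * cross2 (a x) (b x) \<partial>lebesgue_on \<Omega>\<bar> \<le> \<bar>B\<bar> * (L2_norm \<Omega> a * L2_norm \<Omega> b)" .
qed

lemma stream_space_approx:
  assumes "\<psi> \<in> stream_space \<Omega>"
  obtains v where "\<And>n. smooth (v n)" "(\<lambda>n. H1_norm \<Omega> (\<lambda>x. \<psi> x - v n x)) \<longlonglongrightarrow> 0"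
  using assms unfolding stream_space_def has_trace_def by blast

lemma stream_space_H1: "\<psi> \<in> stream_space \<Omega> \<Longrightarrow> \<psi> \<in> H1 \<Omega>"
  by (simp add: stream_space_def)

lemma H10_Linf:
  assumes "\<eta> \<in> H10 \<Omega> \<inter> Linf \<Omega>"
  obtains B where "\<eta> \<in> H10 \<Omega>" "\<eta> \<in> borel_measurable (lebesgue_on \<Omega>)" "AE x in lebesgue_on \<Omega>. \<bar>\<eta> x\<bar> \<le> B"
  using assms unfolding Linf_def by blast

lemma L2_norm_null_seq:
  assumes "\<And>n. has_weak_gradient \<Omega> (u n) (g n)" "has_weak_gradient \<Omega> v h" "(\<lambda>n. H1_norm \<Omega> (\<lambda>x. u n x - v x)) \<longlonglongrightarrow> 0"
  shows "(\<lambda>n. L2_norm \<Omega> (\<lambda>x. u n x - v x)) \<longlonglongrightarrow> 0" "(\<lambda>n. L2_norm \<Omega> (\<lambda>x. g n x - h x)) \<longlonglongrightarrow> 0"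
    "(\<lambda>n. H1_norm \<Omega> (u n)) \<longlonglongrightarrow> H1_norm \<Omega> v"
proof -
  show 1: "(\<lambda>n. L2_norm \<Omega> (\<lambda>x. u n x - v x)) \<longlonglongrightarrow> 0"
    by (rule tendsto_sandwich[OF _ _ tendsto_const assms(3)]) (use L2_norm_le_H1_norm in auto)
  show 2: "(\<lambda>n. L2_norm \<Omega> (\<lambda>x. g n x - h x)) \<longlonglongrightarrow> 0"
    by (rule tendsto_sandwich[OF _ _ tendsto_const assms(3)]) (use L2_norm_grad_diff_le[OF assms(1,2)] in auto)
  have "(\<lambda>n. sqrt ((L2_norm \<Omega> (u n))\<^sup>2 + (L2_norm \<Omega> (g n))\<^sup>2)) \<longlonglongrightarrow> sqrt ((L2_norm \<Omega> v)\<^sup>2 + (L2_norm \<Omega> h)\<^sup>2)"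
    by (intro tendsto_intros L2_norm_tendsto 1 2 has_weak_gradient_L2[OF assms(1)] has_weak_gradient_L2[OF assms(2)])
  then show "(\<lambda>n. H1_norm \<Omega> (u n)) \<longlonglongrightarrow> H1_norm \<Omega> v"
    by (simp only: H1_norm_eq[OF assms(1)] H1_norm_eq[OF assms(2)])
qed

text \<open>The order of the limits matters. While \<eta> is kept bounded, \<psi> and \<theta> are
  approximated by smooth functions, because beside a bounded factor L2 convergence of the gradients
  suffices. Once these gradients are smooth, their Jacobian is a fixed continuous function, and L2
  convergence suffices to approximate \<eta> by test functions. The bound \<open>M + 1\<close>
  leaves room for the norms of the approximations.\<close>

lemma adv_bounded:
  obtains W where "\<And>\<eta> \<psi> \<theta>. \<lbrakk>\<eta> \<in> H10 \<Omega> \<inter> Linf \<Omega>; \<psi> \<in> stream_space \<Omega>; \<theta> \<in> H10 \<Omega>; H1_norm \<Omega> \<eta> \<le> M; H1_norm \<Omega> \<psi> \<le> M; H1_norm \<Omega> \<theta> \<le> M\<rbrakk>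
    \<Longrightarrow> \<bar>adv \<psi> \<theta> \<eta>\<bar> \<le> W"
proof -
  obtain W where W: "\<And>\<eta> v \<theta>. \<lbrakk>\<eta> \<in> test_functions \<Omega>; smooth v; \<theta> \<in> test_functions \<Omega>; H1_norm \<Omega> \<eta> \<le> M + 1; H1_norm \<Omega> v \<le> M + 1; H1_norm \<Omega> \<theta> \<le> M + 1\<rbrakk>
    \<Longrightarrow> \<bar>\<integral>x. \<eta> x * cross2 (gradient v x) (gradient \<theta> x) \<partial>lebesgue_on \<Omega>\<bar> \<le> W"
    using smooth_wente[of "M + 1"] by blast
  have "\<bar>adv \<psi> \<theta> \<eta>\<bar> \<le> W"
    if e: "\<eta> \<in> H10 \<Omega> \<inter> Linf \<Omega>" and p: "\<psi> \<in> stream_space \<Omega>" and t: "\<theta> \<in> H10 \<Omega>"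
      and M: "H1_norm \<Omega> \<eta> \<le> M" "H1_norm \<Omega> \<psi> \<le> M" "H1_norm \<Omega> \<theta> \<le> M" for \<eta> \<psi> \<theta>
  proof -
    obtain B where eta: "\<eta> \<in> H10 \<Omega>" "\<eta> \<in> borel_measurable (lebesgue_on \<Omega>)" "AE x in lebesgue_on \<Omega>. \<bar>\<eta> x\<bar> \<le> B"
      by (rule H10_Linf[OF e])
    obtain v where v: "\<And>n. smooth (v n)" and vl: "(\<lambda>n. H1_norm \<Omega> (\<lambda>x. \<psi> x - v n x)) \<longlonglongrightarrow> 0"
      using stream_space_approx[OF p] by blast
    obtain s where s: "\<And>n. s n \<in> test_functions \<Omega>" and sl: "(\<lambda>n. H1_norm \<Omega> (\<lambda>x. s n x - \<theta> x)) \<longlonglongrightarrow> 0"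
      using H10_approx[OF t] by blast
    obtain q where q: "\<And>n. q n \<in> test_functions \<Omega>" and ql: "(\<lambda>n. H1_norm \<Omega> (\<lambda>x. q n x - \<eta> x)) \<longlonglongrightarrow> 0"
      using H10_approx[OF eta(1)] by blast
    note wv = C1_has_weak_gradient[OF smooth_C1[OF v]] and ws = C1_has_weak_gradient[OF smooth_C1[OF test_function_smooth[OF s]]]
      and wq = C1_has_weak_gradient[OF smooth_C1[OF test_function_smooth[OF q]]]
    note wp = grad_works[OF stream_space_H1[OF p]] and wt = grad_works[OF H10_H1[OF t]] and we = grad_works[OF H10_H1[OF eta(1)]]
    have "H1_norm \<Omega> (\<lambda>x. \<psi> x - v n x) = H1_norm \<Omega> (\<lambda>x. v n x - \<psi> x)" for n
      by (rule H1_norm_minus_commute[OF stream_space_H1[OF p] has_weak_gradient_H1[OF wv]])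
    then have vl': "(\<lambda>n. H1_norm \<Omega> (\<lambda>x. v n x - \<psi> x)) \<longlonglongrightarrow> 0" using vl by presburger
    note lv = L2_norm_null_seq[OF wv wp vl'] and ls = L2_norm_null_seq[OF ws wt sl] and lq = L2_norm_null_seq[OF wq we ql]
    define a where "a = grad \<Omega> \<psi>" define b where "b = grad \<Omega> \<theta>"
    define an where "an = (\<lambda>n. gradient (v n))" define bn where "bn = (\<lambda>n. gradient (s n))"
    have L: "a \<in> L2 \<Omega>" "b \<in> L2 \<Omega>" "an n \<in> L2 \<Omega>" "bn n \<in> L2 \<Omega>" for n
      unfolding a_def b_def an_def bn_def using has_weak_gradient_L2 wp wt wv ws by blast+
    let ?T = "\<lambda>n. \<integral>x. \<eta> x * cross2 (an n x) (bn n x) \<partial>lebesgue_on \<Omega>"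
    have "(\<lambda>n. ?T n - adv \<psi> \<theta> \<eta>) \<longlonglongrightarrow> 0"
    proof (rule Lim_transform_bound[OF always_eventually], rule allI)
      fix n
      have eq: "?T n - adv \<psi> \<theta> \<eta> = (\<integral>x. \<eta> x * cross2 (an n x - a x) (bn n x) \<partial>lebesgue_on \<Omega>) + (\<integral>x. \<eta> x * cross2 (a x) (bn n x - b x) \<partial>lebesgue_on \<Omega>)"
        unfolding adv_def a_def[symmetric] b_def[symmetric] cross2_diff_left cross2_diff_right right_diff_distrib
        using bounded_cross2_integral(1)[OF eta(2,3)] L by simp
      have le: "\<bar>(\<integral>x. \<eta> x * cross2 (an n x - a x) (bn n x) \<partial>lebesgue_on \<Omega>) + (\<integral>x. \<eta> x * cross2 (a x) (bn n x - b x) \<partial>lebesgue_on \<Omega>)\<bar>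
        \<le> \<bar>B\<bar> * (L2_norm \<Omega> (\<lambda>x. an n x - a x) * L2_norm \<Omega> (bn n)) + \<bar>B\<bar> * (L2_norm \<Omega> a * L2_norm \<Omega> (\<lambda>x. bn n x - b x))"
        by (rule order_trans[OF abs_triangle_ineq add_mono]) (intro bounded_cross2_integral(2)[OF eta(2,3)] L2_diff L)+
      show "norm (?T n - adv \<psi> \<theta> \<eta>) \<le> norm (\<bar>B\<bar> * (L2_norm \<Omega> (\<lambda>x. an n x - a x) * L2_norm \<Omega> (bn n)) + \<bar>B\<bar> * (L2_norm \<Omega> a * L2_norm \<Omega> (\<lambda>x. bn n x - b x)))"
        unfolding real_norm_def eq by (rule order_trans[OF le abs_ge_self])
    next
      have an: "(\<lambda>n. L2_norm \<Omega> (\<lambda>x. an n x - a x)) \<longlonglongrightarrow> 0" and bn: "(\<lambda>n. L2_norm \<Omega> (\<lambda>x. bn n x - b x)) \<longlonglongrightarrow> 0"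
        unfolding an_def a_def bn_def b_def by (rule lv(2), rule ls(2))
      have "(\<lambda>n. \<bar>B\<bar> * (L2_norm \<Omega> (\<lambda>x. an n x - a x) * L2_norm \<Omega> (bn n)) + \<bar>B\<bar> * (L2_norm \<Omega> a * L2_norm \<Omega> (\<lambda>x. bn n x - b x)))
        \<longlonglongrightarrow> \<bar>B\<bar> * (0 * L2_norm \<Omega> b) + \<bar>B\<bar> * (L2_norm \<Omega> a * 0)"
        by (intro tendsto_intros an bn L2_norm_tendsto L)
      then show "(\<lambda>n. \<bar>B\<bar> * (L2_norm \<Omega> (\<lambda>x. an n x - a x) * L2_norm \<Omega> (bn n)) + \<bar>B\<bar> * (L2_norm \<Omega> a * L2_norm \<Omega> (\<lambda>x. bn n x - b x))) \<longlonglongrightarrow> 0" by simp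
    qed
    then have T: "?T \<longlonglongrightarrow> adv \<psi> \<theta> \<eta>" by (rule Lim_null[THEN iffD2])
    have "\<forall>\<^sub>F n in sequentially. H1_norm \<Omega> (v n) < M + 1" "\<forall>\<^sub>F n in sequentially. H1_norm \<Omega> (s n) < M + 1"
      by (rule order_tendstoD(2)[OF lv(3)] order_tendstoD(2)[OF ls(3)], use M in simp)+
    then have ev: "\<forall>\<^sub>F n in sequentially. \<bar>?T n\<bar> \<le> W"
    proof eventually_elim
      case (elim n)
      have c: "continuous_on UNIV (\<lambda>x. cross2 (an n x) (bn n x))" unfolding an_def bn_def
        by (intro continuous_intros C1_gradient_continuous[OF smooth_C1[OF v]] C1_gradient_continuous[OF smooth_C1[OF test_function_smooth[OF s]]])
      have "(\<lambda>m. \<integral>x. q m x * cross2 (an n x) (bn n x) \<partial>lebesgue_on \<Omega>) \<longlonglongrightarrow> ?T n"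
        using L2_inner_tendsto[OF has_weak_gradient_L2(1)[OF wq] has_weak_gradient_L2(1)[OF we] continuous_L2[OF c] lq(1)] by simp
      moreover have "\<forall>\<^sub>F m in sequentially. \<bar>\<integral>x. q m x * cross2 (an n x) (bn n x) \<partial>lebesgue_on \<Omega>\<bar> \<le> W"
      proof -
        have "\<forall>\<^sub>F m in sequentially. H1_norm \<Omega> (q m) < M + 1" by (rule order_tendstoD(2)[OF lq(3)]) (use M in simp)
        then show ?thesis unfolding an_def bn_def by eventually_elim (use elim W[OF q v s] in auto)
      qed
      ultimately show ?case by (intro tendsto_upperbound[OF tendsto_rabs]) auto
    qed
    show ?thesis by (rule tendsto_upperbound[OF tendsto_rabs[OF T] ev]) simp
  qed
  then show ?thesis by (rule that)
qed

lemma H10_Linf_combination: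
  assumes u: "u \<in> H10 \<Omega> \<inter> Linf \<Omega>" and v: "v \<in> H10 \<Omega> \<inter> Linf \<Omega>"
  shows "(\<lambda>x. a * u x + b * v x) \<in> H10 \<Omega> \<inter> Linf \<Omega>"
proof -
  obtain A where A: "u \<in> H10 \<Omega>" "u \<in> borel_measurable (lebesgue_on \<Omega>)" "AE x in lebesgue_on \<Omega>. \<bar>u x\<bar> \<le> A" by (rule H10_Linf[OF u])
  obtain B where B: "v \<in> H10 \<Omega>" "v \<in> borel_measurable (lebesgue_on \<Omega>)" "AE x in lebesgue_on \<Omega>. \<bar>v x\<bar> \<le> B" by (rule H10_Linf[OF v])
  have "AE x in lebesgue_on \<Omega>. \<bar>a * u x + b * v x\<bar> \<le> \<bar>a\<bar> * A + \<bar>b\<bar> * B"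
    using A(3) B(3)
  proof eventually_elim
    case (elim x)
    have "\<bar>a * u x + b * v x\<bar> \<le> \<bar>a\<bar> * \<bar>u x\<bar> + \<bar>b\<bar> * \<bar>v x\<bar>" using abs_triangle_ineq[of "a * u x" "b * v x"] by (simp add: abs_mult)
    also have "\<dots> \<le> \<bar>a\<bar> * A + \<bar>b\<bar> * B" using elim by (intro add_mono mult_left_mono) auto
    finally show ?case .
  qed
  then show ?thesis using H10_combination[OF A(1) B(1)] A(2) B(2) by (auto simp: Linf_def)
qed

lemma adv_combination:
  assumes p: "\<psi> \<in> H1 \<Omega>" and t: "\<theta> \<in> H1 \<Omega>" and u: "u \<in> H10 \<Omega> \<inter> Linf \<Omega>" and v: "v \<in> H10 \<Omega> \<inter> Linf \<Omega>"
  shows "adv \<psi> \<theta> (\<lambda>x. a * u x + b * v x) = a * adv \<psi> \<theta> u + b * adv \<psi> \<theta> v"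
proof -
  have i: "integrable (lebesgue_on \<Omega>) (\<lambda>x. w x * cross2 (grad \<Omega> \<psi> x) (grad \<Omega> \<theta> x))" if "w \<in> H10 \<Omega> \<inter> Linf \<Omega>" for w
    by (rule H10_Linf[OF that]) (rule bounded_cross2_integral(1)[OF _ _ H1_L2(2)[OF p] H1_L2(2)[OF t]])
  show ?thesis unfolding adv_def using i[OF u] i[OF v] by (simp add: distrib_right mult.assoc)
qed

text \<open>Linearity in \<eta> turns the bound on bounded sets into a linear one.\<close>

lemma adv_lipschitz:
  assumes p: "\<psi> \<in> stream_space \<Omega>" and t: "\<theta> \<in> H10 \<Omega>"
  obtains C where "C \<ge> 0" "\<And>\<eta>. \<eta> \<in> H10 \<Omega> \<inter> Linf \<Omega> \<Longrightarrow> \<bar>adv \<psi> \<theta> \<eta>\<bar> \<le> C * H1_norm \<Omega> \<eta>"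
proof -
  define M where "M = max 1 (max (H1_norm \<Omega> \<psi>) (H1_norm \<Omega> \<theta>))"
  have M: "1 \<le> M" "H1_norm \<Omega> \<psi> \<le> M" "H1_norm \<Omega> \<theta> \<le> M" by (auto simp: M_def)
  obtain W where W: "\<And>\<eta>. \<eta> \<in> H10 \<Omega> \<inter> Linf \<Omega> \<Longrightarrow> H1_norm \<Omega> \<eta> \<le> M \<Longrightarrow> \<bar>adv \<psi> \<theta> \<eta>\<bar> \<le> W"
    using adv_bounded[of M] p t M by metis
  have "\<bar>adv \<psi> \<theta> \<eta>\<bar> \<le> \<bar>W\<bar> * H1_norm \<Omega> \<eta>" if e: "\<eta> \<in> H10 \<Omega> \<inter> Linf \<Omega>" for \<eta>
  proof (rule LIMSEQ_le_const)
    \<comment> \<open>The added \<open>1 / Suc n\<close> keeps the normalising factor defined when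
      \<eta> has norm 0; it disappears in the limit.\<close>
    let ?d = "\<lambda>n. H1_norm \<Omega> \<eta> + inverse (real (Suc n))"
    have "(\<lambda>n. \<bar>W\<bar> * ?d n) \<longlonglongrightarrow> \<bar>W\<bar> * (H1_norm \<Omega> \<eta> + 0)" by (intro tendsto_intros LIMSEQ_inverse_real_of_nat)
    then show "(\<lambda>n. \<bar>W\<bar> * ?d n) \<longlonglongrightarrow> \<bar>W\<bar> * H1_norm \<Omega> \<eta>" by simp
    have "\<bar>adv \<psi> \<theta> \<eta>\<bar> \<le> \<bar>W\<bar> * ?d n" for n
    proof -
      have d: "?d n > 0" by (simp add: add_nonneg_pos)
      let ?c = "1 / ?d n"
      have ce: "(\<lambda>x. ?c * \<eta> x) \<in> H10 \<Omega> \<inter> Linf \<Omega>" using H10_Linf_combination[OF e e, of ?c 0] by simp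
      have "H1_norm \<Omega> (\<lambda>x. ?c * \<eta> x) = H1_norm \<Omega> \<eta> / ?d n"
        using d e by (subst H1_norm_cmult) (auto intro: H10_H1)
      also have "\<dots> \<le> 1" using d by (simp add: divide_le_eq)
      finally have "H1_norm \<Omega> (\<lambda>x. ?c * \<eta> x) \<le> M" using M(1) by linarith
      from W[OF ce this] have "\<bar>?c * adv \<psi> \<theta> \<eta>\<bar> \<le> W"
        using adv_combination[OF stream_space_H1[OF p] H10_H1[OF t] e e, of ?c 0] by simp
      then have "\<bar>adv \<psi> \<theta> \<eta>\<bar> / ?d n \<le> W" using d by (simp add: abs_mult)
      then have "\<bar>adv \<psi> \<theta> \<eta>\<bar> \<le> W * ?d n" using d by (simp add: pos_divide_le_eq)
      also have "\<dots> \<le> \<bar>W\<bar> * ?d n" using d by (intro mult_right_mono) auto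
      finally show ?thesis .
    qed
    then show "\<exists>N. \<forall>n\<ge>N. \<bar>adv \<psi> \<theta> \<eta>\<bar> \<le> \<bar>W\<bar> * ?d n" by blast
  qed
  then show ?thesis using that[of "\<bar>W\<bar>"] by simp
qed

lemma test_H10_Linf:
  assumes "\<phi> \<in> test_functions \<Omega>" shows "\<phi> \<in> H10 \<Omega> \<inter> Linf \<Omega>"
proof -
  obtain B where "\<And>x. norm (\<phi> x) \<le> B"
    using Cc_bounded[OF C1c_Cc] test_function_supported[OF assms] unfolding supported_in_def by blast
  then show ?thesis using test_H10[OF assms] L2_measurable[OF test_L2(1)[OF assms]] by (auto simp: Linf_def)
qed

text \<open>Justifies the definite description in \<open>advection\<close>. The Lipschitz bound
  makes the integrals along test functions a Cauchy sequence, comparison with them gives every other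
  admissible sequence the same limit, and density of the test functions makes the limit
  unique.\<close>

lemma advection_limit:
  assumes p: "\<psi> \<in> stream_space \<Omega>" and t: "\<theta> \<in> H10 \<Omega>" and x: "\<xi> \<in> H10 \<Omega>"
    and e: "\<And>n. \<eta> n \<in> H10 \<Omega> \<inter> Linf \<Omega>" and el: "(\<lambda>n. H1_norm \<Omega> (\<lambda>x. \<eta> n x - \<xi> x)) \<longlonglongrightarrow> 0"
  shows "(\<lambda>n. adv \<psi> \<theta> (\<eta> n)) \<longlonglongrightarrow> advection \<Omega> \<xi> \<psi> \<theta>"
proof -
  obtain C where C: "C \<ge> 0" "\<And>\<eta>. \<eta> \<in> H10 \<Omega> \<inter> Linf \<Omega> \<Longrightarrow> \<bar>adv \<psi> \<theta> \<eta>\<bar> \<le> C * H1_norm \<Omega> \<eta>" using adv_lipschitz[OF p t] by blast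
  have lip: "\<bar>adv \<psi> \<theta> u - adv \<psi> \<theta> v\<bar> \<le> C * H1_norm \<Omega> (\<lambda>x. u x - v x)" if "u \<in> H10 \<Omega> \<inter> Linf \<Omega>" "v \<in> H10 \<Omega> \<inter> Linf \<Omega>" for u v
    using C(2)[OF H10_Linf_combination[OF that, of 1 "-1"]] adv_combination[OF stream_space_H1[OF p] H10_H1[OF t] that, of 1 "-1"] by simp
  have lip2: "\<bar>adv \<psi> \<theta> u - adv \<psi> \<theta> v\<bar> \<le> C * (H1_norm \<Omega> (\<lambda>x. u x - \<xi> x) + H1_norm \<Omega> (\<lambda>x. v x - \<xi> x))"
    if "u \<in> H10 \<Omega> \<inter> Linf \<Omega>" "v \<in> H10 \<Omega> \<inter> Linf \<Omega>" for u v
  proof -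
    have h: "u \<in> H1 \<Omega>" "v \<in> H1 \<Omega>" "\<xi> \<in> H1 \<Omega>" using that x H10_H1 by auto
    have "H1_norm \<Omega> (\<lambda>x. u x - v x) \<le> H1_norm \<Omega> (\<lambda>x. u x - \<xi> x) + H1_norm \<Omega> (\<lambda>x. v x - \<xi> x)"
      using H1_norm_triangle3[OF h(1,3,2)] H1_norm_minus_commute[OF h(2,3)] by simp
    then show ?thesis using lip[OF that] mult_left_mono[OF _ C(1)] order_trans by blast
  qed
  obtain \<phi> where ph: "\<And>n. \<phi> n \<in> test_functions \<Omega>" and pl: "(\<lambda>n. H1_norm \<Omega> (\<lambda>x. \<phi> n x - \<xi> x)) \<longlonglongrightarrow> 0" using H10_approx[OF x] by blast
  note pb = test_H10_Linf[OF ph]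
  have "Cauchy (\<lambda>n. adv \<psi> \<theta> (\<phi> n))"
  proof (rule CauchyI)
    fix d :: real assume d: "0 < d"
    have "(\<lambda>n. C * H1_norm \<Omega> (\<lambda>x. \<phi> n x - \<xi> x)) \<longlonglongrightarrow> C * 0" by (intro tendsto_intros pl)
    then have "\<forall>\<^sub>F n in sequentially. C * H1_norm \<Omega> (\<lambda>x. \<phi> n x - \<xi> x) < d / 2" by (rule order_tendstoD(2)) (use d in simp)
    then obtain N where N: "\<And>n. n \<ge> N \<Longrightarrow> C * H1_norm \<Omega> (\<lambda>x. \<phi> n x - \<xi> x) < d / 2" by (auto simp: eventually_sequentially)
    have "norm (adv \<psi> \<theta> (\<phi> m) - adv \<psi> \<theta> (\<phi> n)) < d" if "m \<ge> N" "n \<ge> N" for m n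
      using lip2[OF pb[of m] pb[of n]] N[OF that(1)] N[OF that(2)] by (simp add: distrib_left)
    then show "\<exists>N. \<forall>m\<ge>N. \<forall>n\<ge>N. norm (adv \<psi> \<theta> (\<phi> m) - adv \<psi> \<theta> (\<phi> n)) < d" by blast
  qed
  then obtain l where l: "(\<lambda>n. adv \<psi> \<theta> (\<phi> n)) \<longlonglongrightarrow> l" by (auto simp: Cauchy_convergent_iff convergent_def)
  let ?P = "\<lambda>l. \<forall>\<eta> :: nat \<Rightarrow> plane \<Rightarrow> real. (\<forall>n. \<eta> n \<in> H10 \<Omega> \<inter> Linf \<Omega>) \<and> (\<lambda>n. H1_norm \<Omega> (\<lambda>x. \<eta> n x - \<xi> x)) \<longlonglongrightarrow> 0 \<longrightarrow>
        (\<lambda>n. LINT x|lebesgue_on \<Omega>. \<eta> n x * (perp_grad \<Omega> \<psi> x \<bullet> grad \<Omega> \<theta> x)) \<longlonglongrightarrow> l"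
  have Pl: "?P l"
  proof (intro allI impI)
    fix \<eta> :: "nat \<Rightarrow> plane \<Rightarrow> real"
    assume "(\<forall>n. \<eta> n \<in> H10 \<Omega> \<inter> Linf \<Omega>) \<and> (\<lambda>n. H1_norm \<Omega> (\<lambda>x. \<eta> n x - \<xi> x)) \<longlonglongrightarrow> 0"
    then have e: "\<And>n. \<eta> n \<in> H10 \<Omega> \<inter> Linf \<Omega>" and el: "(\<lambda>n. H1_norm \<Omega> (\<lambda>x. \<eta> n x - \<xi> x)) \<longlonglongrightarrow> 0" by auto
    have "(\<lambda>n. adv \<psi> \<theta> (\<eta> n) - adv \<psi> \<theta> (\<phi> n)) \<longlonglongrightarrow> 0"
    proof (rule Lim_transform_bound[OF always_eventually], rule allI)
      show "norm (adv \<psi> \<theta> (\<eta> n) - adv \<psi> \<theta> (\<phi> n)) \<le> norm (C * (H1_norm \<Omega> (\<lambda>x. \<eta> n x - \<xi> x) + H1_norm \<Omega> (\<lambda>x. \<phi> n x - \<xi> x)))" for n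
        using lip2[OF e[of n] pb[of n]] by simp
      have "(\<lambda>n. C * (H1_norm \<Omega> (\<lambda>x. \<eta> n x - \<xi> x) + H1_norm \<Omega> (\<lambda>x. \<phi> n x - \<xi> x))) \<longlonglongrightarrow> C * (0 + 0)" by (intro tendsto_intros el pl)
      then show "(\<lambda>n. C * (H1_norm \<Omega> (\<lambda>x. \<eta> n x - \<xi> x) + H1_norm \<Omega> (\<lambda>x. \<phi> n x - \<xi> x))) \<longlonglongrightarrow> 0" by simp
    qed
    from tendsto_add[OF this l] have "(\<lambda>n. adv \<psi> \<theta> (\<eta> n)) \<longlonglongrightarrow> l" by simp
    then show "(\<lambda>n. LINT x|lebesgue_on \<Omega>. \<eta> n x * (perp_grad \<Omega> \<psi> x \<bullet> grad \<Omega> \<theta> x)) \<longlonglongrightarrow> l"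
      by (simp add: adv_def perp_grad_inner)
  qed
  have "advection \<Omega> \<xi> \<psi> \<theta> = l" unfolding advection_def
  proof (rule the_equality)
    show "?P l" by (rule Pl)
    fix l' assume "?P l'"
    then have "(\<lambda>n. adv \<psi> \<theta> (\<phi> n)) \<longlonglongrightarrow> l'" using pb pl by (simp add: adv_def perp_grad_inner)
    then show "l' = l" using l LIMSEQ_unique by blast
  qed
  then show ?thesis using Pl e el by (simp add: adv_def perp_grad_inner)
qed

lemma advection_combination:
  assumes p: "\<psi> \<in> stream_space \<Omega>" and t: "\<theta> \<in> H10 \<Omega>" and x: "\<xi> \<in> H10 \<Omega>" and z: "\<zeta> \<in> H10 \<Omega>"
  shows "advection \<Omega> (\<lambda>x. a * \<xi> x + b * \<zeta> x) \<psi> \<theta> = a * advection \<Omega> \<xi> \<psi> \<theta> + b * advection \<Omega> \<zeta> \<psi> \<theta>"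
proof -
  obtain u where u: "\<And>n. u n \<in> test_functions \<Omega>" and ul: "(\<lambda>n. H1_norm \<Omega> (\<lambda>x. u n x - \<xi> x)) \<longlonglongrightarrow> 0" using H10_approx[OF x] by blast
  obtain v where v: "\<And>n. v n \<in> test_functions \<Omega>" and vl: "(\<lambda>n. H1_norm \<Omega> (\<lambda>x. v n x - \<zeta> x)) \<longlonglongrightarrow> 0" using H10_approx[OF z] by blast
  note ub = test_H10_Linf[OF u] and vb = test_H10_Linf[OF v]
  have "(\<lambda>n. H1_norm \<Omega> (\<lambda>x. (a * u n x + b * v n x) - (a * \<xi> x + b * \<zeta> x))) \<longlonglongrightarrow> 0"
  proof (rule tendsto_sandwich[OF _ _ tendsto_const])
    have "H1_norm \<Omega> (\<lambda>x. (a * u n x + b * v n x) - (a * \<xi> x + b * \<zeta> x)) \<le> \<bar>a\<bar> * H1_norm \<Omega> (\<lambda>x. u n x - \<xi> x) + \<bar>b\<bar> * H1_norm \<Omega> (\<lambda>x. v n x - \<zeta> x)" for n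
    proof -
      note d = H1_diff[OF test_H1[OF u[of n]] H10_H1[OF x]] H1_diff[OF test_H1[OF v[of n]] H10_H1[OF z]]
      have "(\<lambda>x. (a * u n x + b * v n x) - (a * \<xi> x + b * \<zeta> x)) = (\<lambda>x. a * (u n x - \<xi> x) + b * (v n x - \<zeta> x))" by (simp add: algebra_simps)
      then show ?thesis using H1_norm_triangle[OF H1_cmult[OF d(1), of a] H1_cmult[OF d(2), of b]] by (simp add: H1_norm_cmult d)
    qed
    then show "\<forall>\<^sub>F n in sequentially. H1_norm \<Omega> (\<lambda>x. (a * u n x + b * v n x) - (a * \<xi> x + b * \<zeta> x))
      \<le> \<bar>a\<bar> * H1_norm \<Omega> (\<lambda>x. u n x - \<xi> x) + \<bar>b\<bar> * H1_norm \<Omega> (\<lambda>x. v n x - \<zeta> x)" by simp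
    have "(\<lambda>n. \<bar>a\<bar> * H1_norm \<Omega> (\<lambda>x. u n x - \<xi> x) + \<bar>b\<bar> * H1_norm \<Omega> (\<lambda>x. v n x - \<zeta> x)) \<longlonglongrightarrow> \<bar>a\<bar> * 0 + \<bar>b\<bar> * 0"
      by (intro tendsto_intros ul vl)
    then show "(\<lambda>n. \<bar>a\<bar> * H1_norm \<Omega> (\<lambda>x. u n x - \<xi> x) + \<bar>b\<bar> * H1_norm \<Omega> (\<lambda>x. v n x - \<zeta> x)) \<longlonglongrightarrow> 0" by simp
  qed simp
  from advection_limit[OF p t H10_combination[OF x z] H10_Linf_combination[OF ub vb] this]
  have "(\<lambda>n. a * adv \<psi> \<theta> (u n) + b * adv \<psi> \<theta> (v n)) \<longlonglongrightarrow> advection \<Omega> (\<lambda>x. a * \<xi> x + b * \<zeta> x) \<psi> \<theta>"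
    by (simp only: adv_combination[OF stream_space_H1[OF p] H10_H1[OF t] ub vb])
  moreover have "(\<lambda>n. a * adv \<psi> \<theta> (u n) + b * adv \<psi> \<theta> (v n)) \<longlonglongrightarrow> a * advection \<Omega> \<xi> \<psi> \<theta> + b * advection \<Omega> \<zeta> \<psi> \<theta>"
    by (intro tendsto_intros advection_limit[OF p t x ub ul] advection_limit[OF p t z vb vl])
  ultimately show ?thesis by (rule LIMSEQ_unique)
qed

lemma advection_lipschitz:
  assumes p: "\<psi> \<in> stream_space \<Omega>" and t: "\<theta> \<in> H10 \<Omega>"
  obtains C where "C \<ge> 0" "\<And>\<xi>. \<xi> \<in> H10 \<Omega> \<Longrightarrow> \<bar>advection \<Omega> \<xi> \<psi> \<theta>\<bar> \<le> C * H1_norm \<Omega> \<xi>"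
proof -
  obtain C where C: "C \<ge> 0" "\<And>\<eta>. \<eta> \<in> H10 \<Omega> \<inter> Linf \<Omega> \<Longrightarrow> \<bar>adv \<psi> \<theta> \<eta>\<bar> \<le> C * H1_norm \<Omega> \<eta>" using adv_lipschitz[OF p t] by blast
  have "\<bar>advection \<Omega> \<xi> \<psi> \<theta>\<bar> \<le> C * H1_norm \<Omega> \<xi>" if x: "\<xi> \<in> H10 \<Omega>" for \<xi>
  proof -
    obtain u where u: "\<And>n. u n \<in> test_functions \<Omega>" and ul: "(\<lambda>n. H1_norm \<Omega> (\<lambda>x. u n x - \<xi> x)) \<longlonglongrightarrow> 0" using H10_approx[OF x] by blast
    have l: "(\<lambda>n. H1_norm \<Omega> (u n)) \<longlonglongrightarrow> H1_norm \<Omega> \<xi>"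
      by (rule L2_norm_null_seq(3)[OF grad_works[OF test_H1[OF u]] grad_works[OF H10_H1[OF x]] ul])
    show ?thesis
      by (rule LIMSEQ_le[OF tendsto_rabs[OF advection_limit[OF p t x test_H10_Linf[OF u] ul]] tendsto_mult[OF tendsto_const l]])
        (use C(2)[OF test_H10_Linf[OF u]] in auto)
  qed
  then show ?thesis using that C(1) by blast
qed

lemma advection_continuous:
  assumes p: "\<psi> \<in> stream_space \<Omega>" and t: "\<theta> \<in> H10 \<Omega>" and x: "\<And>n. \<xi> n \<in> H10 \<Omega>" and z: "\<zeta> \<in> H10 \<Omega>"
    and l: "(\<lambda>n. H1_norm \<Omega> (\<lambda>x. \<xi> n x - \<zeta> x)) \<longlonglongrightarrow> 0"
  shows "(\<lambda>n. advection \<Omega> (\<xi> n) \<psi> \<theta>) \<longlonglongrightarrow> advection \<Omega> \<zeta> \<psi> \<theta>"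
proof -
  obtain C where C: "C \<ge> 0" "\<And>\<xi>. \<xi> \<in> H10 \<Omega> \<Longrightarrow> \<bar>advection \<Omega> \<xi> \<psi> \<theta>\<bar> \<le> C * H1_norm \<Omega> \<xi>" using advection_lipschitz[OF p t] by blast
  have b: "norm (advection \<Omega> (\<xi> n) \<psi> \<theta> - advection \<Omega> \<zeta> \<psi> \<theta>) \<le> norm (C * H1_norm \<Omega> (\<lambda>x. \<xi> n x - \<zeta> x))" for n
    using C(2)[OF H10_diff[OF x[of n] z]] advection_combination[OF p t x[of n] z, of 1 "-1"] by simp
  have "(\<lambda>n. C * H1_norm \<Omega> (\<lambda>x. \<xi> n x - \<zeta> x)) \<longlonglongrightarrow> C * 0" by (intro tendsto_intros l)
  then have "(\<lambda>n. C * H1_norm \<Omega> (\<lambda>x. \<xi> n x - \<zeta> x)) \<longlonglongrightarrow> 0" by simp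
  then have "(\<lambda>n. advection \<Omega> (\<xi> n) \<psi> \<theta> - advection \<Omega> \<zeta> \<psi> \<theta>) \<longlonglongrightarrow> 0"
    by (rule Lim_transform_bound[OF always_eventually, rotated]) (use b in blast)
  then show ?thesis by (rule Lim_null[THEN iffD2])
qed

end

subsection \<open>The maximization problem\<close>

lemma L2_parallelogram:
  assumes u: "u \<in> L2 \<Omega>" and v: "v \<in> L2 \<Omega>"
  shows "(L2_norm \<Omega> (\<lambda>x. (1/2) *\<^sub>R u x + (1/2) *\<^sub>R v x))\<^sup>2 = (L2_norm \<Omega> u)\<^sup>2 / 2 + (L2_norm \<Omega> v)\<^sup>2 / 2 - (L2_norm \<Omega> (\<lambda>x. u x - v x))\<^sup>2 / 4"
proof -
  have 1: "(L2_norm \<Omega> (\<lambda>x. u x + v x))\<^sup>2 = (L2_norm \<Omega> u)\<^sup>2 + 2 * (\<integral>x. u x \<bullet> v x \<partial>lebesgue_on \<Omega>) + (L2_norm \<Omega> v)\<^sup>2"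
    by (rule L2_norm_add_power2[OF u v])
  have 2: "(L2_norm \<Omega> (\<lambda>x. u x - v x))\<^sup>2 = (L2_norm \<Omega> u)\<^sup>2 - 2 * (\<integral>x. u x \<bullet> v x \<partial>lebesgue_on \<Omega>) + (L2_norm \<Omega> v)\<^sup>2"
    using L2_norm_add_power2[OF u L2_scaleR[OF v, of "-1"]] L2_norm_scaleR[of \<Omega> "-1" v] by simp
  have "(\<lambda>x. (1/2) *\<^sub>R u x + (1/2) *\<^sub>R v x) = (\<lambda>x. (1/2) *\<^sub>R (u x + v x))" by (simp add: scaleR_add_right)
  then have h: "L2_norm \<Omega> (\<lambda>x. (1/2) *\<^sub>R u x + (1/2) *\<^sub>R v x) = L2_norm \<Omega> (\<lambda>x. u x + v x) / 2"
    using L2_norm_scaleR[of \<Omega> "1/2" "\<lambda>x. u x + v x"] by simp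
  have "(L2_norm \<Omega> (\<lambda>x. (1/2) *\<^sub>R u x + (1/2) *\<^sub>R v x))\<^sup>2 = (L2_norm \<Omega> (\<lambda>x. u x + v x))\<^sup>2 / 4"
    unfolding h by (simp add: power_divide)
  then show ?thesis using 1 2 by linarith
qed

context lipschitz_domain
begin

text \<open>The constant sequence approximates \<phi>, and \<phi> vanishes on the frontier because
  its support lies in the open set \<Omega>; so the trace is 0 on every boundary component.\<close>

lemma test_stream_space:
  assumes p: "\<phi> \<in> test_functions \<Omega>" shows "\<phi> \<in> stream_space \<Omega>"
proof -
  have f0: "\<phi> x = 0" if "x \<in> frontier \<Omega>" for x
  proof -
    have "x \<notin> \<Omega>" using that open_domain by (simp add: frontier_def interior_open)
    then show ?thesis by (rule supported_in_eq_0(1)[OF test_function_supported[OF p]])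
  qed
  have "space (boundary_measure \<Omega>) \<subseteq> frontier \<Omega>" by (auto simp: boundary_measure_def space_restrict_space)
  then have "(\<integral>\<^sup>+x. ennreal ((\<phi> x - 0)\<^sup>2) \<partial>boundary_measure \<Omega>) = (\<integral>\<^sup>+x. 0 \<partial>boundary_measure \<Omega>)"
    using f0 by (intro nn_integral_cong) auto
  then have "has_trace \<Omega> \<phi> (\<lambda>x. 0)"
    unfolding has_trace_def using test_H1[OF p] test_function_smooth[OF p] by (auto intro!: exI[of _ "\<lambda>_. \<phi>"])
  then show ?thesis using test_H1[OF p] unfolding stream_space_def by (auto intro!: exI[of _ "\<lambda>_. 0"])
qed

text \<open>By Poincare's inequality a test function of Dirichlet norm 0 vanishes almost everywhere,
  whereas a bump is nonzero on a nonempty open box.\<close>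

lemma nonzero_test_function:
  obtains \<phi> where "\<phi> \<in> test_functions \<Omega>" "L2_norm \<Omega> (grad \<Omega> \<phi>) > 0"
proof -
  obtain x where "x \<in> \<Omega>" using domain by (auto simp: bounded_lipschitz_domain_def)
  then obtain a b where ab: "x \<in> box a b" "cbox a b \<subseteq> \<Omega>" using open_contains_cbox[OF open_domain] by metis
  let ?\<phi> = "box_bump a b 0"
  have p: "?\<phi> \<in> test_functions \<Omega>" by (rule box_bump_test_function[OF ab(2)])
  obtain K where K: "K \<ge> 0" "\<And>u. u \<in> H10 \<Omega> \<Longrightarrow> H1_norm \<Omega> u \<le> K * L2_norm \<Omega> (grad \<Omega> u)" using poincare by blast
  have "L2_norm \<Omega> (grad \<Omega> ?\<phi>) \<noteq> 0"
  proof
    assume "L2_norm \<Omega> (grad \<Omega> ?\<phi>) = 0"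
    then have "L2_norm \<Omega> ?\<phi> \<le> 0" using K(2)[OF test_H10[OF p]] L2_norm_le_H1_norm(1)[of ?\<phi>] by simp
    then have "L2_norm \<Omega> ?\<phi> = 0" using L2_norm_nonneg[of \<Omega> ?\<phi>] by linarith
    then have "AE x in lebesgue_on \<Omega>. ?\<phi> x = 0" by (rule L2_norm_eq_0_AE[OF test_L2(1)[OF p]])
    then have "AE x in lebesgue. x \<in> \<Omega> \<longrightarrow> ?\<phi> x = 0" using domain_lebesgue by (subst (asm) AE_restrict_space_iff) auto
    then have "AE x in lebesgue. x \<notin> box a b"
    proof eventually_elim
      case (elim y)
      then show ?case using ab(2) box_subset_cbox[of a b] box_bump_eq_0[of a b 0 y] by blast
    qed
    then have "box a b \<in> null_sets lebesgue" by (subst (asm) AE_iff_null_sets[symmetric]) (auto simp: sets_completionI_sets)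
    then have "negligible (box a b)" by (simp add: negligible_iff_null_sets)
    then show False using ab(1) open_not_negligible[OF open_box] by blast
  qed
  then show ?thesis using that[OF p] L2_norm_nonneg[of \<Omega> "grad \<Omega> ?\<phi>"] by linarith
qed

lemma Q_form_eq: "Q_form \<Omega> Pe a \<xi> \<psi> \<theta> = a * (L2_norm \<Omega> (grad \<Omega> \<psi>))\<^sup>2 + (L2_norm \<Omega> (grad \<Omega> \<theta>))\<^sup>2 - Pe * advection \<Omega> \<xi> \<psi> \<theta>"
  by (simp add: Q_form_def L2_norm_power2)

lemma objective_eq: "objective \<Omega> f (a, \<xi>) = f \<xi> - (L2_norm \<Omega> (grad \<Omega> \<xi>))\<^sup>2 / 4 - a"
  by (simp add: objective_def L2_norm_power2)

lemma feasible_iff: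
  "feasible \<Omega> Pe (a, \<xi>) \<longleftrightarrow> \<xi> \<in> H10 \<Omega> \<and> (\<forall>\<psi>\<in>stream_space \<Omega>. \<forall>\<theta>\<in>H10 \<Omega>. 0 \<le> Q_form \<Omega> Pe a \<xi> \<psi> \<theta>)"
  by (simp add: feasible_def Q_nonneg_def)

lemma grad_zero_norm: "L2_norm \<Omega> (grad \<Omega> (\<lambda>x. 0)) = 0"
  using L2_norm_grad[OF C1_has_weak_gradient[OF C1_const[of 0]]] by (simp add: L2_norm_def)

lemma advection_zero:
  assumes "\<psi> \<in> stream_space \<Omega>" "\<theta> \<in> H10 \<Omega>" shows "advection \<Omega> (\<lambda>x. 0) \<psi> \<theta> = 0"
  using advection_combination[OF assms zero_H10 zero_H10, of 0 0] by simp

lemma advection_zero_right: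
  assumes p: "\<psi> \<in> stream_space \<Omega>" and x: "\<xi> \<in> H10 \<Omega>" shows "advection \<Omega> \<xi> \<psi> (\<lambda>x. 0) = 0"
proof -
  obtain u where u: "\<And>n. u n \<in> test_functions \<Omega>" and ul: "(\<lambda>n. H1_norm \<Omega> (\<lambda>x. u n x - \<xi> x)) \<longlonglongrightarrow> 0" using H10_approx[OF x] by blast
  have "adv \<psi> (\<lambda>x. 0) \<eta> = 0" for \<eta>
  proof -
    have "AE x in lebesgue_on \<Omega>. grad \<Omega> (\<lambda>x. 0) x = 0" by (rule grad_AE[OF C1_has_weak_gradient[OF C1_const]])
    then have "AE x in lebesgue_on \<Omega>. \<eta> x * cross2 (grad \<Omega> \<psi> x) (grad \<Omega> (\<lambda>x. 0) x) = 0" by eventually_elim simp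
    then show ?thesis unfolding adv_def by (rule integral_eq_zero_AE)
  qed
  then show ?thesis using advection_limit[OF p zero_H10 x test_H10_Linf[OF u] ul] by (simp add: LIMSEQ_const_iff)
qed

lemma feasible_nonneg:
  assumes "feasible \<Omega> Pe (a, \<xi>)" shows "0 \<le> a"
proof -
  obtain \<phi> where p: "\<phi> \<in> test_functions \<Omega>" "L2_norm \<Omega> (grad \<Omega> \<phi>) > 0" by (rule nonzero_test_function)
  have x: "\<xi> \<in> H10 \<Omega>" using assms by (simp add: feasible_iff)
  have "0 \<le> Q_form \<Omega> Pe a \<xi> \<phi> (\<lambda>x. 0)" using assms test_stream_space[OF p(1)] zero_H10 by (simp add: feasible_iff)
  then have "0 \<le> a * (L2_norm \<Omega> (grad \<Omega> \<phi>))\<^sup>2" by (simp add: Q_form_eq grad_zero_norm advection_zero_right[OF test_stream_space[OF p(1)] x])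
  then show ?thesis using p(2) by (simp add: zero_le_mult_iff)
qed

lemma feasible_zero: "feasible \<Omega> Pe (0, \<lambda>x. 0)"
  by (simp add: feasible_iff zero_H10 Q_form_eq advection_zero)

text \<open>For fixed \<psi> and \<theta> the quadratic form is affine in \<open>(a, \<xi>)\<close>,
  so its nonnegativity survives averaging.\<close>

lemma feasible_midpoint:
  assumes "feasible \<Omega> Pe (a, \<xi>)" "feasible \<Omega> Pe (b, \<zeta>)"
  shows "feasible \<Omega> Pe (a / 2 + b / 2, \<lambda>x. 1/2 * \<xi> x + 1/2 * \<zeta> x)"
  unfolding feasible_iff
proof (intro conjI ballI)
  have x: "\<xi> \<in> H10 \<Omega>" and z: "\<zeta> \<in> H10 \<Omega>" using assms by (auto simp: feasible_iff)
  show "(\<lambda>x. 1/2 * \<xi> x + 1/2 * \<zeta> x) \<in> H10 \<Omega>" by (rule H10_combination[OF x z])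
  fix \<psi> \<theta> assume p: "\<psi> \<in> stream_space \<Omega>" and t: "\<theta> \<in> H10 \<Omega>"
  have "0 \<le> Q_form \<Omega> Pe a \<xi> \<psi> \<theta> / 2 + Q_form \<Omega> Pe b \<zeta> \<psi> \<theta> / 2" using assms p t by (simp add: feasible_iff)
  also have "\<dots> = Q_form \<Omega> Pe (a / 2 + b / 2) (\<lambda>x. 1/2 * \<xi> x + 1/2 * \<zeta> x) \<psi> \<theta>"
    unfolding Q_form_eq advection_combination[OF p t x z] by (simp add: field_simps)
  finally show "0 \<le> Q_form \<Omega> Pe (a / 2 + b / 2) (\<lambda>x. 1/2 * \<xi> x + 1/2 * \<zeta> x) \<psi> \<theta>" .
qed

lemma Hminus1_combination:
  assumes f: "f \<in> Hminus1 \<Omega>" and x: "\<xi> \<in> H10 \<Omega>" and z: "\<zeta> \<in> H10 \<Omega>"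
  shows "f (\<lambda>x. a * \<xi> x + b * \<zeta> x) = a * f \<xi> + b * f \<zeta>"
proof -
  have add: "\<forall>u\<in>H10 \<Omega>. \<forall>v\<in>H10 \<Omega>. f (\<lambda>x. u x + v x) = f u + f v" and scale: "\<forall>u\<in>H10 \<Omega>. \<forall>c. f (\<lambda>x. c * u x) = c * f u"
    using f by (auto simp: Hminus1_def)
  show ?thesis using bspec[OF bspec[OF add H10_cmult[OF x, of a]] H10_cmult[OF z, of b]] scale x z by simp
qed

text \<open>All terms are affine except the Dirichlet term; its coefficient 1/4 times the 1/4 of
  \<open>L2_parallelogram\<close> gives the 1/16.\<close>

lemma objective_midpoint:
  assumes f: "f \<in> Hminus1 \<Omega>" and x: "\<xi> \<in> H10 \<Omega>" and z: "\<zeta> \<in> H10 \<Omega>"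
  shows "objective \<Omega> f (a / 2 + b / 2, \<lambda>x. 1/2 * \<xi> x + 1/2 * \<zeta> x)
    = objective \<Omega> f (a, \<xi>) / 2 + objective \<Omega> f (b, \<zeta>) / 2 + (L2_norm \<Omega> (grad \<Omega> (\<lambda>x. \<xi> x - \<zeta> x)))\<^sup>2 / 16"
proof -
  note wx = grad_works[OF H10_H1[OF x]] and wz = grad_works[OF H10_H1[OF z]]
  have "L2_norm \<Omega> (grad \<Omega> (\<lambda>x. 1/2 * \<xi> x + 1/2 * \<zeta> x)) = L2_norm \<Omega> (\<lambda>x. (1/2) *\<^sub>R grad \<Omega> \<xi> x + (1/2) *\<^sub>R grad \<Omega> \<zeta> x)"
    by (rule L2_norm_grad[OF has_weak_gradient_add[OF has_weak_gradient_cmult[OF wx] has_weak_gradient_cmult[OF wz]]])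
  moreover have "L2_norm \<Omega> (grad \<Omega> (\<lambda>x. \<xi> x - \<zeta> x)) = L2_norm \<Omega> (\<lambda>x. grad \<Omega> \<xi> x - grad \<Omega> \<zeta> x)"
    by (rule L2_norm_grad[OF has_weak_gradient_diff[OF wx wz]])
  ultimately show ?thesis
    unfolding objective_eq Hminus1_combination[OF f x z]
    using L2_parallelogram[OF has_weak_gradient_L2(2)[OF wx] has_weak_gradient_L2(2)[OF wz]] by (simp add: field_simps)
qed

lemma maximizer_exists:
  assumes f: "f \<in> Hminus1 \<Omega>"
  obtains a \<xi> where "is_arg_max (objective \<Omega> f) (feasible \<Omega> Pe) (a, \<xi>)"
proof -
  let ?F = "feasible \<Omega> Pe" and ?J = "objective \<Omega> f"
  obtain K where K: "K \<ge> 0" "\<And>u. u \<in> H10 \<Omega> \<Longrightarrow> H1_norm \<Omega> u \<le> K * L2_norm \<Omega> (grad \<Omega> u)" using poincare by blast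
  obtain C0 where C0: "\<And>u. u \<in> H10 \<Omega> \<Longrightarrow> \<bar>f u\<bar> \<le> C0 * H1_norm \<Omega> u" using f unfolding Hminus1_def by blast
  define C where "C = \<bar>C0\<bar>"
  have C: "\<bar>f u\<bar> \<le> C * H1_norm \<Omega> u" if "u \<in> H10 \<Omega>" for u
    using C0[OF that] mult_right_mono[OF abs_ge_self[of C0] H1_norm_nonneg[of u]] by (simp add: C_def)
  \<comment> \<open>Young's inequality absorbs the linear term into the Dirichlet term of the
    objective, and \<open>0 \<le> a\<close> handles the last one.\<close>
  have bound: "?J (a, \<xi>) \<le> (C * K)\<^sup>2" if F: "?F (a, \<xi>)" for a \<xi>
  proof -
    have x: "\<xi> \<in> H10 \<Omega>" and a: "0 \<le> a" using F feasible_nonneg by (auto simp: feasible_iff)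
    let ?g = "L2_norm \<Omega> (grad \<Omega> \<xi>)"
    have "f \<xi> \<le> C * (K * ?g)"
      using C[OF x] mult_left_mono[OF K(2)[OF x], of C] by (simp add: C_def)
    also have "\<dots> \<le> (C * K)\<^sup>2 + ?g\<^sup>2 / 4"
      using zero_le_power2[of "C * K - ?g / 2"] by (simp add: power2_eq_square algebra_simps)
    finally show ?thesis using a by (simp add: objective_eq)
  qed
  define S where "S = ?J ` {p. ?F p}"
  define s where "s = Sup S"
  have ne: "S \<noteq> {}" using feasible_zero by (auto simp: S_def)
  have bdd: "bdd_above S" unfolding S_def using bound by (intro bdd_aboveI[of _ "(C * K)\<^sup>2"]) auto
  have le_s: "?J p \<le> s" if "?F p" for p unfolding s_def using that bdd by (intro cSup_upper) (auto simp: S_def)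
  have "\<exists>a \<xi>. ?F (a, \<xi>) \<and> s - inverse (real (Suc n)) < ?J (a, \<xi>)" for n
  proof -
    have "s - inverse (real (Suc n)) < Sup S" by (simp add: s_def)
    then obtain y where "y \<in> S" "s - inverse (real (Suc n)) < y" using less_cSup_iff[OF ne bdd] by blast
    then show ?thesis unfolding S_def by auto
  qed
  then obtain a \<xi> where F: "\<And>n. ?F (a n, \<xi> n)" and J: "\<And>n. s - inverse (real (Suc n)) < ?J (a n, \<xi> n)" by metis
  have x: "\<xi> n \<in> H10 \<Omega>" for n using F by (simp add: feasible_iff)
  \<comment> \<open>The midpoint has value at most s, while the endpoints lie within
    \<open>1 / Suc m\<close> and \<open>1 / Suc n\<close> of s. The mean of these errors, multiplied
    by 16, gives the factor 8.\<close>
  have close: "(L2_norm \<Omega> (grad \<Omega> (\<lambda>x. \<xi> m x - \<xi> n x)))\<^sup>2 \<le> 8 * (inverse (real (Suc m)) + inverse (real (Suc n)))" for m n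
    using le_s[OF feasible_midpoint[OF F[of m] F[of n]]] J[of m] J[of n] unfolding objective_midpoint[OF f x x] by simp
  have cauchy: "\<exists>N. \<forall>m\<ge>N. \<forall>n\<ge>N. H1_norm \<Omega> (\<lambda>x. \<xi> m x - \<xi> n x) < e" if e: "e > 0" for e
  proof -
    \<comment> \<open>Chosen so that \<open>8 * (d + d)\<close> is the square of
      \<open>e / (K + 1)\<close>; the added 1 avoids division by 0.\<close>
    define d where "d = (e / (K + 1))\<^sup>2 / 16"
    have d: "d > 0" using e K(1) by (simp add: d_def)
    obtain N where N: "inverse (real (Suc N)) < d" using reals_Archimedean[OF d] by blast
    have "H1_norm \<Omega> (\<lambda>x. \<xi> m x - \<xi> n x) < e" if mn: "m \<ge> N" "n \<ge> N" for m n
    proof -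
      let ?g = "L2_norm \<Omega> (grad \<Omega> (\<lambda>x. \<xi> m x - \<xi> n x))"
      have "inverse (real (Suc m)) + inverse (real (Suc n)) \<le> inverse (real (Suc N)) + inverse (real (Suc N))"
        using mn by (intro add_mono le_imp_inverse_le) auto
      also have "\<dots> < d + d" using N by (intro add_strict_mono)
      finally have "8 * (inverse (real (Suc m)) + inverse (real (Suc n))) < 8 * (d + d)" by (rule mult_strict_left_mono) simp
      then have "?g\<^sup>2 < 8 * (d + d)" by (rule le_less_trans[OF close])
      also have "8 * (d + d) = (e / (K + 1))\<^sup>2" unfolding d_def by simp
      finally have "?g < e / (K + 1)" by (rule power2_less_imp_less) (use e K(1) in simp)
      moreover have "0 < K + 1" using K(1) by simp
      ultimately have "?g * (K + 1) < e" by (simp only: pos_less_divide_eq)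
      moreover have "H1_norm \<Omega> (\<lambda>x. \<xi> m x - \<xi> n x) \<le> K * ?g" by (rule K(2)[OF H10_diff[OF x x]])
      moreover have "K * ?g \<le> ?g * (K + 1)" using L2_norm_nonneg[of \<Omega> "grad \<Omega> (\<lambda>x. \<xi> m x - \<xi> n x)"] by (simp add: distrib_left mult.commute[of K])
      ultimately show ?thesis by (meson le_less_trans)
    qed
    then show ?thesis by blast
  qed
  obtain \<zeta> where z1: "\<zeta> \<in> H1 \<Omega>" and zl: "(\<lambda>n. H1_norm \<Omega> (\<lambda>x. \<xi> n x - \<zeta> x)) \<longlonglongrightarrow> 0"
    by (rule H1_complete[OF H10_H1[OF x] cauchy])
  have z: "\<zeta> \<in> H10 \<Omega>" by (rule H10_closed[OF z1 x zl])
  have fl: "(\<lambda>n. f (\<xi> n)) \<longlonglongrightarrow> f \<zeta>"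
  proof -
    have b: "norm (f (\<xi> n) - f \<zeta>) \<le> norm (C * H1_norm \<Omega> (\<lambda>x. \<xi> n x - \<zeta> x))" for n
      using C[OF H10_diff[OF x[of n] z]] Hminus1_combination[OF f x[of n] z, of 1 "-1"] by simp
    have "(\<lambda>n. C * H1_norm \<Omega> (\<lambda>x. \<xi> n x - \<zeta> x)) \<longlonglongrightarrow> C * 0" by (intro tendsto_intros zl)
    then have "(\<lambda>n. C * H1_norm \<Omega> (\<lambda>x. \<xi> n x - \<zeta> x)) \<longlonglongrightarrow> 0" by simp
    then have "(\<lambda>n. f (\<xi> n) - f \<zeta>) \<longlonglongrightarrow> 0" by (rule Lim_transform_bound[OF always_eventually, rotated]) (use b in blast)
    then show ?thesis by (rule Lim_null[THEN iffD2])
  qed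
  note wx = grad_works[OF H10_H1[OF x]] and wz = grad_works[OF z1]
  have gl: "(\<lambda>n. L2_norm \<Omega> (grad \<Omega> (\<xi> n))) \<longlonglongrightarrow> L2_norm \<Omega> (grad \<Omega> \<zeta>)"
    by (rule L2_norm_tendsto[OF has_weak_gradient_L2(2)[OF wx] has_weak_gradient_L2(2)[OF wz] L2_norm_null_seq(2)[OF wx wz zl]])
  have Jl: "(\<lambda>n. ?J (a n, \<xi> n)) \<longlonglongrightarrow> s"
  proof (rule tendsto_sandwich[OF _ _ _ tendsto_const])
    have "(\<lambda>n. s - inverse (real (Suc n))) \<longlonglongrightarrow> s - 0" by (intro tendsto_diff tendsto_const LIMSEQ_inverse_real_of_nat)
    then show "(\<lambda>n. s - inverse (real (Suc n))) \<longlonglongrightarrow> s" by simp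
    show "\<forall>\<^sub>F n in sequentially. s - inverse (real (Suc n)) \<le> ?J (a n, \<xi> n)" using J by (intro always_eventually) (auto intro: less_imp_le)
    show "\<forall>\<^sub>F n in sequentially. ?J (a n, \<xi> n) \<le> s" using le_s[OF F] by simp
  qed
  \<comment> \<open>b is the solution of \<open>?J (b, \<zeta>) = s\<close>. The objective values
    and their other terms converge, so the numbers \<open>a n\<close> do as well, with this
    limit.\<close>
  define b where "b = f \<zeta> - (L2_norm \<Omega> (grad \<Omega> \<zeta>))\<^sup>2 / 4 - s"
  have al: "a \<longlonglongrightarrow> b"
  proof -
    have "(\<lambda>n. f (\<xi> n) - (L2_norm \<Omega> (grad \<Omega> (\<xi> n)))\<^sup>2 / 4 - ?J (a n, \<xi> n)) \<longlonglongrightarrow> b"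
      unfolding b_def by (intro tendsto_intros fl gl Jl) simp
    then show ?thesis by (simp add: objective_eq)
  qed
  have "?F (b, \<zeta>)" unfolding feasible_iff
  proof (intro conjI ballI z)
    fix \<psi> \<theta> assume p: "\<psi> \<in> stream_space \<Omega>" and t: "\<theta> \<in> H10 \<Omega>"
    have "(\<lambda>n. Q_form \<Omega> Pe (a n) (\<xi> n) \<psi> \<theta>) \<longlonglongrightarrow> Q_form \<Omega> Pe b \<zeta> \<psi> \<theta>"
      unfolding Q_form_eq by (intro tendsto_intros al advection_continuous[OF p t x z zl])
    then show "0 \<le> Q_form \<Omega> Pe b \<zeta> \<psi> \<theta>"
      by (rule LIMSEQ_le_const) (use F p t in \<open>auto simp: feasible_iff\<close>)
  qed
  moreover have "?J (b, \<zeta>) = s" by (simp add: objective_eq b_def)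
  ultimately have "is_arg_max ?J ?F (b, \<zeta>)" unfolding is_arg_max_def using le_s by (auto simp: not_less)
  then show ?thesis by (rule that)
qed

lemma maximizer_unique:
  assumes f: "f \<in> Hminus1 \<Omega>" and m: "is_arg_max (objective \<Omega> f) (feasible \<Omega> Pe) (a, \<xi>)" "is_arg_max (objective \<Omega> f) (feasible \<Omega> Pe) (b, \<zeta>)"
  shows "b = a" "AE x in lebesgue_on \<Omega>. \<zeta> x = \<xi> x"
proof -
  let ?F = "feasible \<Omega> Pe" and ?J = "objective \<Omega> f"
  have F: "?F (a, \<xi>)" "?F (b, \<zeta>)" and le: "\<And>p. ?F p \<Longrightarrow> ?J p \<le> ?J (a, \<xi>)" "\<And>p. ?F p \<Longrightarrow> ?J p \<le> ?J (b, \<zeta>)"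
    using m unfolding is_arg_max_def by (auto simp: not_less)
  have x: "\<xi> \<in> H10 \<Omega>" and z: "\<zeta> \<in> H10 \<Omega>" using F by (auto simp: feasible_iff)
  have eq: "?J (a, \<xi>) = ?J (b, \<zeta>)" using le(1)[OF F(2)] le(2)[OF F(1)] by simp
  \<comment> \<open>Otherwise the feasible midpoint would exceed the common maximum by a sixteenth
    of this square.\<close>
  have "(L2_norm \<Omega> (grad \<Omega> (\<lambda>x. \<xi> x - \<zeta> x)))\<^sup>2 \<le> 0"
    using le(1)[OF feasible_midpoint[OF F]] eq unfolding objective_midpoint[OF f x z] by simp
  then have g: "L2_norm \<Omega> (grad \<Omega> (\<lambda>x. \<xi> x - \<zeta> x)) = 0" by simp
  obtain K where K: "\<And>u. u \<in> H10 \<Omega> \<Longrightarrow> H1_norm \<Omega> u \<le> K * L2_norm \<Omega> (grad \<Omega> u)" using poincare by blast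
  have h: "H1_norm \<Omega> (\<lambda>x. \<xi> x - \<zeta> x) = 0"
    using K[OF H10_diff[OF x z]] g H1_norm_nonneg[of "\<lambda>x. \<xi> x - \<zeta> x"] by simp
  have "L2_norm \<Omega> (\<lambda>x. \<xi> x - \<zeta> x) = 0"
    using L2_norm_le_H1_norm(1)[of "\<lambda>x. \<xi> x - \<zeta> x"] L2_norm_nonneg[of \<Omega> "\<lambda>x. \<xi> x - \<zeta> x"] unfolding h by linarith
  then have "AE x in lebesgue_on \<Omega>. \<xi> x - \<zeta> x = 0"
    by (rule L2_norm_eq_0_AE[OF L2_diff[OF H1_L2(1)[OF H10_H1[OF x]] H1_L2(1)[OF H10_H1[OF z]]]])
  then show "AE x in lebesgue_on \<Omega>. \<zeta> x = \<xi> x" by eventually_elim simp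
  obtain C where C: "\<And>u. u \<in> H10 \<Omega> \<Longrightarrow> \<bar>f u\<bar> \<le> C * H1_norm \<Omega> u" using f unfolding Hminus1_def by blast
  \<comment> \<open>f acts on representatives, which agree only almost everywhere; linearity and the
    bound by the H1 norm, which is 0 for the difference, identify the two values. Equality of the
    objectives then leaves equality of a and b.\<close>
  have "f \<xi> = f \<zeta>" using C[OF H10_diff[OF x z]] h Hminus1_combination[OF f x z, of 1 "-1"] by simp
  moreover have "L2_norm \<Omega> (grad \<Omega> \<xi>) = L2_norm \<Omega> (grad \<Omega> \<zeta>)"
  proof -
    note wx = grad_works[OF H10_H1[OF x]] and wz = grad_works[OF H10_H1[OF z]]
    note L = has_weak_gradient_L2(2)[OF wx] has_weak_gradient_L2(2)[OF wz]
    have d: "L2_norm \<Omega> (\<lambda>x. grad \<Omega> \<xi> x - grad \<Omega> \<zeta> x) = 0" using L2_norm_grad[OF has_weak_gradient_diff[OF wx wz]] g by simp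
    show ?thesis
      using L2_triangle[OF L2_diff[OF L] L(2)] L2_triangle_diff[OF L(1) L2_diff[OF L]] d by simp
  qed
  ultimately show "b = a" using eq by (simp add: objective_eq)
qed

end

theorem proposition2p2:
  fixes \<Omega> :: "(real^2) set"
    and f :: "(real^2 \<Rightarrow> real) \<Rightarrow> real"
    and Pe :: real
  assumes "bounded_lipschitz_domain \<Omega>"
    and "f \<in> Hminus1 \<Omega>"
    and "Pe \<ge> 0"
  shows "\<exists>a \<xi>. is_arg_max (objective \<Omega> f) (feasible \<Omega> Pe) (a, \<xi>) \<and>
           (\<forall>a' \<xi>'. is_arg_max (objective \<Omega> f) (feasible \<Omega> Pe) (a', \<xi>') \<longrightarrow>
              a' = a \<and> (AE x in lebesgue_on \<Omega>. \<xi>' x = \<xi> x))"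
proof -
  interpret lipschitz_domain \<Omega> using assms(1) by unfold_locales
  obtain a \<xi> where m: "is_arg_max (objective \<Omega> f) (feasible \<Omega> Pe) (a, \<xi>)"
    by (rule maximizer_exists[OF assms(2)])
  then show ?thesis using maximizer_unique[OF assms(2) m] by blast
qed

end
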